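(* By restricting $\otimes$ and $[-,-]$ from $\mathbf{sMlt}$ to its full subcategory $\mathbf{Seq}$ of sequential multicategories one gets a monoidal closed structure $(\mathbf{Seq},1_\blacktriangleright,\otimes)$, which is cartesian and which corresponds, under the equivalence $(-)_\blacktriangleright:\mathbf{Cat}\simeq\mathbf{Seq}$, to the cartesian closed structure on $\mathbf{Cat}$.
   Context: $\mathbf{sMlt}$ is the category of (small) symmetric multicategories and symmetric functors; a permutation $\sigma$ of the domain of an arrow $f$ gives an arrow $\sigma f$. For a category $\mathcal C$, $\mathcal C_\blacktriangleright$ is the symmetric multicategory with the objects of $\mathcal C$ and $\mathcal C_\blacktriangleright(X_1,\dots,X_n;X)=\mathcal C(X_1;X)\times\cdots\times\mathcal C(X_n;X)$, composition $\langle f_1,\dots,f_n\rangle(\langle g_{11},\dots,g_{1m_1}\rangle,\dots,\langle g_{n1},\dots,g_{nm_n}\rangle)=\langle f_1g_{11},\dots,f_1g_{1m_1},\dots,f_ng_{n1},\dots,f_ng_{nm_n}\rangle$, and symmetric structure given by permuting sequences. A symmetric multicategory is sequential if it is isomorphic to some $\mathcal C_\blacktriangleright$. The functor $(-)_\blacktriangleright:\mathbf{Cat}\to\mathbf{sMlt}$, $F_\blacktriangleright\langle f_1,\dots,f_n\rangle=\langle Ff_1,\dots,Ff_n\rangle$, is fully faithful and restricts to an equivalence $\mathbf{Cat}\simeq\mathbf{Seq}$. $1$ is the terminal category, so $1_\blacktriangleright$ is the terminal symmetric multicategory. $\otimes$ is the Boardman–Vogt tensor product. The objects of $\mathcal M\otimes\mathcal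 N$ are pairs $\langle A,X\rangle$; its arrows are generated by $f_X:\langle A_1,X\rangle,\dots,\langle A_n,X\rangle\to\langle A,X\rangle$ for $f:A_1,\dots,A_n\to A$ in $\mathcal M$ and $h_A:\langle A,X_1\rangle,\dots,\langle A,X_m\rangle\to\langle A,X\rangle$ for $h:X_1,\dots,X_m\to X$ in $\mathcal N$, subject to the relations making $(-)_X:\mathcal M\to\mathcal M\otimes\mathcal N$ and $(-)_A:\mathcal N\to\mathcal M\otimes\mathcal N$ symmetric functors and to $f_X(h_{A_1},\dots,h_{A_n})=\sigma\,h_A(f_{X_1},\dots,f_{X_m})$, with $\sigma$ the evident permutation matching the domains. The associated internal hom $[\mathcal M,\mathcal N]$ has as objects the symmetric functors $\mathcal M\to\mathcal N$; an arrow $\alpha:F_1,\dots,F_n\to F$ is a family of arrows $\alpha_A:F_1A,\dots,F_nA\to FA$ ($A\in\mathcal M$) such that $Ff(\alpha_{A_1},\dots,\alpha_{A_m})=\sigma\,\alpha_A(F_1f,\dots,F_nf)$ for every $f:A_1,\dots,A_m\to A$ in $\mathcal M$, with $\sigma$ the evident permutation; composition and symmetric structure are pointwise. (The unit of $\otimes$ on the whole of $\mathbf{sMlt}$ is $1^-$, the multicategory with one object and only its identity arrow, not $1_\blacktriangleright$.) *)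

theory Defs
  imports "HOL-Combinatorics.Permutations" "HOL-Library.FuncSet"
begin

section \<open>Permutations acting on concatenations\<close>

text \<open>
  Positions in a list are numbered from 0, and a permutation \<open>\<sigma>\<close> of \<open>{..<n}\<close> sends a list
  \<open>xs\<close> of length \<open>n\<close> to \<open>permute_list \<sigma> xs\<close>, whose \<open>i\<close>-th entry is \<open>xs ! \<sigma> i\<close>.
  The permutations below are given by the list of their values.
\<close>

definition perm_of_list :: "nat list \<Rightarrow> nat \<Rightarrow> nat" where
  "perm_of_list ks = (\<lambda>i. if i < length ks then ks ! i else i)"

primrec blocks :: "nat \<Rightarrow> nat list \<Rightarrow> nat list list" where
  "blocks k [] = []"
| "blocks k (n # ns) = [k..<k + n] # blocks (k + n) ns"

text \<open>Rearranging consecutive blocks of lengths \<open>ns\<close> according to \<open>\<sigma>\<close>.\<close>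

definition block_perm :: "(nat \<Rightarrow> nat) \<Rightarrow> nat list \<Rightarrow> nat \<Rightarrow> nat" where
  "block_perm \<sigma> ns = perm_of_list (concat (permute_list \<sigma> (blocks 0 ns)))"

text \<open>Rearranging each of the consecutive blocks of lengths \<open>ns\<close> internally.\<close>

definition sum_perm :: "(nat \<Rightarrow> nat) list \<Rightarrow> nat list \<Rightarrow> nat \<Rightarrow> nat" where
  "sum_perm \<tau>s ns = perm_of_list (concat (map2 permute_list \<tau>s (blocks 0 ns)))"

text \<open>
  The permutation \<open>i * m + j \<mapsto> j * n + i\<close> for \<open>i < n\<close>, \<open>j < m\<close>: it turns
  \<open>(x\<^sub>0\<^sub>0, x\<^sub>1\<^sub>0, \<dots>, x\<^sub>0\<^sub>1, x\<^sub>1\<^sub>1, \<dots>)\<close>, in which the first index varies fastest, into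
  \<open>(x\<^sub>0\<^sub>0, x\<^sub>0\<^sub>1, \<dots>, x\<^sub>1\<^sub>0, x\<^sub>1\<^sub>1, \<dots>)\<close>.
\<close>

definition transp_perm :: "nat \<Rightarrow> nat \<Rightarrow> nat \<Rightarrow> nat" where
  "transp_perm n m =
     perm_of_list (concat (map (\<lambda>i. map (\<lambda>j. j * n + i) [0..<m]) [0..<n]))"


section \<open>Symmetric multicategories\<close>

record ('o, 'a) smc =
  obj :: "'o set"
  arr :: "'a set"
  src :: "'a \<Rightarrow> 'o list"
  tgt :: "'a \<Rightarrow> 'o"
  idn :: "'o \<Rightarrow> 'a"
  cmp :: "'a \<Rightarrow> 'a list \<Rightarrow> 'a"
  act :: "(nat \<Rightarrow> nat) \<Rightarrow> 'a \<Rightarrow> 'a"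

definition composable :: "('o, 'a) smc \<Rightarrow> 'a \<Rightarrow> 'a list \<Rightarrow> bool" where
  "composable M f gs \<longleftrightarrow> f \<in> arr M \<and> set gs \<subseteq> arr M \<and> map (tgt M) gs = src M f"

text \<open>
  With the convention \<open>src (\<sigma> f) = permute_list \<sigma> (src f)\<close> the symmetric groups act from the
  right, hence the order in \<open>act_comp\<close>.
\<close>

locale sym_multicategory =
  fixes M :: "('o, 'a) smc"
  assumes src_obj: "f \<in> arr M \<Longrightarrow> set (src M f) \<subseteq> obj M"
    and tgt_obj: "f \<in> arr M \<Longrightarrow> tgt M f \<in> obj M"
    and idn_arr: "X \<in> obj M \<Longrightarrow> idn M X \<in> arr M"
    and src_idn: "X \<in> obj M \<Longrightarrow> src M (idn M X) = [X]"
    and tgt_idn: "X \<in> obj M \<Longrightarrow> tgt M (idn M X) = X"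
    and cmp_arr: "composable M f gs \<Longrightarrow> cmp M f gs \<in> arr M"
    and src_cmp: "composable M f gs \<Longrightarrow> src M (cmp M f gs) = concat (map (src M) gs)"
    and tgt_cmp: "composable M f gs \<Longrightarrow> tgt M (cmp M f gs) = tgt M f"
    and idn_cmp: "f \<in> arr M \<Longrightarrow> cmp M (idn M (tgt M f)) [f] = f"
    and cmp_idn: "f \<in> arr M \<Longrightarrow> cmp M f (map (idn M) (src M f)) = f"
    and cmp_assoc: "composable M f gs \<Longrightarrow> list_all2 (composable M) gs hss \<Longrightarrow>
          cmp M (cmp M f gs) (concat hss) = cmp M f (map2 (cmp M) gs hss)"
    and act_arr: "f \<in> arr M \<Longrightarrow> \<sigma> permutes {..<length (src M f)} \<Longrightarrow> act M \<sigma> f \<in> arr M"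
    and src_act: "f \<in> arr M \<Longrightarrow> \<sigma> permutes {..<length (src M f)} \<Longrightarrow>
          src M (act M \<sigma> f) = permute_list \<sigma> (src M f)"
    and tgt_act: "f \<in> arr M \<Longrightarrow> \<sigma> permutes {..<length (src M f)} \<Longrightarrow>
          tgt M (act M \<sigma> f) = tgt M f"
    and act_id: "f \<in> arr M \<Longrightarrow> act M id f = f"
    and act_comp: "f \<in> arr M \<Longrightarrow> \<sigma> permutes {..<length (src M f)} \<Longrightarrow>
          \<tau> permutes {..<length (src M f)} \<Longrightarrow> act M (\<sigma> \<circ> \<tau>) f = act M \<tau> (act M \<sigma> f)"
    and act_cmp_outer: "composable M f gs \<Longrightarrow> \<sigma> permutes {..<length gs} \<Longrightarrow>
          cmp M (act M \<sigma> f) (permute_list \<sigma> gs) =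
          act M (block_perm \<sigma> (map (length \<circ> src M) gs)) (cmp M f gs)"
    and act_cmp_inner: "composable M f gs \<Longrightarrow>
          list_all2 (\<lambda>\<tau> g. \<tau> permutes {..<length (src M g)}) \<tau>s gs \<Longrightarrow>
          cmp M f (map2 (act M) \<tau>s gs) =
          act M (sum_perm \<tau>s (map (length \<circ> src M) gs)) (cmp M f gs)"

text \<open>
  Functors carry their domain and codomain, and their underlying functions are extensional on
  the carriers, so that equality in HOL is equality of functors.
\<close>

record ('o, 'a, 'p, 'b) sfun =
  sdom :: "('o, 'a) smc"
  scod :: "('p, 'b) smc"
  sob :: "'o \<Rightarrow> 'p"
  sar :: "'a \<Rightarrow> 'b"

definition sym_functor :: "('o, 'a, 'p, 'b) sfun \<Rightarrow> bool" where
  "sym_functor F \<longleftrightarrow>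
     sym_multicategory (sdom F) \<and> sym_multicategory (scod F) \<and>
     sob F \<in> obj (sdom F) \<rightarrow>\<^sub>E obj (scod F) \<and>
     sar F \<in> arr (sdom F) \<rightarrow>\<^sub>E arr (scod F) \<and>
     (\<forall>f\<in>arr (sdom F). src (scod F) (sar F f) = map (sob F) (src (sdom F) f) \<and>
                       tgt (scod F) (sar F f) = sob F (tgt (sdom F) f)) \<and>
     (\<forall>X\<in>obj (sdom F). sar F (idn (sdom F) X) = idn (scod F) (sob F X)) \<and>
     (\<forall>f gs. composable (sdom F) f gs \<longrightarrow>
        sar F (cmp (sdom F) f gs) = cmp (scod F) (sar F f) (map (sar F) gs)) \<and>
     (\<forall>f \<sigma>. f \<in> arr (sdom F) \<and> \<sigma> permutes {..<length (src (sdom F) f)} \<longrightarrow>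
        sar F (act (sdom F) \<sigma> f) = act (scod F) \<sigma> (sar F f))"

definition sMlt :: "('o, 'a) smc \<Rightarrow> ('p, 'b) smc \<Rightarrow> ('o, 'a, 'p, 'b) sfun set" where
  "sMlt M N = {F. sym_functor F \<and> sdom F = M \<and> scod F = N}"

definition sid :: "('o, 'a) smc \<Rightarrow> ('o, 'a, 'o, 'a) sfun" where
  "sid M = \<lparr>sdom = M, scod = M, sob = \<lambda>X\<in>obj M. X, sar = \<lambda>f\<in>arr M. f\<rparr>"

definition scomp ::
  "('p, 'b, 'q, 'c) sfun \<Rightarrow> ('o, 'a, 'p, 'b) sfun \<Rightarrow> ('o, 'a, 'q, 'c) sfun"  (infixl \<open>\<circ>\<^sub>s\<close> 55) where
  "G \<circ>\<^sub>s F = \<lparr>sdom = sdom F, scod = scod G,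
     sob = \<lambda>X\<in>obj (sdom F). sob G (sob F X), sar = \<lambda>f\<in>arr (sdom F). sar G (sar F f)\<rparr>"

definition sinverse :: "('o, 'a, 'p, 'b) sfun \<Rightarrow> ('p, 'b, 'o, 'a) sfun \<Rightarrow> bool" where
  "sinverse F G \<longleftrightarrow> F \<in> sMlt (sdom F) (scod F) \<and> G \<in> sMlt (scod F) (sdom F) \<and>
     G \<circ>\<^sub>s F = sid (sdom F) \<and> F \<circ>\<^sub>s G = sid (scod F)"

definition siso :: "('o, 'a, 'p, 'b) sfun \<Rightarrow> bool" where
  "siso F \<longleftrightarrow> (\<exists>G. sinverse F G)"

definition sinv :: "('o, 'a, 'p, 'b) sfun \<Rightarrow> ('p, 'b, 'o, 'a) sfun" where
  "sinv F = (THE G. sinverse F G)"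

definition sisos :: "('o, 'a) smc \<Rightarrow> ('p, 'b) smc \<Rightarrow> ('o, 'a, 'p, 'b) sfun set" where
  "sisos M N = {F \<in> sMlt M N. siso F}"


section \<open>Categories and the cartesian closed structure of Cat\<close>

record ('o, 'a) cat =
  Ob :: "'o set"
  Ar :: "'a set"
  Dom :: "'a \<Rightarrow> 'o"
  Cod :: "'a \<Rightarrow> 'o"
  Idn :: "'o \<Rightarrow> 'a"
  Cmp :: "'a \<Rightarrow> 'a \<Rightarrow> 'a"

locale category =
  fixes C :: "('o, 'a) cat"
  assumes Dom_Ob: "f \<in> Ar C \<Longrightarrow> Dom C f \<in> Ob C"
    and Cod_Ob: "f \<in> Ar C \<Longrightarrow> Cod C f \<in> Ob C"
    and Idn_Ar: "X \<in> Ob C \<Longrightarrow> Idn C X \<in> Ar C"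
    and Dom_Idn: "X \<in> Ob C \<Longrightarrow> Dom C (Idn C X) = X"
    and Cod_Idn: "X \<in> Ob C \<Longrightarrow> Cod C (Idn C X) = X"
    and Cmp_Ar: "f \<in> Ar C \<Longrightarrow> g \<in> Ar C \<Longrightarrow> Cod C g = Dom C f \<Longrightarrow> Cmp C f g \<in> Ar C"
    and Dom_Cmp: "f \<in> Ar C \<Longrightarrow> g \<in> Ar C \<Longrightarrow> Cod C g = Dom C f \<Longrightarrow> Dom C (Cmp C f g) = Dom C g"
    and Cod_Cmp: "f \<in> Ar C \<Longrightarrow> g \<in> Ar C \<Longrightarrow> Cod C g = Dom C f \<Longrightarrow> Cod C (Cmp C f g) = Cod C f"
    and Idn_Cmp: "f \<in> Ar C \<Longrightarrow> Cmp C (Idn C (Cod C f)) f = f"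
    and Cmp_Idn: "f \<in> Ar C \<Longrightarrow> Cmp C f (Idn C (Dom C f)) = f"
    and Cmp_assoc: "f \<in> Ar C \<Longrightarrow> g \<in> Ar C \<Longrightarrow> h \<in> Ar C \<Longrightarrow> Cod C g = Dom C f \<Longrightarrow>
          Cod C h = Dom C g \<Longrightarrow> Cmp C (Cmp C f g) h = Cmp C f (Cmp C g h)"

record ('o, 'a, 'p, 'b) cfun =
  cdom :: "('o, 'a) cat"
  ccod :: "('p, 'b) cat"
  cob :: "'o \<Rightarrow> 'p"
  car :: "'a \<Rightarrow> 'b"

definition "functor" :: "('o, 'a, 'p, 'b) cfun \<Rightarrow> bool" where
  "functor F \<longleftrightarrow>
     category (cdom F) \<and> category (ccod F) \<and>
     cob F \<in> Ob (cdom F) \<rightarrow>\<^sub>E Ob (ccod F) \<and>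
     car F \<in> Ar (cdom F) \<rightarrow>\<^sub>E Ar (ccod F) \<and>
     (\<forall>f\<in>Ar (cdom F). Dom (ccod F) (car F f) = cob F (Dom (cdom F) f) \<and>
                      Cod (ccod F) (car F f) = cob F (Cod (cdom F) f)) \<and>
     (\<forall>X\<in>Ob (cdom F). car F (Idn (cdom F) X) = Idn (ccod F) (cob F X)) \<and>
     (\<forall>f\<in>Ar (cdom F). \<forall>g\<in>Ar (cdom F). Cod (cdom F) g = Dom (cdom F) f \<longrightarrow>
        car F (Cmp (cdom F) f g) = Cmp (ccod F) (car F f) (car F g))"

definition Cat :: "('o, 'a) cat \<Rightarrow> ('p, 'b) cat \<Rightarrow> ('o, 'a, 'p, 'b) cfun set" where
  "Cat C D = {F. functor F \<and> cdom F = C \<and> ccod F = D}"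

definition cid :: "('o, 'a) cat \<Rightarrow> ('o, 'a, 'o, 'a) cfun" where
  "cid C = \<lparr>cdom = C, ccod = C, cob = \<lambda>X\<in>Ob C. X, car = \<lambda>f\<in>Ar C. f\<rparr>"

definition ccomp ::
  "('p, 'b, 'q, 'c) cfun \<Rightarrow> ('o, 'a, 'p, 'b) cfun \<Rightarrow> ('o, 'a, 'q, 'c) cfun"  (infixl \<open>\<circ>\<^sub>c\<close> 55) where
  "G \<circ>\<^sub>c F = \<lparr>cdom = cdom F, ccod = ccod G,
     cob = \<lambda>X\<in>Ob (cdom F). cob G (cob F X), car = \<lambda>f\<in>Ar (cdom F). car G (car F f)\<rparr>"

definition one_cat :: "(unit, unit) cat" where
  "one_cat = \<lparr>Ob = UNIV, Ar = UNIV, Dom = \<lambda>_. (), Cod = \<lambda>_. (), Idn = \<lambda>_. (), Cmp = \<lambda>_ _. ()\<rparr>"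

definition prod_cat ::
  "('o, 'a) cat \<Rightarrow> ('p, 'b) cat \<Rightarrow> ('o \<times> 'p, 'a \<times> 'b) cat"  (infixl \<open>\<times>\<^sub>c\<close> 70) where
  "C \<times>\<^sub>c D = \<lparr>Ob = Ob C \<times> Ob D, Ar = Ar C \<times> Ar D,
     Dom = map_prod (Dom C) (Dom D), Cod = map_prod (Cod C) (Cod D),
     Idn = map_prod (Idn C) (Idn D),
     Cmp = \<lambda>(f, h) (g, k). (Cmp C f g, Cmp D h k)\<rparr>"

definition prod_fun ::
  "('o, 'a, 'p, 'b) cfun \<Rightarrow> ('q, 'c, 'r, 'd) cfun \<Rightarrow> ('o \<times> 'q, 'a \<times> 'c, 'p \<times> 'r, 'b \<times> 'd) cfun"
  (infixl \<open>\<times>\<^sub>f\<close> 70) where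
  "F \<times>\<^sub>f G = \<lparr>cdom = cdom F \<times>\<^sub>c cdom G, ccod = ccod F \<times>\<^sub>c ccod G,
     cob = restrict (map_prod (cob F) (cob G)) (Ob (cdom F \<times>\<^sub>c cdom G)),
     car = restrict (map_prod (car F) (car G)) (Ar (cdom F \<times>\<^sub>c cdom G))\<rparr>"

definition cfst :: "('o, 'a) cat \<Rightarrow> ('p, 'b) cat \<Rightarrow> ('o \<times> 'p, 'a \<times> 'b, 'o, 'a) cfun" where
  "cfst C D = \<lparr>cdom = C \<times>\<^sub>c D, ccod = C,
     cob = restrict fst (Ob (C \<times>\<^sub>c D)), car = restrict fst (Ar (C \<times>\<^sub>c D))\<rparr>"

definition csnd :: "('o, 'a) cat \<Rightarrow> ('p, 'b) cat \<Rightarrow> ('o \<times> 'p, 'a \<times> 'b, 'p, 'b) cfun" where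
  "csnd C D = \<lparr>cdom = C \<times>\<^sub>c D, ccod = D,
     cob = restrict snd (Ob (C \<times>\<^sub>c D)), car = restrict snd (Ar (C \<times>\<^sub>c D))\<rparr>"

definition cassoc :: "('o, 'a) cat \<Rightarrow> ('p, 'b) cat \<Rightarrow> ('q, 'c) cat \<Rightarrow>
    (('o \<times> 'p) \<times> 'q, ('a \<times> 'b) \<times> 'c, 'o \<times> 'p \<times> 'q, 'a \<times> 'b \<times> 'c) cfun" where
  "cassoc C D E = \<lparr>cdom = (C \<times>\<^sub>c D) \<times>\<^sub>c E, ccod = C \<times>\<^sub>c (D \<times>\<^sub>c E),
     cob = restrict (\<lambda>((A, X), Y). (A, X, Y)) (Ob ((C \<times>\<^sub>c D) \<times>\<^sub>c E)),
     car = restrict (\<lambda>((f, h), k). (f, h, k)) (Ar ((C \<times>\<^sub>c D) \<times>\<^sub>c E))\<rparr>"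

definition clunit :: "('o, 'a) cat \<Rightarrow> ('o, 'a, unit \<times> 'o, unit \<times> 'a) cfun" where
  "clunit C = \<lparr>cdom = C, ccod = one_cat \<times>\<^sub>c C,
     cob = \<lambda>X\<in>Ob C. ((), X), car = \<lambda>f\<in>Ar C. ((), f)\<rparr>"

definition crunit :: "('o, 'a) cat \<Rightarrow> ('o, 'a, 'o \<times> unit, 'a \<times> unit) cfun" where
  "crunit C = \<lparr>cdom = C, ccod = C \<times>\<^sub>c one_cat,
     cob = \<lambda>X\<in>Ob C. (X, ()), car = \<lambda>f\<in>Ar C. (f, ())\<rparr>"

text \<open>
  In the functor category, a natural transformation \<open>\<tau> : F \<rightarrow> G\<close> is encoded as the triple
  \<open>(F, G, \<tau>)\<close> with \<open>\<tau>\<close> extensional.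
\<close>

definition nat_trans :: "('o, 'a, 'p, 'b) cfun \<Rightarrow> ('o, 'a, 'p, 'b) cfun \<Rightarrow> ('o \<Rightarrow> 'b) \<Rightarrow> bool" where
  "nat_trans F G \<tau> \<longleftrightarrow>
     \<tau> \<in> extensional (Ob (cdom F)) \<and>
     (\<forall>X\<in>Ob (cdom F). \<tau> X \<in> Ar (ccod F) \<and>
        Dom (ccod F) (\<tau> X) = cob F X \<and> Cod (ccod F) (\<tau> X) = cob G X) \<and>
     (\<forall>f\<in>Ar (cdom F). Cmp (ccod F) (car G f) (\<tau> (Dom (cdom F) f)) =
                      Cmp (ccod F) (\<tau> (Cod (cdom F) f)) (car F f))"

type_synonym ('o, 'a, 'p, 'b) ntrans =
  "('o, 'a, 'p, 'b) cfun \<times> ('o, 'a, 'p, 'b) cfun \<times> ('o \<Rightarrow> 'b)"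

definition fun_cat ::
  "('o, 'a) cat \<Rightarrow> ('p, 'b) cat \<Rightarrow> (('o, 'a, 'p, 'b) cfun, ('o, 'a, 'p, 'b) ntrans) cat" where
  "fun_cat C D = \<lparr>Ob = Cat C D,
     Ar = {(F, G, \<tau>). F \<in> Cat C D \<and> G \<in> Cat C D \<and> nat_trans F G \<tau>},
     Dom = \<lambda>(F, G, \<tau>). F, Cod = \<lambda>(F, G, \<tau>). G,
     Idn = \<lambda>F. (F, F, \<lambda>X\<in>Ob C. Idn D (cob F X)),
     Cmp = \<lambda>(G', H, \<tau>) (F, G, \<upsilon>). (F, H, \<lambda>X\<in>Ob C. Cmp D (\<tau> X) (\<upsilon> X))\<rparr>"

definition fun_map :: "('o', 'a', 'o, 'a) cfun \<Rightarrow> ('p, 'b, 'p', 'b') cfun \<Rightarrow>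
    (('o, 'a, 'p, 'b) cfun, ('o, 'a, 'p, 'b) ntrans,
     ('o', 'a', 'p', 'b') cfun, ('o', 'a', 'p', 'b') ntrans) cfun" where
  "fun_map G H = \<lparr>cdom = fun_cat (ccod G) (cdom H), ccod = fun_cat (cdom G) (ccod H),
     cob = \<lambda>F\<in>Ob (fun_cat (ccod G) (cdom H)). H \<circ>\<^sub>c F \<circ>\<^sub>c G,
     car = restrict
       (\<lambda>(F, F', \<tau>). (H \<circ>\<^sub>c F \<circ>\<^sub>c G, H \<circ>\<^sub>c F' \<circ>\<^sub>c G, \<lambda>X\<in>Ob (cdom G). car H (\<tau> (cob G X))))
       (Ar (fun_cat (ccod G) (cdom H)))\<rparr>"

definition cpartial :: "('o, 'a) cat \<Rightarrow> ('p, 'b) cat \<Rightarrow> ('o \<times> 'p, 'a \<times> 'b, 'q, 'c) cfun \<Rightarrow>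
    'o \<Rightarrow> ('p, 'b, 'q, 'c) cfun" where
  "cpartial C D H A = \<lparr>cdom = D, ccod = ccod H,
     cob = \<lambda>X\<in>Ob D. cob H (A, X), car = \<lambda>h\<in>Ar D. car H (Idn C A, h)\<rparr>"

definition ccurry :: "('o, 'a) cat \<Rightarrow> ('p, 'b) cat \<Rightarrow> ('o \<times> 'p, 'a \<times> 'b, 'q, 'c) cfun \<Rightarrow>
    ('o, 'a, ('p, 'b, 'q, 'c) cfun, ('p, 'b, 'q, 'c) ntrans) cfun" where
  "ccurry C D H = \<lparr>cdom = C, ccod = fun_cat D (ccod H),
     cob = \<lambda>A\<in>Ob C. cpartial C D H A,
     car = \<lambda>f\<in>Ar C. (cpartial C D H (Dom C f), cpartial C D H (Cod C f),
                      \<lambda>X\<in>Ob D. car H (f, Idn D X))\<rparr>"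


section \<open>Sequential multicategories\<close>

text \<open>
  An arrow \<open>\<langle>f\<^sub>1, \<dots>, f\<^sub>n\<rangle> : X\<^sub>1, \<dots>, X\<^sub>n \<rightarrow> X\<close> is encoded as \<open>([f\<^sub>1, \<dots>, f\<^sub>n], X)\<close>; the
  target has to be recorded because of the case \<open>n = 0\<close>.
\<close>

definition seq_smc :: "('o, 'a) cat \<Rightarrow> ('o, 'a list \<times> 'o) smc"  (\<open>_\<^sub>\<triangleright>\<close> [1000] 1000) where
  "C\<^sub>\<triangleright> = \<lparr>obj = Ob C,
     arr = {(fs, X). X \<in> Ob C \<and> (\<forall>f\<in>set fs. f \<in> Ar C \<and> Cod C f = X)},
     src = \<lambda>(fs, X). map (Dom C) fs,
     tgt = \<lambda>(fs, X). X,
     idn = \<lambda>X. ([Idn C X], X),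
     cmp = \<lambda>(fs, X) gs. (concat (map2 (\<lambda>f g. map (Cmp C f) (fst g)) fs gs), X),
     act = \<lambda>\<sigma> (fs, X). (permute_list \<sigma> fs, X)\<rparr>"

definition seq_fun ::
  "('o, 'a, 'p, 'b) cfun \<Rightarrow> ('o, 'a list \<times> 'o, 'p, 'b list \<times> 'p) sfun"  (\<open>_\<^sup>\<triangleright>\<close> [1000] 1000) where
  "F\<^sup>\<triangleright> = \<lparr>sdom = (cdom F)\<^sub>\<triangleright>, scod = (ccod F)\<^sub>\<triangleright>, sob = cob F,
     sar = restrict (\<lambda>(fs, X). (map (car F) fs, cob F X)) (arr ((cdom F)\<^sub>\<triangleright>))\<rparr>"

text \<open>
  Asking the category to live on the same types as \<open>M\<close> is no restriction: if \<open>M\<close> is isomorphic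
  to \<open>D\<^sub>\<triangleright>\<close> for a category \<open>D\<close> on any types, then \<open>D\<close> is isomorphic to the category with
  the objects of \<open>M\<close> and the unary arrows of \<open>M\<close>.
\<close>

definition sequential :: "('o, 'a) smc \<Rightarrow> bool" where
  "sequential M \<longleftrightarrow> (\<exists>C :: ('o, 'a) cat. category C \<and> sisos M C\<^sub>\<triangleright> \<noteq> {})"

definition one_smc :: "(unit, unit list \<times> unit) smc" where
  "one_smc = one_cat\<^sub>\<triangleright>"

definition bang :: "('o, 'a) smc \<Rightarrow> ('o, 'a, unit, unit list \<times> unit) sfun" where
  "bang M = \<lparr>sdom = M, scod = one_smc, sob = \<lambda>X\<in>obj M. (),
     sar = \<lambda>f\<in>arr M. (map (\<lambda>_. ()) (src M f), ())\<rparr>"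


section \<open>Symmetric multicategories by generators and relations\<close>

record ('o, 'g) mgraph =
  vert :: "'o set"
  edge :: "'g set"
  esrc :: "'g \<Rightarrow> 'o list"
  etgt :: "'g \<Rightarrow> 'o"

datatype ('o, 'g) mterm =
    Idt 'o
  | Gen 'g
  | Cmpt "('o, 'g) mterm" "('o, 'g) mterm list"
  | Actt "nat \<Rightarrow> nat" "('o, 'g) mterm"

primrec tsrc :: "('o, 'g) mgraph \<Rightarrow> ('o, 'g) mterm \<Rightarrow> 'o list" where
  "tsrc G (Idt X) = [X]"
| "tsrc G (Gen g) = esrc G g"
| "tsrc G (Cmpt t us) = concat (map (tsrc G) us)"
| "tsrc G (Actt \<sigma> t) = permute_list \<sigma> (tsrc G t)"

primrec ttgt :: "('o, 'g) mgraph \<Rightarrow> ('o, 'g) mterm \<Rightarrow> 'o" where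
  "ttgt G (Idt X) = X"
| "ttgt G (Gen g) = etgt G g"
| "ttgt G (Cmpt t us) = ttgt G t"
| "ttgt G (Actt \<sigma> t) = ttgt G t"

inductive twf :: "('o, 'g) mgraph \<Rightarrow> ('o, 'g) mterm \<Rightarrow> bool" for G where
  "X \<in> vert G \<Longrightarrow> twf G (Idt X)"
| "g \<in> edge G \<Longrightarrow> twf G (Gen g)"
| "twf G t \<Longrightarrow> (\<forall>u\<in>set us. twf G u) \<Longrightarrow> map (ttgt G) us = tsrc G t \<Longrightarrow> twf G (Cmpt t us)"
| "twf G t \<Longrightarrow> \<sigma> permutes {..<length (tsrc G t)} \<Longrightarrow> twf G (Actt \<sigma> t)"

definition tcomposable :: "('o, 'g) mgraph \<Rightarrow> ('o, 'g) mterm \<Rightarrow> ('o, 'g) mterm list \<Rightarrow> bool" where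
  "tcomposable G t us \<longleftrightarrow> twf G t \<and> (\<forall>u\<in>set us. twf G u) \<and> map (ttgt G) us = tsrc G t"

text \<open>
  The congruence on well-formed terms generated by a relation \<open>R\<close> (which is meant to relate
  well-formed terms with equal source and equal target) and the axioms of symmetric
  multicategories.
\<close>

inductive teq :: "('o, 'g) mgraph \<Rightarrow> (('o, 'g) mterm \<Rightarrow> ('o, 'g) mterm \<Rightarrow> bool) \<Rightarrow>
    ('o, 'g) mterm \<Rightarrow> ('o, 'g) mterm \<Rightarrow> bool" for G R where
  teq_rel: "R t u \<Longrightarrow> teq G R t u"
| teq_refl: "twf G t \<Longrightarrow> teq G R t t"
| teq_sym: "teq G R t u \<Longrightarrow> teq G R u t"
| teq_trans: "teq G R t u \<Longrightarrow> teq G R u v \<Longrightarrow> teq G R t v"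
| teq_Cmpt: "tcomposable G t us \<Longrightarrow> teq G R t t' \<Longrightarrow> list_all2 (teq G R) us us' \<Longrightarrow>
    teq G R (Cmpt t us) (Cmpt t' us')"
| teq_Actt: "\<sigma> permutes {..<length (tsrc G t)} \<Longrightarrow> teq G R t t' \<Longrightarrow>
    teq G R (Actt \<sigma> t) (Actt \<sigma> t')"
| teq_idn_cmp: "twf G t \<Longrightarrow> teq G R (Cmpt (Idt (ttgt G t)) [t]) t"
| teq_cmp_idn: "twf G t \<Longrightarrow> teq G R (Cmpt t (map Idt (tsrc G t))) t"
| teq_assoc: "tcomposable G t us \<Longrightarrow> list_all2 (tcomposable G) us vss \<Longrightarrow>
    teq G R (Cmpt (Cmpt t us) (concat vss)) (Cmpt t (map2 Cmpt us vss))"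
| teq_act_id: "twf G t \<Longrightarrow> teq G R (Actt id t) t"
| teq_act_comp: "twf G t \<Longrightarrow> \<sigma> permutes {..<length (tsrc G t)} \<Longrightarrow>
    \<tau> permutes {..<length (tsrc G t)} \<Longrightarrow> teq G R (Actt (\<sigma> \<circ> \<tau>) t) (Actt \<tau> (Actt \<sigma> t))"
| teq_act_outer: "tcomposable G t us \<Longrightarrow> \<sigma> permutes {..<length us} \<Longrightarrow>
    teq G R (Cmpt (Actt \<sigma> t) (permute_list \<sigma> us))
            (Actt (block_perm \<sigma> (map (length \<circ> tsrc G) us)) (Cmpt t us))"
| teq_act_inner: "tcomposable G t us \<Longrightarrow>
    list_all2 (\<lambda>\<tau> u. \<tau> permutes {..<length (tsrc G u)}) \<tau>s us \<Longrightarrow>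
    teq G R (Cmpt t (map2 Actt \<tau>s us))
            (Actt (sum_perm \<tau>s (map (length \<circ> tsrc G) us)) (Cmpt t us))"

definition tcls :: "('o, 'g) mgraph \<Rightarrow> (('o, 'g) mterm \<Rightarrow> ('o, 'g) mterm \<Rightarrow> bool) \<Rightarrow>
    ('o, 'g) mterm \<Rightarrow> ('o, 'g) mterm set" where
  "tcls G R t = {u. teq G R t u}"

definition trep :: "('o, 'g) mterm set \<Rightarrow> ('o, 'g) mterm" where
  "trep c = (SOME t. t \<in> c)"

definition presented :: "('o, 'g) mgraph \<Rightarrow> (('o, 'g) mterm \<Rightarrow> ('o, 'g) mterm \<Rightarrow> bool) \<Rightarrow>
    ('o, ('o, 'g) mterm set) smc" where
  "presented G R = \<lparr>obj = vert G,
     arr = tcls G R ` {t. twf G t},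
     src = \<lambda>c. tsrc G (trep c),
     tgt = \<lambda>c. ttgt G (trep c),
     idn = \<lambda>X. tcls G R (Idt X),
     cmp = \<lambda>c cs. tcls G R (Cmpt (trep c) (map trep cs)),
     act = \<lambda>\<sigma> c. tcls G R (Actt \<sigma> (trep c))\<rparr>"

text \<open>Value of a term in \<open>P\<close>, given values of the vertices and edges.\<close>

primrec teval :: "('p, 'b) smc \<Rightarrow> ('o \<Rightarrow> 'p) \<Rightarrow> ('g \<Rightarrow> 'b) \<Rightarrow> ('o, 'g) mterm \<Rightarrow> 'b" where
  "teval P \<phi> \<gamma> (Idt X) = idn P (\<phi> X)"
| "teval P \<phi> \<gamma> (Gen g) = \<gamma> g"
| "teval P \<phi> \<gamma> (Cmpt t us) = cmp P (teval P \<phi> \<gamma> t) (map (teval P \<phi> \<gamma>) us)"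
| "teval P \<phi> \<gamma> (Actt \<sigma> t) = act P \<sigma> (teval P \<phi> \<gamma> t)"


section \<open>The Boardman-Vogt tensor product\<close>

text \<open>The generators \<open>Inl (f, X)\<close> and \<open>Inr (A, h)\<close> stand for \<open>f\<^sub>X\<close> and \<open>h\<^sub>A\<close>.\<close>

type_synonym ('o, 'a, 'p, 'b) tgen = "('a \<times> 'p) + ('o \<times> 'b)"
type_synonym ('o, 'a, 'p, 'b) tarr = "('o \<times> 'p, ('o, 'a, 'p, 'b) tgen) mterm set"

definition tensor_graph ::
  "('o, 'a) smc \<Rightarrow> ('p, 'b) smc \<Rightarrow> ('o \<times> 'p, ('o, 'a, 'p, 'b) tgen) mgraph" where
  "tensor_graph M N = \<lparr>vert = obj M \<times> obj N,
     edge = Inl ` (arr M \<times> obj N) \<union> Inr ` (obj M \<times> arr N),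
     esrc = case_sum (\<lambda>(f, X). map (\<lambda>A. (A, X)) (src M f)) (\<lambda>(A, h). map (\<lambda>X. (A, X)) (src N h)),
     etgt = case_sum (\<lambda>(f, X). (tgt M f, X)) (\<lambda>(A, h). (A, tgt N h))\<rparr>"

inductive tensor_rel :: "('o, 'a) smc \<Rightarrow> ('p, 'b) smc \<Rightarrow>
    ('o \<times> 'p, ('o, 'a, 'p, 'b) tgen) mterm \<Rightarrow> ('o \<times> 'p, ('o, 'a, 'p, 'b) tgen) mterm \<Rightarrow> bool"
  for M N where
  left_idn: "A \<in> obj M \<Longrightarrow> X \<in> obj N \<Longrightarrow>
    tensor_rel M N (Gen (Inl (idn M A, X))) (Idt (A, X))"
| left_cmp: "composable M f gs \<Longrightarrow> X \<in> obj N \<Longrightarrow>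
    tensor_rel M N (Gen (Inl (cmp M f gs, X)))
                   (Cmpt (Gen (Inl (f, X))) (map (\<lambda>g. Gen (Inl (g, X))) gs))"
| left_act: "f \<in> arr M \<Longrightarrow> \<sigma> permutes {..<length (src M f)} \<Longrightarrow> X \<in> obj N \<Longrightarrow>
    tensor_rel M N (Gen (Inl (act M \<sigma> f, X))) (Actt \<sigma> (Gen (Inl (f, X))))"
| right_idn: "A \<in> obj M \<Longrightarrow> X \<in> obj N \<Longrightarrow>
    tensor_rel M N (Gen (Inr (A, idn N X))) (Idt (A, X))"
| right_cmp: "A \<in> obj M \<Longrightarrow> composable N h ks \<Longrightarrow>
    tensor_rel M N (Gen (Inr (A, cmp N h ks)))
                   (Cmpt (Gen (Inr (A, h))) (map (\<lambda>k. Gen (Inr (A, k))) ks))"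
| right_act: "A \<in> obj M \<Longrightarrow> h \<in> arr N \<Longrightarrow> \<sigma> permutes {..<length (src N h)} \<Longrightarrow>
    tensor_rel M N (Gen (Inr (A, act N \<sigma> h))) (Actt \<sigma> (Gen (Inr (A, h))))"
| interchange: "f \<in> arr M \<Longrightarrow> h \<in> arr N \<Longrightarrow>
    tensor_rel M N
      (Cmpt (Gen (Inl (f, tgt N h))) (map (\<lambda>A. Gen (Inr (A, h))) (src M f)))
      (Actt (transp_perm (length (src M f)) (length (src N h)))
         (Cmpt (Gen (Inr (tgt M f, h))) (map (\<lambda>X. Gen (Inl (f, X))) (src N h))))"

definition tensor ::
  "('o, 'a) smc \<Rightarrow> ('p, 'b) smc \<Rightarrow> ('o \<times> 'p, ('o, 'a, 'p, 'b) tarr) smc"  (infixl \<open>\<otimes>\<close> 70) where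
  "M \<otimes> N = presented (tensor_graph M N) (tensor_rel M N)"

definition genL :: "('o, 'a) smc \<Rightarrow> ('p, 'b) smc \<Rightarrow> 'a \<Rightarrow> 'p \<Rightarrow> ('o, 'a, 'p, 'b) tarr" where
  "genL M N f X = tcls (tensor_graph M N) (tensor_rel M N) (Gen (Inl (f, X)))"

definition genR :: "('o, 'a) smc \<Rightarrow> ('p, 'b) smc \<Rightarrow> 'o \<Rightarrow> 'b \<Rightarrow> ('o, 'a, 'p, 'b) tarr" where
  "genR M N A h = tcls (tensor_graph M N) (tensor_rel M N) (Gen (Inr (A, h)))"

definition inclL :: "('o, 'a) smc \<Rightarrow> ('p, 'b) smc \<Rightarrow> 'p \<Rightarrow>
    ('o, 'a, 'o \<times> 'p, ('o, 'a, 'p, 'b) tarr) sfun" where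
  "inclL M N X = \<lparr>sdom = M, scod = M \<otimes> N,
     sob = \<lambda>A\<in>obj M. (A, X), sar = \<lambda>f\<in>arr M. genL M N f X\<rparr>"

definition inclR :: "('o, 'a) smc \<Rightarrow> ('p, 'b) smc \<Rightarrow> 'o \<Rightarrow>
    ('p, 'b, 'o \<times> 'p, ('o, 'a, 'p, 'b) tarr) sfun" where
  "inclR M N A = \<lparr>sdom = N, scod = M \<otimes> N,
     sob = \<lambda>X\<in>obj N. (A, X), sar = \<lambda>h\<in>arr N. genR M N A h\<rparr>"

text \<open>The functor out of \<open>M \<otimes> N\<close> with prescribed values on objects and on the generators.\<close>

definition tensor_lift :: "('o, 'a) smc \<Rightarrow> ('p, 'b) smc \<Rightarrow> ('q, 'c) smc \<Rightarrow>
    ('o \<times> 'p \<Rightarrow> 'q) \<Rightarrow> ('a \<Rightarrow> 'p \<Rightarrow> 'c) \<Rightarrow> ('o \<Rightarrow> 'b \<Rightarrow> 'c) \<Rightarrow>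
    ('o \<times> 'p, ('o, 'a, 'p, 'b) tarr, 'q, 'c) sfun" where
  "tensor_lift M N P \<phi> l r = \<lparr>sdom = M \<otimes> N, scod = P,
     sob = restrict \<phi> (obj (M \<otimes> N)),
     sar = \<lambda>c\<in>arr (M \<otimes> N). teval P \<phi> (case_sum (case_prod l) (case_prod r)) (trep c)\<rparr>"

definition tensor_map :: "('o, 'a, 'o', 'a') sfun \<Rightarrow> ('p, 'b, 'p', 'b') sfun \<Rightarrow>
    ('o \<times> 'p, ('o, 'a, 'p, 'b) tarr, 'o' \<times> 'p', ('o', 'a', 'p', 'b') tarr) sfun"
  (infixl \<open>\<otimes>\<^sub>f\<close> 70) where
  "F \<otimes>\<^sub>f G = tensor_lift (sdom F) (sdom G) (scod F \<otimes> scod G)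
     (map_prod (sob F) (sob G))
     (\<lambda>f X. genL (scod F) (scod G) (sar F f) (sob G X))
     (\<lambda>A h. genR (scod F) (scod G) (sob F A) (sar G h))"

text \<open>The associator: \<open>(f\<^sub>X)\<^sub>Y \<mapsto> f\<^sub>(\<^sub>X\<^sub>,\<^sub>Y\<^sub>)\<close>, \<open>(h\<^sub>A)\<^sub>Y \<mapsto> (h\<^sub>Y)\<^sub>A\<close> and \<open>k\<^sub>(\<^sub>A\<^sub>,\<^sub>X\<^sub>) \<mapsto> (k\<^sub>X)\<^sub>A\<close>.\<close>

definition assoc :: "('o, 'a) smc \<Rightarrow> ('p, 'b) smc \<Rightarrow> ('q, 'c) smc \<Rightarrow>
    (('o \<times> 'p) \<times> 'q, ('o \<times> 'p, ('o, 'a, 'p, 'b) tarr, 'q, 'c) tarr,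
     'o \<times> 'p \<times> 'q, ('o, 'a, 'p \<times> 'q, ('p, 'b, 'q, 'c) tarr) tarr) sfun" where
  "assoc M N P = tensor_lift (M \<otimes> N) P (M \<otimes> (N \<otimes> P))
     (\<lambda>((A, X), Y). (A, X, Y))
     (\<lambda>c Y. sar (tensor_lift M N (M \<otimes> (N \<otimes> P))
                   (\<lambda>(A, X). (A, X, Y))
                   (\<lambda>f X. genL M (N \<otimes> P) f (X, Y))
                   (\<lambda>A h. genR M (N \<otimes> P) A (genL N P h Y))) c)
     (\<lambda>(A, X) k. genR M (N \<otimes> P) A (genR N P X k))"

text \<open>
  The inverse unitors, in the direction in which they are defined for all symmetric multicategories:
  \<open>M \<rightarrow> 1\<^sub>\<triangleright> \<otimes> M\<close> and \<open>M \<rightarrow> M \<otimes> 1\<^sub>\<triangleright>\<close>.  In general they are not invertible.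
\<close>

definition lunit :: "('o, 'a) smc \<Rightarrow>
    ('o, 'a, unit \<times> 'o, (unit, unit list \<times> unit, 'o, 'a) tarr) sfun" where
  "lunit M = inclR one_smc M ()"

definition runit :: "('o, 'a) smc \<Rightarrow>
    ('o, 'a, 'o \<times> unit, ('o, 'a, unit, unit list \<times> unit) tarr) sfun" where
  "runit M = inclL M one_smc ()"

text \<open>The projections of a monoidal structure whose unit is terminal.\<close>

definition projL :: "('o, 'a) smc \<Rightarrow> ('p, 'b) smc \<Rightarrow>
    ('o \<times> 'p, ('o, 'a, 'p, 'b) tarr, 'o, 'a) sfun" where
  "projL M N = sinv (runit M) \<circ>\<^sub>s (sid M \<otimes>\<^sub>f bang N)"

definition projR :: "('o, 'a) smc \<Rightarrow> ('p, 'b) smc \<Rightarrow>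
    ('o \<times> 'p, ('o, 'a, 'p, 'b) tarr, 'p, 'b) sfun" where
  "projR M N = sinv (lunit N) \<circ>\<^sub>s (bang M \<otimes>\<^sub>f sid N)"


section \<open>The internal hom\<close>

text \<open>An arrow \<open>\<alpha> : F\<^sub>1, \<dots>, F\<^sub>n \<rightarrow> F\<close> is encoded as \<open>([F\<^sub>1, \<dots>, F\<^sub>n], F, \<alpha>)\<close> with \<open>\<alpha>\<close> extensional.\<close>

type_synonym ('o, 'a, 'p, 'b) mtrans =
  "('o, 'a, 'p, 'b) sfun list \<times> ('o, 'a, 'p, 'b) sfun \<times> ('o \<Rightarrow> 'b)"

definition multi_trans :: "('o, 'a) smc \<Rightarrow> ('p, 'b) smc \<Rightarrow>
    ('o, 'a, 'p, 'b) sfun list \<Rightarrow> ('o, 'a, 'p, 'b) sfun \<Rightarrow> ('o \<Rightarrow> 'b) \<Rightarrow> bool" where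
  "multi_trans M N Fs F \<alpha> \<longleftrightarrow>
     \<alpha> \<in> extensional (obj M) \<and>
     (\<forall>A\<in>obj M. \<alpha> A \<in> arr N \<and> src N (\<alpha> A) = map (\<lambda>G. sob G A) Fs \<and> tgt N (\<alpha> A) = sob F A) \<and>
     (\<forall>f\<in>arr M. cmp N (sar F f) (map \<alpha> (src M f)) =
        act N (transp_perm (length (src M f)) (length Fs))
          (cmp N (\<alpha> (tgt M f)) (map (\<lambda>G. sar G f) Fs)))"

definition ihom :: "('o, 'a) smc \<Rightarrow> ('p, 'b) smc \<Rightarrow>
    (('o, 'a, 'p, 'b) sfun, ('o, 'a, 'p, 'b) mtrans) smc" where
  "ihom M N = \<lparr>obj = sMlt M N,
     arr = {(Fs, F, \<alpha>). set Fs \<subseteq> sMlt M N \<and> F \<in> sMlt M N \<and> multi_trans M N Fs F \<alpha>},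
     src = \<lambda>(Fs, F, \<alpha>). Fs,
     tgt = \<lambda>(Fs, F, \<alpha>). F,
     idn = \<lambda>F. ([F], F, \<lambda>A\<in>obj M. idn N (sob F A)),
     cmp = \<lambda>(Fs, F, \<alpha>) \<beta>s. (concat (map fst \<beta>s), F,
             \<lambda>A\<in>obj M. cmp N (\<alpha> A) (map (\<lambda>(Gs, G, \<beta>). \<beta> A) \<beta>s)),
     act = \<lambda>\<sigma> (Fs, F, \<alpha>). (permute_list \<sigma> Fs, F, \<lambda>A\<in>obj M. act N \<sigma> (\<alpha> A))\<rparr>"

definition ihom_map :: "('o', 'a', 'o, 'a) sfun \<Rightarrow> ('p, 'b, 'p', 'b') sfun \<Rightarrow>
    (('o, 'a, 'p, 'b) sfun, ('o, 'a, 'p, 'b) mtrans,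
     ('o', 'a', 'p', 'b') sfun, ('o', 'a', 'p', 'b') mtrans) sfun" where
  "ihom_map G H = \<lparr>sdom = ihom (scod G) (sdom H), scod = ihom (sdom G) (scod H),
     sob = \<lambda>F\<in>obj (ihom (scod G) (sdom H)). H \<circ>\<^sub>s F \<circ>\<^sub>s G,
     sar = restrict
       (\<lambda>(Fs, F, \<alpha>). (map (\<lambda>F'. H \<circ>\<^sub>s F' \<circ>\<^sub>s G) Fs, H \<circ>\<^sub>s F \<circ>\<^sub>s G,
                      \<lambda>A\<in>obj (sdom G). sar H (\<alpha> (sob G A))))
       (arr (ihom (scod G) (sdom H)))\<rparr>"

text \<open>Transposition of a functor \<open>H : M \<otimes> N \<rightarrow> P\<close> to \<open>M \<rightarrow> [N, P]\<close>.\<close>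

definition scurry :: "('o, 'a) smc \<Rightarrow> ('p, 'b) smc \<Rightarrow>
    ('o \<times> 'p, ('o, 'a, 'p, 'b) tarr, 'q, 'c) sfun \<Rightarrow>
    ('o, 'a, ('p, 'b, 'q, 'c) sfun, ('p, 'b, 'q, 'c) mtrans) sfun" where
  "scurry M N H = \<lparr>sdom = M, scod = ihom N (scod H),
     sob = \<lambda>A\<in>obj M. H \<circ>\<^sub>s inclR M N A,
     sar = \<lambda>f\<in>arr M. (map (\<lambda>A. H \<circ>\<^sub>s inclR M N A) (src M f), H \<circ>\<^sub>s inclR M N (tgt M f),
                       \<lambda>X\<in>obj N. sar H (genL M N f X))\<rparr>"


section \<open>Comparison of the structures on Cat and on sequential multicategories\<close>

text \<open>\<open>C\<^sub>\<triangleright> \<otimes> D\<^sub>\<triangleright> \<rightarrow> (C \<times> D)\<^sub>\<triangleright>\<close>, the identity on objects.\<close>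

definition seq_prod :: "('o, 'a) cat \<Rightarrow> ('p, 'b) cat \<Rightarrow>
    ('o \<times> 'p, ('o, 'a list \<times> 'o, 'p, 'b list \<times> 'p) tarr, 'o \<times> 'p, ('a \<times> 'b) list \<times> 'o \<times> 'p) sfun" where
  "seq_prod C D = tensor_lift C\<^sub>\<triangleright> D\<^sub>\<triangleright> (C \<times>\<^sub>c D)\<^sub>\<triangleright>
     (\<lambda>(A, X). (A, X))
     (\<lambda>(fs, A) X. (map (\<lambda>f. (f, Idn D X)) fs, A, X))
     (\<lambda>A (hs, X). (map (\<lambda>h. (Idn C A, h)) hs, A, X))"

text \<open>\<open>[C, D]\<^sub>\<triangleright> \<rightarrow> [C\<^sub>\<triangleright>, D\<^sub>\<triangleright>]\<close>, with value \<open>F\<^sup>\<triangleright>\<close> at an object \<open>F\<close>.\<close>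

definition seq_hom :: "('o, 'a) cat \<Rightarrow> ('p, 'b) cat \<Rightarrow>
    (('o, 'a, 'p, 'b) cfun, ('o, 'a, 'p, 'b) ntrans list \<times> ('o, 'a, 'p, 'b) cfun,
     ('o, 'a list \<times> 'o, 'p, 'b list \<times> 'p) sfun,
     ('o, 'a list \<times> 'o, 'p, 'b list \<times> 'p) mtrans) sfun" where
  "seq_hom C D = \<lparr>sdom = (fun_cat C D)\<^sub>\<triangleright>, scod = ihom C\<^sub>\<triangleright> D\<^sub>\<triangleright>,
     sob = \<lambda>F\<in>Cat C D. F\<^sup>\<triangleright>,
     sar = restrict
       (\<lambda>(\<tau>s, F). (map (\<lambda>(G, G', \<tau>). G\<^sup>\<triangleright>) \<tau>s, F\<^sup>\<triangleright>,
                   \<lambda>A\<in>Ob C. (map (\<lambda>(G, G', \<tau>). \<tau> A) \<tau>s, cob F A)))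
       (arr ((fun_cat C D)\<^sub>\<triangleright>))\<rparr>"

end

theory Submission
  imports Defs
begin

text \<open>
  In \<open>C\<^sub>\<triangleright>\<close> every arrow is the arrow \<open>\<langle>1, \<dots>, 1\<rangle>\<close> composed with unary arrows. In
  \<open>C\<^sub>\<triangleright> \<otimes> D\<^sub>\<triangleright>\<close> the arrows \<open>\<langle>1, \<dots>, 1\<rangle>\<close> coming from the two factors agree by an
  Eckmann-Hilton argument, so that every arrow has a normal form and
  \<open>C\<^sub>\<triangleright> \<otimes> D\<^sub>\<triangleright> \<cong> (C \<times> D)\<^sub>\<triangleright>\<close>. All structure maps are then compared on generators with those
  of \<open>Cat\<close>. For the internal hom, the arrows \<open>F\<^sub>1, \<dots>, F\<^sub>n \<rightarrow> F\<close> of \<open>[C\<^sub>\<triangleright>, D\<^sub>\<triangleright>]\<close> are the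
  families of natural transformations \<open>F\<^sub>i \<rightarrow> F\<close>, which gives \<open>[C\<^sub>\<triangleright>, D\<^sub>\<triangleright>] \<cong> [C, D]\<^sub>\<triangleright>\<close>.
\<close>

subsection \<open>Permutations acting on concatenations\<close>

text \<open>Two obstacles shape the development. \<open>ihom M N\<close> is not shown to satisfy the
  axioms of a symmetric multicategory for arbitrary \<open>M\<close> and \<open>N\<close>; for
  sequential ones the axioms are carried over along a structure-preserving bijection from the image
  of a functor category. Maps therefore have to be studied before anything is known about their
  codomain. Functors out of a tensor product evaluate chosen representatives of classes of terms,
  and each of them demands a proof of the interchange law. That law is verified directly only where
  a new functor arises: for the comparison with the product category, for functoriality, and for
  uncurrying. A sequential multicategory is given only up to isomorphism with some
  \<open>C\<^sub>\<triangleright>\<close>. Statements about it are conjugated by chosen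
  isomorphisms, after which arrows are lists and can be compared entry by entry. Nullary arrows do
  much of the work: they isolate one component of an arrow, which gives fullness of the embedding of
  categories, and they fill the off-diagonal places in the Eckmann-Hilton argument.\<close>

lemma permute_perm_of_list:
  "length ks = length xs \<Longrightarrow> permute_list (perm_of_list ks) xs = map ((!) xs) ks"
  by (rule nth_equalityI) (auto simp: permute_list_def perm_of_list_def)

text \<open>By counting, n entries that cover n values are pairwise distinct. So for a permutation
  given by its list of values, only the set of these values has to be computed.\<close>

lemma perm_of_list_permutes:
  assumes "set ks = {..<length ks}"
  shows "perm_of_list ks permutes {..<length ks}"
proof -
  have dist: "distinct ks"
    using assms by (intro card_distinct) simp
  have "bij_betw ((!) ks) {..<length ks} (set ks)"
    by (rule bij_betw_nth[OF dist]) auto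
  then have "bij_betw (perm_of_list ks) {..<length ks} {..<length ks}"
    using assms by (subst bij_betw_cong[where g = "(!) ks"]) (auto simp: perm_of_list_def)
  then show ?thesis
    by (rule bij_imp_permutes) (auto simp: perm_of_list_def)
qed

lemma concat_blocks: "concat (blocks k ns) = [k..<k + sum_list ns]"
proof (induction ns arbitrary: k)
  case (Cons n ns)
  then show ?case
    using upt_add_eq_append[of k "k + n" "sum_list ns"] by (simp add: add.assoc)
qed simp

lemma map_length_blocks: "map length (blocks k ns) = ns"
  by (induction ns arbitrary: k) auto

lemma length_blocks [simp]: "length (blocks k ns) = length ns"
  by (induction ns arbitrary: k) auto

text \<open>The prefix \<open>pre\<close> is there for the induction: once the first list has been
  read off it joins the prefix, and the remaining blocks start at the new length. The applications
  take \<open>pre\<close> empty.\<close>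

lemma map_nth_blocks:
  "map (map ((!) (pre @ concat xss))) (blocks (length pre) (map length xss)) = xss"
proof (induction xss arbitrary: pre)
  case (Cons xs xss)
  have "map ((!) (pre @ xs @ concat xss)) [length pre..<length pre + length xs] = xs"
    by (rule nth_equalityI) (auto simp: nth_append)
  then show ?case
    using Cons.IH[of "pre @ xs"] by simp
qed simp

text \<open>Permuting the blocks leaves the multiset of blocks unchanged, hence also the multiset of
  the indices in their concatenation, which for the unpermuted blocks is an interval.\<close>

lemma length_block_perm_list:
  assumes "\<sigma> permutes {..<length ns}"
  shows "set (concat (permute_list \<sigma> (blocks 0 ns))) = {..<sum_list ns}"
    and "length (concat (permute_list \<sigma> (blocks 0 ns))) = sum_list ns"
proof -
  have m: "mset (permute_list \<sigma> (blocks 0 ns)) = mset (blocks 0 ns)"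
    using assms by (intro mset_permute_list) simp
  have "mset (concat (permute_list \<sigma> (blocks 0 ns))) = mset (concat (blocks 0 ns))"
    unfolding mset_concat using m by (metis mset_map sum_mset_sum_list)
  then show "set (concat (permute_list \<sigma> (blocks 0 ns))) = {..<sum_list ns}"
    and "length (concat (permute_list \<sigma> (blocks 0 ns))) = sum_list ns"
    by (metis concat_blocks add_0 atLeast_upt mset_eq_setD)
      (metis concat_blocks add_0 diff_zero length_upt mset_eq_length
        \<open>mset (concat (permute_list \<sigma> (blocks 0 ns))) = mset (concat (blocks 0 ns))\<close>)
qed

lemma block_perm_permutes:
  "\<sigma> permutes {..<length ns} \<Longrightarrow> block_perm \<sigma> ns permutes {..<sum_list ns}"
  unfolding block_perm_def using perm_of_list_permutes length_block_perm_list by metis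

text \<open>Permuting a list is reading it along a list of indices. Reading commutes with
  concatenation and with the permutation of blocks, and it turns the blocks of indices back into the
  lists \<open>xss\<close> themselves.\<close>

lemma permute_block_perm:
  assumes "\<sigma> permutes {..<length xss}"
  shows "permute_list (block_perm \<sigma> (map length xss)) (concat xss) = concat (permute_list \<sigma> xss)"
proof -
  have "permute_list (block_perm \<sigma> (map length xss)) (concat xss) =
      map ((!) (concat xss)) (concat (permute_list \<sigma> (blocks 0 (map length xss))))"
    unfolding block_perm_def
    using length_block_perm_list(2)[of \<sigma> "map length xss"] assms
    by (intro permute_perm_of_list) (simp add: length_concat)
  also have "\<dots> = concat (permute_list \<sigma> (map (map ((!) (concat xss))) (blocks 0 (map length xss))))"
    using assms by (simp add: map_concat permute_list_map)
  also have "\<dots> = concat (permute_list \<sigma> xss)"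
    using map_nth_blocks[of "[]" xss] by simp
  finally show ?thesis .
qed

text \<open>The start \<open>k\<close> is arbitrary because the induction shifts it by the length of
  the first block.\<close>

lemma sum_perm_list:
  assumes "list_all2 (\<lambda>\<tau> n. \<tau> permutes {..<n}) \<tau>s ns"
  shows "set (concat (map2 permute_list \<tau>s (blocks k ns))) = {k..<k + sum_list ns}"
    and "length (concat (map2 permute_list \<tau>s (blocks k ns))) = sum_list ns"
  using assms
proof (induction \<tau>s ns arbitrary: k rule: list_all2_induct)
  case (Cons \<tau> \<tau>s n ns)
  { case 1
    have "set (permute_list \<tau> [k..<k + n]) = {k..<k + n}"
      using Cons by (subst set_permute_list) auto
    then show ?case using Cons.IH(1)[of "k + n"] by auto
  next
    case 2
    then show ?case using Cons.IH(2)[of "k + n"] by auto }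
qed auto

lemma sum_perm_permutes:
  assumes "list_all2 (\<lambda>\<tau> n. \<tau> permutes {..<n}) \<tau>s ns"
  shows "sum_perm \<tau>s ns permutes {..<sum_list ns}"
  using perm_of_list_permutes[of "concat (map2 permute_list \<tau>s (blocks 0 ns))"]
    sum_perm_list[OF assms, of 0]
  unfolding sum_perm_def by (simp add: atLeast0LessThan)

lemma permute_sum_perm:
  assumes "list_all2 (\<lambda>\<tau> xs. \<tau> permutes {..<length xs}) \<tau>s xss"
  shows "permute_list (sum_perm \<tau>s (map length xss)) (concat xss) =
      concat (map2 permute_list \<tau>s xss)"
proof -
  have a: "list_all2 (\<lambda>\<tau> n. \<tau> permutes {..<n}) \<tau>s (map length xss)"
    using assms by (simp add: list.rel_map)
  have "permute_list (sum_perm \<tau>s (map length xss)) (concat xss) =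
      map ((!) (concat xss)) (concat (map2 permute_list \<tau>s (blocks 0 (map length xss))))"
    unfolding sum_perm_def using sum_perm_list(2)[OF a, of 0]
    by (intro permute_perm_of_list) (simp add: length_concat)
  also have "\<dots> = concat (map (map ((!) (concat xss)))
      (map2 permute_list \<tau>s (blocks 0 (map length xss))))"
    by (simp add: map_concat)
  also have "map (map ((!) (concat xss))) (map2 permute_list \<tau>s (blocks 0 (map length xss))) =
      map2 permute_list \<tau>s (map (map ((!) (concat xss))) (blocks 0 (map length xss)))"
  proof (rule nth_equalityI)
    fix i assume "i < length (map (map ((!) (concat xss)))
      (map2 permute_list \<tau>s (blocks 0 (map length xss))))"
    then have i: "i < length \<tau>s" "i < length xss" by auto
    \<comment> \<open>The i-th block of indices has the length of the i-th list, so
      \<open>\<tau>s ! i\<close> permutes its positions and commutes with reading off the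
      entries.\<close>
    have "length (blocks 0 (map length xss) ! i) = length (xss ! i)"
      using map_length_blocks[of 0 "map length xss"] i(2) by (metis length_blocks length_map nth_map)
    then have "\<tau>s ! i permutes {..<length (blocks 0 (map length xss) ! i)}"
      using assms i by (auto simp: list_all2_conv_all_nth)
    then show "map (map ((!) (concat xss)))
        (map2 permute_list \<tau>s (blocks 0 (map length xss))) ! i =
      map2 permute_list \<tau>s (map (map ((!) (concat xss))) (blocks 0 (map length xss))) ! i"
      using i by (simp add: permute_list_map)
  qed simp
  also have "map (map ((!) (concat xss))) (blocks 0 (map length xss)) = xss"
    using map_nth_blocks[of "[]" xss] by simp
  finally show ?thesis .
qed

section \<open>Transposition of a rectangular grid\<close>

lemma length_concat_grid: "length (concat (map (\<lambda>j. map (F j) [0..<n]) [0..<m])) = m * n"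
  by (simp add: length_concat o_def sum_list_triv)

lemma nth_concat_grid:
  "i < n \<Longrightarrow> j < m \<Longrightarrow> concat (map (\<lambda>j. map (F j) [0..<n]) [0..<m]) ! (j * n + i) = F j i"
proof (induction m)
  case (Suc m)
  show ?case
  proof (cases "j < m")
    case True
    then have "Suc j * n \<le> m * n" by (intro mult_le_mono1) simp
    then have "j * n + i < m * n" using Suc.prems by simp
    then show ?thesis
      using Suc True by (simp add: nth_append length_concat_grid)
  next
    case False
    then have "j = m" using Suc.prems by simp
    then show ?thesis
      using Suc.prems by (simp add: nth_append length_concat_grid)
  qed
qed simp

lemma grid_index_less: "(i::nat) < n \<Longrightarrow> j < m \<Longrightarrow> j * n + i < n * m"
  by (metis add.commute add_less_cancel_left div_less less_mult_imp_div_less linorder_not_less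
      mod_less mult.commute nat_mult_less_cancel_disj div_mult_self3 add_cancel_right_left
      div_less_iff_less_mult gr_zeroI less_zeroE)

lemma transp_perm_index:
  "i < n \<Longrightarrow> j < m \<Longrightarrow> transp_perm n m (i * m + j) = j * n + i"
  using grid_index_less[of j m i n] unfolding transp_perm_def perm_of_list_def
  by (simp add: length_concat_grid nth_concat_grid mult.commute)

lemma transp_perm_permutes: "transp_perm n m permutes {..<n * m}"
proof -
  let ?ks = "concat (map (\<lambda>i. map (\<lambda>j. j * n + i) [0..<m]) [0..<n])"
  have len: "length ?ks = n * m" by (rule length_concat_grid)
  have "set ?ks = {..<n * m}"
  proof (intro set_eqI iffI)
    fix k assume "k \<in> set ?ks"
    then show "k \<in> {..<n * m}" using grid_index_less by auto
  next
    fix k assume "k \<in> {..<n * m}"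
    then have k: "k < n * m" by simp
    then have "n > 0" by (cases n) auto
    \<comment> \<open>Row \<open>i\<close> of the grid lists the numbers \<open>j * n + i\<close>,
      so \<open>k\<close> is found in row \<open>k mod n\<close> at place
      \<open>k div n\<close>.\<close>
    then have "k mod n < n" "k div n < m" "k = (k div n) * n + k mod n"
      using k by (auto simp: less_mult_imp_div_less mult.commute)
    then have "k \<in> (\<lambda>j. j * n + k mod n) ` {0..<m}" by (intro image_eqI[of _ _ "k div n"]) auto
    then show "k \<in> set ?ks" using \<open>k mod n < n\<close> by auto
  qed
  then show ?thesis
    unfolding transp_perm_def using perm_of_list_permutes len by metis
qed

text \<open>Inside the grid both transpositions are given by division with remainder; outside it
  both fix every number. The lemma is needed for currying, where the interchange relation and the
  naturality condition of the internal hom are written with opposite transpositions.\<close>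

lemma transp_perm_inverse: "transp_perm n m \<circ> transp_perm m n = id"
proof
  fix k
  show "(transp_perm n m \<circ> transp_perm m n) k = id k"
  proof (cases "k < m * n")
    case True
    then have "n > 0" by (cases n) auto
    then have k: "k mod n < n" "k div n < m" "k = (k div n) * n + k mod n"
      using True by (auto simp: less_mult_imp_div_less)
    then have "transp_perm m n k = (k mod n) * m + k div n"
      using transp_perm_index by metis
    then show ?thesis using k transp_perm_index by simp
  next
    case False
    then show ?thesis
      using transp_perm_permutes[of m n] transp_perm_permutes[of n m]
      by (simp add: permutes_not_in mult.commute)
  qed
qed

text \<open>The two sides list one table of values \<open>F f h\<close> by columns and by rows.
  Every interchange or naturality law verified by hand in some
  \<open>C\<^sub>\<triangleright>\<close> comes down to this identity.\<close>

lemma permute_transp_perm: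
  "permute_list (transp_perm (length fs) (length hs)) (concat (map (\<lambda>h. map (\<lambda>f. F f h) fs) hs)) =
     concat (map (\<lambda>f. map (F f) hs) fs)"
proof -
  let ?n = "length fs" and ?m = "length hs"
  let ?xs = "concat (map (\<lambda>j. map (\<lambda>i. F (fs ! i) (hs ! j)) [0..<?n]) [0..<?m])"
  \<comment> \<open>Replaces the two lists by their ranges of positions, so that entries of the
    concatenation can be addressed by the formula \<open>j * n + i\<close>.\<close>
  have grid: "concat (map (\<lambda>y. map (\<lambda>x. G x y) xs) ys) =
      concat (map (\<lambda>j. map (\<lambda>i. G (xs ! i) (ys ! j)) [0..<length xs]) [0..<length ys])"
    for G :: "'x \<Rightarrow> 'y \<Rightarrow> 'z" and xs ys
    by (rule arg_cong[where f = concat]) (auto intro!: nth_equalityI)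
  have "permute_list (transp_perm ?n ?m) ?xs =
      map ((!) ?xs) (concat (map (\<lambda>i. map (\<lambda>j. j * ?n + i) [0..<?m]) [0..<?n]))"
    unfolding transp_perm_def
    by (rule permute_perm_of_list) (simp add: length_concat_grid)
  also have "\<dots> = concat (map (\<lambda>i. map (\<lambda>j. F (fs ! i) (hs ! j)) [0..<?m]) [0..<?n])"
    by (auto simp: map_concat nth_concat_grid intro!: arg_cong[where f = concat])
  finally show ?thesis
    using grid[of F fs hs] grid[of "\<lambda>h f. F f h" hs fs] by simp
qed

subsection \<open>Symmetric functors\<close>

text \<open>
  Nothing is required of the domain and the codomain here, so that a bijective \<open>smorph\<close> can be
  used to transport the axioms of symmetric multicategories (\<open>smorph_bij\<close>).
\<close>

definition smorph :: "('o, 'a, 'p, 'b) sfun \<Rightarrow> bool" where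
  "smorph F \<longleftrightarrow>
     sob F \<in> obj (sdom F) \<rightarrow>\<^sub>E obj (scod F) \<and>
     sar F \<in> arr (sdom F) \<rightarrow>\<^sub>E arr (scod F) \<and>
     (\<forall>f\<in>arr (sdom F). src (scod F) (sar F f) = map (sob F) (src (sdom F) f) \<and>
                       tgt (scod F) (sar F f) = sob F (tgt (sdom F) f)) \<and>
     (\<forall>X\<in>obj (sdom F). sar F (idn (sdom F) X) = idn (scod F) (sob F X)) \<and>
     (\<forall>f gs. composable (sdom F) f gs \<longrightarrow>
        sar F (cmp (sdom F) f gs) = cmp (scod F) (sar F f) (map (sar F) gs)) \<and>
     (\<forall>f \<sigma>. f \<in> arr (sdom F) \<and> \<sigma> permutes {..<length (src (sdom F) f)} \<longrightarrow>
        sar F (act (sdom F) \<sigma> f) = act (scod F) \<sigma> (sar F f))"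

lemma sym_functor_iff:
  "sym_functor F \<longleftrightarrow> sym_multicategory (sdom F) \<and> sym_multicategory (scod F) \<and> smorph F"
  unfolding sym_functor_def smorph_def by blast

lemma sMlt_iff:
  "F \<in> sMlt M N \<longleftrightarrow> sdom F = M \<and> scod F = N \<and> sym_multicategory M \<and> sym_multicategory N \<and> smorph F"
  unfolding sMlt_def sym_functor_iff by blast

lemma sMltI:
  assumes "sdom F = M" "scod F = N" "sym_multicategory M" "sym_multicategory N"
    "sob F \<in> extensional (obj M)" "sar F \<in> extensional (arr M)"
    "\<And>X. X \<in> obj M \<Longrightarrow> sob F X \<in> obj N"
    "\<And>f. f \<in> arr M \<Longrightarrow> sar F f \<in> arr N"
    "\<And>f. f \<in> arr M \<Longrightarrow> src N (sar F f) = map (sob F) (src M f)"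
    "\<And>f. f \<in> arr M \<Longrightarrow> tgt N (sar F f) = sob F (tgt M f)"
    "\<And>X. X \<in> obj M \<Longrightarrow> sar F (idn M X) = idn N (sob F X)"
    "\<And>f gs. composable M f gs \<Longrightarrow> sar F (cmp M f gs) = cmp N (sar F f) (map (sar F) gs)"
    "\<And>f \<sigma>. f \<in> arr M \<Longrightarrow> \<sigma> permutes {..<length (src M f)} \<Longrightarrow>
       sar F (act M \<sigma> f) = act N \<sigma> (sar F f)"
  shows "F \<in> sMlt M N"
  unfolding sMlt_iff smorph_def using assms by (auto simp: PiE_def)

lemma sMltD:
  assumes "F \<in> sMlt M N"
  shows "sdom F = M" "scod F = N" "sym_multicategory M" "sym_multicategory N"
    "sob F \<in> extensional (obj M)" "sar F \<in> extensional (arr M)"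
    "X \<in> obj M \<Longrightarrow> sob F X \<in> obj N"
    "f \<in> arr M \<Longrightarrow> sar F f \<in> arr N"
    "f \<in> arr M \<Longrightarrow> src N (sar F f) = map (sob F) (src M f)"
    "f \<in> arr M \<Longrightarrow> tgt N (sar F f) = sob F (tgt M f)"
    "X \<in> obj M \<Longrightarrow> sar F (idn M X) = idn N (sob F X)"
    "composable M f gs \<Longrightarrow> sar F (cmp M f gs) = cmp N (sar F f) (map (sar F) gs)"
    "f \<in> arr M \<Longrightarrow> \<sigma> permutes {..<length (src M f)} \<Longrightarrow>
       sar F (act M \<sigma> f) = act N \<sigma> (sar F f)"
  using assms unfolding sMlt_iff smorph_def by (auto simp: PiE_def Pi_def)

lemma sfun_eqI:
  assumes "F \<in> sMlt M N" "G \<in> sMlt M N"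
    and "\<And>X. X \<in> obj M \<Longrightarrow> sob F X = sob G X" "\<And>f. f \<in> arr M \<Longrightarrow> sar F f = sar G f"
  shows "F = G"
proof -
  have "sob F = sob G" "sar F = sar G"
    using sMltD(5,6)[OF assms(1)] sMltD(5,6)[OF assms(2)] assms(3,4)
    by (auto intro: extensionalityI)
  then show ?thesis
    using sMltD(1,2)[OF assms(1)] sMltD(1,2)[OF assms(2)] by (cases F; cases G) simp
qed

section \<open>Identities and composition of symmetric functors\<close>

lemma scomp_simps [simp]:
  "sdom (G \<circ>\<^sub>s F) = sdom F" "scod (G \<circ>\<^sub>s F) = scod G"
  "X \<in> obj (sdom F) \<Longrightarrow> sob (G \<circ>\<^sub>s F) X = sob G (sob F X)"
  "f \<in> arr (sdom F) \<Longrightarrow> sar (G \<circ>\<^sub>s F) f = sar G (sar F f)"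
  by (simp_all add: scomp_def)

lemma sid_simps [simp]:
  "sdom (sid M) = M" "scod (sid M) = M"
  "X \<in> obj M \<Longrightarrow> sob (sid M) X = X" "f \<in> arr M \<Longrightarrow> sar (sid M) f = f"
  by (simp_all add: sid_def)

lemma composable_sMlt:
  assumes "F \<in> sMlt M N" "composable M f gs"
  shows "composable N (sar F f) (map (sar F) gs)"
proof -
  note F = sMltD[OF assms(1)]
  have f: "f \<in> arr M" and gs: "set gs \<subseteq> arr M" and eq: "map (tgt M) gs = src M f"
    using assms(2) unfolding composable_def by auto
  have "map (tgt N) (map (sar F) gs) = map (sob F) (map (tgt M) gs)"
    using F(10) gs by auto
  then show ?thesis
    using f gs F(8,9) unfolding composable_def eq by auto
qed

lemma composableD:
  assumes "composable M f gs"
  shows "f \<in> arr M" "set gs \<subseteq> arr M" "map (tgt M) gs = src M f" "length gs = length (src M f)"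
  using assms unfolding composable_def by (blast, blast, blast, metis length_map)

lemma composable_arr: "composable M f gs \<Longrightarrow> g \<in> set gs \<Longrightarrow> g \<in> arr M"
  unfolding composable_def by blast

lemma sid_sMlt [simp]: "sym_multicategory M \<Longrightarrow> sid M \<in> sMlt M M"
proof -
  assume M: "sym_multicategory M"
  interpret sym_multicategory M by (rule M)
  show ?thesis
  proof (rule sMltI)
    fix f assume f: "f \<in> arr M"
    have "map (sob (sid M)) (src M f) = src M f"
      using src_obj[OF f] by (intro map_idI) auto
    then show "src M (sar (sid M) f) = map (sob (sid M)) (src M f)" using f by simp
  next
    fix f gs assume fg: "composable M f gs"
    then have "map (sar (sid M)) gs = gs"
      by (intro map_idI) (auto dest: composable_arr)
    then show "sar (sid M) (cmp M f gs) = cmp M (sar (sid M) f) (map (sar (sid M)) gs)"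
      using fg cmp_arr by (auto dest: composableD)
  qed (use M in \<open>auto simp: sid_def tgt_obj idn_arr act_arr\<close>)
qed

lemma scomp_sMlt [intro]:
  assumes "G \<in> sMlt N P" "F \<in> sMlt M N"
  shows "G \<circ>\<^sub>s F \<in> sMlt M P"
proof -
  interpret M: sym_multicategory M using sMltD(3)[OF assms(2)] .
  note G = sMltD[OF assms(1)] note F = sMltD[OF assms(2)]
  show ?thesis
  proof (rule sMltI)
    fix f assume f: "f \<in> arr M"
    show "src P (sar (G \<circ>\<^sub>s F) f) = map (sob (G \<circ>\<^sub>s F)) (src M f)"
      using f F G M.src_obj[OF f] by (auto simp: subset_iff)
  next
    fix f gs assume fg: "composable M f gs"
    then have c: "map (sar (G \<circ>\<^sub>s F)) gs = map (sar G) (map (sar F) gs)"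
      using F(1) by (auto dest: composable_arr)
    show "sar (G \<circ>\<^sub>s F) (cmp M f gs) =
        cmp P (sar (G \<circ>\<^sub>s F) f) (map (sar (G \<circ>\<^sub>s F)) gs)"
      unfolding c using composable_sMlt[OF assms(2) fg] F(1,12) G(12) M.cmp_arr fg composableD(1)[OF fg]
      by simp
  next
    fix f \<sigma> assume "f \<in> arr M" "\<sigma> permutes {..<length (src M f)}"
    then show "sar (G \<circ>\<^sub>s F) (act M \<sigma> f) = act P \<sigma> (sar (G \<circ>\<^sub>s F) f)"
      using F G M.act_arr by simp
  qed (use F G in \<open>auto simp: M.tgt_obj M.idn_arr scomp_def\<close>)
qed

lemma scomp_assoc:
  assumes "H \<in> sMlt P Q" "G \<in> sMlt N P" "F \<in> sMlt M N"
  shows "H \<circ>\<^sub>s G \<circ>\<^sub>s F = H \<circ>\<^sub>s (G \<circ>\<^sub>s F)"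
  using sMltD[OF assms(1)] sMltD[OF assms(2)] sMltD[OF assms(3)]
  by (auto simp: scomp_def)

lemma scomp_sid [simp]: "F \<in> sMlt M N \<Longrightarrow> F \<circ>\<^sub>s sid M = F" "F \<in> sMlt M N \<Longrightarrow> sid N \<circ>\<^sub>s F = F"
  using sMltD[of F M N] by (auto intro!: sfun_eqI[of _ M N] scomp_sMlt)

section \<open>Isomorphisms\<close>

lemma sinverse_unique:
  assumes "sinverse F G" "sinverse F H"
  shows "G = H"
proof -
  obtain M N where F: "F \<in> sMlt M N" and G: "G \<in> sMlt N M" "G \<circ>\<^sub>s F = sid M"
    and H: "H \<in> sMlt N M" "F \<circ>\<^sub>s H = sid N"
    using assms unfolding sinverse_def by blast
  have "G = G \<circ>\<^sub>s (F \<circ>\<^sub>s H)"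
    using G(1) H(2) by simp
  also have "\<dots> = H"
    using scomp_assoc[OF G(1) F H(1)] G(2) H(1) by simp
  finally show ?thesis .
qed

lemma sinverse_sinv: "siso F \<Longrightarrow> sinverse F (sinv F)"
  unfolding siso_def sinv_def using sinverse_unique by (metis (mono_tags, lifting) theI')

lemma sisosD:
  assumes "F \<in> sisos M N"
  shows "F \<in> sMlt M N" "sinv F \<in> sisos N M" "sinv F \<in> sMlt N M"
    "sinv F \<circ>\<^sub>s F = sid M" "F \<circ>\<^sub>s sinv F = sid N"
proof -
  show F: "F \<in> sMlt M N" using assms unfolding sisos_def by blast
  have "sinverse F (sinv F)" using assms sinverse_sinv unfolding sisos_def by blast
  then show "sinv F \<in> sisos N M" "sinv F \<in> sMlt N M" "sinv F \<circ>\<^sub>s F = sid M" "F \<circ>\<^sub>s sinv F = sid N"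
    using sMltD(1,2)[OF F] unfolding sisos_def siso_def sinverse_def
    by (auto simp: sMltD(1,2)[of "sinv F" N M])
qed

lemma sisosI:
  assumes "F \<in> sMlt M N" "G \<in> sMlt N M" "G \<circ>\<^sub>s F = sid M" "F \<circ>\<^sub>s G = sid N"
  shows "F \<in> sisos M N"
  using assms sMltD(1,2)[of F M N] unfolding sisos_def siso_def sinverse_def by auto

lemma sid_sisos [simp]: "sym_multicategory M \<Longrightarrow> sid M \<in> sisos M M"
  by (rule sisosI[of _ _ _ "sid M"]) (auto simp: scomp_sid[of _ M M])

lemma scomp_sisos:
  assumes "G \<in> sisos N P" "F \<in> sisos M N"
  shows "G \<circ>\<^sub>s F \<in> sisos M P"
proof (rule sisosI)
  note G = sisosD[OF assms(1)] note F = sisosD[OF assms(2)]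
  show "G \<circ>\<^sub>s F \<in> sMlt M P" "sinv F \<circ>\<^sub>s sinv G \<in> sMlt P M"
    using F(1,3) G(1,3) by (blast intro: scomp_sMlt)+
  have "sinv F \<circ>\<^sub>s sinv G \<circ>\<^sub>s (G \<circ>\<^sub>s F) = sinv F \<circ>\<^sub>s (sinv G \<circ>\<^sub>s G \<circ>\<^sub>s F)"
    using scomp_assoc[OF F(3) G(3) scomp_sMlt[OF G(1) F(1)]] scomp_assoc[OF G(3,1) F(1)] by simp
  then show "sinv F \<circ>\<^sub>s sinv G \<circ>\<^sub>s (G \<circ>\<^sub>s F) = sid M"
    unfolding F(4) G(4) scomp_sid(2)[OF F(1)] .
  have "G \<circ>\<^sub>s F \<circ>\<^sub>s (sinv F \<circ>\<^sub>s sinv G) = G \<circ>\<^sub>s (F \<circ>\<^sub>s sinv F \<circ>\<^sub>s sinv G)"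
    using scomp_assoc[OF G(1) F(1) scomp_sMlt[OF F(3) G(3)]] scomp_assoc[OF F(1,3) G(3)] by simp
  then show "G \<circ>\<^sub>s F \<circ>\<^sub>s (sinv F \<circ>\<^sub>s sinv G) = sid P"
    unfolding F(5) G(5) scomp_sid(2)[OF G(3)] .
qed

lemma sisos_inverse:
  assumes "J \<in> sisos M N"
  shows "X \<in> obj M \<Longrightarrow> sob (sinv J) (sob J X) = X" "f \<in> arr M \<Longrightarrow> sar (sinv J) (sar J f) = f"
    "Y \<in> obj N \<Longrightarrow> sob J (sob (sinv J) Y) = Y" "g \<in> arr N \<Longrightarrow> sar J (sar (sinv J) g) = g"
  using sisosD(4)[OF assms] sisosD(5)[OF assms] sMltD(1)[OF sisosD(1)[OF assms]]
    sMltD(1)[OF sisosD(3)[OF assms]]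
  by (metis scomp_simps(3) sid_simps(3), metis scomp_simps(4) sid_simps(4),
      metis scomp_simps(3) sid_simps(3), metis scomp_simps(4) sid_simps(4))

lemma sisos_cancel_left:
  assumes "J \<in> sisos N P" "F \<in> sMlt M N" "G \<in> sMlt M N" "J \<circ>\<^sub>s F = J \<circ>\<^sub>s G"
  shows "F = G"
proof -
  have "sinv J \<circ>\<^sub>s (J \<circ>\<^sub>s F) = F" if "F \<in> sMlt M N" for F :: "('e, 'f, 'a, 'b) sfun"
    using scomp_assoc[OF sisosD(3)[OF assms(1)] sisosD(1)[OF assms(1)] that]
      sisosD(4)[OF assms(1)] scomp_sid(2)[OF that] by simp
  then show ?thesis using assms(2-4) by metis
qed

lemma sinv_cancel:
  assumes "J \<in> sisos N P" "F \<in> sMlt M P"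
  shows "J \<circ>\<^sub>s (sinv J \<circ>\<^sub>s F) = F"
  using scomp_assoc[OF sisosD(1)[OF assms(1)] sisosD(3)[OF assms(1)] assms(2)]
    sisosD(5)[OF assms(1)] scomp_sid(2)[OF assms(2)] by simp

text \<open>Every axiom for the codomain is the image of the same axiom for the domain: the arrows
  involved are lifted along the bijection, the axiom is applied upstairs, and the result is mapped
  down. The codomain is not assumed to satisfy anything, and this is how the internal homs come to
  be symmetric multicategories.\<close>

lemma smorph_bij:
  assumes M: "sym_multicategory (sdom F)" and F: "smorph F"
    and bob: "bij_betw (sob F) (obj (sdom F)) (obj (scod F))"
    and bar: "bij_betw (sar F) (arr (sdom F)) (arr (scod F))"
  shows "sym_multicategory (scod F)" "F \<in> sisos (sdom F) (scod F)"
proof -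
  define M N \<phi> \<psi> where defs: "M = sdom F" "N = scod F" "\<phi> = sob F" "\<psi> = sar F"
  interpret M: sym_multicategory M using M unfolding defs .
  have ob: "\<phi> X \<in> obj N" if "X \<in> obj M" for X
    using F that unfolding smorph_def defs by auto
  have ar: "\<psi> f \<in> arr N" "src N (\<psi> f) = map \<phi> (src M f)" "tgt N (\<psi> f) = \<phi> (tgt M f)"
    if "f \<in> arr M" for f
    using F that unfolding smorph_def defs by auto
  have id: "\<psi> (idn M X) = idn N (\<phi> X)" if "X \<in> obj M" for X
    using F that unfolding smorph_def defs by auto
  have cm: "cmp N (\<psi> f) (map \<psi> gs) = \<psi> (cmp M f gs)" if "composable M f gs" for f gs
    using F that unfolding smorph_def defs by auto
  have ac: "act N \<sigma> (\<psi> f) = \<psi> (act M \<sigma> f)" if "f \<in> arr M" "\<sigma> permutes {..<length (src M f)}" for f \<sigma>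
    using F that unfolding smorph_def defs by auto
  have inj: "inj_on \<phi> (obj M)" and injar: "inj_on \<psi> (arr M)"
    and surj: "\<phi> ` obj M = obj N" and surjar: "\<psi> ` arr M = arr N"
    using bob bar unfolding defs bij_betw_def by auto
  have lift1: "\<exists>f0\<in>arr M. f = \<psi> f0" if "f \<in> arr N" for f using that surjar by blast
  have lift_list: "\<exists>fs0. set fs0 \<subseteq> arr M \<and> fs = map \<psi> fs0" if "set fs \<subseteq> arr N" for fs
  proof -
    have "fs \<in> lists (\<psi> ` arr M)" using that surjar by auto
    then show ?thesis unfolding lists_image by auto
  qed
  \<comment> \<open>Composability is reflected as well as preserved because the map on objects is
    injective, so that equal lists of images come from equal lists of objects.\<close>
  have comp_iff: "composable N (\<psi> f) (map \<psi> gs) \<longleftrightarrow> composable M f gs"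
    if "f \<in> arr M" "set gs \<subseteq> arr M" for f gs
  proof -
    have t: "map (tgt N) (map \<psi> gs) = map \<phi> (map (tgt M) gs)" using that ar by (auto simp: subset_iff)
    have "map \<phi> (map (tgt M) gs) = map \<phi> (src M f) \<longleftrightarrow> map (tgt M) gs = src M f"
      by (intro inj_on_map_eq_map inj_on_subset[OF inj])
        (use that M.tgt_obj M.src_obj in auto)
    then show ?thesis using that ar(1,2) unfolding composable_def t by auto
  qed
  have lift: "\<exists>f0 gs0. composable M f0 gs0 \<and> f = \<psi> f0 \<and> gs = map \<psi> gs0" if "composable N f gs" for f gs
  proof -
    obtain f0 where "f0 \<in> arr M" "f = \<psi> f0" using lift1 composableD(1)[OF \<open>composable N f gs\<close>] by auto
    moreover obtain gs0 where "set gs0 \<subseteq> arr M" "gs = map \<psi> gs0"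
      using lift_list composableD(2)[OF \<open>composable N f gs\<close>] by blast
    ultimately show ?thesis using comp_iff that by blast
  qed
  have len: "length (src N (\<psi> f)) = length (src M f)" if "f \<in> arr M" for f
    using ar that by simp
  have lens: "map (length \<circ> src N) (map \<psi> gs) = map (length \<circ> src M) gs" if "set gs \<subseteq> arr M" for gs
    using ar that by (auto simp: subset_iff)
  have N: "sym_multicategory N"
  proof
    fix f assume "f \<in> arr N"
    then obtain f0 where f0: "f0 \<in> arr M" "f = \<psi> f0" using lift1 by auto
    show "set (src N f) \<subseteq> obj N" "tgt N f \<in> obj N"
      using f0 ar ob M.src_obj[OF f0(1)] M.tgt_obj by auto
    show "cmp N (idn N (tgt N f)) [f] = f"
    proof -
      have "composable M (idn M (tgt M f0)) [f0]"
        using f0 M.idn_arr M.src_idn M.tgt_obj unfolding composable_def by simp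
      from cm[OF this] show ?thesis using f0 ar id M.tgt_obj M.idn_cmp by simp
    qed
    show "cmp N f (map (idn N) (src N f)) = f"
    proof -
      have s: "set (src M f0) \<subseteq> obj M" using f0 M.src_obj by auto
      then have "composable M f0 (map (idn M) (src M f0))"
        using f0 M.idn_arr M.tgt_idn unfolding composable_def by (auto intro!: map_idI)
      from cm[OF this] show ?thesis
        using f0 ar M.cmp_idn s id by (auto simp: comp_def subset_iff cong: map_cong)
    qed
    show "act N id f = f" using f0 ac[of f0 id] M.act_id permutes_id by simp
    fix \<sigma> assume \<sigma>: "\<sigma> permutes {..<length (src N f)}"
    then have \<sigma>0: "\<sigma> permutes {..<length (src M f0)}" using f0 len by simp
    have a: "act N \<sigma> f = \<psi> (act M \<sigma> f0)" using f0 ac \<sigma>0 by simp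
    show "act N \<sigma> f \<in> arr N" "src N (act N \<sigma> f) = permute_list \<sigma> (src N f)"
      "tgt N (act N \<sigma> f) = tgt N f"
      using a f0 ar \<sigma>0 M.act_arr M.src_act M.tgt_act by (simp_all add: permute_list_map)
    fix \<tau> assume "\<tau> permutes {..<length (src N f)}"
    then have \<tau>0: "\<tau> permutes {..<length (src M f0)}" using f0 len by simp
    have "act N \<tau> (act N \<sigma> f) = \<psi> (act M \<tau> (act M \<sigma> f0))"
      using a ac[of "act M \<sigma> f0" \<tau>] f0 \<sigma>0 \<tau>0 M.act_arr M.src_act by simp
    then show "act N (\<sigma> \<circ> \<tau>) f = act N \<tau> (act N \<sigma> f)"
      using f0 \<sigma>0 \<tau>0 ac permutes_compose M.act_comp by metis
  next
    fix X assume "X \<in> obj N"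
    then obtain X0 where X0: "X0 \<in> obj M" "X = \<phi> X0" using surj by auto
    then show "idn N X \<in> arr N" "src N (idn N X) = [X]" "tgt N (idn N X) = X"
      using id[of X0] ar[of "idn M X0"] M.idn_arr M.src_idn M.tgt_idn by simp_all
  next
    fix f gs assume "composable N f gs"
    then obtain f0 gs0 where c0: "composable M f0 gs0" and eqs: "f = \<psi> f0" "gs = map \<psi> gs0"
      using lift by blast
    note c0D = composableD[OF c0]
    have c: "cmp N f gs = \<psi> (cmp M f0 gs0)" using c0 eqs cm by simp
    have lgs: "map (length \<circ> src N) gs = map (length \<circ> src M) gs0" using eqs lens c0D by simp
    show "cmp N f gs \<in> arr N" "tgt N (cmp N f gs) = tgt N f"
      using c c0 c0D ar M.cmp_arr M.tgt_cmp eqs by simp_all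
    show "src N (cmp N f gs) = concat (map (src N) gs)"
      using c c0 c0D ar M.cmp_arr M.src_cmp eqs
      by (auto simp: map_concat subset_iff intro!: arg_cong[where f = concat])
    \<comment> \<open>Preservation of the action applies only to permutations of the right size;
      this computes the size for the block and sum permutations below.\<close>
    have lsrc: "length (src M (cmp M f0 gs0)) = sum_list (map (length \<circ> src M) gs0)"
      using M.src_cmp c0 by (simp add: length_concat comp_def)
    show "cmp N (cmp N f gs) (concat hss) = cmp N f (map2 (cmp N) gs hss)"
      if "list_all2 (composable N) gs hss" for hss
    proof -
      \<comment> \<open>The lists in \<open>hss\<close> are lifted one after the other, each being
        composable with the image of an arrow whose lift is already chosen.\<close>
      have "\<exists>hss0. hss = map (map \<psi>) hss0 \<and> list_all2 (composable M) gs0 hss0"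
        using that c0D(2) unfolding eqs(2) list_all2_map1
      proof (induction gs0 arbitrary: hss)
        case (Cons g gs0)
        then obtain hs hss' where h: "hss = hs # hss'" "composable N (\<psi> g) hs"
          "list_all2 (\<lambda>x. composable N (\<psi> x)) gs0 hss'" by (auto simp: list_all2_Cons1)
        obtain hs0 where hs0: "set hs0 \<subseteq> arr M" "hs = map \<psi> hs0"
          using lift_list composableD(2)[OF h(2)] by blast
        then have "composable M g hs0" using h(2) comp_iff Cons.prems by auto
        moreover obtain hss0 where "hss' = map (map \<psi>) hss0" "list_all2 (composable M) gs0 hss0"
          using Cons.IH[of hss'] h(3) Cons.prems by auto
        ultimately have "hss = map (map \<psi>) (hs0 # hss0) \<and> list_all2 (composable M) (g # gs0) (hs0 # hss0)"
          using h hs0 by auto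
        then show ?case by blast
      qed auto
      then obtain hss0 where hss0: "hss = map (map \<psi>) hss0" "list_all2 (composable M) gs0 hss0"
        by blast
      have m2: "map2 (cmp N) gs hss = map \<psi> (map2 (cmp M) gs0 hss0)"
        using hss0(2) unfolding eqs(2) hss0(1)
        by (induction rule: list_all2_induct) (auto simp: cm)
      have ca: "composable M f0 (map2 (cmp M) gs0 hss0)"
      proof -
        have "set (map2 (cmp M) gs0 hss0) \<subseteq> arr M \<and>
            map (tgt M) (map2 (cmp M) gs0 hss0) = map (tgt M) gs0"
          using hss0(2) by (induction rule: list_all2_induct) (auto simp: M.cmp_arr M.tgt_cmp)
        then show ?thesis using c0D unfolding composable_def by auto
      qed
      have cb: "composable M (cmp M f0 gs0) (concat hss0)"
      proof -
        have "set (concat hss0) \<subseteq> arr M \<and> map (tgt M) (concat hss0) = concat (map (src M) gs0)"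
          using hss0(2) by (induction rule: list_all2_induct) (auto simp: composable_def)
        then show ?thesis using M.cmp_arr M.src_cmp c0 unfolding composable_def by auto
      qed
      have "cmp N (cmp N f gs) (concat hss) = \<psi> (cmp M (cmp M f0 gs0) (concat hss0))"
        unfolding c hss0(1) using cm[OF cb] by (simp add: map_concat)
      also have "\<dots> = cmp N f (map2 (cmp N) gs hss)"
        unfolding m2 eqs(1) using cm[OF ca] M.cmp_assoc[OF c0 hss0(2)] by simp
      finally show ?thesis .
    qed
    show "cmp N (act N \<sigma> f) (permute_list \<sigma> gs) =
        act N (block_perm \<sigma> (map (length \<circ> src N) gs)) (cmp N f gs)"
      if "\<sigma> permutes {..<length gs}" for \<sigma>
    proof -
      have \<sigma>: "\<sigma> permutes {..<length gs0}" "\<sigma> permutes {..<length (src M f0)}"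
        using that eqs c0D(4) by simp_all
      have "composable M (act M \<sigma> f0) (permute_list \<sigma> gs0)"
        using \<sigma> c0D M.act_arr M.src_act set_permute_list[OF \<sigma>(1)]
        unfolding composable_def by (simp flip: permute_list_map)
      then have "cmp N (act N \<sigma> f) (permute_list \<sigma> gs) = \<psi> (cmp M (act M \<sigma> f0) (permute_list \<sigma> gs0))"
        using cm[of "act M \<sigma> f0" "permute_list \<sigma> gs0"] ac[of f0 \<sigma>] \<sigma> c0D eqs
        by (simp add: permute_list_map)
      moreover have "block_perm \<sigma> (map (length \<circ> src M) gs0) permutes {..<length (src M (cmp M f0 gs0))}"
        unfolding lsrc using \<sigma>(1) by (intro block_perm_permutes) simp
      ultimately show ?thesis
        unfolding c lgs using M.act_cmp_outer[OF c0 \<sigma>(1)] ac M.cmp_arr c0 by simp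
    qed
    show "cmp N f (map2 (act N) \<tau>s gs) =
        act N (sum_perm \<tau>s (map (length \<circ> src N) gs)) (cmp N f gs)"
      if "list_all2 (\<lambda>\<tau> g. \<tau> permutes {..<length (src N g)}) \<tau>s gs" for \<tau>s
    proof -
      have \<tau>s: "list_all2 (\<lambda>\<tau> g. \<tau> permutes {..<length (src M g)} \<and> g \<in> arr M) \<tau>s gs0"
        using that c0D(2) len unfolding eqs by (auto simp: list_all2_conv_all_nth subset_iff)
      then have \<tau>s': "list_all2 (\<lambda>\<tau> g. \<tau> permutes {..<length (src M g)}) \<tau>s gs0"
        by (rule list_all2_mono) auto
      have m2: "map2 (act N) \<tau>s gs = map \<psi> (map2 (act M) \<tau>s gs0)"
        using \<tau>s unfolding eqs(2) by (induction rule: list_all2_induct) (auto simp: ac)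
      have "set (map2 (act M) \<tau>s gs0) \<subseteq> arr M \<and> map (tgt M) (map2 (act M) \<tau>s gs0) = map (tgt M) gs0"
        using \<tau>s by (induction rule: list_all2_induct) (auto simp: M.act_arr M.tgt_act)
      then have ca: "composable M f0 (map2 (act M) \<tau>s gs0)" using c0D unfolding composable_def by auto
      have "sum_perm \<tau>s (map (length \<circ> src M) gs0) permutes {..<length (src M (cmp M f0 gs0))}"
        unfolding lsrc using \<tau>s' by (intro sum_perm_permutes) (simp add: list.rel_map)
      then show ?thesis
        unfolding c lgs m2 unfolding eqs(1)
        using cm[OF ca] M.act_cmp_inner[OF c0 \<tau>s'] ac M.cmp_arr c0 by simp
    qed
  qed
  show "sym_multicategory (scod F)" using N unfolding defs .
  have FMN: "F \<in> sMlt M N" using M.sym_multicategory_axioms N F unfolding sMlt_iff defs by simp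
  define G where "G = \<lparr>sdom = N, scod = M, sob = \<lambda>X\<in>obj N. inv_into (obj M) \<phi> X,
    sar = \<lambda>f\<in>arr N. inv_into (arr M) \<psi> f\<rparr>"
  have Gob: "sob G (\<phi> X) = X" if "X \<in> obj M" for X
    using that inj ob unfolding G_def by simp
  have Gar: "sar G (\<psi> f) = f" if "f \<in> arr M" for f
    using that injar ar unfolding G_def by simp
  have GNM: "G \<in> sMlt N M"
  proof (rule sMltI)
    fix f assume "f \<in> arr N"
    then obtain f0 where f0: "f0 \<in> arr M" "f = \<psi> f0" using lift1 by auto
    show "sar G f \<in> arr M" "tgt M (sar G f) = sob G (tgt N f)"
      using f0 Gar Gob ar M.tgt_obj by simp_all
    show "src M (sar G f) = map (sob G) (src N f)"
      using f0 Gar ar M.src_obj[OF f0(1)] Gob by (simp add: subset_iff map_idI)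
    fix \<sigma> assume "\<sigma> permutes {..<length (src N f)}"
    then show "sar G (act N \<sigma> f) = act M \<sigma> (sar G f)"
      using f0 len ac Gar M.act_arr by simp
  next
    fix X assume "X \<in> obj N"
    then obtain X0 where X0: "X0 \<in> obj M" "X = \<phi> X0" using surj by auto
    then show "sob G X \<in> obj M" "sar G (idn N X) = idn M (sob G X)"
      using Gob Gar[of "idn M X0"] id M.idn_arr by simp_all
  next
    fix f gs assume "composable N f gs"
    then obtain f0 gs0 where c0: "composable M f0 gs0" and eqs: "f = \<psi> f0" "gs = map \<psi> gs0"
      using lift by blast
    then show "sar G (cmp N f gs) = cmp M (sar G f) (map (sar G) gs)"
      using cm Gar M.cmp_arr composableD[OF c0] by (auto simp: subset_iff map_idI)
  qed (use M.sym_multicategory_axioms N in \<open>auto simp: G_def\<close>)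
  have "F \<in> sisos M N"
  proof (rule sisosI[OF FMN GNM])
    show "G \<circ>\<^sub>s F = sid M"
      using Gob Gar sMltD(1)[OF FMN]
      by (intro sfun_eqI[OF scomp_sMlt[OF GNM FMN] sid_sMlt[OF M.sym_multicategory_axioms]])
        (auto simp flip: defs(3,4))
    have sd: "sdom G = N" by (simp add: G_def)
    show "F \<circ>\<^sub>s G = sid N"
    proof (rule sfun_eqI[OF scomp_sMlt[OF FMN GNM] sid_sMlt[OF N]])
      fix X assume "X \<in> obj N"
      then obtain X0 where X0: "X0 \<in> obj M" "X = \<phi> X0" using surj by auto
      then show "sob (F \<circ>\<^sub>s G) X = sob (sid N) X" using sd Gob ob by (simp flip: defs(3,4))
    next
      fix f assume "f \<in> arr N"
      then obtain f0 where f0: "f0 \<in> arr M" "f = \<psi> f0" using lift1 by auto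
      then show "sar (F \<circ>\<^sub>s G) f = sar (sid N) f" using sd Gar ar by (simp flip: defs(3,4))
    qed
  qed
  then show "F \<in> sisos (sdom F) (scod F)" unfolding defs .
qed

subsection \<open>Sequential multicategories\<close>

lemma seq_smc_simps [simp]:
  "obj C\<^sub>\<triangleright> = Ob C"
  "src C\<^sub>\<triangleright> (fs, X) = map (Dom C) fs"
  "tgt C\<^sub>\<triangleright> (fs, X) = X"
  "idn C\<^sub>\<triangleright> X = ([Idn C X], X)"
  "cmp C\<^sub>\<triangleright> (fs, X) gs = (concat (map2 (\<lambda>f g. map (Cmp C f) (fst g)) fs gs), X)"
  "act C\<^sub>\<triangleright> \<sigma> (fs, X) = (permute_list \<sigma> fs, X)"
  by (simp_all add: seq_smc_def)

lemma seq_smc_arr [simp]: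
  "(fs, X) \<in> arr C\<^sub>\<triangleright> \<longleftrightarrow> X \<in> Ob C \<and> (\<forall>f\<in>set fs. f \<in> Ar C \<and> Cod C f = X)"
  by (simp add: seq_smc_def)

text \<open>Composability becomes a relation between corresponding entries of two lists, the form on
  which induction over both lists at once can run.\<close>

lemma composable_seq_smc:
  "composable C\<^sub>\<triangleright> (fs, X) gs \<longleftrightarrow>
    (fs, X) \<in> arr C\<^sub>\<triangleright> \<and> list_all2 (\<lambda>f g. f \<in> Ar C \<and> g \<in> arr C\<^sub>\<triangleright> \<and> snd g = Dom C f) fs gs"
proof -
  have e: "map snd gs = map (Dom C) fs \<and> set gs \<subseteq> A \<and> set fs \<subseteq> B \<longleftrightarrow>
      list_all2 (\<lambda>f g. f \<in> B \<and> g \<in> A \<and> snd g = Dom C f) fs gs" for A B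
  proof (induction fs arbitrary: gs)
    case (Cons f fs)
    then show ?case by (cases gs) auto
  qed auto
  have t: "map (tgt C\<^sub>\<triangleright>) gs = map snd gs"
    by (rule map_cong) (auto simp: seq_smc_def)
  have "(fs, X) \<in> arr C\<^sub>\<triangleright> \<Longrightarrow> set fs \<subseteq> Ar C" by auto
  then show ?thesis
    unfolding composable_def t seq_smc_simps(2) using e[of "arr C\<^sub>\<triangleright>" "Ar C"] by blast
qed

section \<open>The axioms of a symmetric multicategory for
  \<open>C\<^sub>\<triangleright>\<close>\<close>

context category
begin

lemma Cmp_concat:
  assumes "f \<in> Ar C"
    and "list_all2 (\<lambda>g h. g \<in> Ar C \<and> h \<in> arr C\<^sub>\<triangleright> \<and> snd h = Dom C g) gs hs"
    and "\<forall>g\<in>set gs. Cod C g = Dom C f"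
  shows "concat (map2 (\<lambda>g h. map (Cmp C g) (fst h)) (map (Cmp C f) gs) hs) =
     map (Cmp C f) (concat (map2 (\<lambda>g h. map (Cmp C g) (fst h)) gs hs))"
  using assms(2,3)
  by (induction rule: list_all2_induct)
    (auto simp: Cmp_assoc assms(1) split: prod.splits)

text \<open>The lists split according to the entries of \<open>fs\<close>. For a single entry
  \<open>f\<close>, \<open>Cmp_concat\<close> draws the outer factor \<open>f\<close> out of all
  inner composites, which is associativity in \<open>C\<close> applied to each of them.\<close>

lemma seq_cmp_assoc:
  assumes "list_all2 (\<lambda>f g. f \<in> Ar C \<and> g \<in> arr C\<^sub>\<triangleright> \<and> snd g = Dom C f) fs gs"
    and "list_all2 (composable C\<^sub>\<triangleright>) gs hss"
  shows "concat (map2 (\<lambda>f g. map (Cmp C f) (fst g))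
           (concat (map2 (\<lambda>f g. map (Cmp C f) (fst g)) fs gs)) (concat hss)) =
         concat (map2 (\<lambda>f g. map (Cmp C f) (fst g)) fs (map2 (cmp C\<^sub>\<triangleright>) gs hss))"
  using assms
proof (induction fs gs arbitrary: hss rule: list_all2_induct)
  case (Cons f fs g gs)
  obtain hs hss' where hss: "hss = hs # hss'" "composable C\<^sub>\<triangleright> g hs"
    "list_all2 (composable C\<^sub>\<triangleright>) gs hss'" using Cons.prems by (auto simp: list_all2_Cons1)
  obtain gl Y where g: "g = (gl, Y)" by (cases g)
  have gh: "list_all2 (\<lambda>g h. g \<in> Ar C \<and> h \<in> arr C\<^sub>\<triangleright> \<and> snd h = Dom C g) gl hs"
    using hss(2) unfolding g composable_seq_smc by auto
  then have len: "length gl = length hs" by (rule list_all2_lengthD)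
  have cod: "\<forall>g\<in>set gl. Cod C g = Dom C f" using Cons.hyps(1) g by auto
  show ?case
    using Cmp_concat[OF _ gh cod] Cons.hyps(1) Cons.IH[OF hss(3)] len
    by (simp add: hss(1) g zip_append)
qed simp

lemma seq_cmp_src:
  assumes "list_all2 (\<lambda>f g. f \<in> Ar C \<and> g \<in> arr C\<^sub>\<triangleright> \<and> snd g = Dom C f) fs gs"
    and "\<forall>f\<in>set fs. Cod C f = X"
  shows "map (Dom C) (concat (map2 (\<lambda>f g. map (Cmp C f) (fst g)) fs gs)) =
      concat (map (src C\<^sub>\<triangleright>) gs)"
    "\<forall>k\<in>set (concat (map2 (\<lambda>f g. map (Cmp C f) (fst g)) fs gs)). k \<in> Ar C \<and> Cod C k = X"
  using assms
  by (induction rule: list_all2_induct) (auto simp: Dom_Cmp Cmp_Ar Cod_Cmp)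

lemma length_src_seq: "length (src C\<^sub>\<triangleright> g) = length (fst g)"
  by (cases g) simp

lemma sym_multicategory_seq [simp]: "sym_multicategory C\<^sub>\<triangleright>"
proof
  fix a assume a: "a \<in> arr C\<^sub>\<triangleright>"
  obtain fs X where fs: "a = (fs, X)" by (cases a)
  show "set (src C\<^sub>\<triangleright> a) \<subseteq> obj C\<^sub>\<triangleright>" "tgt C\<^sub>\<triangleright> a \<in> obj C\<^sub>\<triangleright>"
    using a by (auto simp: fs Dom_Ob)
  show "cmp C\<^sub>\<triangleright> (idn C\<^sub>\<triangleright> (tgt C\<^sub>\<triangleright> a)) [a] = a"
    using a by (auto simp: fs Idn_Cmp intro!: map_idI)
  show "cmp C\<^sub>\<triangleright> a (map (idn C\<^sub>\<triangleright>) (src C\<^sub>\<triangleright> a)) = a"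
  proof -
    have "concat (map2 (\<lambda>f g. map (Cmp C f) (fst g)) fs (map (\<lambda>x. ([Idn C (Dom C x)], Dom C x)) fs)) = fs"
      if "\<forall>f\<in>set fs. f \<in> Ar C"
      using that by (induction fs) (auto simp: Cmp_Idn)
    then show ?thesis using a by (simp add: fs comp_def)
  qed
  show "act C\<^sub>\<triangleright> id a = a" by (simp add: fs)
  fix \<sigma> assume "\<sigma> permutes {..<length (src C\<^sub>\<triangleright> a)}"
  then have \<sigma>: "\<sigma> permutes {..<length fs}" by (simp add: fs)
  show "act C\<^sub>\<triangleright> \<sigma> a \<in> arr C\<^sub>\<triangleright>" using a \<sigma> by (simp add: fs)
  show "src C\<^sub>\<triangleright> (act C\<^sub>\<triangleright> \<sigma> a) = permute_list \<sigma> (src C\<^sub>\<triangleright> a)" "tgt C\<^sub>\<triangleright> (act C\<^sub>\<triangleright> \<sigma> a) = tgt C\<^sub>\<triangleright> a"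
    using \<sigma> by (simp_all add: fs permute_list_map)
  fix \<tau> assume "\<tau> permutes {..<length (src C\<^sub>\<triangleright> a)}"
  then have "\<tau> permutes {..<length fs}" by (simp add: fs)
  then show "act C\<^sub>\<triangleright> (\<sigma> \<circ> \<tau>) a = act C\<^sub>\<triangleright> \<tau> (act C\<^sub>\<triangleright> \<sigma> a)"
    by (simp add: fs permute_list_compose)
next
  fix X assume "X \<in> obj C\<^sub>\<triangleright>"
  then show "idn C\<^sub>\<triangleright> X \<in> arr C\<^sub>\<triangleright>" "src C\<^sub>\<triangleright> (idn C\<^sub>\<triangleright> X) = [X]" "tgt C\<^sub>\<triangleright> (idn C\<^sub>\<triangleright> X) = X"
    by (simp_all add: Idn_Ar Dom_Idn Cod_Idn)
next
  fix a gs assume c: "composable C\<^sub>\<triangleright> a gs"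
  obtain fs X where fs: "a = (fs, X)" by (cases a)
  have fg: "list_all2 (\<lambda>f g. f \<in> Ar C \<and> g \<in> arr C\<^sub>\<triangleright> \<and> snd g = Dom C f) fs gs"
    and ar: "X \<in> Ob C" "\<forall>f\<in>set fs. Cod C f = X"
    using c unfolding fs composable_seq_smc by auto
  note len = list_all2_lengthD[OF fg]
  let ?K = "\<lambda>f g. map (Cmp C f) (fst g)"
  \<comment> \<open>The blocks on which the permutations act are the lists
    \<open>map (Cmp C f) (fst g)\<close>, whose lengths are the arities of the inner arrows.\<close>
  have lens: "map length (map2 ?K fs gs) = map (length \<circ> src C\<^sub>\<triangleright>) gs"
    using len by (auto intro!: nth_equalityI simp: length_src_seq)
  show "cmp C\<^sub>\<triangleright> a gs \<in> arr C\<^sub>\<triangleright>" "tgt C\<^sub>\<triangleright> (cmp C\<^sub>\<triangleright> a gs) = tgt C\<^sub>\<triangleright> a"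
    "src C\<^sub>\<triangleright> (cmp C\<^sub>\<triangleright> a gs) = concat (map (src C\<^sub>\<triangleright>) gs)"
    using seq_cmp_src[OF fg ar(2)] ar(1) by (simp_all add: fs del: set_concat)
  show "cmp C\<^sub>\<triangleright> (cmp C\<^sub>\<triangleright> a gs) (concat hss) = cmp C\<^sub>\<triangleright> a (map2 (cmp C\<^sub>\<triangleright>) gs hss)"
    if "list_all2 (composable C\<^sub>\<triangleright>) gs hss" for hss
    using seq_cmp_assoc[OF fg that] by (simp add: fs)
  show "cmp C\<^sub>\<triangleright> (act C\<^sub>\<triangleright> \<sigma> a) (permute_list \<sigma> gs) =
      act C\<^sub>\<triangleright> (block_perm \<sigma> (map (length \<circ> src C\<^sub>\<triangleright>) gs)) (cmp C\<^sub>\<triangleright> a gs)"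
    if \<sigma>: "\<sigma> permutes {..<length gs}" for \<sigma>
  proof -
    have "zip (permute_list \<sigma> fs) (permute_list \<sigma> gs) = permute_list \<sigma> (zip fs gs)"
      using len \<sigma> by (intro permute_list_zip[symmetric, of _ "{..<length gs}"]) auto
    then show ?thesis
      unfolding lens[symmetric]
      using permute_block_perm[of \<sigma> "map2 ?K fs gs"] \<sigma> len by (simp add: fs permute_list_map)
  qed
  show "cmp C\<^sub>\<triangleright> a (map2 (act C\<^sub>\<triangleright>) \<tau>s gs) =
      act C\<^sub>\<triangleright> (sum_perm \<tau>s (map (length \<circ> src C\<^sub>\<triangleright>) gs)) (cmp C\<^sub>\<triangleright> a gs)"
    if \<tau>s: "list_all2 (\<lambda>\<tau> g. \<tau> permutes {..<length (src C\<^sub>\<triangleright> g)}) \<tau>s gs" for \<tau>s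
  proof -
    \<comment> \<open>Composing with \<open>f\<close> is a \<open>map\<close> over the inner list,
      so it commutes with a permutation of that list.\<close>
    have "map2 ?K fs (map2 (act C\<^sub>\<triangleright>) \<tau>s gs) = map2 permute_list \<tau>s (map2 ?K fs gs)"
    proof (rule nth_equalityI)
      fix i assume "i < length (map2 ?K fs (map2 (act C\<^sub>\<triangleright>) \<tau>s gs))"
      then have i: "i < length fs" "i < length gs" "i < length \<tau>s" by auto
      then have "\<tau>s ! i permutes {..<length (fst (gs ! i))}"
        using \<tau>s by (auto simp: list_all2_conv_all_nth length_src_seq)
      then show "map2 ?K fs (map2 (act C\<^sub>\<triangleright>) \<tau>s gs) ! i = map2 permute_list \<tau>s (map2 ?K fs gs) ! i"
        using i by (cases "gs ! i") (simp add: permute_list_map)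
    qed (simp add: min.left_commute)
    moreover have "list_all2 (\<lambda>\<tau> xs. \<tau> permutes {..<length xs}) \<tau>s (map2 ?K fs gs)"
      using \<tau>s len by (auto simp: list_all2_conv_all_nth length_src_seq)
    ultimately show ?thesis
      unfolding lens[symmetric] using permute_sum_perm[of \<tau>s "map2 ?K fs gs"] by (simp add: fs)
  qed
qed

end

section \<open>Functors of categories and their images\<close>

lemma functorD:
  assumes "F \<in> Cat C D"
  shows "cdom F = C" "ccod F = D" "category C" "category D"
    "cob F \<in> extensional (Ob C)" "car F \<in> extensional (Ar C)"
    "X \<in> Ob C \<Longrightarrow> cob F X \<in> Ob D" "f \<in> Ar C \<Longrightarrow> car F f \<in> Ar D"
    "f \<in> Ar C \<Longrightarrow> Dom D (car F f) = cob F (Dom C f)"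
    "f \<in> Ar C \<Longrightarrow> Cod D (car F f) = cob F (Cod C f)"
    "X \<in> Ob C \<Longrightarrow> car F (Idn C X) = Idn D (cob F X)"
    "f \<in> Ar C \<Longrightarrow> g \<in> Ar C \<Longrightarrow> Cod C g = Dom C f \<Longrightarrow>
        car F (Cmp C f g) = Cmp D (car F f) (car F g)"
  using assms unfolding Cat_def functor_def by (auto simp: PiE_def Pi_def)

lemma CatI:
  assumes "cdom F = C" "ccod F = D" "category C" "category D"
    "cob F \<in> extensional (Ob C)" "car F \<in> extensional (Ar C)"
    "\<And>X. X \<in> Ob C \<Longrightarrow> cob F X \<in> Ob D" "\<And>f. f \<in> Ar C \<Longrightarrow> car F f \<in> Ar D"
    "\<And>f. f \<in> Ar C \<Longrightarrow> Dom D (car F f) = cob F (Dom C f)"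
    "\<And>f. f \<in> Ar C \<Longrightarrow> Cod D (car F f) = cob F (Cod C f)"
    "\<And>X. X \<in> Ob C \<Longrightarrow> car F (Idn C X) = Idn D (cob F X)"
    "\<And>f g. f \<in> Ar C \<Longrightarrow> g \<in> Ar C \<Longrightarrow> Cod C g = Dom C f \<Longrightarrow>
        car F (Cmp C f g) = Cmp D (car F f) (car F g)"
  shows "F \<in> Cat C D"
  using assms unfolding Cat_def functor_def by (auto simp: PiE_def Pi_def)

lemma cfun_eqI:
  assumes "F \<in> Cat C D" "G \<in> Cat C D"
    and "\<And>X. X \<in> Ob C \<Longrightarrow> cob F X = cob G X" "\<And>f. f \<in> Ar C \<Longrightarrow> car F f = car G f"
  shows "F = G"
proof -
  have "cob F = cob G" "car F = car G"
    using functorD(5,6)[OF assms(1)] functorD(5,6)[OF assms(2)] assms(3,4)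
    by (auto intro: extensionalityI)
  then show ?thesis
    using functorD(1,2)[OF assms(1)] functorD(1,2)[OF assms(2)] by (cases F; cases G) simp
qed

lemma ccomp_simps [simp]:
  "cdom (G \<circ>\<^sub>c F) = cdom F" "ccod (G \<circ>\<^sub>c F) = ccod G"
  "X \<in> Ob (cdom F) \<Longrightarrow> cob (G \<circ>\<^sub>c F) X = cob G (cob F X)"
  "f \<in> Ar (cdom F) \<Longrightarrow> car (G \<circ>\<^sub>c F) f = car G (car F f)"
  by (simp_all add: ccomp_def)

lemma cid_simps [simp]:
  "cdom (cid C) = C" "ccod (cid C) = C"
  "X \<in> Ob C \<Longrightarrow> cob (cid C) X = X" "f \<in> Ar C \<Longrightarrow> car (cid C) f = f"
  by (simp_all add: cid_def)

lemma cid_Cat [simp]: "category C \<Longrightarrow> cid C \<in> Cat C C"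
  by (intro CatI)
    (auto simp: cid_def category.Dom_Ob category.Cod_Ob category.Idn_Ar category.Cmp_Ar)

lemma ccomp_Cat [intro]: "G \<in> Cat D E \<Longrightarrow> F \<in> Cat C D \<Longrightarrow> G \<circ>\<^sub>c F \<in> Cat C E"
proof -
  assume G: "G \<in> Cat D E" and F: "F \<in> Cat C D"
  interpret C: category C by (rule functorD(3)[OF F])
  note GD = functorD[OF G] note FD = functorD[OF F]
  show "G \<circ>\<^sub>c F \<in> Cat C E"
    by (rule CatI)
      (use GD FD in \<open>auto simp: C.Dom_Ob C.Cod_Ob C.Idn_Ar C.Cmp_Ar ccomp_def\<close>)
qed

lemma seq_fun_simps [simp]:
  "sdom F\<^sup>\<triangleright> = (cdom F)\<^sub>\<triangleright>" "scod F\<^sup>\<triangleright> = (ccod F)\<^sub>\<triangleright>" "sob F\<^sup>\<triangleright> = cob F"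
  "(fs, X) \<in> arr (cdom F)\<^sub>\<triangleright> \<Longrightarrow> sar F\<^sup>\<triangleright> (fs, X) = (map (car F) fs, cob F X)"
  by (simp_all add: seq_fun_def)

lemma seq_fun_sMlt [intro]:
  assumes "F \<in> Cat C D"
  shows "F\<^sup>\<triangleright> \<in> sMlt C\<^sub>\<triangleright> D\<^sub>\<triangleright>"
proof -
  note F = functorD[OF assms]
  interpret C: category C by (rule F)
  interpret D: category D by (rule F)
  show ?thesis
  proof (rule sMltI)
    fix a assume a: "a \<in> arr C\<^sub>\<triangleright>"
    obtain fs X where fs: "a = (fs, X)" by (cases a)
    show "sar F\<^sup>\<triangleright> a \<in> arr D\<^sub>\<triangleright>" "src D\<^sub>\<triangleright> (sar F\<^sup>\<triangleright> a) = map (sob F\<^sup>\<triangleright>) (src C\<^sub>\<triangleright> a)"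
      "tgt D\<^sub>\<triangleright> (sar F\<^sup>\<triangleright> a) = sob F\<^sup>\<triangleright> (tgt C\<^sub>\<triangleright> a)"
      using a F by (auto simp: fs)
    fix \<sigma> assume "\<sigma> permutes {..<length (src C\<^sub>\<triangleright> a)}"
    then show "sar F\<^sup>\<triangleright> (act C\<^sub>\<triangleright> \<sigma> a) = act D\<^sub>\<triangleright> \<sigma> (sar F\<^sup>\<triangleright> a)"
      using a F by (simp add: fs permute_list_map)
  next
    fix a gs assume c: "composable C\<^sub>\<triangleright> a gs"
    obtain fs X where fs: "a = (fs, X)" by (cases a)
    have fg: "list_all2 (\<lambda>f g. f \<in> Ar C \<and> g \<in> arr C\<^sub>\<triangleright> \<and> snd g = Dom C f) fs gs"
      and ar: "X \<in> Ob C" "\<forall>f\<in>set fs. f \<in> Ar C \<and> Cod C f = X"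
      using c unfolding fs composable_seq_smc by auto
    have "map (car F) (concat (map2 (\<lambda>f g. map (Cmp C f) (fst g)) fs gs)) =
        concat (map2 (\<lambda>f g. map (Cmp D f) (fst g)) (map (car F) fs) (map (sar F\<^sup>\<triangleright>) gs))"
      using fg
    proof (induction rule: list_all2_induct)
      case (Cons f fs g gs)
      then show ?case using F by (cases g) auto
    qed simp
    then show "sar F\<^sup>\<triangleright> (cmp C\<^sub>\<triangleright> a gs) = cmp D\<^sub>\<triangleright> (sar F\<^sup>\<triangleright> a) (map (sar F\<^sup>\<triangleright>) gs)"
      using C.sym_multicategory_seq sym_multicategory.cmp_arr[OF _ c] ar F(1)
      by (simp add: fs)
  qed (use F in \<open>auto simp: seq_fun_def C.Idn_Ar C.Cod_Idn\<close>)
qed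

lemma seq_fun_cid: "category C \<Longrightarrow> (cid C)\<^sup>\<triangleright> = sid C\<^sub>\<triangleright>"
proof (rule sfun_eqI)
  assume C: "category C"
  show "(cid C)\<^sup>\<triangleright> \<in> sMlt C\<^sub>\<triangleright> C\<^sub>\<triangleright>" "sid C\<^sub>\<triangleright> \<in> sMlt C\<^sub>\<triangleright> C\<^sub>\<triangleright>"
    using sid_sMlt[OF category.sym_multicategory_seq[OF C]] C by auto
  fix f assume "f \<in> arr C\<^sub>\<triangleright>"
  then show "sar (cid C)\<^sup>\<triangleright> f = sar (sid C\<^sub>\<triangleright>) f" by (cases f) (auto intro: map_idI)
qed simp

lemma seq_fun_ccomp:
  assumes "F \<in> Cat C D" "G \<in> Cat D E"
  shows "(G \<circ>\<^sub>c F)\<^sup>\<triangleright> = G\<^sup>\<triangleright> \<circ>\<^sub>s F\<^sup>\<triangleright>"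
proof (rule sfun_eqI)
  show "(G \<circ>\<^sub>c F)\<^sup>\<triangleright> \<in> sMlt C\<^sub>\<triangleright> E\<^sub>\<triangleright>" "G\<^sup>\<triangleright> \<circ>\<^sub>s F\<^sup>\<triangleright> \<in> sMlt C\<^sub>\<triangleright> E\<^sub>\<triangleright>"
    using assms by auto
next
  note F = functorD[OF assms(1)] functorD[OF assms(2)]
  fix f assume "f \<in> arr C\<^sub>\<triangleright>"
  then show "sar (G \<circ>\<^sub>c F)\<^sup>\<triangleright> f = sar (G\<^sup>\<triangleright> \<circ>\<^sub>s F\<^sup>\<triangleright>) f"
    using F by (cases f) auto
qed (use functorD(1)[OF assms(1)] in simp)

section \<open>Full faithfulness of the embedding of categories\<close>

lemma sar_seq_unary:
  assumes "K \<in> sMlt C\<^sub>\<triangleright> D\<^sub>\<triangleright>" "f \<in> Ar C" "category C"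
  shows "\<exists>k\<in>Ar D. sar K ([f], Cod C f) = ([k], sob K (Cod C f)) \<and>
    Dom D k = sob K (Dom C f) \<and> Cod D k = sob K (Cod C f)"
proof -
  note K = sMltD[OF assms(1)]
  have f: "([f], Cod C f) \<in> arr C\<^sub>\<triangleright>" using assms by (simp add: category.Cod_Ob)
  obtain ks Y where k: "sar K ([f], Cod C f) = (ks, Y)" by fastforce
  \<comment> \<open>A functor preserves the length of the source, so the image of a unary arrow is a
    list with one entry.\<close>
  have "map (Dom D) ks = [sob K (Dom C f)]" "Y = sob K (Cod C f)"
    using K(9)[OF f] K(10)[OF f] unfolding k by simp_all
  then show ?thesis using K(8)[OF f] unfolding k by auto
qed

lemma seq_arr_components:
  assumes "category C" "(fs, X) \<in> arr C\<^sub>\<triangleright>"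
  shows "composable C\<^sub>\<triangleright> (replicate (length fs) (Idn C X), X) (map (\<lambda>f. ([f], X)) fs)"
    "(fs, X) = cmp C\<^sub>\<triangleright> (replicate (length fs) (Idn C X), X) (map (\<lambda>f. ([f], X)) fs)"
proof -
  interpret category C by fact
  show "composable C\<^sub>\<triangleright> (replicate (length fs) (Idn C X), X) (map (\<lambda>f. ([f], X)) fs)"
    using assms by (auto simp: composable_seq_smc list_all2_conv_all_nth Idn_Ar Cod_Idn Dom_Idn)
  have "concat (map2 (\<lambda>f g. map (Cmp C f) (fst g))
      (replicate (length fs) (Idn C X)) (map (\<lambda>f. ([f], X)) fs)) = fs"
    using assms(2) by (induction fs) (use Idn_Cmp in fastforce)+
  then show "(fs, X) = cmp C\<^sub>\<triangleright> (replicate (length fs) (Idn C X), X) (map (\<lambda>f. ([f], X)) fs)"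
    by simp
qed

lemma concat_map_if: "i < n \<Longrightarrow> concat (map (\<lambda>j. if j = i then F j else []) [0..<n]) = F i"
proof (induction n)
  case (Suc n)
  have "concat (map (\<lambda>j. if j = n then F j else []) [0..<n]) = []" by auto
  then show ?case using Suc by (cases "i = n") auto
qed simp

text \<open>
  Composition with the families \<open>pick C i ds\<close> separates the components of an arrow of
  \<open>C\<^sub>\<triangleright>\<close>, and every functor preserves these families; this is why \<open>(-)\<^sub>\<triangleright>\<close> is full.
\<close>

definition pick :: "('o, 'a) cat \<Rightarrow> nat \<Rightarrow> 'o list \<Rightarrow> ('a list \<times> 'o) list" where
  "pick C i ds = map (\<lambda>j. (if j = i then [Idn C (ds ! j)] else [], ds ! j)) [0..<length ds]"

text \<open>The nullary arrows in the family erase every component but the i-th, which is composed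
  with an identity.\<close>

lemma cmp_pick:
  assumes "category C" "(fs, X) \<in> arr C\<^sub>\<triangleright>" "i < length fs"
  shows "composable C\<^sub>\<triangleright> (fs, X) (pick C i (map (Dom C) fs))"
    "cmp C\<^sub>\<triangleright> (fs, X) (pick C i (map (Dom C) fs)) = ([fs ! i], X)"
proof -
  interpret category C by fact
  have fs: "f \<in> Ar C" if "f \<in> set fs" for f using assms(2) that by auto
  show "composable C\<^sub>\<triangleright> (fs, X) (pick C i (map (Dom C) fs))"
    using assms(2) fs unfolding composable_seq_smc pick_def
    by (auto simp: list_all2_conv_all_nth Idn_Ar Dom_Ob Cod_Idn)
  have "map2 (\<lambda>f g. map (Cmp C f) (fst g)) fs (pick C i (map (Dom C) fs)) =
      map (\<lambda>j. if j = i then [Cmp C (fs ! j) (Idn C (Dom C (fs ! j)))] else []) [0..<length fs]"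
    by (rule nth_equalityI) (auto simp: pick_def)
  then show "cmp C\<^sub>\<triangleright> (fs, X) (pick C i (map (Dom C) fs)) = ([fs ! i], X)"
    using concat_map_if[OF assms(3), of "\<lambda>j. [Cmp C (fs ! j) (Idn C (Dom C (fs ! j)))]"] fs assms(3)
    by (simp add: Cmp_Idn)
qed

text \<open>Each object of \<open>D\<^sub>\<triangleright>\<close> is the target of exactly one
  nullary arrow, so a functor has no choice on nullary arrows; the remaining member of the family is
  an identity.\<close>

lemma map_sar_pick:
  assumes "K \<in> sMlt C\<^sub>\<triangleright> D\<^sub>\<triangleright>" "set ds \<subseteq> Ob C" "category C"
  shows "map (sar K) (pick C i ds) = pick D i (map (sob K) ds)"
proof (rule nth_equalityI)
  note K = sMltD[OF assms(1)]
  interpret category C by fact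
  fix j assume "j < length (map (sar K) (pick C i ds))"
  then have j: "j < length ds" by (simp add: pick_def)
  then have d: "ds ! j \<in> Ob C" using assms(2) by auto
  have "sar K ([], ds ! j) = ([], sob K (ds ! j))"
    using K(9)[of "([], ds ! j)"] K(10)[of "([], ds ! j)"] d
    by (cases "sar K ([], ds ! j)") simp
  moreover have "sar K ([Idn C (ds ! j)], ds ! j) = ([Idn D (sob K (ds ! j))], sob K (ds ! j))"
    using K(11)[of "ds ! j"] d by simp
  ultimately show "map (sar K) (pick C i ds) ! j = pick D i (map (sob K) ds) ! j"
    using j by (cases "j = i") (auto simp: pick_def)
qed (simp add: pick_def)

text \<open>Composing the image of an arrow with \<open>pick\<close> extracts its i-th component.
  Composing before the functor is applied gives the unary arrow on the i-th entry. Since the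
  families are preserved the results agree, and the functor is determined by unary arrows.\<close>

lemma sar_seq_component:
  assumes K: "K \<in> sMlt C\<^sub>\<triangleright> D\<^sub>\<triangleright>" and "category C" "category D"
    and a: "(fs, X) \<in> arr C\<^sub>\<triangleright>"
  shows "sar K (fs, X) = (map (\<lambda>f. hd (fst (sar K ([f], Cod C f)))) fs, sob K X)"
proof -
  note KD = sMltD[OF K]
  interpret category C by fact
  obtain ks Y where k: "sar K (fs, X) = (ks, Y)" by fastforce
  have ks: "(ks, Y) \<in> arr D\<^sub>\<triangleright>" "map (Dom D) ks = map (sob K) (map (Dom C) fs)" "Y = sob K X"
    using KD(8)[OF a] KD(9)[OF a] KD(10)[OF a] unfolding k by (simp_all del: map_map)
  then have len: "length ks = length fs" by (metis length_map)
  have "ks ! i = hd (fst (sar K ([fs ! i], Cod C (fs ! i))))" if i: "i < length fs" for i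
  proof -
    have "sar K ([fs ! i], X) = cmp D\<^sub>\<triangleright> (ks, Y) (pick D i (map (Dom D) ks))"
      using KD(12)[OF cmp_pick(1)[OF assms(2) a i]] cmp_pick(2)[OF assms(2) a i]
        map_sar_pick[OF K _ assms(2), of "map (Dom C) fs" i] a Dom_Ob
      by (simp add: k ks(2) image_subset_iff del: map_map)
    also have "\<dots> = ([ks ! i], Y)"
      using cmp_pick(2)[OF assms(3) ks(1)] i len by simp
    finally show ?thesis using a i by simp
  qed
  then show ?thesis unfolding k using len ks(3) by (auto intro: nth_equalityI)
qed

lemma bij_betw_seq_fun:
  assumes "category C" "category D"
  shows "bij_betw seq_fun (Cat C D) (sMlt C\<^sub>\<triangleright> D\<^sub>\<triangleright>)"
proof -
  interpret C: category C by fact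
  interpret D: category D by fact
  have "inj_on seq_fun (Cat C D)"
  proof (rule inj_onI)
    fix F G assume F: "F \<in> Cat C D" and G: "G \<in> Cat C D" and eq: "F\<^sup>\<triangleright> = G\<^sup>\<triangleright>"
    show "F = G"
    proof (rule cfun_eqI[OF F G])
      show "cob F X = cob G X" for X using arg_cong[OF eq, of sob] by simp
      fix f assume "f \<in> Ar C"
      then have "([f], Cod C f) \<in> arr C\<^sub>\<triangleright>" by (simp add: C.Cod_Ob)
      then show "car F f = car G f"
        using arg_cong[OF eq, of "\<lambda>K. sar K ([f], Cod C f)"] functorD(1)[OF F] functorD(1)[OF G]
        by simp
    qed
  qed
  moreover have "seq_fun ` Cat C D \<subseteq> sMlt C\<^sub>\<triangleright> D\<^sub>\<triangleright>"
    by (auto intro: seq_fun_sMlt)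
  moreover have "\<exists>F\<in>Cat C D. K = F\<^sup>\<triangleright>" if K: "K \<in> sMlt C\<^sub>\<triangleright> D\<^sub>\<triangleright>" for K
  proof
    note KD = sMltD[OF K]
    \<comment> \<open>Taking the head is justified by \<open>sar_seq_unary\<close>: on a unary arrow
      the list has exactly one entry.\<close>
    define k where "k f = hd (fst (sar K ([f], Cod C f)))" for f
    have k: "sar K ([f], Cod C f) = ([k f], sob K (Cod C f))" "k f \<in> Ar D"
      "Dom D (k f) = sob K (Dom C f)" "Cod D (k f) = sob K (Cod C f)" if "f \<in> Ar C" for f
      using sar_seq_unary[OF K that assms(1)] unfolding k_def by auto
    define F where "F = \<lparr>cdom = C, ccod = D, cob = sob K, car = \<lambda>f\<in>Ar C. k f\<rparr>"
    show F: "F \<in> Cat C D"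
    proof (rule CatI)
      fix X assume X: "X \<in> Ob C"
      then show "car F (Idn C X) = Idn D (cob F X)"
        using KD(11)[of X] k(1)[of "Idn C X"] by (simp add: F_def C.Idn_Ar C.Cod_Idn)
    next
      fix f g assume fg: "f \<in> Ar C" "g \<in> Ar C" "Cod C g = Dom C f"
      \<comment> \<open>Composition of unary arrows in \<open>C\<^sub>\<triangleright>\<close> is
        composition in \<open>C\<close>, so functoriality of \<open>F\<close> is read off from that
        of \<open>K\<close>.\<close>
      have "composable C\<^sub>\<triangleright> ([f], Cod C f) [([g], Cod C g)]"
        using fg by (simp add: composable_seq_smc C.Cod_Ob C.Dom_Ob)
      from KD(12)[OF this] show "car F (Cmp C f g) = Cmp D (car F f) (car F g)"
        using fg k(1)[of f] k(1)[of g] k(1)[of "Cmp C f g"]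
        by (simp add: F_def C.Cmp_Ar C.Cod_Cmp)
    qed (use KD k assms in \<open>auto simp: F_def\<close>)
    have "F\<^sup>\<triangleright> = K"
    proof (rule sfun_eqI[OF seq_fun_sMlt[OF F] K])
      fix a assume a: "a \<in> arr C\<^sub>\<triangleright>"
      then show "sar F\<^sup>\<triangleright> a = sar K a"
        using sar_seq_component[OF K assms, of "fst a" "snd a"]
        by (cases a) (auto simp: F_def k_def)
    qed (simp add: F_def)
    then show "K = F\<^sup>\<triangleright>" by simp
  qed
  ultimately show ?thesis unfolding bij_betw_def by blast
qed

lemma seq_full:
  assumes "K \<in> sMlt C\<^sub>\<triangleright> D\<^sub>\<triangleright>" "category C" "category D"
  obtains F where "F \<in> Cat C D" "K = F\<^sup>\<triangleright>"
  using bij_betw_seq_fun[OF assms(2,3)] assms(1) unfolding bij_betw_def by blast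

section \<open>Recognising sequential multicategories\<close>

lemma sequentialE:
  fixes M :: "('o, 'a) smc"
  assumes "sequential M"
  obtains C :: "('o, 'a) cat" and J where "category C" "J \<in> sisos M C\<^sub>\<triangleright>"
  using assms unfolding sequential_def by blast

lemma sequential_sym_multicategory: "sequential M \<Longrightarrow> sym_multicategory M"
  by (metis sequentialE sisosD(1) sMltD(3))

text \<open>The category \<open>E\<close> is replaced by an isomorphic one on the objects and unary arrows of \<open>M\<close>.\<close>

lemma sequentialI:
  fixes M :: "('o, 'a) smc" and E :: "('p, 'b) cat"
  assumes J: "J \<in> sisos M E\<^sub>\<triangleright>" and E: "category E"
  shows "sequential M"
proof -
  interpret E: category E by fact
  define I where "I = sinv J"
  have I: "I \<in> sMlt E\<^sub>\<triangleright> M" using sisosD(3)[OF J] unfolding I_def .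
  note JD = sMltD[OF sisosD(1)[OF J]] note ID = sMltD[OF I]
  note inv = sisos_inverse[OF J, folded I_def]
  \<comment> \<open>\<open>t\<close> turns an arrow of \<open>E\<close> into a unary arrow of
    \<open>M\<close> and \<open>s\<close> reads it back. Since \<open>s (t f) = f\<close> and the
    arrows of \<open>C\<close> are exactly the values of \<open>t\<close>, the axioms for
    \<open>C\<close> reduce to those for \<open>E\<close>.\<close>
  define t where "t f = sar I ([f], Cod E f)" for f
  define s where "s g = hd (fst (sar J g))" for g
  have unary: "([f], Cod E f) \<in> arr E\<^sub>\<triangleright>" if "f \<in> Ar E" for f using that by (simp add: E.Cod_Ob)
  have st: "s (t f) = f" if "f \<in> Ar E" for f unfolding s_def t_def using inv(4)[OF unary[OF that]] by simp
  have t_eq: "t f = t g \<longleftrightarrow> f = g" if "f \<in> Ar E" "g \<in> Ar E" for f g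
    using st that by metis
  define C where "C = \<lparr>Ob = obj M, Ar = t ` Ar E, Dom = \<lambda>g. sob I (Dom E (s g)),
    Cod = \<lambda>g. sob I (Cod E (s g)), Idn = \<lambda>X. t (Idn E (sob J X)),
    Cmp = \<lambda>f g. t (Cmp E (s f) (s g))\<rparr>"
  have oI: "sob I Y \<in> obj M" "sob J (sob I Y) = Y" if "Y \<in> Ob E" for Y
    using that ID(7) inv(3) by auto
  have oI_eq: "sob I Y = sob I Y' \<longleftrightarrow> Y = Y'" if "Y \<in> Ob E" "Y' \<in> Ob E" for Y Y'
    using that oI(2) by metis
  have C: "category C"
    by (rule category.intro)
      (use JD(7) inv(1) in \<open>auto simp: C_def st oI oI_eq E.Dom_Ob E.Cod_Ob E.Idn_Ar E.Dom_Idn E.Cod_Idn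
        E.Cmp_Ar E.Dom_Cmp E.Cod_Cmp E.Idn_Cmp E.Cmp_Idn E.Cmp_assoc\<close>)
  define T where "T = \<lparr>cdom = E, ccod = C, cob = \<lambda>Y\<in>Ob E. sob I Y, car = \<lambda>f\<in>Ar E. t f\<rparr>"
  define S where "S = \<lparr>cdom = C, ccod = E, cob = \<lambda>X\<in>obj M. sob J X, car = \<lambda>g\<in>Ar C. s g\<rparr>"
  have T: "T \<in> Cat E C"
    by (rule CatI)
      (use C in \<open>auto simp: T_def E C_def st oI oI_eq E.Dom_Ob E.Cod_Ob E.Idn_Ar E.Cmp_Ar\<close>)
  have S: "S \<in> Cat C E"
    by (rule CatI)
      (use JD(7) C in \<open>auto simp: S_def E C_def st t_eq oI oI_eq E.Dom_Ob E.Cod_Ob E.Idn_Ar E.Cmp_Ar\<close>)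
  have "S \<circ>\<^sub>c T = cid E"
    by (rule cfun_eqI[OF ccomp_Cat[OF S T] cid_Cat[OF E]])
      (auto simp: T_def S_def C_def st oI)
  moreover have "T \<circ>\<^sub>c S = cid C"
    by (rule cfun_eqI[OF ccomp_Cat[OF T S] cid_Cat[OF C]])
      (use JD(7) inv(1) in \<open>auto simp: T_def S_def C_def st oI\<close>)
  ultimately have "T\<^sup>\<triangleright> \<in> sisos E\<^sub>\<triangleright> C\<^sub>\<triangleright>"
    using T S C E by (metis sisosI seq_fun_sMlt seq_fun_ccomp seq_fun_cid)
  then show ?thesis
    using scomp_sisos[OF _ J] C unfolding sequential_def by blast
qed

lemma sequential_seq: "category C \<Longrightarrow> sequential C\<^sub>\<triangleright>"
  by (rule sequentialI[of "sid C\<^sub>\<triangleright>"]) (simp_all add: category.sym_multicategory_seq)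

section \<open>The terminal symmetric multicategory\<close>

lemma category_one [simp]: "category one_cat"
  by standard (auto simp: one_cat_def)

lemma sequential_one: "sequential one_smc"
  unfolding one_smc_def by (rule sequential_seq) simp

lemma sym_multicategory_one [simp]: "sym_multicategory one_smc"
  by (rule sequential_sym_multicategory[OF sequential_one])

lemma one_cat_simps [simp]:
  "Ob one_cat = UNIV" "Ar one_cat = UNIV" "Dom one_cat f = ()" "Cod one_cat f = ()"
  "Idn one_cat X = ()" "Cmp one_cat f g = ()"
  by (simp_all add: one_cat_def)

text \<open>Over the type \<open>unit\<close> a list is determined by its length, so equations
  between arrows of \<open>one_smc\<close> are equations between arities.\<close>

lemma one_arr_eqI: "length (fst a) = length (fst b) \<Longrightarrow> a = (b :: unit list \<times> unit)"
  by (cases a; cases b) (auto intro: nth_equalityI)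

lemma bang_sMlt [simp]:
  assumes "sym_multicategory M"
  shows "bang M \<in> sMlt M one_smc"
proof -
  interpret sym_multicategory M by fact
  have one: "src one_smc a = fst a" "tgt one_smc a = ()" for a
    by (cases a, auto simp: one_smc_def intro: nth_equalityI)+
  show ?thesis
  proof (rule sMltI)
    fix f gs assume c: "composable M f gs"
    have "map (tgt one_smc) (map (sar (bang M)) gs) = src one_smc (sar (bang M) f)"
      using composableD[OF c] by (auto simp: one bang_def intro: nth_equalityI)
    then have c1: "composable one_smc (sar (bang M) f) (map (sar (bang M)) gs)"
      unfolding composable_def by (auto simp: one_smc_def seq_smc_def)
    interpret one: sym_multicategory one_smc by simp
    show "sar (bang M) (cmp M f gs) = cmp one_smc (sar (bang M) f) (map (sar (bang M)) gs)"
    \<comment> \<open>Both arities are the sum of the arities of the arrows in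
      \<open>gs\<close>.\<close>
    proof (rule one_arr_eqI)
      have "length (fst (cmp one_smc (sar (bang M) f) (map (sar (bang M)) gs))) =
          sum_list (map (length \<circ> fst \<circ> sar (bang M)) gs)"
        using one.src_cmp[OF c1] by (simp add: one length_concat comp_def)
      also have "\<dots> = sum_list (map (length \<circ> src M) gs)"
        using c by (intro arg_cong[where f = sum_list] map_cong)
          (auto simp: bang_def dest: composable_arr)
      finally show "length (fst (sar (bang M) (cmp M f gs))) =
          length (fst (cmp one_smc (sar (bang M) f) (map (sar (bang M)) gs)))"
        using c by (simp add: bang_def cmp_arr src_cmp length_concat comp_def)
    qed
  next
    fix f assume f: "f \<in> arr M"
    then show "sar (bang M) f \<in> arr one_smc" "tgt one_smc (sar (bang M) f) = sob (bang M) (tgt M f)"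
      "src one_smc (sar (bang M) f) = map (sob (bang M)) (src M f)"
      by (simp_all add: one one_smc_def bang_def tgt_obj)
    fix \<sigma> assume "\<sigma> permutes {..<length (src M f)}"
    then show "sar (bang M) (act M \<sigma> f) = act one_smc \<sigma> (sar (bang M) f)"
      using f by (intro one_arr_eqI) (simp add: bang_def one_smc_def act_arr src_act)
  next
    fix X assume "X \<in> obj M"
    then show "sob (bang M) X \<in> obj one_smc" "sar (bang M) (idn M X) = idn one_smc (sob (bang M) X)"
      by (simp_all add: bang_def one_smc_def idn_arr src_idn)
  qed (use assms in \<open>simp_all add: bang_def\<close>)
qed

text \<open>A functor preserves arities, and an arrow of \<open>one_smc\<close> is nothing but its
  arity.\<close>

lemma one_terminal:
  assumes "sym_multicategory M"
  shows "\<exists>!F. F \<in> sMlt M one_smc"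
proof (rule ex1I)
  show "bang M \<in> sMlt M one_smc" using assms by simp
  fix F assume F: "F \<in> sMlt M one_smc"
  show "F = bang M"
  proof (rule sfun_eqI[OF F])
    fix f assume "f \<in> arr M"
    then have "length (src one_smc (sar F f)) = length (src M f)"
      using sMltD(9)[OF F] by simp
    then show "sar F f = sar (bang M) f"
      using \<open>f \<in> arr M\<close>
      by (cases "sar F f") (auto simp: bang_def one_smc_def intro!: nth_equalityI)
  qed (use assms in auto)
qed

subsection \<open>Symmetric multicategories by generators and relations\<close>

inductive_simps twf_Idt [simp]: "twf G (Idt X)"
inductive_simps twf_Gen [simp]: "twf G (Gen g)"
inductive_simps twf_Cmpt: "twf G (Cmpt t us)"
inductive_simps twf_Actt: "twf G (Actt \<sigma> t)"

lemma twf_Cmpt_iff [simp]: "twf G (Cmpt t us) \<longleftrightarrow> tcomposable G t us"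
  unfolding twf_Cmpt tcomposable_def by blast

text \<open>These are the conditions under which source and target are constant on the classes of
  \<open>teq\<close>: generators have their boundary among the vertices, and relations hold between
  well-formed terms with a common boundary.\<close>

locale presentation =
  fixes G :: "('o, 'g) mgraph" and R :: "('o, 'g) mterm \<Rightarrow> ('o, 'g) mterm \<Rightarrow> bool"
  assumes edge: "g \<in> edge G \<Longrightarrow> set (esrc G g) \<subseteq> vert G \<and> etgt G g \<in> vert G"
    and rel: "R t u \<Longrightarrow> twf G t \<and> twf G u \<and> tsrc G t = tsrc G u \<and> ttgt G t = ttgt G u"
begin

lemma twf_vert: "twf G t \<Longrightarrow> set (tsrc G t) \<subseteq> vert G \<and> ttgt G t \<in> vert G"
  by (induction rule: twf.induct) (auto simp: edge)

text \<open>This lemma and its two companions for the action supply the substantial cases of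
  \<open>teq_wf\<close>: the two sides of an axiom are well formed and have the same source.\<close>

lemma tcomposable_assoc:
  assumes "tcomposable G t us" "list_all2 (tcomposable G) us vss"
  shows "tcomposable G (Cmpt t us) (concat vss)" "tcomposable G t (map2 Cmpt us vss)"
    "concat (map (tsrc G) (concat vss)) = concat (map (tsrc G) (map2 Cmpt us vss))"
proof -
  have "(\<forall>v\<in>set (concat vss). twf G v) \<and> map (ttgt G) (concat vss) = concat (map (tsrc G) us) \<and>
      (\<forall>v\<in>set (map2 Cmpt us vss). twf G v) \<and> map (ttgt G) (map2 Cmpt us vss) = map (ttgt G) us \<and>
      concat (map (tsrc G) (concat vss)) = concat (map (tsrc G) (map2 Cmpt us vss))"
    using assms(2) by (induction rule: list_all2_induct) (auto simp: tcomposable_def)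
  then show "tcomposable G (Cmpt t us) (concat vss)" "tcomposable G t (map2 Cmpt us vss)"
    "concat (map (tsrc G) (concat vss)) = concat (map (tsrc G) (map2 Cmpt us vss))"
    using assms(1) unfolding tcomposable_def[of G t] tcomposable_def[of G "Cmpt t us"]
    by (auto simp: tcomposable_def)
qed

lemma length_concat_tsrc:
  "sum_list (map (length \<circ> tsrc G) us) = length (concat (map (tsrc G) us))"
  by (simp add: length_concat comp_def)

lemma tcomposable_outer:
  assumes "tcomposable G t us" "\<sigma> permutes {..<length us}"
  shows "tcomposable G (Actt \<sigma> t) (permute_list \<sigma> us)"
    "twf G (Actt (block_perm \<sigma> (map (length \<circ> tsrc G) us)) (Cmpt t us))"
    "concat (map (tsrc G) (permute_list \<sigma> us)) =
       permute_list (block_perm \<sigma> (map (length \<circ> tsrc G) us)) (concat (map (tsrc G) us))"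
proof -
  have "length us = length (tsrc G t)"
    using assms(1) unfolding tcomposable_def by (metis length_map)
  then show "tcomposable G (Actt \<sigma> t) (permute_list \<sigma> us)"
    using assms set_permute_list[OF assms(2)] unfolding tcomposable_def
    by (auto simp: twf_Actt simp flip: permute_list_map)
  show "concat (map (tsrc G) (permute_list \<sigma> us)) =
       permute_list (block_perm \<sigma> (map (length \<circ> tsrc G) us)) (concat (map (tsrc G) us))"
    using permute_block_perm[of \<sigma> "map (tsrc G) us"] assms(2) by (simp add: permute_list_map)
  show "twf G (Actt (block_perm \<sigma> (map (length \<circ> tsrc G) us)) (Cmpt t us))"
    using block_perm_permutes[of \<sigma> "map (length \<circ> tsrc G) us"] assms
    unfolding length_concat_tsrc by (simp add: twf_Actt)
qed

lemma tcomposable_inner: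
  assumes "tcomposable G t us" "list_all2 (\<lambda>\<tau> u. \<tau> permutes {..<length (tsrc G u)}) \<tau>s us"
  shows "tcomposable G t (map2 Actt \<tau>s us)"
    "twf G (Actt (sum_perm \<tau>s (map (length \<circ> tsrc G) us)) (Cmpt t us))"
    "concat (map (tsrc G) (map2 Actt \<tau>s us)) =
       permute_list (sum_perm \<tau>s (map (length \<circ> tsrc G) us)) (concat (map (tsrc G) us))"
proof -
  have "(\<forall>u\<in>set us. twf G u) \<longrightarrow> (\<forall>v\<in>set (map2 Actt \<tau>s us). twf G v) \<and>
      map (ttgt G) (map2 Actt \<tau>s us) = map (ttgt G) us"
    using assms(2) by (induction rule: list_all2_induct) (auto simp: twf_Actt)
  then show "tcomposable G t (map2 Actt \<tau>s us)"
    using assms(1) unfolding tcomposable_def by auto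
  have "map (tsrc G) (map2 Actt \<tau>s us) = map2 permute_list \<tau>s (map (tsrc G) us)"
    using assms(2) by (induction rule: list_all2_induct) auto
  then show "concat (map (tsrc G) (map2 Actt \<tau>s us)) =
       permute_list (sum_perm \<tau>s (map (length \<circ> tsrc G) us)) (concat (map (tsrc G) us))"
    using permute_sum_perm[of \<tau>s "map (tsrc G) us"] assms(2) by (simp add: list.rel_map)
  show "twf G (Actt (sum_perm \<tau>s (map (length \<circ> tsrc G) us)) (Cmpt t us))"
    using sum_perm_permutes[of \<tau>s "map (length \<circ> tsrc G) us"] assms
    unfolding length_concat_tsrc by (simp add: twf_Actt list.rel_map)
qed

text \<open>Makes source and target invariants of a class, so that the structure of
  \<open>presented\<close>, which is defined through arbitrary representatives, makes sense.\<close>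

lemma teq_wf:
  "teq G R t u \<Longrightarrow> twf G t \<and> twf G u \<and> tsrc G t = tsrc G u \<and> ttgt G t = ttgt G u"
proof (induction rule: teq.induct)
  case (teq_Cmpt t us t' us')
  have "(\<forall>u\<in>set us'. twf G u) \<and> map (ttgt G) us' = map (ttgt G) us \<and> map (tsrc G) us' = map (tsrc G) us"
    using teq_Cmpt(4) by (induction rule: list_all2_induct) auto
  then show ?case using teq_Cmpt by (auto simp: tcomposable_def)
next
  case (teq_idn_cmp t)
  then show ?case using twf_vert by (simp add: tcomposable_def)
next
  case (teq_cmp_idn t)
  then have "map (tsrc G \<circ> Idt) (tsrc G t) = map (\<lambda>x. [x]) (tsrc G t)" by simp
  then have "concat (map (tsrc G \<circ> Idt) (tsrc G t)) = tsrc G t" by (simp only: concat_map_singleton) simp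
  then show ?case using teq_cmp_idn twf_vert by (auto simp: tcomposable_def comp_def)
next
  case (teq_assoc t us vss)
  then show ?case using tcomposable_assoc[OF teq_assoc] by simp
next
  case (teq_act_comp t \<sigma> \<tau>)
  then show ?case by (simp add: twf_Actt permutes_compose permute_list_compose)
next
  case (teq_act_outer t us \<sigma>)
  then show ?case using tcomposable_outer[OF teq_act_outer] by simp
next
  case (teq_act_inner t us \<tau>s)
  then show ?case using tcomposable_inner[OF teq_act_inner] by simp
qed (auto simp: rel twf_Actt permutes_id)

section \<open>The quotient by the generated congruence\<close>

abbreviation "cls \<equiv> tcls G R"
abbreviation "pres \<equiv> presented G R"

lemma cls_eqI: "teq G R t u \<Longrightarrow> cls t = cls u"
  unfolding tcls_def by (blast intro: teq_sym teq_trans)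

lemma trep_cls: "twf G t \<Longrightarrow> teq G R t (trep (cls t))"
  unfolding trep_def tcls_def by (rule someI2[of _ t]) (auto intro: teq_refl)

lemma trep_wf: "twf G t \<Longrightarrow> twf G (trep (cls t)) \<and> tsrc G (trep (cls t)) = tsrc G t \<and>
    ttgt G (trep (cls t)) = ttgt G t"
  using teq_wf[OF trep_cls] by auto

lemma pres_simps:
  "obj pres = vert G" "arr pres = cls ` {t. twf G t}"
  "twf G t \<Longrightarrow> src pres (cls t) = tsrc G t" "twf G t \<Longrightarrow> tgt pres (cls t) = ttgt G t"
  "idn pres X = cls (Idt X)"
  by (auto simp: presented_def trep_wf)

text \<open>The congruence rule absorbs the difference between the given terms and the
  representatives chosen by \<open>trep\<close>. From here on composites can be computed on any
  representatives.\<close>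

lemma cmp_pres: "tcomposable G t us \<Longrightarrow> cmp pres (cls t) (map cls us) = cls (Cmpt t us)"
proof -
  assume c: "tcomposable G t us"
  have "teq G R (Cmpt t us) (Cmpt (trep (cls t)) (map trep (map cls us)))"
    using c trep_cls by (intro teq_Cmpt) (auto simp: tcomposable_def list_all2_conv_all_nth)
  then show ?thesis by (simp add: presented_def cls_eqI)
qed

lemma act_pres: "twf G t \<Longrightarrow> \<sigma> permutes {..<length (tsrc G t)} \<Longrightarrow>
    act pres \<sigma> (cls t) = cls (Actt \<sigma> t)"
proof -
  assume c: "twf G t" "\<sigma> permutes {..<length (tsrc G t)}"
  then have "teq G R (Actt \<sigma> t) (Actt \<sigma> (trep (cls t)))"
    using trep_cls by (intro teq_Actt) auto
  then show ?thesis by (simp add: presented_def cls_eqI)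
qed

lemma composable_pres:
  assumes "composable pres f gs"
  obtains t us where "tcomposable G t us" "f = cls t" "gs = map cls us"
proof -
  obtain t where t: "f = cls t" "twf G t"
    using composableD(1)[OF assms] pres_simps(2) by blast
  have "gs \<in> lists (cls ` {t. twf G t})" using composableD(2)[OF assms] pres_simps(2) by auto
  then obtain us where us: "gs = map cls us" "set us \<subseteq> {t. twf G t}" by (auto simp: lists_image)
  have m: "map (ttgt G) us = map (tgt pres) gs" using us by (auto simp: pres_simps subset_iff)
  have "tcomposable G t us"
    using composableD(3)[OF assms] t us(2) unfolding tcomposable_def m by (auto simp: pres_simps)
  then show thesis using that t us by blast
qed

text \<open>Each equation is literally a rule of \<open>teq\<close>; the work lies in replacing
  classes by terms and in checking that these terms are well formed.\<close>

lemma sym_multicategory_pres: "sym_multicategory pres"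
proof
  fix f assume "f \<in> arr pres"
  then obtain t where t: "f = cls t" "twf G t" using pres_simps(2) by blast
  show "set (src pres f) \<subseteq> obj pres" "tgt pres f \<in> obj pres"
    using t twf_vert by (auto simp: pres_simps)
  have "tcomposable G (Idt (ttgt G t)) [t]" using t twf_vert by (simp add: tcomposable_def)
  from cmp_pres[OF this] show "cmp pres (idn pres (tgt pres f)) [f] = f"
    using cls_eqI[OF teq_idn_cmp[OF t(2)]] t by (simp add: pres_simps)
  have "tcomposable G t (map Idt (tsrc G t))"
    using t twf_vert[OF t(2)] by (auto simp: tcomposable_def comp_def)
  moreover have "map (idn pres) (tsrc G t) = map cls (map Idt (tsrc G t))"
    by (simp add: pres_simps)
  ultimately show "cmp pres f (map (idn pres) (src pres f)) = f"
    using cls_eqI[OF teq_cmp_idn[OF t(2)]] t cmp_pres by (simp add: pres_simps del: map_map)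
  show "act pres id f = f"
    using cls_eqI[OF teq_act_id[OF t(2)]] act_pres[OF t(2), of id] t by (simp add: permutes_id)
  fix \<sigma> assume "\<sigma> permutes {..<length (src pres f)}"
  then have \<sigma>: "\<sigma> permutes {..<length (tsrc G t)}" using t by (simp add: pres_simps)
  then have w: "twf G (Actt \<sigma> t)" using t by (simp add: twf_Actt)
  then show "act pres \<sigma> f \<in> arr pres" "src pres (act pres \<sigma> f) = permute_list \<sigma> (src pres f)"
    "tgt pres (act pres \<sigma> f) = tgt pres f"
    using t \<sigma> by (auto simp: act_pres pres_simps)
  fix \<tau> assume "\<tau> permutes {..<length (src pres f)}"
  then have \<tau>: "\<tau> permutes {..<length (tsrc G t)}" using t by (simp add: pres_simps)
  show "act pres (\<sigma> \<circ> \<tau>) f = act pres \<tau> (act pres \<sigma> f)"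
    using cls_eqI[OF teq_act_comp[OF t(2) \<sigma> \<tau>]] t(1) act_pres[OF t(2)] act_pres[OF w, of \<tau>] \<sigma> \<tau>
    by (simp add: permutes_compose)
next
  fix X assume "X \<in> obj pres"
  then show "idn pres X \<in> arr pres" "src pres (idn pres X) = [X]" "tgt pres (idn pres X) = X"
    by (auto simp: pres_simps)
next
  fix f gs assume "composable pres f gs"
  then obtain t us where c: "tcomposable G t us" and f: "f = cls t" and gs: "gs = map cls us"
    by (rule composable_pres)
  have t: "twf G t" and us: "\<forall>u\<in>set us. twf G u" using c by (auto simp: tcomposable_def)
  have srcs: "map (src pres) gs = map (tsrc G) us" using us gs by (auto simp: pres_simps)
  have lens: "map (length \<circ> src pres) gs = map (length \<circ> tsrc G) us"
    using srcs by (metis map_map)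
  have cm: "cmp pres f gs = cls (Cmpt t us)" using c f gs cmp_pres by simp
  show "cmp pres f gs \<in> arr pres" "src pres (cmp pres f gs) = concat (map (src pres) gs)"
    "tgt pres (cmp pres f gs) = tgt pres f"
    using c t unfolding cm srcs unfolding f by (auto simp: pres_simps)
  show "cmp pres (cmp pres f gs) (concat hss) = cmp pres f (map2 (cmp pres) gs hss)"
    if "list_all2 (composable pres) gs hss" for hss
  proof -
    have "\<exists>vss. hss = map (map cls) vss \<and> list_all2 (tcomposable G) us vss"
      using that us unfolding gs list_all2_map1
    proof (induction us arbitrary: hss)
      case (Cons u us)
      then obtain hs hss' where h: "hss = hs # hss'" "composable pres (cls u) hs"
        "list_all2 (\<lambda>x. composable pres (cls x)) us hss'" by (auto simp: list_all2_Cons1)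
      have u: "twf G u" using Cons.prems by simp
      obtain u' vs where v: "tcomposable G u' vs" "cls u = cls u'" "hs = map cls vs"
        using composable_pres[OF h(2)] by metis
      \<comment> \<open>The representative \<open>u'\<close> obtained from composability need not be
        the given \<open>u\<close>, but both have the same source, so \<open>vs\<close> can be
        composed with \<open>u\<close> itself.\<close>
      have "tsrc G u' = tsrc G u"
        using u v pres_simps(3) by (metis tcomposable_def)
      then have "tcomposable G u vs" using v u by (simp add: tcomposable_def)
      moreover obtain vss where "hss' = map (map cls) vss" "list_all2 (tcomposable G) us vss"
        using Cons.IH[OF h(3)] Cons.prems by auto
      ultimately show ?case using h v by (intro exI[of _ "vs # vss"]) simp
    qed simp
    then obtain vss where vss: "hss = map (map cls) vss" "list_all2 (tcomposable G) us vss" by blast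
    have "map2 (cmp pres) gs hss = map cls (map2 Cmpt us vss)"
      using vss(2) unfolding gs vss(1)
      by (induction rule: list_all2_induct) (auto simp: cmp_pres)
    then show ?thesis
      using cls_eqI[OF teq_assoc[OF c vss(2)]] tcomposable_assoc(1,2)[OF c vss(2)] cmp_pres
      unfolding cm unfolding f vss(1) map_concat[symmetric] by (simp del: map_map)
  qed
  show "cmp pres (act pres \<sigma> f) (permute_list \<sigma> gs) =
      act pres (block_perm \<sigma> (map (length \<circ> src pres) gs)) (cmp pres f gs)"
    if "\<sigma> permutes {..<length gs}" for \<sigma>
  proof -
    have \<sigma>: "\<sigma> permutes {..<length us}" using that gs by simp
    note out = tcomposable_outer[OF c \<sigma>]
    have "act pres \<sigma> f = cls (Actt \<sigma> t)"
      using out(1) f t act_pres by (simp add: tcomposable_def twf_Actt)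
    moreover have "permute_list \<sigma> gs = map cls (permute_list \<sigma> us)"
      using \<sigma> gs by (simp add: permute_list_map)
    moreover have "act pres (block_perm \<sigma> (map (length \<circ> tsrc G) us)) (cls (Cmpt t us)) =
        cls (Actt (block_perm \<sigma> (map (length \<circ> tsrc G) us)) (Cmpt t us))"
      using out(2) c by (intro act_pres) (auto simp: twf_Actt)
    ultimately show ?thesis
      using cls_eqI[OF teq_act_outer[OF c \<sigma>]] cmp_pres[OF out(1)] unfolding cm lens by simp
  qed
  show "cmp pres f (map2 (act pres) \<tau>s gs) =
      act pres (sum_perm \<tau>s (map (length \<circ> src pres) gs)) (cmp pres f gs)"
    if "list_all2 (\<lambda>\<tau> g. \<tau> permutes {..<length (src pres g)}) \<tau>s gs" for \<tau>s
  proof -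
    have \<tau>s: "list_all2 (\<lambda>\<tau> u. \<tau> permutes {..<length (tsrc G u)}) \<tau>s us"
      using that us unfolding gs by (auto simp: list_all2_conv_all_nth pres_simps)
    note inn = tcomposable_inner[OF c \<tau>s]
    have "map2 (act pres) \<tau>s gs = map cls (map2 Actt \<tau>s us)"
      using \<tau>s us unfolding gs
      by (induction rule: list_all2_induct) (auto simp: act_pres)
    moreover have "act pres (sum_perm \<tau>s (map (length \<circ> tsrc G) us)) (cls (Cmpt t us)) =
        cls (Actt (sum_perm \<tau>s (map (length \<circ> tsrc G) us)) (Cmpt t us))"
      using inn(2) c by (intro act_pres) (auto simp: twf_Actt)
    ultimately show ?thesis
      using cls_eqI[OF teq_act_inner[OF c \<tau>s]] cmp_pres[OF inn(1)] unfolding cm lens unfolding f by simp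
  qed
qed

text \<open>Uniqueness in the universal property: the classes of generators and the identities
  generate all arrows, so induction on terms applies.\<close>

lemma pres_ext:
  assumes F: "F \<in> sMlt pres P" and H: "H \<in> sMlt pres P"
    and ob: "\<And>X. X \<in> vert G \<Longrightarrow> sob F X = sob H X"
    and gen: "\<And>g. g \<in> edge G \<Longrightarrow> sar F (cls (Gen g)) = sar H (cls (Gen g))"
  shows "F = H"
proof (rule sfun_eqI[OF F H])
  fix X assume "X \<in> obj pres"
  then show "sob F X = sob H X" using ob by (simp add: pres_simps)
next
  have eq: "sar F (cls t) = sar H (cls t)" if "twf G t" for t
    using that
  proof (induction rule: twf.induct)
    case (1 X)
    then show ?case using sMltD(11)[OF F, of X] sMltD(11)[OF H, of X] ob by (simp add: pres_simps)
  next
    case (3 t us)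
    then have c: "tcomposable G t us" by (auto simp: tcomposable_def)
    have "\<forall>u\<in>set us. twf G u" using 3 by auto
    then have "map (tgt pres) (map cls us) = map (ttgt G) us"
      by (auto simp: pres_simps)
    also have "\<dots> = src pres (cls t)"
      using 3 by (auto simp: pres_simps)
    finally have c': "composable pres (cls t) (map cls us)"
      using c unfolding composable_def tcomposable_def pres_simps(2) by auto
    have m: "map (sar F) (map cls us) = map (sar H) (map cls us)" using 3 by auto
    have "sar F (cls t) = sar H (cls t)" using 3 by simp
    then show ?case
      using sMltD(12)[OF F c'] sMltD(12)[OF H c'] unfolding m cmp_pres[OF c] by (simp del: map_map)
  next
    case (4 t \<sigma>)
    then show ?case
      using sMltD(13)[OF F, of "cls t" \<sigma>] sMltD(13)[OF H, of "cls t" \<sigma>]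
      by (simp add: pres_simps act_pres)
  qed (use gen in auto)
  fix f assume "f \<in> arr pres"
  then show "sar F f = sar H f" using eq by (auto simp: pres_simps)
qed

text \<open>Existence in the universal property. Evaluation of terms is invariant under
  \<open>teq\<close> because every rule other than the given relations becomes an axiom of
  \<open>P\<close>; hence it does not matter that \<open>F\<close> evaluates a chosen
  representative.\<close>

lemma pres_lift:
  assumes P: "sym_multicategory P"
    and ob: "\<And>X. X \<in> vert G \<Longrightarrow> \<phi> X \<in> obj P"
    and gen: "\<And>g. g \<in> edge G \<Longrightarrow> \<gamma> g \<in> arr P \<and> src P (\<gamma> g) = map \<phi> (esrc G g) \<and> tgt P (\<gamma> g) = \<phi> (etgt G g)"
    and rel': "\<And>t u. R t u \<Longrightarrow> teval P \<phi> \<gamma> t = teval P \<phi> \<gamma> u"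
  defines "F \<equiv> \<lparr>sdom = pres, scod = P, sob = restrict \<phi> (obj pres),
     sar = \<lambda>c\<in>arr pres. teval P \<phi> \<gamma> (trep c)\<rparr>"
  shows "F \<in> sMlt pres P" "twf G t \<Longrightarrow> sar F (cls t) = teval P \<phi> \<gamma> t"
proof -
  interpret P: sym_multicategory P by fact
  let ?e = "teval P \<phi> \<gamma>"
  have ev: "?e t \<in> arr P \<and> src P (?e t) = map \<phi> (tsrc G t) \<and> tgt P (?e t) = \<phi> (ttgt G t)"
    if "twf G t" for t
    using that
  proof (induction rule: twf.induct)
    case (3 t us)
    have "\<forall>u\<in>set us. tgt P (?e u) = \<phi> (ttgt G u)" using 3 by auto
    then have "map (tgt P) (map ?e us) = map \<phi> (map (ttgt G) us)" by auto
    also have "map (ttgt G) us = tsrc G t" using 3 by auto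
    also have "map \<phi> (tsrc G t) = src P (?e t)" using 3 by simp
    finally have c: "composable P (?e t) (map ?e us)"
      using 3 unfolding composable_def by auto
    have m: "map (src P) (map ?e us) = map (map \<phi>) (map (tsrc G) us)" using 3 by auto
    show ?case
      using P.cmp_arr[OF c] P.src_cmp[OF c] P.tgt_cmp[OF c] 3 unfolding m
      by (simp add: map_concat del: map_map)
  next
    case (4 t \<sigma>)
    then show ?case by (simp add: P.act_arr P.src_act P.tgt_act permute_list_map)
  qed (auto simp: ob gen P.idn_arr P.src_idn P.tgt_idn)
  have evc: "composable P (?e t) (map ?e us)" if "tcomposable G t us" for t us
  proof -
    have t: "twf G t" and us: "\<forall>u\<in>set us. twf G u" and eq: "map (ttgt G) us = tsrc G t"
      using that unfolding tcomposable_def by auto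
    have "map (tgt P) (map ?e us) = map \<phi> (map (ttgt G) us)"
      using us ev by auto
    then show ?thesis
      using t us ev unfolding composable_def eq by auto
  qed
  have eq: "?e t = ?e u" if "teq G R t u" for t u
    using that
  proof (induction rule: teq.induct)
    case (teq_Cmpt t us t' us')
    have "map ?e us = map ?e us'"
      using teq_Cmpt(4) by (induction rule: list_all2_induct) auto
    then show ?case using teq_Cmpt by simp
  next
    case (teq_idn_cmp t)
    then show ?case using P.idn_cmp[of "?e t"] ev by simp
  next
    case (teq_cmp_idn t)
    then show ?case using P.cmp_idn[of "?e t"] ev by (simp add: comp_def)
  next
    case (teq_assoc t us vss)
    have "list_all2 (composable P) (map ?e us) (map (map ?e) vss)"
      using teq_assoc(2) evc by (auto simp: list_all2_conv_all_nth)
    moreover have "map ?e (map2 Cmpt us vss) = map2 (cmp P) (map ?e us) (map (map ?e) vss)"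
      using teq_assoc(2) by (induction rule: list_all2_induct) auto
    ultimately show ?case
      using P.cmp_assoc[OF evc[OF teq_assoc(1)], of "map (map ?e) vss"] by (simp add: map_concat)
  next
    case (teq_act_id t)
    then show ?case using P.act_id ev by simp
  next
    case (teq_act_comp t \<sigma> \<tau>)
    then show ?case using P.act_comp[of "?e t" \<sigma> \<tau>] ev by simp
  next
    case (teq_act_outer t us \<sigma>)
    have l: "map (length \<circ> tsrc G) us = map (length \<circ> src P) (map ?e us)"
      using teq_act_outer(1) ev by (auto simp: tcomposable_def)
    show ?case
      using P.act_cmp_outer[OF evc[OF teq_act_outer(1)], of \<sigma>] teq_act_outer(2)
      unfolding l by (simp add: permute_list_map)
  next
    case (teq_act_inner t us \<tau>s)
    have l: "map (length \<circ> tsrc G) us = map (length \<circ> src P) (map ?e us)"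
      using teq_act_inner(1) ev by (auto simp: tcomposable_def)
    have "list_all2 (\<lambda>\<tau> g. \<tau> permutes {..<length (src P g)}) \<tau>s (map ?e us)"
      using teq_act_inner ev by (auto simp: list_all2_conv_all_nth tcomposable_def)
    moreover have m: "map ?e (map2 Actt \<tau>s us) = map2 (act P) \<tau>s (map ?e us)"
      using teq_act_inner(2) by (induction rule: list_all2_induct) auto
    ultimately show ?case
      using P.act_cmp_inner[OF evc[OF teq_act_inner(1)], of \<tau>s]
      unfolding l teval.simps m by simp
  qed (auto simp: rel')
  have val: "sar F (cls t) = ?e t" if "twf G t" for t
    using that eq[OF trep_cls[OF that]] by (simp add: F_def pres_simps)
  then show "twf G t \<Longrightarrow> sar F (cls t) = ?e t" .
  show "F \<in> sMlt pres P"
  proof (rule sMltI)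
    fix f assume "f \<in> arr pres"
    then obtain t where t: "f = cls t" "twf G t" using pres_simps(2) by blast
    show "sar F f \<in> arr P" "tgt P (sar F f) = sob F (tgt pres f)"
      using t ev val twf_vert by (simp_all add: pres_simps F_def)
    show "src P (sar F f) = map (sob F) (src pres f)"
      using t ev val twf_vert[OF t(2)] by (simp add: pres_simps F_def subset_iff)
    fix \<sigma> assume "\<sigma> permutes {..<length (src pres f)}"
    then have "\<sigma> permutes {..<length (tsrc G t)}" using t by (simp add: pres_simps)
    then show "sar F (act pres \<sigma> f) = act P \<sigma> (sar F f)"
      using t val by (simp add: act_pres twf_Actt)
  next
    fix f gs assume "composable pres f gs"
    then obtain t us where c: "tcomposable G t us" and f: "f = cls t" and gs: "gs = map cls us"
      by (rule composable_pres)
    then have m: "map (sar F) (map cls us) = map ?e us" using val by (auto simp: tcomposable_def)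
    have "twf G t" using c by (simp add: tcomposable_def)
    then show "sar F (cmp pres f gs) = cmp P (sar F f) (map (sar F) gs)"
      using c val unfolding f gs m by (simp add: cmp_pres)
  next
    fix X assume X: "X \<in> obj pres"
    then show "sob F X \<in> obj P" using ob by (simp add: F_def pres_simps)
    show "sar F (idn pres X) = idn P (sob F X)" 
      using X val[of "Idt X"] by (simp add: pres_simps) (simp add: F_def pres_simps)
  qed (use P sym_multicategory_pres in \<open>auto simp: F_def\<close>)
qed

end


subsection \<open>The tensor product of symmetric multicategories\<close>

lemma tensor_graph_simps [simp]:
  "vert (tensor_graph M N) = obj M \<times> obj N"
  "Inl (f, X) \<in> edge (tensor_graph M N) \<longleftrightarrow> f \<in> arr M \<and> X \<in> obj N"
  "Inr (A, h) \<in> edge (tensor_graph M N) \<longleftrightarrow> A \<in> obj M \<and> h \<in> arr N"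
  "esrc (tensor_graph M N) (Inl (f, X)) = map (\<lambda>A. (A, X)) (src M f)"
  "esrc (tensor_graph M N) (Inr (A, h)) = map (\<lambda>X. (A, X)) (src N h)"
  "etgt (tensor_graph M N) (Inl (f, X)) = (tgt M f, X)"
  "etgt (tensor_graph M N) (Inr (A, h)) = (A, tgt N h)"
  by (auto simp: tensor_graph_def)

lemma tensor_edgeE:
  assumes "g \<in> edge (tensor_graph M N)"
  obtains f X where "g = Inl (f, X)" "f \<in> arr M" "X \<in> obj N"
  | A h where "g = Inr (A, h)" "A \<in> obj M" "h \<in> arr N"
  using assms by (auto simp: tensor_graph_def)

lemma tensor_presentation:
  assumes "sym_multicategory M" "sym_multicategory N"
  shows "presentation (tensor_graph M N) (tensor_rel M N)"
proof
  interpret M: sym_multicategory M by fact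
  interpret N: sym_multicategory N by fact
  let ?G = "tensor_graph M N"
  fix g assume "g \<in> edge ?G"
  then show "set (esrc ?G g) \<subseteq> vert ?G \<and> etgt ?G g \<in> vert ?G"
    using M.src_obj N.src_obj M.tgt_obj N.tgt_obj by (elim tensor_edgeE) auto
next
  interpret M: sym_multicategory M by fact
  interpret N: sym_multicategory N by fact
  let ?G = "tensor_graph M N"
  fix t u assume "tensor_rel M N t u"
  then show "twf ?G t \<and> twf ?G u \<and> tsrc ?G t = tsrc ?G u \<and> ttgt ?G t = ttgt ?G u"
  proof cases
    case (left_idn A X)
    then show ?thesis by (auto simp: M.idn_arr M.src_idn M.tgt_idn)
  next
    case (left_cmp f gs X)
    have "map (\<lambda>g. (tgt M g, X)) gs = map (\<lambda>A. (A, X)) (src M f)"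
      unfolding composableD(3)[OF left_cmp(3), symmetric] by simp
    then show ?thesis using left_cmp composableD[OF left_cmp(3)]
      by (auto simp: M.cmp_arr M.src_cmp M.tgt_cmp tcomposable_def map_concat comp_def)
  next
    case (left_act f \<sigma> X)
    then show ?thesis by (auto simp: twf_Actt M.act_arr M.src_act M.tgt_act permute_list_map)
  next
    case (right_idn A X)
    then show ?thesis by (auto simp: N.idn_arr N.src_idn N.tgt_idn)
  next
    case (right_cmp A h ks)
    have "map (\<lambda>k. (A, tgt N k)) ks = map (\<lambda>X. (A, X)) (src N h)"
      unfolding composableD(3)[OF right_cmp(4), symmetric] by simp
    then show ?thesis using right_cmp composableD[OF right_cmp(4)]
      by (auto simp: N.cmp_arr N.src_cmp N.tgt_cmp tcomposable_def map_concat comp_def)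
  next
    case (right_act A h \<sigma>)
    then show ?thesis by (auto simp: twf_Actt N.act_arr N.src_act N.tgt_act permute_list_map)
  next
    \<comment> \<open>The left side has its source listed with the second index running fastest, the
      right side with the first index running fastest; the transposition in the relation reconciles
      the two lists.\<close>
    case (interchange f h)
    have "length (concat (map (\<lambda>X. map (\<lambda>A. (A, X)) (src M f)) (src N h))) =
        length (src M f) * length (src N h)"
      by (simp add: length_concat comp_def sum_list_triv)
    then show ?thesis
      using interchange transp_perm_permutes[of "length (src M f)" "length (src N h)"]
        M.src_obj[OF interchange(3)] N.src_obj[OF interchange(4)] M.tgt_obj N.tgt_obj
        permute_transp_perm[of "src M f" "src N h" Pair]
      by (auto simp: twf_Actt tcomposable_def comp_def)
  qed
qed

lemma sym_multicategory_tensor [simp]: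
  "sym_multicategory M \<Longrightarrow> sym_multicategory N \<Longrightarrow> sym_multicategory (M \<otimes> N)"
  unfolding tensor_def by (intro presentation.sym_multicategory_pres tensor_presentation)

lemma obj_tensor [simp]: "obj (M \<otimes> N) = obj M \<times> obj N"
  by (simp add: tensor_def presented_def)

locale smc_pair =
  fixes M :: "('o, 'a) smc" and N :: "('p, 'b) smc"
  assumes M: "sym_multicategory M" and N: "sym_multicategory N"
begin

sublocale M: sym_multicategory M by (rule M)
sublocale N: sym_multicategory N by (rule N)
sublocale presentation "tensor_graph M N" "tensor_rel M N"
  by (rule tensor_presentation[OF M N])

lemmas T = sym_multicategory_tensor[OF M N]

sublocale T: sym_multicategory "M \<otimes> N" by (rule T)

lemma genL [simp]:
  assumes "f \<in> arr M" "X \<in> obj N"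
  shows "genL M N f X \<in> arr (M \<otimes> N)" "src (M \<otimes> N) (genL M N f X) = map (\<lambda>A. (A, X)) (src M f)"
    "tgt (M \<otimes> N) (genL M N f X) = (tgt M f, X)"
  using assms unfolding genL_def tensor_def by (simp_all add: pres_simps)

lemma genR [simp]:
  assumes "A \<in> obj M" "h \<in> arr N"
  shows "genR M N A h \<in> arr (M \<otimes> N)" "src (M \<otimes> N) (genR M N A h) = map (\<lambda>X. (A, X)) (src N h)"
    "tgt (M \<otimes> N) (genR M N A h) = (A, tgt N h)"
  using assms unfolding genR_def tensor_def by (simp_all add: pres_simps)

lemma cls_rel:
  assumes "tensor_rel M N t u"
  shows "cls t = cls u" "twf (tensor_graph M N) t" "twf (tensor_graph M N) u"
  using rel[OF assms] cls_eqI[OF teq_rel[where R = "tensor_rel M N", OF assms]] by auto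

text \<open>The relations \<open>left_idn\<close>, \<open>left_cmp\<close> and
  \<open>left_act\<close> were imposed for this; \<open>inclR_sMlt\<close> uses the other three in
  the same way.\<close>

lemma inclL_sMlt [simp]:
  assumes X: "X \<in> obj N"
  shows "inclL M N X \<in> sMlt M (M \<otimes> N)"
proof (rule sMltI)
  fix A assume "A \<in> obj M"
  then show "sar (inclL M N X) (idn M A) = idn (M \<otimes> N) (sob (inclL M N X) A)"
    using cls_rel(1)[OF left_idn[OF _ X]]
    by (simp add: inclL_def M.idn_arr genL_def tensor_def pres_simps)
next
  fix f gs assume c: "composable M f gs"
  note r = cls_rel[OF left_cmp[OF c X]]
  have "cmp (M \<otimes> N) (genL M N f X) (map (\<lambda>g. genL M N g X) gs) = genL M N (cmp M f gs) X"
    using r cmp_pres[of "Gen (Inl (f, X))" "map (\<lambda>g. Gen (Inl (g, X))) gs"]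
    unfolding tensor_def genL_def by (simp add: comp_def)
  then show "sar (inclL M N X) (cmp M f gs) =
      cmp (M \<otimes> N) (sar (inclL M N X) f) (map (sar (inclL M N X)) gs)"
    using c composableD[OF c] by (simp add: inclL_def M.cmp_arr subset_iff cong: map_cong)
next
  fix f \<sigma> assume f: "f \<in> arr M" "\<sigma> permutes {..<length (src M f)}"
  then have "act (M \<otimes> N) \<sigma> (genL M N f X) = genL M N (act M \<sigma> f) X"
    using cls_rel[OF left_act[OF f X]] act_pres[of "Gen (Inl (f, X))" \<sigma>] X
    unfolding tensor_def genL_def by simp
  then show "sar (inclL M N X) (act M \<sigma> f) = act (M \<otimes> N) \<sigma> (sar (inclL M N X) f)"
    using f by (simp add: inclL_def M.act_arr)
next
  fix f assume f: "f \<in> arr M"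
  show "src (M \<otimes> N) (sar (inclL M N X) f) = map (sob (inclL M N X)) (src M f)"
    using M.src_obj[OF f] X f by (simp add: inclL_def subset_iff)
qed (use M N X in \<open>auto simp: inclL_def M.tgt_obj\<close>)

lemma inclR_sMlt [simp]:
  assumes A: "A \<in> obj M"
  shows "inclR M N A \<in> sMlt N (M \<otimes> N)"
proof (rule sMltI)
  fix X assume "X \<in> obj N"
  then show "sar (inclR M N A) (idn N X) = idn (M \<otimes> N) (sob (inclR M N A) X)"
    using cls_rel(1)[OF right_idn[OF A]]
    by (simp add: inclR_def N.idn_arr genR_def tensor_def pres_simps)
next
  fix h ks assume c: "composable N h ks"
  note r = cls_rel[OF right_cmp[OF A c]]
  have "cmp (M \<otimes> N) (genR M N A h) (map (\<lambda>k. genR M N A k) ks) = genR M N A (cmp N h ks)"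
    using r cmp_pres[of "Gen (Inr (A, h))" "map (\<lambda>k. Gen (Inr (A, k))) ks"]
    unfolding tensor_def genR_def by (simp add: comp_def)
  then show "sar (inclR M N A) (cmp N h ks) =
      cmp (M \<otimes> N) (sar (inclR M N A) h) (map (sar (inclR M N A)) ks)"
    using c composableD[OF c] by (simp add: inclR_def N.cmp_arr subset_iff cong: map_cong)
next
  fix h \<sigma> assume h: "h \<in> arr N" "\<sigma> permutes {..<length (src N h)}"
  then have "act (M \<otimes> N) \<sigma> (genR M N A h) = genR M N A (act N \<sigma> h)"
    using cls_rel[OF right_act[OF A h]] act_pres[of "Gen (Inr (A, h))" \<sigma>] A
    unfolding tensor_def genR_def by simp
  then show "sar (inclR M N A) (act N \<sigma> h) = act (M \<otimes> N) \<sigma> (sar (inclR M N A) h)"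
    using h by (simp add: inclR_def N.act_arr)
next
  fix h assume h: "h \<in> arr N"
  show "src (M \<otimes> N) (sar (inclR M N A) h) = map (sob (inclR M N A)) (src N h)"
    using N.src_obj[OF h] A h by (simp add: inclR_def subset_iff)
qed (use M N A in \<open>auto simp: inclR_def N.tgt_obj\<close>)

lemma incl_simps [simp]:
  "sdom (inclL M N X) = M" "sdom (inclR M N A) = N"
  "scod (inclL M N X) = M \<otimes> N" "scod (inclR M N A) = M \<otimes> N"
  "A \<in> obj M \<Longrightarrow> sob (inclL M N X) A = (A, X)" "X \<in> obj N \<Longrightarrow> sob (inclR M N A) X = (A, X)"
  "f \<in> arr M \<Longrightarrow> sar (inclL M N X) f = genL M N f X" "h \<in> arr N \<Longrightarrow> sar (inclR M N A) h = genR M N A h"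
  by (simp_all add: inclL_def inclR_def)

lemma tensor_interchange:
  assumes f: "f \<in> arr M" and h: "h \<in> arr N"
  shows "cmp (M \<otimes> N) (genL M N f (tgt N h)) (map (\<lambda>A. genR M N A h) (src M f)) =
    act (M \<otimes> N) (transp_perm (length (src M f)) (length (src N h)))
      (cmp (M \<otimes> N) (genR M N (tgt M f) h) (map (\<lambda>X. genL M N f X) (src N h)))"
  using cls_rel[OF interchange[OF assms]]
    cmp_pres[of "Gen (Inl (f, tgt N h))" "map (\<lambda>A. Gen (Inr (A, h))) (src M f)"]
    cmp_pres[of "Gen (Inr (tgt M f, h))" "map (\<lambda>X. Gen (Inl (f, X))) (src N h)"]
    act_pres[of "Cmpt (Gen (Inr (tgt M f, h))) (map (\<lambda>X. Gen (Inl (f, X))) (src N h))"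
      "transp_perm (length (src M f)) (length (src N h))"]
  unfolding tensor_def genL_def genR_def by (simp add: comp_def twf_Actt)

lemma tensor_ext:
  assumes "F \<in> sMlt (M \<otimes> N) P" "H \<in> sMlt (M \<otimes> N) P"
    and "\<And>A X. A \<in> obj M \<Longrightarrow> X \<in> obj N \<Longrightarrow> sob F (A, X) = sob H (A, X)"
    and "\<And>f X. f \<in> arr M \<Longrightarrow> X \<in> obj N \<Longrightarrow> sar F (genL M N f X) = sar H (genL M N f X)"
    and "\<And>A h. A \<in> obj M \<Longrightarrow> h \<in> arr N \<Longrightarrow> sar F (genR M N A h) = sar H (genR M N A h)"
  shows "F = H"
  using assms unfolding tensor_def genL_def genR_def
  by (intro pres_ext) (auto elim!: tensor_edgeE)

text \<open>The universal property of the tensor product. The functors \<open>L X\<close> and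
  \<open>R A\<close> take care of the relations in each variable separately, so that interchange is
  the one family of equations left to verify.\<close>

lemma tensor_lift_sMlt:
  assumes L: "\<And>X. X \<in> obj N \<Longrightarrow> L X \<in> sMlt M P"
      "\<And>A X. A \<in> obj M \<Longrightarrow> X \<in> obj N \<Longrightarrow> sob (L X) A = \<phi> (A, X)"
      "\<And>f X. f \<in> arr M \<Longrightarrow> X \<in> obj N \<Longrightarrow> sar (L X) f = l f X"
    and R: "\<And>A. A \<in> obj M \<Longrightarrow> R A \<in> sMlt N P"
      "\<And>A X. A \<in> obj M \<Longrightarrow> X \<in> obj N \<Longrightarrow> sob (R A) X = \<phi> (A, X)"
      "\<And>A h. A \<in> obj M \<Longrightarrow> h \<in> arr N \<Longrightarrow> sar (R A) h = r A h"
    and I: "\<And>f h. f \<in> arr M \<Longrightarrow> h \<in> arr N \<Longrightarrow>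
      cmp P (l f (tgt N h)) (map (\<lambda>A. r A h) (src M f)) =
      act P (transp_perm (length (src M f)) (length (src N h)))
        (cmp P (r (tgt M f) h) (map (\<lambda>X. l f X) (src N h)))"
    and P: "sym_multicategory P"
  shows "tensor_lift M N P \<phi> l r \<in> sMlt (M \<otimes> N) P"
    "A \<in> obj M \<Longrightarrow> X \<in> obj N \<Longrightarrow> sob (tensor_lift M N P \<phi> l r) (A, X) = \<phi> (A, X)"
    "f \<in> arr M \<Longrightarrow> X \<in> obj N \<Longrightarrow> sar (tensor_lift M N P \<phi> l r) (genL M N f X) = l f X"
    "A \<in> obj M \<Longrightarrow> h \<in> arr N \<Longrightarrow> sar (tensor_lift M N P \<phi> l r) (genR M N A h) = r A h"
proof -
  let ?\<gamma> = "case_sum (case_prod l) (case_prod r)"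
  have ob: "\<phi> X \<in> obj P" if "X \<in> vert (tensor_graph M N)" for X
    using that sMltD(7)[OF L(1)] L(2) by (cases X) auto
  have gen: "?\<gamma> g \<in> arr P \<and> src P (?\<gamma> g) = map \<phi> (esrc (tensor_graph M N) g) \<and>
      tgt P (?\<gamma> g) = \<phi> (etgt (tensor_graph M N) g)" if "g \<in> edge (tensor_graph M N)" for g
    using that
  proof (cases rule: tensor_edgeE)
    case (1 f X)
    then have "map (sob (L X)) (src M f) = map (\<lambda>A. \<phi> (A, X)) (src M f)"
      using L(2) M.src_obj[of f] by auto
    then show ?thesis
      using 1 sMltD(8-10)[OF L(1), of X f] L(2,3) M.tgt_obj[of f] by (simp add: comp_def)
  next
    case (2 A h)
    then have "map (sob (R A)) (src N h) = map (\<lambda>X. \<phi> (A, X)) (src N h)"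
      using R(2) N.src_obj[of h] by auto
    then show ?thesis
      using 2 sMltD(8-10)[OF R(1), of A h] R(2,3) N.tgt_obj[of h] by (simp add: comp_def)
  qed
  have rl: "teval P \<phi> ?\<gamma> t = teval P \<phi> ?\<gamma> u" if "tensor_rel M N t u" for t u
    using that
  proof cases
    case (left_idn A X)
    then show ?thesis using sMltD(11)[OF L(1), of X A] L by (simp add: M.idn_arr)
  next
    case (left_cmp f gs X)
    have m: "map (sar (L X)) gs = map (\<lambda>g. l g X) gs"
      using composableD(2)[OF left_cmp(3)] left_cmp L(3) by auto
    show ?thesis
      using left_cmp sMltD(12)[OF L(1), of X f gs] composableD(1)[OF left_cmp(3)] L(3)
      unfolding m by (simp add: M.cmp_arr comp_def)
  next
    case (left_act f \<sigma> X)
    then show ?thesis using sMltD(13)[OF L(1), of X f \<sigma>] L by (simp add: M.act_arr)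
  next
    case (right_idn A X)
    then show ?thesis using sMltD(11)[OF R(1), of A X] R by (simp add: N.idn_arr)
  next
    case (right_cmp A h ks)
    have m: "map (sar (R A)) ks = map (\<lambda>k. r A k) ks"
      using composableD(2)[OF right_cmp(4)] right_cmp R(3) by auto
    show ?thesis
      using right_cmp sMltD(12)[OF R(1), of A h ks] composableD(1)[OF right_cmp(4)] R(3)
      unfolding m by (simp add: N.cmp_arr comp_def)
  next
    case (right_act A h \<sigma>)
    then show ?thesis using sMltD(13)[OF R(1), of A h \<sigma>] R by (simp add: N.act_arr)
  next
    case (interchange f h)
    then show ?thesis using I by (simp add: comp_def)
  qed
  note lift = pres_lift[OF P, of \<phi> ?\<gamma>, OF ob gen rl]
  show "tensor_lift M N P \<phi> l r \<in> sMlt (M \<otimes> N) P"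
    using lift(1) unfolding tensor_lift_def tensor_def .
  show "A \<in> obj M \<Longrightarrow> X \<in> obj N \<Longrightarrow> sob (tensor_lift M N P \<phi> l r) (A, X) = \<phi> (A, X)"
    by (simp add: tensor_lift_def)
  show "f \<in> arr M \<Longrightarrow> X \<in> obj N \<Longrightarrow> sar (tensor_lift M N P \<phi> l r) (genL M N f X) = l f X"
    using lift(2)[of "Gen (Inl (f, X))"] unfolding tensor_lift_def tensor_def genL_def by simp
  show "A \<in> obj M \<Longrightarrow> h \<in> arr N \<Longrightarrow> sar (tensor_lift M N P \<phi> l r) (genR M N A h) = r A h"
    using lift(2)[of "Gen (Inr (A, h))"] unfolding tensor_lift_def tensor_def genR_def by simp
qed

lemma gen_composable:
  assumes f: "f \<in> arr M" and h: "h \<in> arr N"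
  shows "composable (M \<otimes> N) (genL M N f (tgt N h)) (map (\<lambda>A. genR M N A h) (src M f))"
    "composable (M \<otimes> N) (genR M N (tgt M f) h) (map (\<lambda>X. genL M N f X) (src N h))"
    "length (src (M \<otimes> N) (cmp (M \<otimes> N) (genR M N (tgt M f) h) (map (\<lambda>X. genL M N f X) (src N h)))) =
       length (src M f) * length (src N h)"
proof -
  note so = M.src_obj[OF f] N.src_obj[OF h]
  show "composable (M \<otimes> N) (genL M N f (tgt N h)) (map (\<lambda>A. genR M N A h) (src M f))"
    using f h so N.tgt_obj unfolding composable_def by auto
  show c: "composable (M \<otimes> N) (genR M N (tgt M f) h) (map (\<lambda>X. genL M N f X) (src N h))"
    using f h so M.tgt_obj unfolding composable_def by auto
  have m: "map (src (M \<otimes> N)) (map (\<lambda>X. genL M N f X) (src N h)) =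
      map (\<lambda>X. map (\<lambda>A. (A, X)) (src M f)) (src N h)"
    using f so by auto
  show "length (src (M \<otimes> N) (cmp (M \<otimes> N) (genR M N (tgt M f) h) (map (\<lambda>X. genL M N f X) (src N h)))) =
       length (src M f) * length (src N h)"
    unfolding T.src_cmp[OF c] m by (simp add: length_concat comp_def sum_list_triv)
qed

text \<open>Identifies a functor prescribed on generators with a functor \<open>K\<close> that is
  already known. The prescribed values then satisfy the interchange law because it holds between
  generators and \<open>K\<close> preserves it.\<close>

lemma tensor_lift_eq:
  assumes K: "K \<in> sMlt (M \<otimes> N) P"
    and \<phi>: "\<And>A X. A \<in> obj M \<Longrightarrow> X \<in> obj N \<Longrightarrow> \<phi> (A, X) = sob K (A, X)"
    and l: "\<And>f X. f \<in> arr M \<Longrightarrow> X \<in> obj N \<Longrightarrow> l f X = sar K (genL M N f X)"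
    and r: "\<And>A h. A \<in> obj M \<Longrightarrow> h \<in> arr N \<Longrightarrow> r A h = sar K (genR M N A h)"
  shows "tensor_lift M N P \<phi> l r = K"
proof -
  note KD = sMltD[OF K]
  have I: "cmp P (l f (tgt N h)) (map (\<lambda>A. r A h) (src M f)) =
      act P (transp_perm (length (src M f)) (length (src N h)))
        (cmp P (r (tgt M f) h) (map (\<lambda>X. l f X) (src N h)))"
    if f: "f \<in> arr M" and h: "h \<in> arr N" for f h
  proof -
    note so = M.src_obj[OF f] N.src_obj[OF h]
    note c = gen_composable[OF f h]
    have m1: "map (\<lambda>A. r A h) (src M f) = map (sar K) (map (\<lambda>A. genR M N A h) (src M f))"
      using r h so by auto
    have m2: "map (\<lambda>X. l f X) (src N h) = map (sar K) (map (\<lambda>X. genL M N f X) (src N h))"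
      using l f so by auto
    show ?thesis
      unfolding m1 m2 l[OF f N.tgt_obj[OF h]] r[OF M.tgt_obj[OF f] h]
      using KD(12)[OF c(1)] KD(12)[OF c(2)] tensor_interchange[OF f h] c(3)
        KD(13)[OF T.cmp_arr[OF c(2)], of "transp_perm (length (src M f)) (length (src N h))"]
        transp_perm_permutes by simp
  qed
  have L: "K \<circ>\<^sub>s inclL M N X \<in> sMlt M P" if "X \<in> obj N" for X
    using that K by (intro scomp_sMlt[OF K]) simp
  have R: "K \<circ>\<^sub>s inclR M N A \<in> sMlt N P" if "A \<in> obj M" for A
    using that K by (intro scomp_sMlt[OF K]) simp
  note lift = tensor_lift_sMlt[of "\<lambda>X. K \<circ>\<^sub>s inclL M N X" P \<phi> l "\<lambda>A. K \<circ>\<^sub>s inclR M N A" r,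
      OF L _ _ R _ _ I KD(4)]
  show ?thesis
    by (rule tensor_ext[OF lift(1) K]) (use lift(2-4) \<phi> l r in auto)
qed

end

subsection \<open>The tensor product of sequential multicategories\<close>

lemma src_seq_smc: "src C\<^sub>\<triangleright> a = map (Dom C) (fst a)"
  and tgt_seq_smc: "tgt C\<^sub>\<triangleright> a = snd a"
  by (cases a, simp)+

lemma seq_ext:
  assumes K: "K \<in> sMlt C\<^sub>\<triangleright> D\<^sub>\<triangleright>" "K' \<in> sMlt C\<^sub>\<triangleright> D\<^sub>\<triangleright>" and C: "category C" "category D"
    and "\<And>X. X \<in> Ob C \<Longrightarrow> sob K X = sob K' X"
    and "\<And>f. f \<in> Ar C \<Longrightarrow> sar K ([f], Cod C f) = sar K' ([f], Cod C f)"
  shows "K = K'"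
proof (rule sfun_eqI[OF K])
  fix a assume a: "a \<in> arr C\<^sub>\<triangleright>"
  obtain fs X where fs: "a = (fs, X)" by fastforce
  show "sar K a = sar K' a"
    using a assms(5,6) unfolding fs sar_seq_component[OF K(1) C a[unfolded fs]]
      sar_seq_component[OF K(2) C a[unfolded fs]] by auto
qed (use assms(5) in simp)

text \<open>These are the arrows \<open><1, ..., 1>\<close>, the n-fold multiplications of the
  commutative monoid structure that every object of \<open>C\<^sub>\<triangleright>\<close>
  carries.\<close>

definition seqU :: "('o, 'a) cat \<Rightarrow> 'o \<Rightarrow> nat \<Rightarrow> 'a list \<times> 'o" where
  "seqU C X n = (replicate n (Idn C X), X)"

definition unary :: "('o, 'a) cat \<Rightarrow> 'a \<Rightarrow> 'a list \<times> 'o" where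
  "unary C f = ([f], Cod C f)"

lemma permute_list_replicate:
  assumes "\<sigma> permutes {..<n}"
  shows "permute_list \<sigma> (replicate n x) = replicate n x"
proof (rule nth_equalityI)
  fix i assume "i < length (permute_list \<sigma> (replicate n x))"
  moreover from this have "\<sigma> i < n" using permutes_in_image[OF assms, of i] by simp
  ultimately show "permute_list \<sigma> (replicate n x) ! i = replicate n x ! i"
    by (simp add: permute_list_def)
qed simp

context category
begin

text \<open>The last four claims are the laws of a commutative monoid in unbiased form: the unary
  multiplication is the identity, multiplications are symmetric, and a multiplication of
  multiplications is a multiplication.\<close>

lemma seqU:
  assumes "X \<in> Ob C"
  shows "seqU C X n \<in> arr C\<^sub>\<triangleright>" "src C\<^sub>\<triangleright> (seqU C X n) = replicate n X" "tgt C\<^sub>\<triangleright> (seqU C X n) = X"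
    "seqU C X (Suc 0) = idn C\<^sub>\<triangleright> X" "\<sigma> permutes {..<n} \<Longrightarrow> act C\<^sub>\<triangleright> \<sigma> (seqU C X n) = seqU C X n"
    "composable C\<^sub>\<triangleright> (seqU C X (length ns)) (map (seqU C X) ns)"
    "cmp C\<^sub>\<triangleright> (seqU C X (length ns)) (map (seqU C X) ns) = seqU C X (sum_list ns)"
proof -
  show 1: "seqU C X n \<in> arr C\<^sub>\<triangleright>" "src C\<^sub>\<triangleright> (seqU C X n) = replicate n X" "tgt C\<^sub>\<triangleright> (seqU C X n) = X"
    for n using assms by (simp_all add: seqU_def Idn_Ar Cod_Idn Dom_Idn)
  show "seqU C X (Suc 0) = idn C\<^sub>\<triangleright> X" by (simp add: seqU_def)
  show "\<sigma> permutes {..<n} \<Longrightarrow> act C\<^sub>\<triangleright> \<sigma> (seqU C X n) = seqU C X n"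
    by (simp add: seqU_def permute_list_replicate)
  show "composable C\<^sub>\<triangleright> (seqU C X (length ns)) (map (seqU C X) ns)"
    using 1 unfolding composable_def by (auto simp: map_replicate_const intro: nth_equalityI)
  have "concat (map2 (\<lambda>f g. map (Cmp C f) (fst g)) (replicate (length ns) (Idn C X)) (map (seqU C X) ns)) =
      replicate (sum_list ns) (Idn C X)"
    using Cmp_Idn[OF Idn_Ar[OF assms]]
    by (induction ns) (auto simp: seqU_def replicate_add Dom_Idn[OF assms])
  then show "cmp C\<^sub>\<triangleright> (seqU C X (length ns)) (map (seqU C X) ns) = seqU C X (sum_list ns)"
    by (simp add: seqU_def)
qed

text \<open>The last claim says that every arrow of \<open>C\<close> is a homomorphism for these
  multiplications: both sides are the list of n copies of \<open>f\<close>.\<close>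

lemma unary:
  assumes "f \<in> Ar C"
  shows "unary C f \<in> arr C\<^sub>\<triangleright>" "src C\<^sub>\<triangleright> (unary C f) = [Dom C f]" "tgt C\<^sub>\<triangleright> (unary C f) = Cod C f"
    "composable C\<^sub>\<triangleright> (unary C f) [seqU C (Dom C f) n]"
    "composable C\<^sub>\<triangleright> (seqU C (Cod C f) n) (replicate n (unary C f))"
    "cmp C\<^sub>\<triangleright> (unary C f) [seqU C (Dom C f) n] = cmp C\<^sub>\<triangleright> (seqU C (Cod C f) n) (replicate n (unary C f))"
proof -
  show 1: "unary C f \<in> arr C\<^sub>\<triangleright>" "src C\<^sub>\<triangleright> (unary C f) = [Dom C f]" "tgt C\<^sub>\<triangleright> (unary C f) = Cod C f"
    using assms by (simp_all add: unary_def Cod_Ob)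
  show "composable C\<^sub>\<triangleright> (unary C f) [seqU C (Dom C f) n]"
    "composable C\<^sub>\<triangleright> (seqU C (Cod C f) n) (replicate n (unary C f))"
    using 1 seqU[OF Dom_Ob[OF assms]] seqU[OF Cod_Ob[OF assms]] unfolding composable_def by auto
  have "concat (map2 (\<lambda>f g. map (Cmp C f) (fst g)) (replicate n (Idn C (Cod C f))) (replicate n (unary C f))) =
      replicate n f"
    using Idn_Cmp[OF assms] by (induction n) (auto simp: unary_def)
  then show "cmp C\<^sub>\<triangleright> (unary C f) [seqU C (Dom C f) n] = cmp C\<^sub>\<triangleright> (seqU C (Cod C f) n) (replicate n (unary C f))"
    using Cmp_Idn[OF assms] by (simp add: unary_def seqU_def)
qed

lemma unary_Idn: "X \<in> Ob C \<Longrightarrow> unary C (Idn C X) = idn C\<^sub>\<triangleright> X"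
  by (simp add: unary_def Cod_Idn)

lemma unary_Cmp:
  assumes "f \<in> Ar C" "g \<in> Ar C" "Cod C g = Dom C f"
  shows "composable C\<^sub>\<triangleright> (unary C f) [unary C g]" "unary C (Cmp C f g) = cmp C\<^sub>\<triangleright> (unary C f) [unary C g]"
  using assms unary[OF assms(1)] unary[OF assms(2)] by (simp_all add: composable_def) (simp add: unary_def Cod_Cmp)

lemma seq_arr_decompose:
  assumes "(fs, X) \<in> arr C\<^sub>\<triangleright>"
  shows "composable C\<^sub>\<triangleright> (seqU C X (length fs)) (map (unary C) fs)"
    "cmp C\<^sub>\<triangleright> (seqU C X (length fs)) (map (unary C) fs) = (fs, X)"
proof -
  have m: "map (unary C) fs = map (\<lambda>f. ([f], X)) fs" using assms by (auto simp: unary_def)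
  show "composable C\<^sub>\<triangleright> (seqU C X (length fs)) (map (unary C) fs)"
    "cmp C\<^sub>\<triangleright> (seqU C X (length fs)) (map (unary C) fs) = (fs, X)"
    using seq_arr_components[OF category_axioms assms] unfolding m seqU_def by simp_all
qed

end

section \<open>Constructing functors out of \<open>C\<^sub>\<triangleright>\<close>\<close>

lemma (in sym_multicategory) cmp_assoc1:
  assumes "composable M f [g]" "composable M g hs"
  shows "cmp M (cmp M f [g]) hs = cmp M f [cmp M g hs]"
  using cmp_assoc[OF assms(1), of "[hs]"] assms(2) by simp

lemma (in sym_multicategory) cmp_assoc_unary:
  assumes "composable M f gs" "list_all2 (\<lambda>g h. composable M g [h]) gs hs"
  shows "cmp M (cmp M f gs) hs = cmp M f (map2 (\<lambda>g h. cmp M g [h]) gs hs)"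
proof -
  have "list_all2 (composable M) gs (map (\<lambda>h. [h]) hs)"
    using assms(2) by (simp add: list.rel_map)
  then show ?thesis
    using cmp_assoc[OF assms(1), of "map (\<lambda>h. [h]) hs"]
    by (simp add: map2_map_map zip_map2 split_def comp_def)
qed

text \<open>The data form a functor from \<open>C\<close> to the commutative monoids in
  \<open>P\<close>: \<open>k\<close> is functorial, \<open>u\<close> gives multiplications on each
  \<open>\<phi> X\<close>, and every \<open>k f\<close> is a homomorphism by \<open>nat\<close>. The
  resulting functor sends a list of arrows to their images followed by one multiplication. In a
  composite, the inner multiplications are moved past the \<open>k f\<close> and merged with the
  outer one.\<close>

lemma seq_functorI:
  fixes P :: "('p, 'b) smc" and k :: "'a \<Rightarrow> 'b" and u :: "'o \<Rightarrow> nat \<Rightarrow> 'b" and \<phi> :: "'o \<Rightarrow> 'p"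
  assumes C: "category C" and P: "sym_multicategory P"
    and ob: "\<And>X. X \<in> Ob C \<Longrightarrow> \<phi> X \<in> obj P"
    and k: "\<And>f. f \<in> Ar C \<Longrightarrow> k f \<in> arr P" "\<And>f. f \<in> Ar C \<Longrightarrow> src P (k f) = [\<phi> (Dom C f)]"
      "\<And>f. f \<in> Ar C \<Longrightarrow> tgt P (k f) = \<phi> (Cod C f)"
    and k_id: "\<And>X. X \<in> Ob C \<Longrightarrow> k (Idn C X) = idn P (\<phi> X)"
    and k_cmp: "\<And>f g. f \<in> Ar C \<Longrightarrow> g \<in> Ar C \<Longrightarrow> Cod C g = Dom C f \<Longrightarrow>
        k (Cmp C f g) = cmp P (k f) [k g]"
    and u: "\<And>X n. X \<in> Ob C \<Longrightarrow> u X n \<in> arr P" "\<And>X n. X \<in> Ob C \<Longrightarrow> src P (u X n) = replicate n (\<phi> X)"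
      "\<And>X n. X \<in> Ob C \<Longrightarrow> tgt P (u X n) = \<phi> X"
    and u_1: "\<And>X. X \<in> Ob C \<Longrightarrow> u X (Suc 0) = idn P (\<phi> X)"
    and u_cmp: "\<And>X ns. X \<in> Ob C \<Longrightarrow> cmp P (u X (length ns)) (map (u X) ns) = u X (sum_list ns)"
    and u_act: "\<And>X n \<sigma>. X \<in> Ob C \<Longrightarrow> \<sigma> permutes {..<n} \<Longrightarrow> act P \<sigma> (u X n) = u X n"
    and nat: "\<And>f n. f \<in> Ar C \<Longrightarrow> cmp P (k f) [u (Dom C f) n] = cmp P (u (Cod C f) n) (replicate n (k f))"
  defines "K \<equiv> \<lparr>sdom = C\<^sub>\<triangleright>, scod = P, sob = restrict \<phi> (Ob C),
      sar = \<lambda>a\<in>arr C\<^sub>\<triangleright>. cmp P (u (snd a) (length (fst a))) (map k (fst a))\<rparr>"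
  shows "K \<in> sMlt C\<^sub>\<triangleright> P" "f \<in> Ar C \<Longrightarrow> sar K (unary C f) = k f"
proof -
  interpret C: category C by fact
  interpret P: sym_multicategory P by fact
  have comp: "composable P (u X (length fs)) (map k fs)" if "(fs, X) \<in> arr C\<^sub>\<triangleright>" for fs X
  proof -
    have "map (tgt P) (map k fs) = replicate (length fs) (\<phi> X)"
      using that k(3) by (auto intro: nth_equalityI)
    then show ?thesis using that u k(1) unfolding composable_def by auto
  qed
  \<comment> \<open>A single \<open>k f\<close> after a multiplication is exchanged for copies of
    \<open>k f\<close> before it, and these are absorbed by functoriality of
    \<open>k\<close>.\<close>
  have kf: "cmp P (k f) [cmp P (u (Dom C f) (length gs)) (map k gs)] =
      cmp P (u (Cod C f) (length gs)) (map (\<lambda>g. k (Cmp C f g)) gs)"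
    if f: "f \<in> Ar C" and gs: "(gs, Dom C f) \<in> arr C\<^sub>\<triangleright>" for f gs
  proof -
    have u1: "composable P (k f) [u (Dom C f) (length gs)]"
      using f k u C.Dom_Ob by (simp add: composable_def)
    have u2: "composable P (u (Cod C f) (length gs)) (replicate (length gs) (k f))"
      using f k u C.Cod_Ob by (auto simp: composable_def)
    have "cmp P (k f) [cmp P (u (Dom C f) (length gs)) (map k gs)] =
        cmp P (cmp P (u (Cod C f) (length gs)) (replicate (length gs) (k f))) (map k gs)"
      using P.cmp_assoc1[OF u1 comp[OF gs]] nat[OF f] by simp
    also have "\<dots> = cmp P (u (Cod C f) (length gs))
        (map2 (\<lambda>g h. cmp P g [h]) (replicate (length gs) (k f)) (map k gs))"
      using f gs k by (intro P.cmp_assoc_unary[OF u2]) (auto simp: list_all2_conv_all_nth composable_def)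
    also have "map2 (\<lambda>g h. cmp P g [h]) (replicate (length gs) (k f)) (map k gs) =
        map (\<lambda>g. k (Cmp C f g)) gs"
      using f gs k_cmp by (auto intro!: nth_equalityI)
    finally show ?thesis .
  qed
  have val: "sar K (fs, X) = cmp P (u X (length fs)) (map k fs)" if "(fs, X) \<in> arr C\<^sub>\<triangleright>" for fs X
    using that by (simp add: K_def)
  show "K \<in> sMlt C\<^sub>\<triangleright> P"
  proof (rule sMltI)
    fix a assume a: "a \<in> arr C\<^sub>\<triangleright>"
    obtain fs X where fs: "a = (fs, X)" by fastforce
    note c = comp[OF a[unfolded fs]]
    show "sar K a \<in> arr P" using P.cmp_arr[OF c] val a by (simp add: fs)
    show "tgt P (sar K a) = sob K (tgt C\<^sub>\<triangleright> a)"
      using P.tgt_cmp[OF c] val a u by (simp add: fs K_def)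
    have m: "map (src P) (map k fs) = map (\<lambda>f. [\<phi> (Dom C f)]) fs" using a k by (auto simp: fs)
    have "concat (map (src P) (map k fs)) = map (\<lambda>f. \<phi> (Dom C f)) fs" unfolding m by simp
    then show "src P (sar K a) = map (sob K) (src C\<^sub>\<triangleright> a)"
      using P.src_cmp[OF c] val a C.Dom_Ob unfolding fs by (simp add: K_def)
    fix \<sigma> assume "\<sigma> permutes {..<length (src C\<^sub>\<triangleright> a)}"
    then have \<sigma>: "\<sigma> permutes {..<length fs}" by (simp add: fs)
    have X: "X \<in> Ob C" using a by (simp add: fs)
    have "map (length \<circ> src P) (map k fs) = replicate (length fs) 1"
      using a k by (auto simp: fs intro!: nth_equalityI)
    \<comment> \<open>The arrows \<open>k f\<close> are unary, so the blocks have length one and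
      permuting blocks is permuting entries.\<close>
    moreover have "block_perm \<sigma> (replicate (length fs) 1) = \<sigma>"
    proof -
      have b: "blocks i (replicate n 1) = map (\<lambda>j. [j]) [i..<i + n]" for i n
        by (induction n arbitrary: i) (auto simp: upt_rec)
      have "concat (permute_list \<sigma> (blocks 0 (replicate (length fs) 1))) = map \<sigma> [0..<length fs]"
      proof -
        have "permute_list \<sigma> [0..<length fs] = map \<sigma> [0..<length fs]"
          using permutes_in_image[OF \<sigma>] by (simp add: permute_list_def)
        then show ?thesis
          using permute_list_map[of \<sigma> "[0..<length fs]" "\<lambda>j. [j]"] \<sigma> unfolding b by (simp add: comp_def)
      qed
      then show ?thesis
        unfolding block_perm_def perm_of_list_def using \<sigma> by (auto simp: permutes_not_in)
    qed
    ultimately have "cmp P (act P \<sigma> (u X (length fs))) (permute_list \<sigma> (map k fs)) =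
        act P \<sigma> (cmp P (u X (length fs)) (map k fs))"
      using P.act_cmp_outer[OF c, of \<sigma>] \<sigma> by simp
    then show "sar K (act C\<^sub>\<triangleright> \<sigma> a) = act P \<sigma> (sar K a)"
      using u_act[OF X \<sigma>] val a \<sigma> by (simp add: fs permute_list_map)
  next
    fix X assume X: "X \<in> obj C\<^sub>\<triangleright>"
    then show "sar K (idn C\<^sub>\<triangleright> X) = idn P (sob K X)"
      using val[of "[Idn C X]" X] C.Idn_Ar C.Cod_Idn u_1 k_id P.idn_cmp[of "idn P (\<phi> X)"] ob
        P.idn_arr P.tgt_idn by (simp add: K_def)
  next
    fix a gs assume c: "composable C\<^sub>\<triangleright> a gs"
    obtain fs X where fs: "a = (fs, X)" by fastforce
    have fg: "list_all2 (\<lambda>f g. f \<in> Ar C \<and> g \<in> arr C\<^sub>\<triangleright> \<and> snd g = Dom C f) fs gs"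
      and ar: "(fs, X) \<in> arr C\<^sub>\<triangleright>"
      using c unfolding fs composable_seq_smc by auto
    note len = list_all2_lengthD[OF fg]
    have X: "X \<in> Ob C" using ar by simp
    have cd: "\<forall>f\<in>set fs. Cod C f = X" using ar by simp
    let ?us = "map (\<lambda>g. u X (length (fst g))) gs"
    let ?kss = "map2 (\<lambda>f g. map (\<lambda>h. k (Cmp C f h)) (fst g)) fs gs"
    have k1: "list_all2 (\<lambda>g h. composable P g [h]) (map k fs) (map (sar K) gs)"
    proof (unfold list_all2_conv_all_nth, intro conjI allI impI)
      fix i assume i: "i < length (map k fs)"
      then have g: "fs ! i \<in> Ar C" "(fst (gs ! i), Dom C (fs ! i)) \<in> arr C\<^sub>\<triangleright>"
        using list_all2_nthD[OF fg, of i] by (cases "gs ! i", auto)+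
      have "gs ! i = (fst (gs ! i), Dom C (fs ! i))"
        using list_all2_nthD[OF fg, of i] i by (cases "gs ! i", auto)
      then show "composable P (map k fs ! i) [map (sar K) gs ! i]"
        using i len g P.cmp_arr[OF comp[OF g(2)]] P.tgt_cmp[OF comp[OF g(2)]] val[OF g(2)] k
          u C.Dom_Ob by (simp add: composable_def)
    qed (use len in simp)
    \<comment> \<open>By \<open>kf\<close> every inner composite becomes a multiplication on the
      common target \<open>X\<close>, so that \<open>u_cmp\<close> can merge it with the outer
      one.\<close>
    have pair_arr: "map2 (\<lambda>g h. cmp P g [h]) (map k fs) (map (sar K) gs) = map2 (cmp P) ?us ?kss"
    proof (rule nth_equalityI)
      fix i assume "i < length (map2 (\<lambda>g h. cmp P g [h]) (map k fs) (map (sar K) gs))"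
      then have i: "i < length fs" "i < length gs" using len by auto
      then have g: "fs ! i \<in> Ar C" "(fst (gs ! i), Dom C (fs ! i)) \<in> arr C\<^sub>\<triangleright>"
        "gs ! i = (fst (gs ! i), Dom C (fs ! i))" "Cod C (fs ! i) = X"
        using list_all2_nthD[OF fg, of i] cd by (cases "gs ! i", auto)+
      then have "sar K (gs ! i) = cmp P (u (Dom C (fs ! i)) (length (fst (gs ! i)))) (map k (fst (gs ! i)))"
        using val by metis
      then show "map2 (\<lambda>g h. cmp P g [h]) (map k fs) (map (sar K) gs) ! i = map2 (cmp P) ?us ?kss ! i"
        using i g kf[OF g(1,2)] by simp
    qed (use len in simp)
    have cu: "composable P (u X (length fs)) ?us"
      using u X len by (auto simp: composable_def intro!: nth_equalityI)
    have ck: "list_all2 (composable P) ?us ?kss"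
    proof (unfold list_all2_conv_all_nth, intro conjI allI impI)
      fix i assume i: "i < length ?us"
      then have i': "i < length fs" "i < length gs" using len by auto
      then have g: "fs ! i \<in> Ar C" "\<forall>h\<in>set (fst (gs ! i)). h \<in> Ar C \<and> Cod C h = Dom C (fs ! i)"
        "Cod C (fs ! i) = X"
        using list_all2_nthD[OF fg, of i] cd by (cases "gs ! i", auto)+
      have "(map (Cmp C (fs ! i)) (fst (gs ! i)), X) \<in> arr C\<^sub>\<triangleright>"
        using g X by (auto simp: C.Cmp_Ar C.Cod_Cmp)
      from comp[OF this] show "composable P (?us ! i) (?kss ! i)"
        using i' by (simp add: comp_def)
    qed (use len in simp)
    have "sar K (cmp C\<^sub>\<triangleright> a gs) = cmp P (u X (sum_list (map (length \<circ> fst) gs))) (concat ?kss)"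
    proof -
      have "length (concat (map2 (\<lambda>f g. map (Cmp C f) (fst g)) fs gs)) = sum_list (map (length \<circ> fst) gs)"
        using fg by (induction rule: list_all2_induct) auto
      moreover have "map k (concat (map2 (\<lambda>f g. map (Cmp C f) (fst g)) fs gs)) = concat ?kss"
        by (simp add: map_concat split_def comp_def)
      moreover have "cmp C\<^sub>\<triangleright> a gs \<in> arr C\<^sub>\<triangleright>"
        using sym_multicategory.cmp_arr[OF C.sym_multicategory_seq c] .
      ultimately show ?thesis using val unfolding fs seq_smc_simps by metis
    qed
    also have "u X (sum_list (map (length \<circ> fst) gs)) = cmp P (u X (length fs)) ?us"
      using u_cmp[OF X, of "map (length \<circ> fst) gs"] len by (simp add: comp_def)
    also have "cmp P (cmp P (u X (length fs)) ?us) (concat ?kss) =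
        cmp P (u X (length fs)) (map2 (\<lambda>g h. cmp P g [h]) (map k fs) (map (sar K) gs))"
      unfolding pair_arr by (rule P.cmp_assoc[OF cu ck])
    also have "\<dots> = cmp P (sar K a) (map (sar K) gs)"
      using P.cmp_assoc_unary[OF comp[OF ar] k1] val[OF ar] by (simp add: fs)
    finally show "sar K (cmp C\<^sub>\<triangleright> a gs) = cmp P (sar K a) (map (sar K) gs)" .
  qed (use C P ob in \<open>auto simp: K_def C.sym_multicategory_seq\<close>)
  show "sar K (unary C f) = k f" if f: "f \<in> Ar C"
    using val[of "[f]" "Cod C f"] f C.Cod_Ob u_1 P.idn_cmp[of "k f"] k by (simp add: unary_def)
qed


section \<open>The comparison functor from the tensor product to the product category\<close>

lemma category_prod [simp]:
  assumes "category C" "category D"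
  shows "category (C \<times>\<^sub>c D)"
proof -
  interpret C: category C by fact
  interpret D: category D by fact
  show ?thesis
    by (rule category.intro)
      (auto simp: prod_cat_def C.Dom_Ob C.Cod_Ob C.Idn_Ar C.Dom_Idn C.Cod_Idn C.Cmp_Ar C.Dom_Cmp
        C.Cod_Cmp C.Idn_Cmp C.Cmp_Idn C.Cmp_assoc D.Dom_Ob D.Cod_Ob D.Idn_Ar D.Dom_Idn D.Cod_Idn
        D.Cmp_Ar D.Dom_Cmp D.Cod_Cmp D.Idn_Cmp D.Cmp_Idn D.Cmp_assoc)
qed

lemma prod_cat_simps [simp]:
  "Ob (C \<times>\<^sub>c D) = Ob C \<times> Ob D" "Ar (C \<times>\<^sub>c D) = Ar C \<times> Ar D"
  "Dom (C \<times>\<^sub>c D) (f, h) = (Dom C f, Dom D h)" "Cod (C \<times>\<^sub>c D) (f, h) = (Cod C f, Cod D h)"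
  "Idn (C \<times>\<^sub>c D) (A, X) = (Idn C A, Idn D X)"
  "Cmp (C \<times>\<^sub>c D) (f, h) (g, k) = (Cmp C f g, Cmp D h k)"
  by (simp_all add: prod_cat_def)

locale cat_pair =
  fixes C :: "('o, 'a) cat" and D :: "('p, 'b) cat"
  assumes C: "category C" and D: "category D"
begin

sublocale C: category C by (rule C)
sublocale D: category D by (rule D)
sublocale CD: category "C \<times>\<^sub>c D" by (rule category_prod[OF C D])
sublocale smc_pair "C\<^sub>\<triangleright>" "D\<^sub>\<triangleright>"
  by (rule smc_pair.intro[OF C.sym_multicategory_seq D.sym_multicategory_seq])

definition partL :: "'p \<Rightarrow> ('o, 'a, 'o \<times> 'p, 'a \<times> 'b) cfun" where
  "partL X = \<lparr>cdom = C, ccod = C \<times>\<^sub>c D, cob = \<lambda>A\<in>Ob C. (A, X), car = \<lambda>f\<in>Ar C. (f, Idn D X)\<rparr>"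

definition partR :: "'o \<Rightarrow> ('p, 'b, 'o \<times> 'p, 'a \<times> 'b) cfun" where
  "partR A = \<lparr>cdom = D, ccod = C \<times>\<^sub>c D, cob = \<lambda>X\<in>Ob D. (A, X), car = \<lambda>h\<in>Ar D. (Idn C A, h)\<rparr>"

lemma Idn_Idn: "Cmp C (Idn C A) (Idn C A) = Idn C A" if "A \<in> Ob C"
  using C.Idn_Cmp[OF C.Idn_Ar[OF that]] C.Cod_Idn[OF that] by simp

lemma Idn_IdnD: "Cmp D (Idn D A) (Idn D A) = Idn D A" if "A \<in> Ob D"
  using D.Idn_Cmp[OF D.Idn_Ar[OF that]] D.Cod_Idn[OF that] by simp

lemma partL: "X \<in> Ob D \<Longrightarrow> partL X \<in> Cat C (C \<times>\<^sub>c D)"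
  using CD.category_axioms C
  by (intro CatI) (auto simp: partL_def D.Idn_Ar C.Dom_Ob C.Cod_Ob C.Idn_Ar C.Cmp_Ar D.Dom_Idn D.Cod_Idn
      Idn_IdnD)

lemma partR: "A \<in> Ob C \<Longrightarrow> partR A \<in> Cat D (C \<times>\<^sub>c D)"
  using CD.category_axioms D
  by (intro CatI) (auto simp: partR_def C.Idn_Ar D.Dom_Ob D.Cod_Ob D.Idn_Ar D.Cmp_Ar C.Dom_Idn C.Cod_Idn
      Idn_Idn)

abbreviation "\<Phi> \<equiv> seq_prod C D"

lemma seq_prod:
  "\<Phi> \<in> sMlt (C\<^sub>\<triangleright> \<otimes> D\<^sub>\<triangleright>) (C \<times>\<^sub>c D)\<^sub>\<triangleright>"
  "A \<in> Ob C \<Longrightarrow> X \<in> Ob D \<Longrightarrow> sob \<Phi> (A, X) = (A, X)"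
  "a \<in> arr C\<^sub>\<triangleright> \<Longrightarrow> X \<in> Ob D \<Longrightarrow>
     sar \<Phi> (genL C\<^sub>\<triangleright> D\<^sub>\<triangleright> a X) = (map (\<lambda>f. (f, Idn D X)) (fst a), snd a, X)"
  "A \<in> Ob C \<Longrightarrow> b \<in> arr D\<^sub>\<triangleright> \<Longrightarrow>
     sar \<Phi> (genR C\<^sub>\<triangleright> D\<^sub>\<triangleright> A b) = (map (\<lambda>h. (Idn C A, h)) (fst b), A, snd b)"
proof -
  let ?l = "\<lambda>(fs, A) X. (map (\<lambda>f. (f, Idn D X)) fs, A, X)"
  let ?r = "\<lambda>A (hs, X). (map (\<lambda>h. (Idn C A, h)) hs, A, X)"
  have L: "(partL X)\<^sup>\<triangleright> \<in> sMlt C\<^sub>\<triangleright> (C \<times>\<^sub>c D)\<^sub>\<triangleright>" if "X \<in> obj D\<^sub>\<triangleright>" for X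
    using that partL by auto
  have R: "(partR A)\<^sup>\<triangleright> \<in> sMlt D\<^sub>\<triangleright> (C \<times>\<^sub>c D)\<^sub>\<triangleright>" if "A \<in> obj C\<^sub>\<triangleright>" for A
    using that partR by auto
  have Lv: "sar (partL X)\<^sup>\<triangleright> a = ?l a X" if "a \<in> arr C\<^sub>\<triangleright>" "X \<in> obj D\<^sub>\<triangleright>" for a X
    using that by (cases a) (simp add: partL_def)
  have Rv: "sar (partR A)\<^sup>\<triangleright> b = ?r A b" if "A \<in> obj C\<^sub>\<triangleright>" "b \<in> arr D\<^sub>\<triangleright>" for A b
    using that by (cases b) (simp add: partR_def)
  \<comment> \<open>In each composite one coordinate is always an identity, so both consist of all
    pairs \<open>(f, h)\<close>; they differ only in the order in which the table of pairs is
    listed.\<close>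
  have I: "cmp (C \<times>\<^sub>c D)\<^sub>\<triangleright> (?l a (tgt D\<^sub>\<triangleright> b)) (map (\<lambda>A. ?r A b) (src C\<^sub>\<triangleright> a)) =
      act (C \<times>\<^sub>c D)\<^sub>\<triangleright> (transp_perm (length (src C\<^sub>\<triangleright> a)) (length (src D\<^sub>\<triangleright> b)))
        (cmp (C \<times>\<^sub>c D)\<^sub>\<triangleright> (?r (tgt C\<^sub>\<triangleright> a) b) (map (\<lambda>X. ?l a X) (src D\<^sub>\<triangleright> b)))"
    if a: "a \<in> arr C\<^sub>\<triangleright>" and b: "b \<in> arr D\<^sub>\<triangleright>" for a b
  proof -
    obtain fs A where fs: "a = (fs, A)" by fastforce
    obtain hs X where hs: "b = (hs, X)" by fastforce
    have idf: "Cmp C f (Idn C (Dom C f)) = f" "Cmp C (Idn C A) f = f" if "f \<in> set fs" for f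
      using a that C.Cmp_Idn[of f] C.Idn_Cmp[of f] by (auto simp: fs)
    have idh: "Cmp D h (Idn D (Dom D h)) = h" "Cmp D (Idn D X) h = h" if "h \<in> set hs" for h
      using b that D.Cmp_Idn[of h] D.Idn_Cmp[of h] by (auto simp: hs)
    have 1: "map2 (\<lambda>p g. map (Cmp (C \<times>\<^sub>c D) p) (fst g)) (map (\<lambda>f. (f, Idn D X)) fs)
        (map (\<lambda>A. (map (\<lambda>h. (Idn C A, h)) hs, A, X)) (map (Dom C) fs)) =
      map (\<lambda>f. map (\<lambda>h. (f, h)) hs) fs"
      using idf idh by (auto intro!: nth_equalityI)
    have 2: "map2 (\<lambda>p g. map (Cmp (C \<times>\<^sub>c D) p) (fst g)) (map (\<lambda>h. (Idn C A, h)) hs)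
        (map (\<lambda>X. (map (\<lambda>f. (f, Idn D X)) fs, A, X)) (map (Dom D) hs)) =
      map (\<lambda>h. map (\<lambda>f. (f, h)) fs) hs"
      using idf idh by (auto intro!: nth_equalityI)
    show ?thesis
      unfolding fs hs seq_smc_simps split length_map 1 2
      using permute_transp_perm[of fs hs Pair] by simp
  qed
  have ob: "sob (partL X)\<^sup>\<triangleright> A = (case (A, X) of (A, X) \<Rightarrow> (A, X))"
    "sob (partR A)\<^sup>\<triangleright> X = (case (A, X) of (A, X) \<Rightarrow> (A, X))"
    if "A \<in> obj C\<^sub>\<triangleright>" "X \<in> obj D\<^sub>\<triangleright>" for A X
    using that by (simp_all add: partL_def partR_def)
  note lift' = tensor_lift_sMlt[where \<phi> = "\<lambda>(A, X). (A, X)",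
      OF L ob(1) Lv R ob(2) Rv I CD.sym_multicategory_seq, folded seq_prod_def]
  show "\<Phi> \<in> sMlt (C\<^sub>\<triangleright> \<otimes> D\<^sub>\<triangleright>) (C \<times>\<^sub>c D)\<^sub>\<triangleright>" by (rule lift'(1))
  show "A \<in> Ob C \<Longrightarrow> X \<in> Ob D \<Longrightarrow> sob \<Phi> (A, X) = (A, X)" using lift'(2)[of A X] by simp
  show "a \<in> arr C\<^sub>\<triangleright> \<Longrightarrow> X \<in> Ob D \<Longrightarrow>
     sar \<Phi> (genL C\<^sub>\<triangleright> D\<^sub>\<triangleright> a X) = (map (\<lambda>f. (f, Idn D X)) (fst a), snd a, X)"
    using lift'(3)[of a X] by (simp add: split_def)
  show "A \<in> Ob C \<Longrightarrow> b \<in> arr D\<^sub>\<triangleright> \<Longrightarrow>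
     sar \<Phi> (genR C\<^sub>\<triangleright> D\<^sub>\<triangleright> A b) = (map (\<lambda>h. (Idn C A, h)) (fst b), A, snd b)"
    using lift'(4)[of A b] by (simp add: split_def)
qed

section \<open>Two monoid structures on each object of the tensor product\<close>

abbreviation "CT \<equiv> C\<^sub>\<triangleright> \<otimes> D\<^sub>\<triangleright>"
abbreviation "gL \<equiv> genL C\<^sub>\<triangleright> D\<^sub>\<triangleright>"
abbreviation "gR \<equiv> genR C\<^sub>\<triangleright> D\<^sub>\<triangleright>"

lemma gL_cmp: "composable C\<^sub>\<triangleright> a bs \<Longrightarrow> X \<in> Ob D \<Longrightarrow>
    gL (cmp C\<^sub>\<triangleright> a bs) X = cmp CT (gL a X) (map (\<lambda>b. gL b X) bs)"
  and gL_comp: "composable C\<^sub>\<triangleright> a bs \<Longrightarrow> X \<in> Ob D \<Longrightarrow> composable CT (gL a X) (map (\<lambda>b. gL b X) bs)"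
proof -
  assume c: "composable C\<^sub>\<triangleright> a bs" and X: "X \<in> Ob D"
  have m: "map (sar (inclL C\<^sub>\<triangleright> D\<^sub>\<triangleright> X)) bs = map (\<lambda>b. gL b X) bs"
    using composableD[OF c] by auto
  show "gL (cmp C\<^sub>\<triangleright> a bs) X = cmp CT (gL a X) (map (\<lambda>b. gL b X) bs)"
    using sMltD(12)[OF inclL_sMlt c, of X] X composableD(1)[OF c] M.cmp_arr[OF c] unfolding m by simp
  show "composable CT (gL a X) (map (\<lambda>b. gL b X) bs)"
    using composable_sMlt[OF inclL_sMlt c, of X] X composableD(1)[OF c] unfolding m by simp
qed

lemma gR_cmp: "composable D\<^sub>\<triangleright> a bs \<Longrightarrow> A \<in> Ob C \<Longrightarrow>
    gR A (cmp D\<^sub>\<triangleright> a bs) = cmp CT (gR A a) (map (gR A) bs)"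
  and gR_comp: "composable D\<^sub>\<triangleright> a bs \<Longrightarrow> A \<in> Ob C \<Longrightarrow> composable CT (gR A a) (map (gR A) bs)"
proof -
  assume c: "composable D\<^sub>\<triangleright> a bs" and A: "A \<in> Ob C"
  have m: "map (sar (inclR C\<^sub>\<triangleright> D\<^sub>\<triangleright> A)) bs = map (gR A) bs"
    using composableD[OF c] by auto
  show "gR A (cmp D\<^sub>\<triangleright> a bs) = cmp CT (gR A a) (map (gR A) bs)"
    using sMltD(12)[OF inclR_sMlt c, of A] A composableD(1)[OF c] N.cmp_arr[OF c] unfolding m by simp
  show "composable CT (gR A a) (map (gR A) bs)"
    using composable_sMlt[OF inclR_sMlt c, of A] A composableD(1)[OF c] unfolding m by simp
qed

lemma gL_idn: "A \<in> Ob C \<Longrightarrow> X \<in> Ob D \<Longrightarrow> gL (idn C\<^sub>\<triangleright> A) X = idn CT (A, X)"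
  using sMltD(11)[OF inclL_sMlt, of X A] M.idn_arr[of A] by simp

lemma gR_idn: "A \<in> Ob C \<Longrightarrow> X \<in> Ob D \<Longrightarrow> gR A (idn D\<^sub>\<triangleright> X) = idn CT (A, X)"
  using sMltD(11)[OF inclR_sMlt, of A X] N.idn_arr[of X] by simp

abbreviation "uL A X n \<equiv> gL (seqU C A n) X"
abbreviation "uR A X n \<equiv> gR A (seqU D X n)"

text \<open>The inclusions of the two factors carry the multiplications \<open>seqU\<close> to the
  object \<open>(A, X)\<close>, which thus has one monoid structure from \<open>C\<close> and one
  from \<open>D\<close>.\<close>

lemma u_basic:
  assumes "A \<in> Ob C" "X \<in> Ob D"
  shows "uL A X n \<in> arr CT" "src CT (uL A X n) = replicate n (A, X)" "tgt CT (uL A X n) = (A, X)"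
    "uL A X (Suc 0) = idn CT (A, X)" "\<sigma> permutes {..<n} \<Longrightarrow> act CT \<sigma> (uL A X n) = uL A X n"
    "cmp CT (uL A X (length ns)) (map (uL A X) ns) = uL A X (sum_list ns)"
    "uR A X n \<in> arr CT" "src CT (uR A X n) = replicate n (A, X)" "tgt CT (uR A X n) = (A, X)"
    "uR A X (Suc 0) = idn CT (A, X)"
    "cmp CT (uR A X (length ns)) (map (uR A X) ns) = uR A X (sum_list ns)"
proof -
  note U = C.seqU[OF assms(1)] D.seqU[OF assms(2)]
  show "uL A X n \<in> arr CT" "src CT (uL A X n) = replicate n (A, X)" "tgt CT (uL A X n) = (A, X)"
    "uL A X (Suc 0) = idn CT (A, X)"
    "uR A X n \<in> arr CT" "src CT (uR A X n) = replicate n (A, X)" "tgt CT (uR A X n) = (A, X)"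
    "uR A X (Suc 0) = idn CT (A, X)"
    using U(1-4,8-11) assms gL_idn gR_idn by simp_all
  show "\<sigma> permutes {..<n} \<Longrightarrow> act CT \<sigma> (uL A X n) = uL A X n"
    using sMltD(13)[OF inclL_sMlt, of X "seqU C A n" \<sigma>] U(1,2,5) assms by simp
  show "cmp CT (uL A X (length ns)) (map (uL A X) ns) = uL A X (sum_list ns)"
    using gL_cmp[OF U(6) assms(2)] U(7) by (simp add: comp_def)
  show "cmp CT (uR A X (length ns)) (map (uR A X) ns) = uR A X (sum_list ns)"
    using gR_cmp[OF U(13) assms(1)] U(14) by (simp add: comp_def)
qed

text \<open>
  The Eckmann-Hilton argument: both sides of the interchange law for the two binary arrows are
  composed with identities on the diagonal and with nullary arrows elsewhere.
\<close>

lemma uL_eq_uR: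
  assumes "A \<in> Ob C" "X \<in> Ob D"
  shows "uL A X n = uR A X n"
proof -
  note u = u_basic[OF assms]
  have CU: "seqU C A k \<in> arr C\<^sub>\<triangleright>" "src C\<^sub>\<triangleright> (seqU C A k) = replicate k A" "tgt C\<^sub>\<triangleright> (seqU C A k) = A" for k
    using C.seqU[OF assms(1)] by auto
  have DU: "seqU D X k \<in> arr D\<^sub>\<triangleright>" "src D\<^sub>\<triangleright> (seqU D X k) = replicate k X" "tgt D\<^sub>\<triangleright> (seqU D X k) = X" for k
    using D.seqU[OF assms(2)] by auto
  \<comment> \<open>Only \<open>k = 0\<close> and \<open>k = 2\<close> are used below.\<close>
  have inter: "cmp CT (uL A X k) (replicate k (uR A X k)) =
      act CT (transp_perm k k) (cmp CT (uR A X k) (replicate k (uL A X k)))" for k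
    using tensor_interchange[OF CU(1) DU(1), of k k] by (simp add: CU DU)
  \<comment> \<open>The empty case of Eckmann-Hilton: with no inputs on either side the interchange
    law equates the two nullary arrows.\<close>
  have u0: "uL A X 0 = uR A X 0"
  proof -
    have "transp_perm 0 0 = id" using transp_perm_permutes[of 0 0] by simp
    then show ?thesis
      using inter[of 0] T.cmp_idn[of "uL A X 0"] T.cmp_idn[of "uR A X 0"] u T.act_id by simp
  qed
  let ?i = "idn CT (A, X)" and ?z = "uL A X 0"
  have i: "?i \<in> arr CT" "src CT ?i = [(A, X)]" "tgt CT ?i = (A, X)"
    using assms T.idn_arr T.src_idn T.tgt_idn by auto
  have two: "replicate (Suc (Suc 0)) y = [y, y]" for y :: 'z by simp
  have U2: "cmp CT (uL A X 2) [?i, ?i] = uL A X 2" "cmp CT (uR A X 2) [?i, ?i] = uR A X 2"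
    using T.cmp_idn[of "uL A X 2"] T.cmp_idn[of "uR A X 2"] u by (simp_all add: numeral_2_eq_2)
  have L2: "cmp CT (uL A X 2) [?i, ?z] = ?i" "cmp CT (uL A X 2) [?z, ?i] = ?i"
    using u(6)[of "[Suc 0, 0]"] u(6)[of "[0, Suc 0]"] u(4) by (simp_all add: numeral_2_eq_2)
  have R2: "cmp CT (uR A X 2) [?i, ?z] = ?i" "cmp CT (uR A X 2) [?z, ?i] = ?i"
    using u(11)[of "[Suc 0, 0]"] u(11)[of "[0, Suc 0]"] u(10) by (simp_all add: numeral_2_eq_2 u0)
  have comp2: "composable CT (uL A X 2) [uR A X 2, uR A X 2]" "composable CT (uR A X 2) [uL A X 2, uL A X 2]"
    using u by (auto simp: composable_def numeral_2_eq_2)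
  have hss: "list_all2 (composable CT) [uR A X 2, uR A X 2] [[?i, ?z], [?z, ?i]]"
    "list_all2 (composable CT) [uL A X 2, uL A X 2] [[?i, ?z], [?z, ?i]]"
    using u i by (auto simp: composable_def numeral_2_eq_2)
  \<comment> \<open>The transposition of a 2 by 2 grid exchanges the two off-diagonal places. Both
    hold the same nullary arrow \<open>?z\<close>, so the list \<open>?gs\<close> is
    unchanged.\<close>
  let ?\<tau> = "transp_perm 2 2" and ?gs = "[?i, ?z, ?z, ?i]"
  let ?Y = "cmp CT (uR A X 2) [uL A X 2, uL A X 2]"
  have Y: "?Y \<in> arr CT" "src CT ?Y = replicate 4 (A, X)"
    using T.cmp_arr[OF comp2(2)] T.src_cmp[OF comp2(2)] u by (simp_all add: numeral_eq_Suc)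
  have cY: "composable CT ?Y ?gs" using Y i u by (auto simp: composable_def numeral_eq_Suc)
  have \<tau>: "?\<tau> permutes {..<length ?gs}" using transp_perm_permutes[of 2 2] by (simp add: numeral_eq_Suc)
  \<comment> \<open>Stated for arbitrary entries because it is applied to \<open>?gs\<close> and
    also to the list of its index blocks.\<close>
  have \<tau>_gs: "permute_list ?\<tau> [a, b, b, c] = [a, b, b, c]" for a b c :: 'z
    by (simp add: transp_perm_def perm_of_list_def permute_list_def upt_rec numeral_2_eq_2)
  \<comment> \<open>The two blocks that change places are empty, so no input moves and the
    permutation drops out of the interchange law.\<close>
  have "block_perm ?\<tau> [Suc 0, 0, 0, Suc 0] = id"
    unfolding block_perm_def blocks.simps
    by (simp add: \<tau>_gs upt_rec) (auto simp: perm_of_list_def less_Suc_eq)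
  moreover have "map (length \<circ> src CT) ?gs = [Suc 0, 0, 0, Suc 0]"
    using i u by simp
  ultimately have act_gs: "cmp CT (act CT ?\<tau> ?Y) ?gs = cmp CT ?Y ?gs"
    using T.act_cmp_outer[OF cY \<tau>] T.act_id[OF T.cmp_arr[OF cY]] unfolding \<tau>_gs by simp
  have "uL A X 2 = cmp CT (cmp CT (uL A X 2) [uR A X 2, uR A X 2]) ?gs"
    using T.cmp_assoc[OF comp2(1) hss(1)] R2 U2 by simp
  also have "\<dots> = cmp CT ?Y ?gs"
    using inter[of 2] act_gs by (simp add: numeral_2_eq_2)
  also have "\<dots> = uR A X 2"
    using T.cmp_assoc[OF comp2(2) hss(2)] L2 U2 by simp
  finally have u2: "uL A X (Suc (Suc 0)) = uR A X (Suc (Suc 0))" by (simp add: numeral_2_eq_2)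
  show ?thesis
  proof (induction n)
    \<comment> \<open>A multiplication of n + 1 factors is the binary one composed with an identity
      and an n-fold one, for either structure.\<close>
    case (Suc n)
    then show ?case
      using u(6)[of "[Suc 0, n]"] u(11)[of "[Suc 0, n]"] u2 u(4,10) by simp
  qed (rule u0)
qed

section \<open>The inverse of the comparison functor\<close>

definition pair_arr :: "'a \<times> 'b \<Rightarrow> ('o \<times> 'p, ('o, 'a list \<times> 'o, 'p, 'b list \<times> 'p) tgen) mterm set" where
  "pair_arr = (\<lambda>(f, h). cmp CT (gL (unary C f) (Cod D h)) [gR (Dom C f) (unary D h)])"

text \<open>This is the functor built in \<open>seq_functorI\<close> for the category
  \<open>C \<times>\<^sub>c D\<close>, with \<open>pair_arr\<close> as its values on unary arrows
  and \<open>uL\<close> as the multiplications.\<close>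

definition seq_prod_inv where
  "seq_prod_inv = \<lparr>sdom = (C \<times>\<^sub>c D)\<^sub>\<triangleright>, scod = CT, sob = restrict id (Ob (C \<times>\<^sub>c D)),
      sar = \<lambda>a\<in>arr (C \<times>\<^sub>c D)\<^sub>\<triangleright>. cmp CT (uL (fst (snd a)) (snd (snd a)) (length (fst a))) (map pair_arr (fst a))\<rparr>"

lemma composable_pair_arr: "f \<in> Ar C \<Longrightarrow> h \<in> Ar D \<Longrightarrow>
    composable CT (gL (unary C f) (Cod D h)) [gR (Dom C f) (unary D h)]"
  using C.unary[of f] D.unary[of h] C.Dom_Ob[of f] D.Cod_Ob[of h] by (simp add: composable_def)

text \<open>The 1 by 1 instance of interchange, where the transposition is trivial. It shows that
  the order of the two factors in \<open>pair_arr\<close> does not matter.\<close>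

lemma interchange1:
  assumes "f \<in> Ar C" "h \<in> Ar D"
  shows "cmp CT (gL (unary C f) (Cod D h)) [gR (Dom C f) (unary D h)] =
    cmp CT (gR (Cod C f) (unary D h)) [gL (unary C f) (Dom D h)]"
proof -
  note f = C.unary[OF assms(1)] and h = D.unary[OF assms(2)]
  have c: "composable CT (gR (Cod C f) (unary D h)) [gL (unary C f) (Dom D h)]"
    using f h C.Cod_Ob[OF assms(1)] D.Dom_Ob[OF assms(2)] by (simp add: composable_def)
  have "transp_perm (Suc 0) (Suc 0) = id"
    using transp_perm_permutes[of "Suc 0" "Suc 0"] by (simp add: lessThan_Suc)
  then show ?thesis
    using tensor_interchange[OF f(1) h(1)] f h T.act_id[OF T.cmp_arr[OF c]] by simp
qed

lemma pair_arr:
  assumes "f \<in> Ar C" "h \<in> Ar D"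
  shows "pair_arr (f, h) \<in> arr CT" "src CT (pair_arr (f, h)) = [(Dom C f, Dom D h)]"
    "tgt CT (pair_arr (f, h)) = (Cod C f, Cod D h)"
  using T.cmp_arr[OF composable_pair_arr[OF assms]] T.src_cmp[OF composable_pair_arr[OF assms]] T.tgt_cmp[OF composable_pair_arr[OF assms]]
    C.unary[OF assms(1)] D.unary[OF assms(2)] C.Dom_Ob[of f] D.Cod_Ob[of h] assms by (simp_all add: pair_arr_def)

text \<open>After both coordinates are expanded, the order from the outside is \<open>f\<close>,
  \<open>f'\<close>, \<open>h\<close>, \<open>h'\<close>; exchanging the two middle factors by
  \<open>interchange1\<close> regroups them into the two pairs.\<close>

lemma pair_arr_cmp:
  assumes f: "f \<in> Ar C" "f' \<in> Ar C" "Cod C f' = Dom C f" and h: "h \<in> Ar D" "h' \<in> Ar D" "Cod D h' = Dom D h"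
  shows "pair_arr (Cmp C f f', Cmp D h h') = cmp CT (pair_arr (f, h)) [pair_arr (f', h')]"
proof -
  note uf = C.unary[OF f(1)] C.unary[OF f(2)] and uh = D.unary[OF h(1)] D.unary[OF h(2)]
  note ob = C.Dom_Ob[OF f(1)] C.Dom_Ob[OF f(2)] C.Cod_Ob[OF f(1)] C.Cod_Ob[OF f(2)]
    D.Dom_Ob[OF h(1)] D.Dom_Ob[OF h(2)] D.Cod_Ob[OF h(1)] D.Cod_Ob[OF h(2)]
  let ?X = "Cod D h" and ?A = "Dom C f'"
  let ?l = "gL (unary C f) ?X" and ?l' = "gL (unary C f') ?X" and ?r = "gR ?A (unary D h)" and ?r' = "gR ?A (unary D h')"
  have 1: "composable CT ?l [?l']" "composable CT ?r [?r']" "composable CT ?l' [?r]"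
    using uf uh ob f h by (simp_all add: composable_def)
  have rr: "composable CT ?l' [cmp CT ?r [?r']]"
    using 1 T.cmp_arr[OF 1(2)] T.tgt_cmp[OF 1(2)] by (simp add: composable_def)
  have "pair_arr (Cmp C f f', Cmp D h h') = cmp CT (cmp CT ?l [?l']) [cmp CT ?r [?r']]"
    using C.unary_Cmp[OF f] D.unary_Cmp[OF h] gL_cmp[OF C.unary_Cmp(1)[OF f], of ?X] gR_cmp[OF D.unary_Cmp(1)[OF h], of ?A]
      ob by (simp add: pair_arr_def f h C.Dom_Cmp D.Cod_Cmp)
  also have "\<dots> = cmp CT ?l [cmp CT (cmp CT ?l' [?r]) [?r']]"
    using T.cmp_assoc1[OF 1(1) rr] T.cmp_assoc1[OF 1(3,2)] by simp
  also have "cmp CT ?l' [?r] = cmp CT (gR (Dom C f) (unary D h)) [gL (unary C f') (Dom D h)]"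
    using interchange1[OF f(2) h(1)] f by simp
  also have "cmp CT (cmp CT (gR (Dom C f) (unary D h)) [gL (unary C f') (Dom D h)]) [?r'] =
      cmp CT (gR (Dom C f) (unary D h)) [pair_arr (f', h')]"
    using T.cmp_assoc1[of "gR (Dom C f) (unary D h)" "gL (unary C f') (Dom D h)" "[?r']"] uf uh ob f h
    by (simp add: composable_def pair_arr_def)
  also have "cmp CT ?l [cmp CT (gR (Dom C f) (unary D h)) [pair_arr (f', h')]] = cmp CT (pair_arr (f, h)) [pair_arr (f', h')]"
  proof -
    have "composable CT (gR (Dom C f) (unary D h)) [pair_arr (f', h')]"
      using pair_arr[OF f(2) h(2)] uh ob f h by (simp add: composable_def)
    from T.cmp_assoc1[OF composable_pair_arr[OF f(1) h(1)] this] show ?thesis by (simp add: pair_arr_def)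
  qed
  finally show ?thesis .
qed

text \<open>The arrow \<open>h\<close> is a homomorphism for the multiplications coming from
  \<open>D\<close>, and \<open>f\<close> for those coming from \<open>C\<close>. The composite is a
  homomorphism for one structure only because \<open>uL_eq_uR\<close> identifies the two.\<close>

lemma pair_arr_nat:
  assumes f: "f \<in> Ar C" and h: "h \<in> Ar D"
  shows "cmp CT (pair_arr (f, h)) [uL (Dom C f) (Dom D h) n] =
    cmp CT (uL (Cod C f) (Cod D h) n) (replicate n (pair_arr (f, h)))"
proof -
  let ?A = "Dom C f" and ?B = "Cod C f" and ?X = "Dom D h" and ?Y = "Cod D h"
  note ob = C.Dom_Ob[OF f] C.Cod_Ob[OF f] D.Dom_Ob[OF h] D.Cod_Ob[OF h]
  note cf = C.unary(4-6)[OF f, of n] and ch = D.unary(4-6)[OF h, of n]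
  let ?l = "gL (unary C f) ?Y" and ?r = "gR ?A (unary D h)"
  note c = composable_pair_arr[OF f h]
  have c2: "composable CT ?r [uR ?A ?X n]" "composable CT (uR ?A ?Y n) (replicate n ?r)"
    using gR_comp[OF ch(1) ob(1)] gR_comp[OF ch(2) ob(1)] by simp_all
  have c3: "composable CT ?l [uL ?A ?Y n]" "composable CT (uL ?B ?Y n) (replicate n ?l)"
    using gL_comp[OF cf(1) ob(4)] gL_comp[OF cf(2) ob(4)] by simp_all
  have "cmp CT (pair_arr (f, h)) [uL ?A ?X n] = cmp CT ?l [cmp CT ?r [uR ?A ?X n]]"
    using T.cmp_assoc1[OF c c2(1)] uL_eq_uR[OF ob(1,3)] by (simp add: pair_arr_def)
  also have "cmp CT ?r [uR ?A ?X n] = cmp CT (uL ?A ?Y n) (replicate n ?r)"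
    using gR_cmp[OF ch(1) ob(1)] gR_cmp[OF ch(2) ob(1)] ch(3) uL_eq_uR[OF ob(1,4)] by simp
  also have "cmp CT ?l [cmp CT (uL ?A ?Y n) (replicate n ?r)] =
      cmp CT (cmp CT ?l [uL ?A ?Y n]) (replicate n ?r)"
    using T.cmp_assoc1[OF c3(1), of "replicate n ?r"] c2(2) uL_eq_uR[OF ob(1,4)] by simp
  also have "cmp CT ?l [uL ?A ?Y n] = cmp CT (uL ?B ?Y n) (replicate n ?l)"
    using gL_cmp[OF cf(1) ob(4)] gL_cmp[OF cf(2) ob(4)] cf(3) by simp
  also have "cmp CT (cmp CT (uL ?B ?Y n) (replicate n ?l)) (replicate n ?r) =
      cmp CT (uL ?B ?Y n) (map2 (\<lambda>g h. cmp CT g [h]) (replicate n ?l) (replicate n ?r))"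
    using c by (intro T.cmp_assoc_unary[OF c3(2)]) (simp add: list_all2_conv_all_nth)
  also have "map2 (\<lambda>g h. cmp CT g [h]) (replicate n ?l) (replicate n ?r) = replicate n (pair_arr (f, h))"
    by (simp add: pair_arr_def map_replicate zip_replicate)
  finally show ?thesis .
qed

lemma seq_prod_inv:
  "seq_prod_inv \<in> sMlt (C \<times>\<^sub>c D)\<^sub>\<triangleright> CT"
  "p \<in> Ar (C \<times>\<^sub>c D) \<Longrightarrow> sar seq_prod_inv (unary (C \<times>\<^sub>c D) p) = pair_arr p"
proof -
  have k_id: "pair_arr (Idn (C \<times>\<^sub>c D) Z) = idn CT (id Z)" if "Z \<in> Ob (C \<times>\<^sub>c D)" for Z
  proof -
    obtain A X where Z: "Z = (A, X)" "A \<in> Ob C" "X \<in> Ob D" using \<open>Z \<in> Ob (C \<times>\<^sub>c D)\<close> by auto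
    have "cmp CT (idn CT (A, X)) [idn CT (A, X)] = idn CT (A, X)"
      using T.idn_cmp[of "idn CT (A, X)"] Z T.idn_arr T.tgt_idn by simp
    then show ?thesis
      using Z gL_idn[of A X] gR_idn[of A X]
      by (simp add: pair_arr_def C.unary_Idn D.unary_Idn C.Dom_Idn D.Cod_Idn del: seq_smc_simps)
  qed
  have kp: "pair_arr p \<in> arr CT" "src CT (pair_arr p) = [id (Dom (C \<times>\<^sub>c D) p)]" "tgt CT (pair_arr p) = id (Cod (C \<times>\<^sub>c D) p)"
    if "p \<in> Ar (C \<times>\<^sub>c D)" for p
    using that pair_arr by auto
  have kc: "pair_arr (Cmp (C \<times>\<^sub>c D) p q) = cmp CT (pair_arr p) [pair_arr q]"
    if "p \<in> Ar (C \<times>\<^sub>c D)" "q \<in> Ar (C \<times>\<^sub>c D)" "Cod (C \<times>\<^sub>c D) q = Dom (C \<times>\<^sub>c D) p" for p q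
    using that pair_arr_cmp by auto
  have kn: "cmp CT (pair_arr p) [(\<lambda>Z. uL (fst Z) (snd Z)) (Dom (C \<times>\<^sub>c D) p) n] =
      cmp CT ((\<lambda>Z. uL (fst Z) (snd Z)) (Cod (C \<times>\<^sub>c D) p) n) (replicate n (pair_arr p))"
    if "p \<in> Ar (C \<times>\<^sub>c D)" for p n
    using that pair_arr_nat by auto
  note F = seq_functorI[OF CD.category_axioms T, of id pair_arr "\<lambda>Z. uL (fst Z) (snd Z)", OF _ kp k_id kc _ _ _ _ _ _ kn]
  show "seq_prod_inv \<in> sMlt (C \<times>\<^sub>c D)\<^sub>\<triangleright> CT"
    unfolding seq_prod_inv_def by (rule F(1)) (auto simp: u_basic)
  show "p \<in> Ar (C \<times>\<^sub>c D) \<Longrightarrow> sar seq_prod_inv (unary (C \<times>\<^sub>c D) p) = pair_arr p"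
    unfolding seq_prod_inv_def by (rule F(2)) (auto simp: u_basic)
qed

lemma pair_arr_Idn:
  "f \<in> Ar C \<Longrightarrow> X \<in> Ob D \<Longrightarrow> pair_arr (f, Idn D X) = gL (unary C f) X"
  "A \<in> Ob C \<Longrightarrow> h \<in> Ar D \<Longrightarrow> pair_arr (Idn C A, h) = gR A (unary D h)"
proof -
  assume a: "f \<in> Ar C" "X \<in> Ob D"
  then show "pair_arr (f, Idn D X) = gL (unary C f) X"
    using T.cmp_idn[of "gL (unary C f) X"] C.unary[OF a(1)] gR_idn[of "Dom C f" X] C.Dom_Ob
    by (simp add: pair_arr_def D.unary_Idn D.Cod_Idn del: seq_smc_simps(4))
next
  assume a: "A \<in> Ob C" "h \<in> Ar D"
  then show "pair_arr (Idn C A, h) = gR A (unary D h)"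
    using T.idn_cmp[of "gR A (unary D h)"] D.unary[OF a(2)] gL_idn[of A "Cod D h"] D.Cod_Ob
    by (simp add: pair_arr_def C.unary_Idn C.Dom_Idn del: seq_smc_simps(4))
qed

text \<open>Functors between \<open>(C \<times>\<^sub>c D)\<^sub>\<triangleright>\<close> and itself
  are compared on unary arrows, functors out of the tensor product on generators. A generator is
  recovered from its decomposition into a multiplication and unary arrows.\<close>

lemma seq_prod_sisos: "\<Phi> \<in> sisos CT (C \<times>\<^sub>c D)\<^sub>\<triangleright>"
proof (rule sisosI[OF seq_prod(1) seq_prod_inv(1)])
  have sd: "sdom \<Phi> = CT" "sdom seq_prod_inv = (C \<times>\<^sub>c D)\<^sub>\<triangleright>"
    using sMltD(1)[OF seq_prod(1)] by (simp_all add: seq_prod_inv_def)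
  have obi: "sob seq_prod_inv (A, X) = (A, X)" if "A \<in> Ob C" "X \<in> Ob D" for A X
    using that by (simp add: seq_prod_inv_def)
  show "\<Phi> \<circ>\<^sub>s seq_prod_inv = sid (C \<times>\<^sub>c D)\<^sub>\<triangleright>"
  proof (rule seq_ext[OF scomp_sMlt[OF seq_prod(1) seq_prod_inv(1)] sid_sMlt[OF CD.sym_multicategory_seq]
        CD.category_axioms CD.category_axioms])
    fix Z assume "Z \<in> Ob (C \<times>\<^sub>c D)"
    then show "sob (\<Phi> \<circ>\<^sub>s seq_prod_inv) Z = sob (sid (C \<times>\<^sub>c D)\<^sub>\<triangleright>) Z"
      using seq_prod(2) obi sd by auto
  next
    fix p assume p: "p \<in> Ar (C \<times>\<^sub>c D)"
    obtain f h where fh: "p = (f, h)" "f \<in> Ar C" "h \<in> Ar D" using p by auto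
    have "sar \<Phi> (pair_arr p) = ([p], Cod (C \<times>\<^sub>c D) p)"
      using sMltD(12)[OF seq_prod(1) composable_pair_arr[OF fh(2,3)]] seq_prod(3,4) C.unary[OF fh(2)] D.unary[OF fh(3)]
        C.Dom_Ob D.Cod_Ob fh by (simp add: pair_arr_def unary_def C.Cmp_Idn D.Idn_Cmp)
    then show "sar (\<Phi> \<circ>\<^sub>s seq_prod_inv) ([p], Cod (C \<times>\<^sub>c D) p) =
        sar (sid (C \<times>\<^sub>c D)\<^sub>\<triangleright>) ([p], Cod (C \<times>\<^sub>c D) p)"
      using seq_prod_inv(2)[OF p] sd CD.unary(1)[OF p] by (simp add: unary_def[of "C \<times>\<^sub>c D"] del: seq_smc_arr)
  qed
  show "seq_prod_inv \<circ>\<^sub>s \<Phi> = sid CT"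
  proof (rule tensor_ext[OF scomp_sMlt[OF seq_prod_inv(1) seq_prod(1)] sid_sMlt[OF T]])
    fix A X assume "A \<in> obj C\<^sub>\<triangleright>" "X \<in> obj D\<^sub>\<triangleright>"
    then show "sob (seq_prod_inv \<circ>\<^sub>s \<Phi>) (A, X) = sob (sid CT) (A, X)"
      using seq_prod(2) obi sd by simp
  next
    fix a X assume a: "a \<in> arr C\<^sub>\<triangleright>" and X: "X \<in> obj D\<^sub>\<triangleright>"
    obtain fs A where fs: "a = (fs, A)" by fastforce
    have ar: "(map (\<lambda>f. (f, Idn D X)) fs, A, X) \<in> arr (C \<times>\<^sub>c D)\<^sub>\<triangleright>"
      using a X by (auto simp: fs D.Idn_Ar D.Cod_Idn)
    have m: "map pair_arr (map (\<lambda>f. (f, Idn D X)) fs) = map (\<lambda>b. gL b X) (map (unary C) fs)"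
      using a X pair_arr_Idn(1) by (simp add: fs)
    have "sar seq_prod_inv (map (\<lambda>f. (f, Idn D X)) fs, A, X) = gL a X"
      using ar gL_cmp[OF C.seq_arr_decompose(1)[OF a[unfolded fs]], of X]
        C.seq_arr_decompose(2)[OF a[unfolded fs]] X m
      by (simp add: seq_prod_inv_def fs del: map_map seq_smc_arr)
    then show "sar (seq_prod_inv \<circ>\<^sub>s \<Phi>) (gL a X) = sar (sid CT) (gL a X)"
      using a X seq_prod(3) sd by (simp add: fs)
  next
    fix A b assume A: "A \<in> obj C\<^sub>\<triangleright>" and b: "b \<in> arr D\<^sub>\<triangleright>"
    obtain hs X where hs: "b = (hs, X)" by fastforce
    have ar: "(map (\<lambda>h. (Idn C A, h)) hs, A, X) \<in> arr (C \<times>\<^sub>c D)\<^sub>\<triangleright>"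
      using A b by (auto simp: hs C.Idn_Ar C.Cod_Idn)
    have m: "map pair_arr (map (\<lambda>h. (Idn C A, h)) hs) = map (gR A) (map (unary D) hs)"
      using A b pair_arr_Idn(2) by (simp add: hs)
    \<comment> \<open>The inverse multiplies with \<open>uL\<close>, whereas a generator coming from
      \<open>D\<close> decomposes with \<open>uR\<close>; here too the Eckmann-Hilton identity is
      required.\<close>
    have "uL A X (length hs) = uR A X (length hs)"
      using A b uL_eq_uR by (simp add: hs)
    then have "sar seq_prod_inv (map (\<lambda>h. (Idn C A, h)) hs, A, X) = gR A b"
      using ar gR_cmp[OF D.seq_arr_decompose(1)[OF b[unfolded hs]], of A]
        D.seq_arr_decompose(2)[OF b[unfolded hs]] A m
      by (simp add: seq_prod_inv_def hs del: map_map seq_smc_arr)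
    then show "sar (seq_prod_inv \<circ>\<^sub>s \<Phi>) (gR A b) = sar (sid CT) (gR A b)"
      using A b seq_prod(4) sd by (simp add: hs)
  qed
qed

end

section \<open>Functoriality of the tensor product\<close>

lemma tensor_map:
  assumes F: "F \<in> sMlt M M'" and G: "G \<in> sMlt N N'"
  shows "F \<otimes>\<^sub>f G \<in> sMlt (M \<otimes> N) (M' \<otimes> N')"
    "A \<in> obj M \<Longrightarrow> X \<in> obj N \<Longrightarrow> sob (F \<otimes>\<^sub>f G) (A, X) = (sob F A, sob G X)"
    "f \<in> arr M \<Longrightarrow> X \<in> obj N \<Longrightarrow> sar (F \<otimes>\<^sub>f G) (genL M N f X) = genL M' N' (sar F f) (sob G X)"
    "A \<in> obj M \<Longrightarrow> h \<in> arr N \<Longrightarrow> sar (F \<otimes>\<^sub>f G) (genR M N A h) = genR M' N' (sob F A) (sar G h)"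
proof -
  note FD = sMltD[OF F] and GD = sMltD[OF G]
  interpret T: smc_pair M N using FD(3) GD(3) by (simp add: smc_pair_def)
  interpret T': smc_pair M' N' using FD(4) GD(4) by (simp add: smc_pair_def)
  have L: "inclL M' N' (sob G X) \<circ>\<^sub>s F \<in> sMlt M (M' \<otimes> N')" if "X \<in> obj N" for X
    using that GD by (intro scomp_sMlt[OF _ F] T'.inclL_sMlt) simp
  have R: "inclR M' N' (sob F A) \<circ>\<^sub>s G \<in> sMlt N (M' \<otimes> N')" if "A \<in> obj M" for A
    using that FD by (intro scomp_sMlt[OF _ G] T'.inclR_sMlt) simp
  have I: "cmp (M' \<otimes> N') (genL M' N' (sar F f) (sob G (tgt N h)))
        (map (\<lambda>A. genR M' N' (sob F A) (sar G h)) (src M f)) =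
      act (M' \<otimes> N') (transp_perm (length (src M f)) (length (src N h)))
        (cmp (M' \<otimes> N') (genR M' N' (sob F (tgt M f)) (sar G h))
          (map (\<lambda>X. genL M' N' (sar F f) (sob G X)) (src N h)))"
    if "f \<in> arr M" "h \<in> arr N" for f h
    using T'.tensor_interchange[of "sar F f" "sar G h"] that FD GD by (simp add: comp_def)
  note lift = T.tensor_lift_sMlt[where \<phi> = "map_prod (sob F) (sob G)"
      and l = "\<lambda>f X. genL M' N' (sar F f) (sob G X)" and r = "\<lambda>A h. genR M' N' (sob F A) (sar G h)",
      OF L _ _ R _ _ I T'.T]
  have e: "F \<otimes>\<^sub>f G = tensor_lift M N (M' \<otimes> N') (map_prod (sob F) (sob G))
     (\<lambda>f X. genL M' N' (sar F f) (sob G X)) (\<lambda>A h. genR M' N' (sob F A) (sar G h))"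
    using FD GD by (simp add: tensor_map_def)
  show "F \<otimes>\<^sub>f G \<in> sMlt (M \<otimes> N) (M' \<otimes> N')"
    unfolding e by (rule lift(1)) (use FD GD in auto)
  show "A \<in> obj M \<Longrightarrow> X \<in> obj N \<Longrightarrow> sob (F \<otimes>\<^sub>f G) (A, X) = (sob F A, sob G X)"
    unfolding e by (simp add: tensor_lift_def)
  show "f \<in> arr M \<Longrightarrow> X \<in> obj N \<Longrightarrow> sar (F \<otimes>\<^sub>f G) (genL M N f X) = genL M' N' (sar F f) (sob G X)"
    unfolding e by (rule lift(3)) (use FD GD in auto)
  show "A \<in> obj M \<Longrightarrow> h \<in> arr N \<Longrightarrow> sar (F \<otimes>\<^sub>f G) (genR M N A h) = genR M' N' (sob F A) (sar G h)"
    unfolding e by (rule lift(4)) (use FD GD in auto)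
qed

lemma tensor_map_sid:
  assumes "sym_multicategory M" "sym_multicategory N"
  shows "sid M \<otimes>\<^sub>f sid N = sid (M \<otimes> N)"
proof -
  interpret smc_pair M N using assms by (simp add: smc_pair_def)
  note t = tensor_map[OF sid_sMlt[OF M] sid_sMlt[OF N]]
  show ?thesis by (rule tensor_ext[OF t(1) sid_sMlt[OF T]]) (use t(2-4) in auto)
qed

lemma tensor_map_scomp:
  assumes F: "F \<in> sMlt M M'" and G: "G \<in> sMlt N N'" and F': "F' \<in> sMlt M' M''" and G': "G' \<in> sMlt N' N''"
  shows "(F' \<circ>\<^sub>s F) \<otimes>\<^sub>f (G' \<circ>\<^sub>s G) = (F' \<otimes>\<^sub>f G') \<circ>\<^sub>s (F \<otimes>\<^sub>f G)"
proof -
  note D = sMltD[OF F] sMltD[OF G] sMltD[OF F'] sMltD[OF G']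
  interpret smc_pair M N using D by (simp add: smc_pair_def)
  note t = tensor_map[OF scomp_sMlt[OF F' F] scomp_sMlt[OF G' G]]
  note t1 = tensor_map[OF F G] and t2 = tensor_map[OF F' G']
  show ?thesis
    by (rule tensor_ext[OF t(1) scomp_sMlt[OF t2(1) t1(1)]])
      (use t(2-4) t1(2-4) t2(2-4) sMltD(1)[OF t1(1)] D in auto)
qed

lemma tensor_map_sisos:
  assumes J: "J \<in> sisos M M'" and K: "K \<in> sisos N N'"
  shows "J \<otimes>\<^sub>f K \<in> sisos (M \<otimes> N) (M' \<otimes> N')"
proof (rule sisosI)
  note JD = sisosD[OF J] and KD = sisosD[OF K]
  show "J \<otimes>\<^sub>f K \<in> sMlt (M \<otimes> N) (M' \<otimes> N')" "sinv J \<otimes>\<^sub>f sinv K \<in> sMlt (M' \<otimes> N') (M \<otimes> N)"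
    using JD KD tensor_map(1) by blast+
  show "(sinv J \<otimes>\<^sub>f sinv K) \<circ>\<^sub>s (J \<otimes>\<^sub>f K) = sid (M \<otimes> N)"
    using tensor_map_scomp[OF JD(1) KD(1) JD(3) KD(3)] JD KD tensor_map_sid sMltD(3)
    by metis
  show "(J \<otimes>\<^sub>f K) \<circ>\<^sub>s (sinv J \<otimes>\<^sub>f sinv K) = sid (M' \<otimes> N')"
    using tensor_map_scomp[OF JD(3) KD(3) JD(1) KD(1)] JD KD tensor_map_sid sMltD(4)
    by metis
qed

text \<open>Reduces a tensor product of sequential multicategories to a product category once
  isomorphisms \<open>J\<close> and \<open>K\<close> are chosen. For \<open>J\<close> and
  \<open>K\<close> induced by functors of categories it is one side of the naturality square of
  \<open>seq_prod\<close>.\<close>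

definition seq_iso where
  "seq_iso C D J K = seq_prod C D \<circ>\<^sub>s (J \<otimes>\<^sub>f K)"

lemma seq_iso:
  assumes C: "category C" and D: "category D" and J: "J \<in> sMlt M C\<^sub>\<triangleright>" and K: "K \<in> sMlt N D\<^sub>\<triangleright>"
  shows "seq_iso C D J K \<in> sMlt (M \<otimes> N) (C \<times>\<^sub>c D)\<^sub>\<triangleright>"
    "A \<in> obj M \<Longrightarrow> X \<in> obj N \<Longrightarrow> sob (seq_iso C D J K) (A, X) = (sob J A, sob K X)"
    "f \<in> arr M \<Longrightarrow> X \<in> obj N \<Longrightarrow> sar (seq_iso C D J K) (genL M N f X) =
       (map (\<lambda>f. (f, Idn D (sob K X))) (fst (sar J f)), sob J (tgt M f), sob K X)"
    "A \<in> obj M \<Longrightarrow> h \<in> arr N \<Longrightarrow> sar (seq_iso C D J K) (genR M N A h) =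
       (map (\<lambda>h. (Idn C (sob J A), h)) (fst (sar K h)), sob J A, sob K (tgt N h))"
proof -
  interpret cat_pair C D using C D by (simp add: cat_pair_def)
  note t = tensor_map[OF J K]
  note JD = sMltD[OF J] and KD = sMltD[OF K]
  interpret MN: smc_pair M N using JD KD by (simp add: smc_pair_def)
  have sd: "sdom (J \<otimes>\<^sub>f K) = M \<otimes> N" using sMltD(1)[OF t(1)] .
  show "seq_iso C D J K \<in> sMlt (M \<otimes> N) (C \<times>\<^sub>c D)\<^sub>\<triangleright>"
    unfolding seq_iso_def by (rule scomp_sMlt[OF seq_prod(1) t(1)])
  show "A \<in> obj M \<Longrightarrow> X \<in> obj N \<Longrightarrow> sob (seq_iso C D J K) (A, X) = (sob J A, sob K X)"
    using JD(7)[of A] KD(7)[of X] t(2) seq_prod(2) by (simp add: seq_iso_def sd)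
  show "f \<in> arr M \<Longrightarrow> X \<in> obj N \<Longrightarrow> sar (seq_iso C D J K) (genL M N f X) =
       (map (\<lambda>f. (f, Idn D (sob K X))) (fst (sar J f)), sob J (tgt M f), sob K X)"
    using JD(8)[of f] JD(10)[of f] KD(7)[of X] t(3) seq_prod(3) tgt_seq_smc[of C "sar J f"]
    by (simp add: seq_iso_def sd)
  show "A \<in> obj M \<Longrightarrow> h \<in> arr N \<Longrightarrow> sar (seq_iso C D J K) (genR M N A h) =
       (map (\<lambda>h. (Idn C (sob J A), h)) (fst (sar K h)), sob J A, sob K (tgt N h))"
    using JD(7)[of A] KD(8)[of h] KD(10)[of h] t(4) seq_prod(4) tgt_seq_smc[of D "sar K h"]
    by (simp add: seq_iso_def sd)
qed

lemma seq_iso_sisos: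
  assumes "category C" "category D" "J \<in> sisos M C\<^sub>\<triangleright>" "K \<in> sisos N D\<^sub>\<triangleright>"
  shows "seq_iso C D J K \<in> sisos (M \<otimes> N) (C \<times>\<^sub>c D)\<^sub>\<triangleright>"
  using scomp_sisos[OF cat_pair.seq_prod_sisos tensor_map_sisos[OF assms(3,4)], of] assms(1,2)
  unfolding seq_iso_def by (simp add: cat_pair_def)

lemma sequential_tensor:
  assumes "sequential M" "sequential N"
  shows "sequential (M \<otimes> N)"
  using assms by (metis sequentialE sequentialI seq_iso_sisos category_prod)


subsection \<open>The associator and the unitors\<close>

lemma cassoc:
  assumes "category C" "category D" "category E"
  shows "cassoc C D E \<in> Cat ((C \<times>\<^sub>c D) \<times>\<^sub>c E) (C \<times>\<^sub>c (D \<times>\<^sub>c E))"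
    "(cassoc C D E)\<^sup>\<triangleright> \<in> sisos ((C \<times>\<^sub>c D) \<times>\<^sub>c E)\<^sub>\<triangleright> (C \<times>\<^sub>c (D \<times>\<^sub>c E))\<^sub>\<triangleright>"
proof -
  interpret C: category C by fact
  interpret D: category D by fact
  interpret E: category E by fact
  note cats = category_prod[OF category_prod[OF assms(1,2)] assms(3)]
    category_prod[OF assms(1) category_prod[OF assms(2,3)]]
  note ax = C.Dom_Ob C.Cod_Ob D.Dom_Ob D.Cod_Ob E.Dom_Ob E.Cod_Ob C.Idn_Ar D.Idn_Ar E.Idn_Ar
    C.Cmp_Ar D.Cmp_Ar E.Cmp_Ar
  define B where "B = \<lparr>cdom = C \<times>\<^sub>c (D \<times>\<^sub>c E), ccod = (C \<times>\<^sub>c D) \<times>\<^sub>c E,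
     cob = restrict (\<lambda>(A, X, Y). ((A, X), Y)) (Ob (C \<times>\<^sub>c (D \<times>\<^sub>c E))),
     car = restrict (\<lambda>(f, h, k). ((f, h), k)) (Ar (C \<times>\<^sub>c (D \<times>\<^sub>c E)))\<rparr>"
  show A: "cassoc C D E \<in> Cat ((C \<times>\<^sub>c D) \<times>\<^sub>c E) (C \<times>\<^sub>c (D \<times>\<^sub>c E))"
    by (rule CatI) (use cats ax in \<open>auto simp: cassoc_def\<close>)
  have B: "B \<in> Cat (C \<times>\<^sub>c (D \<times>\<^sub>c E)) ((C \<times>\<^sub>c D) \<times>\<^sub>c E)"
    by (rule CatI) (use cats ax in \<open>auto simp: B_def\<close>)
  have "B \<circ>\<^sub>c cassoc C D E = cid ((C \<times>\<^sub>c D) \<times>\<^sub>c E)"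
    by (rule cfun_eqI[OF ccomp_Cat[OF B A] cid_Cat[OF cats(1)]]) (auto simp: B_def cassoc_def)
  moreover have "cassoc C D E \<circ>\<^sub>c B = cid (C \<times>\<^sub>c (D \<times>\<^sub>c E))"
    by (rule cfun_eqI[OF ccomp_Cat[OF A B] cid_Cat[OF cats(2)]]) (auto simp: B_def cassoc_def)
  ultimately show "(cassoc C D E)\<^sup>\<triangleright> \<in> sisos ((C \<times>\<^sub>c D) \<times>\<^sub>c E)\<^sub>\<triangleright> (C \<times>\<^sub>c (D \<times>\<^sub>c E))\<^sub>\<triangleright>"
    using A B cats by (metis sisosI seq_fun_sMlt seq_fun_ccomp seq_fun_cid)
qed

text \<open>
  The associator is computed by comparing it with the associator of \<open>Cat\<close>; this makes it
  unnecessary to verify the interchange law for it.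
\<close>

lemma assoc_aux:
  assumes cat: "category C" "category D" "category E"
    and J: "J \<in> sisos M C\<^sub>\<triangleright>" and K: "K \<in> sisos N D\<^sub>\<triangleright>" and L: "L \<in> sisos P E\<^sub>\<triangleright>"
  shows "assoc M N P = sinv (seq_iso C (D \<times>\<^sub>c E) J (seq_iso D E K L)) \<circ>\<^sub>s
      ((cassoc C D E)\<^sup>\<triangleright> \<circ>\<^sub>s seq_iso (C \<times>\<^sub>c D) E (seq_iso C D J K) L)" (is "_ = ?T")
    and "assoc M N P \<in> sisos ((M \<otimes> N) \<otimes> P) (M \<otimes> (N \<otimes> P))"
    and "A \<in> obj M \<Longrightarrow> X \<in> obj N \<Longrightarrow> Y \<in> obj P \<Longrightarrow> sob (assoc M N P) ((A, X), Y) = (A, X, Y)"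
    and "f \<in> arr M \<Longrightarrow> X \<in> obj N \<Longrightarrow> Y \<in> obj P \<Longrightarrow>
      sar (assoc M N P) (genL (M \<otimes> N) P (genL M N f X) Y) = genL M (N \<otimes> P) f (X, Y)"
    and "A \<in> obj M \<Longrightarrow> h \<in> arr N \<Longrightarrow> Y \<in> obj P \<Longrightarrow>
      sar (assoc M N P) (genL (M \<otimes> N) P (genR M N A h) Y) = genR M (N \<otimes> P) A (genL N P h Y)"
    and "A \<in> obj M \<Longrightarrow> X \<in> obj N \<Longrightarrow> k \<in> arr P \<Longrightarrow>
      sar (assoc M N P) (genR (M \<otimes> N) P (A, X) k) = genR M (N \<otimes> P) A (genR N P X k)"
proof -
  interpret C: category C by fact
  interpret D: category D by fact
  interpret E: category E by fact
  note CD = category_prod[OF cat(1,2)] and DE = category_prod[OF cat(2,3)]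
  note JD = sMltD[OF sisosD(1)[OF J]] and KD = sMltD[OF sisosD(1)[OF K]] and LD = sMltD[OF sisosD(1)[OF L]]
  interpret MN: smc_pair M N using JD KD by (simp add: smc_pair_def)
  interpret NP: smc_pair N P using KD LD by (simp add: smc_pair_def)
  interpret MN_P: smc_pair "M \<otimes> N" P using MN.T LD by (simp add: smc_pair_def)
  interpret M_NP: smc_pair M "N \<otimes> P" using NP.T JD by (simp add: smc_pair_def)
  let ?S1 = "seq_iso C D J K" and ?S2 = "seq_iso D E K L"
  let ?S3 = "seq_iso (C \<times>\<^sub>c D) E ?S1 L" and ?S4 = "seq_iso C (D \<times>\<^sub>c E) J ?S2"
  note i1 = seq_iso_sisos[OF cat(1,2) J K] and i2 = seq_iso_sisos[OF cat(2,3) K L]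
  note i3 = seq_iso_sisos[OF CD cat(3) i1 L] and i4 = seq_iso_sisos[OF cat(1) DE J i2]
  note v1 = seq_iso[OF cat(1,2) sisosD(1)[OF J] sisosD(1)[OF K]]
    and v2 = seq_iso[OF cat(2,3) sisosD(1)[OF K] sisosD(1)[OF L]]
    and v3 = seq_iso[OF CD cat(3) sisosD(1)[OF i1] sisosD(1)[OF L]]
    and v4 = seq_iso[OF cat(1) DE sisosD(1)[OF J] sisosD(1)[OF i2]]
  have sd: "sdom ?S3 = (M \<otimes> N) \<otimes> P" using sMltD(1)[OF v3(1)] .
  have T: "?T \<in> sisos ((M \<otimes> N) \<otimes> P) (M \<otimes> (N \<otimes> P))"
    using scomp_sisos[OF sisosD(2)[OF i4] scomp_sisos[OF cassoc(2)[OF cat] i3]] .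
  note Ts = sisosD(1)[OF T]
  note ob = MN.M.tgt_obj MN.N.tgt_obj NP.N.tgt_obj JD(7) KD(7) LD(7)
  have Cc: "(fs, Z) \<in> arr ((C \<times>\<^sub>c D) \<times>\<^sub>c E)\<^sub>\<triangleright> \<Longrightarrow> sar (cassoc C D E)\<^sup>\<triangleright> (fs, Z) =
      (map (\<lambda>((f, h), k). (f, h, k)) fs, (\<lambda>((A, X), Y). (A, X, Y)) Z)" for fs Z
    by (auto simp: seq_fun_def cassoc_def)
  have To: "sob ?T ((A, X), Y) = (A, X, Y)" if "A \<in> obj M" "X \<in> obj N" "Y \<in> obj P" for A X Y
  proof -
    have "sob (cassoc C D E)\<^sup>\<triangleright> (sob ?S3 ((A, X), Y)) = sob ?S4 (A, X, Y)"
      using that v1(2) v2(2) v3(2) v4(2) ob by (simp add: cassoc_def)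
    then show ?thesis
      using sisos_inverse(1)[OF i4, of "(A, X, Y)"] that by (simp add: sd)
  qed
  \<comment> \<open>Applying the isomorphism \<open>?S4\<close> moves the comparison of arrows into
    the image of a triple product of categories, where it is a comparison of lists.\<close>
  have Tv: "sar ?T a = b" if "a \<in> arr ((M \<otimes> N) \<otimes> P)" "b \<in> arr (M \<otimes> (N \<otimes> P))"
    "sar (cassoc C D E)\<^sup>\<triangleright> (sar ?S3 a) = sar ?S4 b" for a b
    using sisos_inverse(2)[OF i4 that(2)] that by (simp add: sd)
  have S3a: "sar ?S3 a \<in> arr ((C \<times>\<^sub>c D) \<times>\<^sub>c E)\<^sub>\<triangleright>" if "a \<in> arr ((M \<otimes> N) \<otimes> P)" for a
    using sMltD(8)[OF v3(1) that] .
  have TLL: "sar ?T (genL (M \<otimes> N) P (genL M N f X) Y) = genL M (N \<otimes> P) f (X, Y)"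
    if "f \<in> arr M" "X \<in> obj N" "Y \<in> obj P" for f X Y
    using that S3a[of "genL (M \<otimes> N) P (genL M N f X) Y"] v1(2,3) v2(2) v3(3) v4(3) ob
    by (intro Tv) (auto simp: Cc)
  have TLR: "sar ?T (genL (M \<otimes> N) P (genR M N A h) Y) = genR M (N \<otimes> P) A (genL N P h Y)"
    if "A \<in> obj M" "h \<in> arr N" "Y \<in> obj P" for A h Y
    using that S3a[of "genL (M \<otimes> N) P (genR M N A h) Y"] v1(2,4) v2(2,3) v3(3) v4(4) ob
    by (intro Tv) (auto simp: Cc)
  have TR: "sar ?T (genR (M \<otimes> N) P (A, X) k) = genR M (N \<otimes> P) A (genR N P X k)"
    if "A \<in> obj M" "X \<in> obj N" "k \<in> arr P" for A X k
    using that S3a[of "genR (M \<otimes> N) P (A, X) k"] v1(2) v2(2,4) v3(4) v4(4) ob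
    by (intro Tv) (auto simp: Cc)
  \<comment> \<open>The inner \<open>tensor_lift\<close> in the definition of \<open>assoc\<close>
    is the restriction of \<open>?T\<close> to a fixed object \<open>Y\<close>; its interchange law
    comes with that of \<open>?T\<close>.\<close>
  have inner: "tensor_lift M N (M \<otimes> (N \<otimes> P)) (\<lambda>(A, X). (A, X, Y))
      (\<lambda>f X. genL M (N \<otimes> P) f (X, Y)) (\<lambda>A h. genR M (N \<otimes> P) A (genL N P h Y)) =
      ?T \<circ>\<^sub>s inclL (M \<otimes> N) P Y" if Y: "Y \<in> obj P" for Y
    by (rule MN.tensor_lift_eq[OF scomp_sMlt[OF Ts MN_P.inclL_sMlt[OF Y]]])
      (use Y To TLL TLR in auto)
  have "tensor_lift (M \<otimes> N) P (M \<otimes> (N \<otimes> P)) (\<lambda>((A, X), Y). (A, X, Y))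
     (\<lambda>c Y. sar (tensor_lift M N (M \<otimes> (N \<otimes> P)) (\<lambda>(A, X). (A, X, Y))
        (\<lambda>f X. genL M (N \<otimes> P) f (X, Y)) (\<lambda>A h. genR M (N \<otimes> P) A (genL N P h Y))) c)
     (\<lambda>(A, X) k. genR M (N \<otimes> P) A (genR N P X k)) = ?T"
    by (rule MN_P.tensor_lift_eq[OF Ts]) (use To TR inner in auto)
  then show e: "assoc M N P = ?T" unfolding assoc_def .
  show "assoc M N P \<in> sisos ((M \<otimes> N) \<otimes> P) (M \<otimes> (N \<otimes> P))" unfolding e by (rule T)
  show "A \<in> obj M \<Longrightarrow> X \<in> obj N \<Longrightarrow> Y \<in> obj P \<Longrightarrow> sob (assoc M N P) ((A, X), Y) = (A, X, Y)"
    unfolding e by (rule To)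
  show "f \<in> arr M \<Longrightarrow> X \<in> obj N \<Longrightarrow> Y \<in> obj P \<Longrightarrow>
      sar (assoc M N P) (genL (M \<otimes> N) P (genL M N f X) Y) = genL M (N \<otimes> P) f (X, Y)"
    unfolding e by (rule TLL)
  show "A \<in> obj M \<Longrightarrow> h \<in> arr N \<Longrightarrow> Y \<in> obj P \<Longrightarrow>
      sar (assoc M N P) (genL (M \<otimes> N) P (genR M N A h) Y) = genR M (N \<otimes> P) A (genL N P h Y)"
    unfolding e by (rule TLR)
  show "A \<in> obj M \<Longrightarrow> X \<in> obj N \<Longrightarrow> k \<in> arr P \<Longrightarrow>
      sar (assoc M N P) (genR (M \<otimes> N) P (A, X) k) = genR M (N \<otimes> P) A (genR N P X k)"
    unfolding e by (rule TR)
qed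

text \<open>The values on generators do not mention the chosen categories and isomorphisms. All
  coherence laws are checked from these values alone.\<close>

lemma assoc:
  assumes "sequential M" "sequential N" "sequential P"
  shows "assoc M N P \<in> sisos ((M \<otimes> N) \<otimes> P) (M \<otimes> (N \<otimes> P))"
    and "assoc M N P \<in> sMlt ((M \<otimes> N) \<otimes> P) (M \<otimes> (N \<otimes> P))"
    and "A \<in> obj M \<Longrightarrow> X \<in> obj N \<Longrightarrow> Y \<in> obj P \<Longrightarrow> sob (assoc M N P) ((A, X), Y) = (A, X, Y)"
    and "f \<in> arr M \<Longrightarrow> X \<in> obj N \<Longrightarrow> Y \<in> obj P \<Longrightarrow>
      sar (assoc M N P) (genL (M \<otimes> N) P (genL M N f X) Y) = genL M (N \<otimes> P) f (X, Y)"
    and "A \<in> obj M \<Longrightarrow> h \<in> arr N \<Longrightarrow> Y \<in> obj P \<Longrightarrow>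
      sar (assoc M N P) (genL (M \<otimes> N) P (genR M N A h) Y) = genR M (N \<otimes> P) A (genL N P h Y)"
    and "A \<in> obj M \<Longrightarrow> X \<in> obj N \<Longrightarrow> k \<in> arr P \<Longrightarrow>
      sar (assoc M N P) (genR (M \<otimes> N) P (A, X) k) = genR M (N \<otimes> P) A (genR N P X k)"
proof -
  obtain C :: "('a, 'b) cat" and J where C: "category C" "J \<in> sisos M C\<^sub>\<triangleright>" using assms(1) by (rule sequentialE)
  obtain D :: "('c, 'd) cat" and K where D: "category D" "K \<in> sisos N D\<^sub>\<triangleright>" using assms(2) by (rule sequentialE)
  obtain E :: "('e, 'f) cat" and L where E: "category E" "L \<in> sisos P E\<^sub>\<triangleright>" using assms(3) by (rule sequentialE)
  note a = assoc_aux[OF C(1) D(1) E(1) C(2) D(2) E(2)]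
  show "assoc M N P \<in> sisos ((M \<otimes> N) \<otimes> P) (M \<otimes> (N \<otimes> P))" by (rule a(2))
  show "assoc M N P \<in> sMlt ((M \<otimes> N) \<otimes> P) (M \<otimes> (N \<otimes> P))" by (rule sisosD(1)[OF a(2)])
  show "A \<in> obj M \<Longrightarrow> X \<in> obj N \<Longrightarrow> Y \<in> obj P \<Longrightarrow> sob (assoc M N P) ((A, X), Y) = (A, X, Y)"
    by (rule a(3))
  show "f \<in> arr M \<Longrightarrow> X \<in> obj N \<Longrightarrow> Y \<in> obj P \<Longrightarrow>
      sar (assoc M N P) (genL (M \<otimes> N) P (genL M N f X) Y) = genL M (N \<otimes> P) f (X, Y)"
    by (rule a(4))
  show "A \<in> obj M \<Longrightarrow> h \<in> arr N \<Longrightarrow> Y \<in> obj P \<Longrightarrow>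
      sar (assoc M N P) (genL (M \<otimes> N) P (genR M N A h) Y) = genR M (N \<otimes> P) A (genL N P h Y)"
    by (rule a(5))
  show "A \<in> obj M \<Longrightarrow> X \<in> obj N \<Longrightarrow> k \<in> arr P \<Longrightarrow>
      sar (assoc M N P) (genR (M \<otimes> N) P (A, X) k) = genR M (N \<otimes> P) A (genR N P X k)"
    by (rule a(6))
qed

text \<open>A generator \<open>c\<^sub>Y\<close> of the outer tensor product may have any arrow
  \<open>c\<close> of \<open>M \<otimes> N\<close> in it. Restricting both functors to a fixed
  \<open>Y\<close> reduces this case to nested generators.\<close>

lemma tensor_ext3:
  assumes "sym_multicategory M" "sym_multicategory N" "sym_multicategory P"
    and F: "F \<in> sMlt ((M \<otimes> N) \<otimes> P) Q" and G: "G \<in> sMlt ((M \<otimes> N) \<otimes> P) Q"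
    and ob: "\<And>A X Y. A \<in> obj M \<Longrightarrow> X \<in> obj N \<Longrightarrow> Y \<in> obj P \<Longrightarrow> sob F ((A, X), Y) = sob G ((A, X), Y)"
    and LL: "\<And>f X Y. f \<in> arr M \<Longrightarrow> X \<in> obj N \<Longrightarrow> Y \<in> obj P \<Longrightarrow>
      sar F (genL (M \<otimes> N) P (genL M N f X) Y) = sar G (genL (M \<otimes> N) P (genL M N f X) Y)"
    and LR: "\<And>A h Y. A \<in> obj M \<Longrightarrow> h \<in> arr N \<Longrightarrow> Y \<in> obj P \<Longrightarrow>
      sar F (genL (M \<otimes> N) P (genR M N A h) Y) = sar G (genL (M \<otimes> N) P (genR M N A h) Y)"
    and R: "\<And>A X k. A \<in> obj M \<Longrightarrow> X \<in> obj N \<Longrightarrow> k \<in> arr P \<Longrightarrow>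
      sar F (genR (M \<otimes> N) P (A, X) k) = sar G (genR (M \<otimes> N) P (A, X) k)"
  shows "F = G"
proof -
  interpret MN: smc_pair M N using assms by (simp add: smc_pair_def)
  interpret MN_P: smc_pair "M \<otimes> N" P using assms by (simp add: smc_pair_def)
  have L: "F \<circ>\<^sub>s inclL (M \<otimes> N) P Y = G \<circ>\<^sub>s inclL (M \<otimes> N) P Y" if Y: "Y \<in> obj P" for Y
    by (rule MN.tensor_ext[OF scomp_sMlt[OF F MN_P.inclL_sMlt[OF Y]] scomp_sMlt[OF G MN_P.inclL_sMlt[OF Y]]])
      (use Y ob LL LR in auto)
  show ?thesis
  proof (rule MN_P.tensor_ext[OF F G])
    fix c Y assume "c \<in> arr (M \<otimes> N)" "Y \<in> obj P"
    then show "sar F (genL (M \<otimes> N) P c Y) = sar G (genL (M \<otimes> N) P c Y)"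
      using arg_cong[OF L, of Y "\<lambda>K. sar K c"] by simp
  qed (use ob R in auto)
qed

lemma assoc_natural:
  assumes seq: "sequential M" "sequential N" "sequential P" "sequential M'" "sequential N'" "sequential P'"
    and F: "F \<in> sMlt M M'" and G: "G \<in> sMlt N N'" and H: "H \<in> sMlt P P'"
  shows "assoc M' N' P' \<circ>\<^sub>s ((F \<otimes>\<^sub>f G) \<otimes>\<^sub>f H) = (F \<otimes>\<^sub>f (G \<otimes>\<^sub>f H)) \<circ>\<^sub>s assoc M N P"
proof -
  note D = sMltD[OF F] sMltD[OF G] sMltD[OF H]
  interpret MN: smc_pair M N using D by (simp add: smc_pair_def)
  interpret NP: smc_pair N P using D by (simp add: smc_pair_def)
  interpret MN_P: smc_pair "M \<otimes> N" P using MN.T D by (simp add: smc_pair_def)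
  note a = assoc[OF seq(1-3)] and a' = assoc[OF seq(4-6)]
  note FG = tensor_map[OF F G] and GH = tensor_map[OF G H]
  note FGH = tensor_map[OF FG(1) H] and FGH' = tensor_map[OF F GH(1)]
  show ?thesis
    by (rule tensor_ext3[OF D(3) D(16) D(29) scomp_sMlt[OF a'(2) FGH(1)] scomp_sMlt[OF FGH'(1) a(2)]])
      (simp_all add: D sMltD(1)[OF FGH(1)] sMltD(1)[OF a(2)] a a' FG GH FGH FGH')
qed

lemma tensor_ext4:
  assumes smc: "sym_multicategory M" "sym_multicategory N" "sym_multicategory P" "sym_multicategory Q"
    and F: "F \<in> sMlt (((M \<otimes> N) \<otimes> P) \<otimes> Q) R" and G: "G \<in> sMlt (((M \<otimes> N) \<otimes> P) \<otimes> Q) R"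
    and ob: "\<And>A X Y Z. A \<in> obj M \<Longrightarrow> X \<in> obj N \<Longrightarrow> Y \<in> obj P \<Longrightarrow> Z \<in> obj Q \<Longrightarrow>
      sob F (((A, X), Y), Z) = sob G (((A, X), Y), Z)"
    and LLL: "\<And>f X Y Z. f \<in> arr M \<Longrightarrow> X \<in> obj N \<Longrightarrow> Y \<in> obj P \<Longrightarrow> Z \<in> obj Q \<Longrightarrow>
      sar F (genL ((M \<otimes> N) \<otimes> P) Q (genL (M \<otimes> N) P (genL M N f X) Y) Z) =
      sar G (genL ((M \<otimes> N) \<otimes> P) Q (genL (M \<otimes> N) P (genL M N f X) Y) Z)"
    and LLR: "\<And>A h Y Z. A \<in> obj M \<Longrightarrow> h \<in> arr N \<Longrightarrow> Y \<in> obj P \<Longrightarrow> Z \<in> obj Q \<Longrightarrow>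
      sar F (genL ((M \<otimes> N) \<otimes> P) Q (genL (M \<otimes> N) P (genR M N A h) Y) Z) =
      sar G (genL ((M \<otimes> N) \<otimes> P) Q (genL (M \<otimes> N) P (genR M N A h) Y) Z)"
    and LR: "\<And>A X k Z. A \<in> obj M \<Longrightarrow> X \<in> obj N \<Longrightarrow> k \<in> arr P \<Longrightarrow> Z \<in> obj Q \<Longrightarrow>
      sar F (genL ((M \<otimes> N) \<otimes> P) Q (genR (M \<otimes> N) P (A, X) k) Z) =
      sar G (genL ((M \<otimes> N) \<otimes> P) Q (genR (M \<otimes> N) P (A, X) k) Z)"
    and R: "\<And>A X Y l. A \<in> obj M \<Longrightarrow> X \<in> obj N \<Longrightarrow> Y \<in> obj P \<Longrightarrow> l \<in> arr Q \<Longrightarrow>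
      sar F (genR ((M \<otimes> N) \<otimes> P) Q ((A, X), Y) l) = sar G (genR ((M \<otimes> N) \<otimes> P) Q ((A, X), Y) l)"
  shows "F = G"
proof -
  interpret MN: smc_pair M N using smc by (simp add: smc_pair_def)
  interpret MN_P: smc_pair "M \<otimes> N" P using smc by (simp add: smc_pair_def)
  interpret MNP_Q: smc_pair "(M \<otimes> N) \<otimes> P" Q using smc by (simp add: smc_pair_def)
  have L: "F \<circ>\<^sub>s inclL ((M \<otimes> N) \<otimes> P) Q Z = G \<circ>\<^sub>s inclL ((M \<otimes> N) \<otimes> P) Q Z" if Z: "Z \<in> obj Q" for Z
    by (rule tensor_ext3[OF smc(1-3) scomp_sMlt[OF F MNP_Q.inclL_sMlt[OF Z]]
          scomp_sMlt[OF G MNP_Q.inclL_sMlt[OF Z]]])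
      (use Z ob LLL LLR LR in auto)
  show ?thesis
  proof (rule MNP_Q.tensor_ext[OF F G])
    fix c Z assume "c \<in> arr ((M \<otimes> N) \<otimes> P)" "Z \<in> obj Q"
    then show "sar F (genL ((M \<otimes> N) \<otimes> P) Q c Z) = sar G (genL ((M \<otimes> N) \<otimes> P) Q c Z)"
      using arg_cong[OF L, of Z "\<lambda>K. sar K c"] by simp
  qed (use ob R in auto)
qed

text \<open>On nested generators an associator only rebrackets the indices and passes the inner
  arrow along, so both paths give the same generator in each of the four cases of
  \<open>tensor_ext4\<close>.\<close>

lemma assoc_pentagon:
  assumes seq: "sequential M" "sequential N" "sequential P" "sequential Q"
  shows "assoc M N (P \<otimes> Q) \<circ>\<^sub>s assoc (M \<otimes> N) P Q =
    (sid M \<otimes>\<^sub>f assoc N P Q) \<circ>\<^sub>s assoc M (N \<otimes> P) Q \<circ>\<^sub>s (assoc M N P \<otimes>\<^sub>f sid Q)"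
proof -
  note smc = seq[THEN sequential_sym_multicategory]
  note seq' = sequential_tensor[OF seq(1,2)] sequential_tensor[OF seq(2,3)] sequential_tensor[OF seq(3,4)]
  interpret MN: smc_pair M N using smc by (simp add: smc_pair_def)
  interpret NP: smc_pair N P using smc by (simp add: smc_pair_def)
  interpret PQ: smc_pair P Q using smc by (simp add: smc_pair_def)
  interpret MN_P: smc_pair "M \<otimes> N" P using smc by (simp add: smc_pair_def)
  interpret N_PQ: smc_pair N "P \<otimes> Q" using smc by (simp add: smc_pair_def)
  interpret NP_Q: smc_pair "N \<otimes> P" Q using smc by (simp add: smc_pair_def)
  interpret MN_PQ: smc_pair "M \<otimes> N" "P \<otimes> Q" using smc by (simp add: smc_pair_def)
  interpret M_NP: smc_pair M "N \<otimes> P" using smc by (simp add: smc_pair_def)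
  interpret M_NP_Q: smc_pair "M \<otimes> (N \<otimes> P)" Q using smc by (simp add: smc_pair_def)
  interpret MNP_Q: smc_pair "(M \<otimes> N) \<otimes> P" Q using smc by (simp add: smc_pair_def)
  note a1 = assoc[OF seq(1,2) seq'(3)] and a2 = assoc[OF seq'(1) seq(3,4)]
    and a3 = assoc[OF seq(2-4)] and a4 = assoc[OF seq(1) seq'(2) seq(4)] and a5 = assoc[OF seq(1-3)]
  note t3 = tensor_map[OF sid_sMlt[OF smc(1)] a3(2)] and t5 = tensor_map[OF a5(2) sid_sMlt[OF smc(4)]]
  note d = sMltD(1)[OF a2(2)] sMltD(1)[OF t5(1)] sMltD(1)[OF a4(2)] sMltD(1)[OF a1(2)]
  show ?thesis
    by (rule tensor_ext4[OF smc scomp_sMlt[OF a1(2) a2(2)] scomp_sMlt[OF scomp_sMlt[OF t3(1) a4(2)] t5(1)]])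
      (simp_all add: d a1 a2 a3 a4 a5 t3 t5)
qed

section \<open>The unitors\<close>

lemma lunit_sMlt [simp]: "sym_multicategory M \<Longrightarrow> lunit M \<in> sMlt M (one_smc \<otimes> M)"
  and runit_sMlt [simp]: "sym_multicategory M \<Longrightarrow> runit M \<in> sMlt M (M \<otimes> one_smc)"
proof -
  assume "sym_multicategory M"
  then interpret l: smc_pair one_smc M by (simp add: smc_pair_def)
  show "lunit M \<in> sMlt M (one_smc \<otimes> M)"
    unfolding lunit_def by (rule l.inclR_sMlt) (simp add: one_smc_def)
next
  assume "sym_multicategory M"
  then interpret r: smc_pair M one_smc by (simp add: smc_pair_def)
  show "runit M \<in> sMlt M (M \<otimes> one_smc)"
    unfolding runit_def by (rule r.inclL_sMlt) (simp add: one_smc_def)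
qed

lemma unit_simps [simp]:
  "sdom (lunit M) = M" "sdom (runit M) = M"
  "X \<in> obj M \<Longrightarrow> sob (lunit M) X = ((), X)" "X \<in> obj M \<Longrightarrow> sob (runit M) X = (X, ())"
  "f \<in> arr M \<Longrightarrow> sar (lunit M) f = genR one_smc M () f"
  "f \<in> arr M \<Longrightarrow> sar (runit M) f = genL M one_smc f ()"
  by (simp_all add: lunit_def runit_def inclL_def inclR_def)

lemma obj_one [simp]: "obj one_smc = UNIV"
  by (simp add: one_smc_def)

lemma unit_natural:
  assumes F: "F \<in> sMlt M M'"
  shows "lunit M' \<circ>\<^sub>s F = (sid one_smc \<otimes>\<^sub>f F) \<circ>\<^sub>s lunit M"
    "runit M' \<circ>\<^sub>s F = (F \<otimes>\<^sub>f sid one_smc) \<circ>\<^sub>s runit M"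
proof -
  note D = sMltD[OF F]
  note l = tensor_map[OF sid_sMlt[OF sym_multicategory_one] F]
    and r = tensor_map[OF F sid_sMlt[OF sym_multicategory_one]]
  show "lunit M' \<circ>\<^sub>s F = (sid one_smc \<otimes>\<^sub>f F) \<circ>\<^sub>s lunit M"
    by (rule sfun_eqI[OF scomp_sMlt[OF lunit_sMlt[OF D(4)] F] scomp_sMlt[OF l(1) lunit_sMlt[OF D(3)]]])
      (simp_all add: D l)
  show "runit M' \<circ>\<^sub>s F = (F \<otimes>\<^sub>f sid one_smc) \<circ>\<^sub>s runit M"
    by (rule sfun_eqI[OF scomp_sMlt[OF runit_sMlt[OF D(4)] F] scomp_sMlt[OF r(1) runit_sMlt[OF D(3)]]])
      (simp_all add: D r)
qed

lemma unit_triangle: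
  assumes seq: "sequential M" "sequential N"
  shows "assoc M one_smc N \<circ>\<^sub>s (runit M \<otimes>\<^sub>f sid N) = sid M \<otimes>\<^sub>f lunit N"
proof -
  note smc = seq[THEN sequential_sym_multicategory]
  interpret smc_pair M N using smc by (simp add: smc_pair_def)
  interpret M1: smc_pair M one_smc using smc by (simp add: smc_pair_def)
  note a = assoc[OF seq(1) sequential_one seq(2)]
  note r = tensor_map[OF runit_sMlt[OF smc(1)] sid_sMlt[OF smc(2)]]
    and l = tensor_map[OF sid_sMlt[OF smc(1)] lunit_sMlt[OF smc(2)]]
  show ?thesis
    by (rule tensor_ext[OF scomp_sMlt[OF a(2) r(1)] l(1)])
      (simp_all add: a r l sMltD(1)[OF r(1)])
qed

lemma clunit:
  assumes "category C"
  shows "clunit C \<in> Cat C (one_cat \<times>\<^sub>c C)" "(clunit C)\<^sup>\<triangleright> \<in> sisos C\<^sub>\<triangleright> (one_cat \<times>\<^sub>c C)\<^sub>\<triangleright>"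
proof -
  interpret C: category C by fact
  note cat = category_prod[OF category_one assms]
  define B where "B = \<lparr>cdom = one_cat \<times>\<^sub>c C, ccod = C,
     cob = restrict snd (Ob (one_cat \<times>\<^sub>c C)), car = restrict snd (Ar (one_cat \<times>\<^sub>c C))\<rparr>"
  show A: "clunit C \<in> Cat C (one_cat \<times>\<^sub>c C)"
    by (rule CatI) (use assms cat in \<open>auto simp: clunit_def C.Dom_Ob C.Cod_Ob C.Idn_Ar C.Cmp_Ar\<close>)
  have B: "B \<in> Cat (one_cat \<times>\<^sub>c C) C"
    by (rule CatI) (use assms cat in \<open>auto simp: B_def C.Dom_Ob C.Cod_Ob C.Idn_Ar C.Cmp_Ar\<close>)
  have "B \<circ>\<^sub>c clunit C = cid C"
    by (rule cfun_eqI[OF ccomp_Cat[OF B A] cid_Cat[OF assms]]) (auto simp: B_def clunit_def)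
  moreover have "clunit C \<circ>\<^sub>c B = cid (one_cat \<times>\<^sub>c C)"
    by (rule cfun_eqI[OF ccomp_Cat[OF A B] cid_Cat[OF cat]]) (auto simp: B_def clunit_def)
  ultimately show "(clunit C)\<^sup>\<triangleright> \<in> sisos C\<^sub>\<triangleright> (one_cat \<times>\<^sub>c C)\<^sub>\<triangleright>"
    using A B assms cat by (metis sisosI seq_fun_sMlt seq_fun_ccomp seq_fun_cid)
qed

lemma crunit:
  assumes "category C"
  shows "crunit C \<in> Cat C (C \<times>\<^sub>c one_cat)" "(crunit C)\<^sup>\<triangleright> \<in> sisos C\<^sub>\<triangleright> (C \<times>\<^sub>c one_cat)\<^sub>\<triangleright>"
proof -
  interpret C: category C by fact
  note cat = category_prod[OF assms category_one]
  define B where "B = \<lparr>cdom = C \<times>\<^sub>c one_cat, ccod = C,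
     cob = restrict fst (Ob (C \<times>\<^sub>c one_cat)), car = restrict fst (Ar (C \<times>\<^sub>c one_cat))\<rparr>"
  show A: "crunit C \<in> Cat C (C \<times>\<^sub>c one_cat)"
    by (rule CatI) (use assms cat in \<open>auto simp: crunit_def C.Dom_Ob C.Cod_Ob C.Idn_Ar C.Cmp_Ar\<close>)
  have B: "B \<in> Cat (C \<times>\<^sub>c one_cat) C"
    by (rule CatI) (use assms cat in \<open>auto simp: B_def C.Dom_Ob C.Cod_Ob C.Idn_Ar C.Cmp_Ar\<close>)
  have "B \<circ>\<^sub>c crunit C = cid C"
    by (rule cfun_eqI[OF ccomp_Cat[OF B A] cid_Cat[OF assms]]) (auto simp: B_def crunit_def)
  moreover have "crunit C \<circ>\<^sub>c B = cid (C \<times>\<^sub>c one_cat)"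
    by (rule cfun_eqI[OF ccomp_Cat[OF A B] cid_Cat[OF cat]]) (auto simp: B_def crunit_def)
  ultimately show "(crunit C)\<^sup>\<triangleright> \<in> sisos C\<^sub>\<triangleright> (C \<times>\<^sub>c one_cat)\<^sub>\<triangleright>"
    using A B assms cat by (metis sisosI seq_fun_sMlt seq_fun_ccomp seq_fun_cid)
qed

lemma sar_crunit: "a \<in> arr C\<^sub>\<triangleright> \<Longrightarrow> sar (crunit C)\<^sup>\<triangleright> a = (map (\<lambda>f. (f, ())) (fst a), snd a, ())"
  and sar_clunit: "a \<in> arr C\<^sub>\<triangleright> \<Longrightarrow> sar (clunit C)\<^sup>\<triangleright> a = (map (\<lambda>f. ((), f)) (fst a), (), snd a)"
  by (cases a; auto simp: seq_fun_def crunit_def clunit_def)+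

lemma cob_unit [simp]:
  "X \<in> Ob C \<Longrightarrow> cob (clunit C) X = ((), X)" "X \<in> Ob C \<Longrightarrow> cob (crunit C) X = (X, ())"
  by (simp_all add: clunit_def crunit_def)

text \<open>Up to isomorphisms, the unitors are the images of the unitors of \<open>Cat\<close>. The
  latter are invertible, and \<open>unit_sisos\<close> concludes by cancelling the
  isomorphisms.\<close>

lemma unit_seq_iso:
  assumes C: "category C" and J: "J \<in> sMlt M C\<^sub>\<triangleright>"
  shows "seq_iso one_cat C (sid one_smc) J \<circ>\<^sub>s lunit M = (clunit C)\<^sup>\<triangleright> \<circ>\<^sub>s J"
    "seq_iso C one_cat J (sid one_smc) \<circ>\<^sub>s runit M = (crunit C)\<^sup>\<triangleright> \<circ>\<^sub>s J"
proof -
  note D = sMltD[OF J]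
  have one: "sid one_smc \<in> sMlt one_smc one_cat\<^sub>\<triangleright>"
    using sid_sMlt[OF sym_multicategory_one] by (simp add: one_smc_def)
  note l = seq_iso[OF category_one C one J] and r = seq_iso[OF C category_one J one]
  note cl = seq_fun_sMlt[OF clunit(1)[OF C]] and cr = seq_fun_sMlt[OF crunit(1)[OF C]]
  have o: "sob J X \<in> Ob C" if "X \<in> obj M" for X using D(7)[OF that] by simp
  have t: "snd (sar J f) = sob J (tgt M f)" if "f \<in> arr M" for f
    using that D(10) tgt_seq_smc by metis
  show "seq_iso one_cat C (sid one_smc) J \<circ>\<^sub>s lunit M = (clunit C)\<^sup>\<triangleright> \<circ>\<^sub>s J"
    by (rule sfun_eqI[OF scomp_sMlt[OF l(1) lunit_sMlt[OF D(3)]] scomp_sMlt[OF cl J]])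
      (simp_all add: D o l t sar_clunit del: seq_smc_simps(4))
  show "seq_iso C one_cat J (sid one_smc) \<circ>\<^sub>s runit M = (crunit C)\<^sup>\<triangleright> \<circ>\<^sub>s J"
    by (rule sfun_eqI[OF scomp_sMlt[OF r(1) runit_sMlt[OF D(3)]] scomp_sMlt[OF cr J]])
      (simp_all add: D o r t sar_crunit del: seq_smc_simps(4))
qed

lemma sisos_right_factor:
  assumes J: "J \<in> sisos N P" and G: "G \<in> sMlt M N" and JG: "J \<circ>\<^sub>s G \<in> sisos M P"
  shows "G \<in> sisos M N"
proof -
  have "G = sinv J \<circ>\<^sub>s (J \<circ>\<^sub>s G)"
    using scomp_assoc[OF sisosD(3,1)[OF J] G] sisosD(4)[OF J] scomp_sid(2)[OF G] by simp
  then show ?thesis using scomp_sisos[OF sisosD(2)[OF J] JG] by simp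
qed

lemma sid_one_sisos: "sid one_smc \<in> sisos one_smc one_cat\<^sub>\<triangleright>"
  using sid_sisos[OF sym_multicategory_one] by (simp add: one_smc_def)

lemma unit_sisos:
  assumes "sequential M"
  shows "lunit M \<in> sisos M (one_smc \<otimes> M)" "runit M \<in> sisos M (M \<otimes> one_smc)"
proof -
  note M = sequential_sym_multicategory[OF assms]
  obtain C :: "('a, 'b) cat" and J where C: "category C" "J \<in> sisos M C\<^sub>\<triangleright>"
    using assms by (rule sequentialE)
  note u = unit_seq_iso[OF C(1) sisosD(1)[OF C(2)]]
  show "lunit M \<in> sisos M (one_smc \<otimes> M)"
    by (rule sisos_right_factor[OF seq_iso_sisos[OF category_one C(1) sid_one_sisos C(2)] lunit_sMlt[OF M]])
      (unfold u, rule scomp_sisos[OF clunit(2)[OF C(1)] C(2)])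
  show "runit M \<in> sisos M (M \<otimes> one_smc)"
    by (rule sisos_right_factor[OF seq_iso_sisos[OF C(1) category_one C(2) sid_one_sisos] runit_sMlt[OF M]])
      (unfold u, rule scomp_sisos[OF crunit(2)[OF C(1)] C(2)])
qed


subsection \<open>The cartesian structure\<close>

lemma cfst: "category C \<Longrightarrow> category D \<Longrightarrow> cfst C D \<in> Cat (C \<times>\<^sub>c D) C"
  and csnd: "category C \<Longrightarrow> category D \<Longrightarrow> csnd C D \<in> Cat (C \<times>\<^sub>c D) D"
proof -
  assume cat: "category C" "category D"
  interpret C: category C by fact
  interpret D: category D by fact
  note ax = C.Dom_Ob C.Cod_Ob C.Idn_Ar C.Cmp_Ar D.Dom_Ob D.Cod_Ob D.Idn_Ar D.Cmp_Ar
  show "cfst C D \<in> Cat (C \<times>\<^sub>c D) C"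
    by (rule CatI) (use cat category_prod[OF cat] ax in \<open>auto simp: cfst_def\<close>)
  show "csnd C D \<in> Cat (C \<times>\<^sub>c D) D"
    by (rule CatI) (use cat category_prod[OF cat] ax in \<open>auto simp: csnd_def\<close>)
qed

lemma sar_cfst: "a \<in> arr (C \<times>\<^sub>c D)\<^sub>\<triangleright> \<Longrightarrow> sar (cfst C D)\<^sup>\<triangleright> a = (map fst (fst a), fst (snd a))"
  and sar_csnd: "a \<in> arr (C \<times>\<^sub>c D)\<^sub>\<triangleright> \<Longrightarrow> sar (csnd C D)\<^sup>\<triangleright> a = (map snd (fst a), snd (snd a))"
  by (cases a; auto simp: seq_fun_def cfst_def csnd_def)+

lemma cob_proj [simp]:
  "A \<in> Ob C \<Longrightarrow> X \<in> Ob D \<Longrightarrow> cob (cfst C D) (A, X) = A"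
  "A \<in> Ob C \<Longrightarrow> X \<in> Ob D \<Longrightarrow> cob (csnd C D) (A, X) = X"
  by (simp_all add: cfst_def csnd_def)

lemma length_sar_seq: "J \<in> sMlt M C\<^sub>\<triangleright> \<Longrightarrow> f \<in> arr M \<Longrightarrow> length (fst (sar J f)) = length (src M f)"
  using sMltD(9)[of J M "C\<^sub>\<triangleright>" f] src_seq_smc[of C "sar J f"] by (metis length_map)

text \<open>The projections are defined with an inverse unitor. Composing with the unitor of
  \<open>Cat\<close> turns it into a unitor that cancels the inverse, so the remaining equations,
  \<open>eL\<close> and \<open>eR\<close>, can be checked on generators.\<close>

lemma proj_seq:
  assumes cat: "category C" "category D" and J: "J \<in> sisos M C\<^sub>\<triangleright>" and K: "K \<in> sisos N D\<^sub>\<triangleright>"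
  shows "projL M N \<in> sMlt (M \<otimes> N) M" "J \<circ>\<^sub>s projL M N = (cfst C D)\<^sup>\<triangleright> \<circ>\<^sub>s seq_iso C D J K"
    "projR M N \<in> sMlt (M \<otimes> N) N" "K \<circ>\<^sub>s projR M N = (csnd C D)\<^sup>\<triangleright> \<circ>\<^sub>s seq_iso C D J K"
proof -
  note JD = sMltD[OF sisosD(1)[OF J]] and KD = sMltD[OF sisosD(1)[OF K]]
  interpret smc_pair M N using JD KD by (simp add: smc_pair_def)
  interpret C: category C by fact
  interpret D: category D by fact
  have seq: "sequential M" "sequential N"
    using J K cat by (auto intro: sequentialI)
  note lu = unit_sisos(1)[OF seq(2)] and ru = unit_sisos(2)[OF seq(1)]
  note tl = tensor_map[OF sid_sMlt[OF M] bang_sMlt[OF N]] and tr = tensor_map[OF bang_sMlt[OF M] sid_sMlt[OF N]]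
  show pL: "projL M N \<in> sMlt (M \<otimes> N) M"
    unfolding projL_def by (rule scomp_sMlt[OF sisosD(3)[OF ru] tl(1)])
  show pR: "projR M N \<in> sMlt (M \<otimes> N) N"
    unfolding projR_def by (rule scomp_sMlt[OF sisosD(3)[OF lu] tr(1)])
  note s = seq_iso[OF cat sisosD(1)[OF J] sisosD(1)[OF K]]
  note sl = seq_iso[OF category_one cat(2) sisosD(1)[OF sid_one_sisos] sisosD(1)[OF K]]
  note sr = seq_iso[OF cat(1) category_one sisosD(1)[OF J] sisosD(1)[OF sid_one_sisos]]
  note cf = seq_fun_sMlt[OF cfst[OF cat]] and cs = seq_fun_sMlt[OF csnd[OF cat]]
  note cr = crunit[OF cat(1)] and cl = clunit[OF cat(2)]
  note d = sMltD(1)[OF s(1)] sMltD(1)[OF tl(1)] sMltD(1)[OF tr(1)]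
  have sa: "sar (seq_iso C D J K) a \<in> arr (C \<times>\<^sub>c D)\<^sub>\<triangleright>" if "a \<in> arr (M \<otimes> N)" for a
    using sMltD(8)[OF s(1) that] .
  have b: "sob (bang M) A = ()" "sob (bang N) X = ()" for A X by (simp_all add: bang_def)
  have ba: "sar (bang M) f = (replicate (length (src M f)) (), ())" if "f \<in> arr M" for f
    using that by (simp add: bang_def map_replicate_const)
  have bb: "sar (bang N) h = (replicate (length (src N h)) (), ())" if "h \<in> arr N" for h
    using that by (simp add: bang_def map_replicate_const)
  have cfa: "sar (cfst C D)\<^sup>\<triangleright> a \<in> arr C\<^sub>\<triangleright>" "sar (csnd C D)\<^sup>\<triangleright> a \<in> arr D\<^sub>\<triangleright>" if "a \<in> arr (C \<times>\<^sub>c D)\<^sub>\<triangleright>" for a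
    using sMltD(8)[OF cf that] sMltD(8)[OF cs that] .
  have eL: "(crunit C)\<^sup>\<triangleright> \<circ>\<^sub>s ((cfst C D)\<^sup>\<triangleright> \<circ>\<^sub>s seq_iso C D J K) =
      seq_iso C one_cat J (sid one_smc) \<circ>\<^sub>s (sid M \<otimes>\<^sub>f bang N)"
  proof (rule tensor_ext[OF scomp_sMlt[OF sisosD(1)[OF cr(2)] scomp_sMlt[OF cf s(1)]] scomp_sMlt[OF sr(1) tl(1)]])
    fix f X assume a: "f \<in> arr M" "X \<in> obj N"
    have g: "genL M N f X \<in> arr (M \<otimes> N)" using a by simp
    show "sar ((crunit C)\<^sup>\<triangleright> \<circ>\<^sub>s ((cfst C D)\<^sup>\<triangleright> \<circ>\<^sub>s seq_iso C D J K)) (genL M N f X) =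
        sar (seq_iso C one_cat J (sid one_smc) \<circ>\<^sub>s (sid M \<otimes>\<^sub>f bang N)) (genL M N f X)"
      using a g sar_crunit[OF cfa(1)[OF sa[OF g]]] sar_cfst[OF sa[OF g]]
      by (simp add: d s(3) sr(3) tl(3) b comp_def)
  next
    fix A h assume a: "A \<in> obj M" "h \<in> arr N"
    have g: "genR M N A h \<in> arr (M \<otimes> N)" using a by simp
    \<comment> \<open>The functor \<open>bang N\<close> keeps only the arity of \<open>h\<close>.
      The image is then a list of identities of that length, which is also what the first projection
      leaves.\<close>
    have o: "(replicate n (), ()) \<in> arr one_smc" for n by (simp add: one_smc_def)
    show "sar ((crunit C)\<^sup>\<triangleright> \<circ>\<^sub>s ((cfst C D)\<^sup>\<triangleright> \<circ>\<^sub>s seq_iso C D J K)) (genR M N A h) =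
        sar (seq_iso C one_cat J (sid one_smc) \<circ>\<^sub>s (sid M \<otimes>\<^sub>f bang N)) (genR M N A h)"
      using a g sar_crunit[OF cfa(1)[OF sa[OF g]]] sar_cfst[OF sa[OF g]] length_sar_seq[OF sisosD(1)[OF K]]
      by (simp add: d s(4) sr(4) tl(4) bb o comp_def map_replicate_const)
  qed (simp_all add: d s(2) sr(2) tl(2) b JD(7)[simplified] KD(7)[simplified])
  have eR: "(clunit D)\<^sup>\<triangleright> \<circ>\<^sub>s ((csnd C D)\<^sup>\<triangleright> \<circ>\<^sub>s seq_iso C D J K) =
      seq_iso one_cat D (sid one_smc) K \<circ>\<^sub>s (bang M \<otimes>\<^sub>f sid N)"
  proof (rule tensor_ext[OF scomp_sMlt[OF sisosD(1)[OF cl(2)] scomp_sMlt[OF cs s(1)]] scomp_sMlt[OF sl(1) tr(1)]])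
    fix f X assume a: "f \<in> arr M" "X \<in> obj N"
    have g: "genL M N f X \<in> arr (M \<otimes> N)" using a by simp
    have o: "(replicate n (), ()) \<in> arr one_smc" for n by (simp add: one_smc_def)
    show "sar ((clunit D)\<^sup>\<triangleright> \<circ>\<^sub>s ((csnd C D)\<^sup>\<triangleright> \<circ>\<^sub>s seq_iso C D J K)) (genL M N f X) =
        sar (seq_iso one_cat D (sid one_smc) K \<circ>\<^sub>s (bang M \<otimes>\<^sub>f sid N)) (genL M N f X)"
      using a g sar_clunit[OF cfa(2)[OF sa[OF g]]] sar_csnd[OF sa[OF g]] length_sar_seq[OF sisosD(1)[OF J]]
      by (simp add: d s(3) sl(3) tr(3) ba o comp_def map_replicate_const)
  next
    fix A h assume a: "A \<in> obj M" "h \<in> arr N"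
    have g: "genR M N A h \<in> arr (M \<otimes> N)" using a by simp
    show "sar ((clunit D)\<^sup>\<triangleright> \<circ>\<^sub>s ((csnd C D)\<^sup>\<triangleright> \<circ>\<^sub>s seq_iso C D J K)) (genR M N A h) =
        sar (seq_iso one_cat D (sid one_smc) K \<circ>\<^sub>s (bang M \<otimes>\<^sub>f sid N)) (genR M N A h)"
      using a g sar_clunit[OF cfa(2)[OF sa[OF g]]] sar_csnd[OF sa[OF g]]
      by (simp add: d s(4) sl(4) tr(4) b comp_def)
  qed (simp_all add: d s(2) sl(2) tr(2) b JD(7)[simplified] KD(7)[simplified])
  show "J \<circ>\<^sub>s projL M N = (cfst C D)\<^sup>\<triangleright> \<circ>\<^sub>s seq_iso C D J K"
  proof (rule sisos_cancel_left[OF cr(2) scomp_sMlt[OF sisosD(1)[OF J] pL] scomp_sMlt[OF cf s(1)]])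
    have "(crunit C)\<^sup>\<triangleright> \<circ>\<^sub>s (J \<circ>\<^sub>s projL M N) = seq_iso C one_cat J (sid one_smc) \<circ>\<^sub>s runit M \<circ>\<^sub>s projL M N"
      using scomp_assoc[OF sisosD(1)[OF cr(2)] sisosD(1)[OF J] pL] unit_seq_iso(2)[OF cat(1) sisosD(1)[OF J]]
      by simp
    also have "\<dots> = seq_iso C one_cat J (sid one_smc) \<circ>\<^sub>s (sid M \<otimes>\<^sub>f bang N)"
      using scomp_assoc[OF sr(1) sisosD(1)[OF ru] pL] sinv_cancel[OF ru tl(1)] by (simp add: projL_def)
    finally show "(crunit C)\<^sup>\<triangleright> \<circ>\<^sub>s (J \<circ>\<^sub>s projL M N) =
        (crunit C)\<^sup>\<triangleright> \<circ>\<^sub>s ((cfst C D)\<^sup>\<triangleright> \<circ>\<^sub>s seq_iso C D J K)" using eL by simp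
  qed
  show "K \<circ>\<^sub>s projR M N = (csnd C D)\<^sup>\<triangleright> \<circ>\<^sub>s seq_iso C D J K"
  proof (rule sisos_cancel_left[OF cl(2) scomp_sMlt[OF sisosD(1)[OF K] pR] scomp_sMlt[OF cs s(1)]])
    have "(clunit D)\<^sup>\<triangleright> \<circ>\<^sub>s (K \<circ>\<^sub>s projR M N) = seq_iso one_cat D (sid one_smc) K \<circ>\<^sub>s lunit N \<circ>\<^sub>s projR M N"
      using scomp_assoc[OF sisosD(1)[OF cl(2)] sisosD(1)[OF K] pR] unit_seq_iso(1)[OF cat(2) sisosD(1)[OF K]]
      by simp
    also have "\<dots> = seq_iso one_cat D (sid one_smc) K \<circ>\<^sub>s (bang M \<otimes>\<^sub>f sid N)"
      using scomp_assoc[OF sl(1) sisosD(1)[OF lu] pR] sinv_cancel[OF lu tr(1)] by (simp add: projR_def)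
    finally show "(clunit D)\<^sup>\<triangleright> \<circ>\<^sub>s (K \<circ>\<^sub>s projR M N) =
        (clunit D)\<^sup>\<triangleright> \<circ>\<^sub>s ((csnd C D)\<^sup>\<triangleright> \<circ>\<^sub>s seq_iso C D J K)" using eR by simp
  qed
qed

lemma cpair:
  assumes F: "F \<in> Cat Z C" and G: "G \<in> Cat Z D"
  obtains H where "H \<in> Cat Z (C \<times>\<^sub>c D)" "cfst C D \<circ>\<^sub>c H = F" "csnd C D \<circ>\<^sub>c H = G"
proof -
  note FD = functorD[OF F] and GD = functorD[OF G]
  interpret Z: category Z by (rule FD)
  define H where "H = \<lparr>cdom = Z, ccod = C \<times>\<^sub>c D, cob = \<lambda>X\<in>Ob Z. (cob F X, cob G X),
    car = \<lambda>f\<in>Ar Z. (car F f, car G f)\<rparr>"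
  have H: "H \<in> Cat Z (C \<times>\<^sub>c D)"
    by (rule CatI)
      (use FD GD category_prod in \<open>auto simp: H_def Z.Dom_Ob Z.Cod_Ob Z.Idn_Ar Z.Cmp_Ar\<close>)
  have "cfst C D \<circ>\<^sub>c H = F"
    by (rule cfun_eqI[OF ccomp_Cat[OF cfst[OF FD(4) GD(4)] H] F])
      (use FD GD in \<open>auto simp: H_def cfst_def\<close>)
  moreover have "csnd C D \<circ>\<^sub>c H = G"
    by (rule cfun_eqI[OF ccomp_Cat[OF csnd[OF FD(4) GD(4)] H] G])
      (use FD GD in \<open>auto simp: H_def csnd_def\<close>)
  ultimately show thesis using that H by blast
qed

lemma prod_arr_eqI:
  assumes "a \<in> arr (C \<times>\<^sub>c D)\<^sub>\<triangleright>" "b \<in> arr (C \<times>\<^sub>c D)\<^sub>\<triangleright>"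
    "sar (cfst C D)\<^sup>\<triangleright> a = sar (cfst C D)\<^sup>\<triangleright> b" "sar (csnd C D)\<^sup>\<triangleright> a = sar (csnd C D)\<^sup>\<triangleright> b"
  shows "a = b"
proof -
  have "map fst (fst a) = map fst (fst b)" "map snd (fst a) = map snd (fst b)" "snd a = snd b"
    using assms(3,4) unfolding sar_cfst[OF assms(1)] sar_cfst[OF assms(2)]
      sar_csnd[OF assms(1)] sar_csnd[OF assms(2)] by (auto simp: prod_eq_iff)
  moreover from this(1,2) have "fst a = fst b" by (metis zip_map_fst_snd)
  ultimately show ?thesis by (simp add: prod_eq_iff)
qed

text \<open>Conjugation by \<open>J\<close>, \<open>K\<close> and \<open>L\<close> turns
  \<open>F\<close> and \<open>G\<close> into functors between images of categories. By fullness
  these come from \<open>Cat\<close>, where they can be paired, and the pairing is carried back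
  along \<open>?S\<close>.\<close>

lemma tensor_product_universal:
  assumes seq: "sequential M" "sequential N" "sequential Q" and F: "F \<in> sMlt Q M" and G: "G \<in> sMlt Q N"
  shows "\<exists>!H. H \<in> sMlt Q (M \<otimes> N) \<and> projL M N \<circ>\<^sub>s H = F \<and> projR M N \<circ>\<^sub>s H = G"
proof -
  obtain C :: "('a, 'b) cat" and J where C: "category C" "J \<in> sisos M C\<^sub>\<triangleright>"
    using seq(1) by (rule sequentialE)
  obtain D :: "('c, 'd) cat" and K where D: "category D" "K \<in> sisos N D\<^sub>\<triangleright>"
    using seq(2) by (rule sequentialE)
  obtain Z :: "('e, 'f) cat" and L where Z: "category Z" "L \<in> sisos Q Z\<^sub>\<triangleright>"
    using seq(3) by (rule sequentialE)
  let ?S = "seq_iso C D J K"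
  note S = seq_iso_sisos[OF C(1) D(1) C(2) D(2)]
  note p = proj_seq[OF C(1) D(1) C(2) D(2)]
  note cf = cfst[OF C(1) D(1)] and cs = csnd[OF C(1) D(1)]
  obtain F0 where F0: "F0 \<in> Cat Z C" "J \<circ>\<^sub>s F \<circ>\<^sub>s sinv L = F0\<^sup>\<triangleright>"
    using seq_full[OF scomp_sMlt[OF scomp_sMlt[OF sisosD(1)[OF C(2)] F] sisosD(3)[OF Z(2)]] Z(1) C(1)] .
  obtain G0 where G0: "G0 \<in> Cat Z D" "K \<circ>\<^sub>s G \<circ>\<^sub>s sinv L = G0\<^sup>\<triangleright>"
    using seq_full[OF scomp_sMlt[OF scomp_sMlt[OF sisosD(1)[OF D(2)] G] sisosD(3)[OF Z(2)]] Z(1) D(1)] .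
  obtain H0 where H0: "H0 \<in> Cat Z (C \<times>\<^sub>c D)" "cfst C D \<circ>\<^sub>c H0 = F0" "csnd C D \<circ>\<^sub>c H0 = G0"
    using cpair[OF F0(1) G0(1)] .
  note H0s = seq_fun_sMlt[OF H0(1)]
  define H where "H = sinv ?S \<circ>\<^sub>s (H0\<^sup>\<triangleright> \<circ>\<^sub>s L)"
  have HL: "H0\<^sup>\<triangleright> \<circ>\<^sub>s L \<in> sMlt Q (C \<times>\<^sub>c D)\<^sub>\<triangleright>" by (rule scomp_sMlt[OF H0s sisosD(1)[OF Z(2)]])
  have H: "H \<in> sMlt Q (M \<otimes> N)"
    unfolding H_def by (rule scomp_sMlt[OF sisosD(3)[OF S] HL])
  have SH: "?S \<circ>\<^sub>s H = H0\<^sup>\<triangleright> \<circ>\<^sub>s L" unfolding H_def by (rule sinv_cancel[OF S HL])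
  have undo: "W \<circ>\<^sub>s sinv L \<circ>\<^sub>s L = W" if "W \<in> sMlt Q R" for W and R :: "('x, 'y) smc"
    using scomp_assoc[OF that sisosD(3,1)[OF Z(2)]] sisosD(4)[OF Z(2)] scomp_sid(1)[OF that] by simp
  have "J \<circ>\<^sub>s (projL M N \<circ>\<^sub>s H) = (cfst C D)\<^sup>\<triangleright> \<circ>\<^sub>s (?S \<circ>\<^sub>s H)"
    using scomp_assoc[OF sisosD(1)[OF C(2)] p(1) H] p(2) scomp_assoc[OF seq_fun_sMlt[OF cf] sisosD(1)[OF S] H]
    by simp
  also have "\<dots> = F0\<^sup>\<triangleright> \<circ>\<^sub>s L"
    unfolding SH using scomp_assoc[OF seq_fun_sMlt[OF cf] H0s sisosD(1)[OF Z(2)]] seq_fun_ccomp[OF H0(1) cf] H0(2)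
    by simp
  also have "\<dots> = J \<circ>\<^sub>s F"
    unfolding F0(2)[symmetric] by (rule undo[OF scomp_sMlt[OF sisosD(1)[OF C(2)] F]])
  finally have pL: "projL M N \<circ>\<^sub>s H = F"
    by (rule sisos_cancel_left[OF C(2) scomp_sMlt[OF p(1) H] F])
  have "K \<circ>\<^sub>s (projR M N \<circ>\<^sub>s H) = (csnd C D)\<^sup>\<triangleright> \<circ>\<^sub>s (?S \<circ>\<^sub>s H)"
    using scomp_assoc[OF sisosD(1)[OF D(2)] p(3) H] p(4) scomp_assoc[OF seq_fun_sMlt[OF cs] sisosD(1)[OF S] H]
    by simp
  also have "\<dots> = G0\<^sup>\<triangleright> \<circ>\<^sub>s L"
    unfolding SH using scomp_assoc[OF seq_fun_sMlt[OF cs] H0s sisosD(1)[OF Z(2)]] seq_fun_ccomp[OF H0(1) cs] H0(3)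
    by simp
  also have "\<dots> = K \<circ>\<^sub>s G"
    unfolding G0(2)[symmetric] by (rule undo[OF scomp_sMlt[OF sisosD(1)[OF D(2)] G]])
  finally have pR: "projR M N \<circ>\<^sub>s H = G"
    by (rule sisos_cancel_left[OF D(2) scomp_sMlt[OF p(3) H] G])
  show ?thesis
  proof (rule ex1I)
    show "H \<in> sMlt Q (M \<otimes> N) \<and> projL M N \<circ>\<^sub>s H = F \<and> projR M N \<circ>\<^sub>s H = G" using H pL pR by simp
    fix W assume W: "W \<in> sMlt Q (M \<otimes> N) \<and> projL M N \<circ>\<^sub>s W = F \<and> projR M N \<circ>\<^sub>s W = G"
    then have Ws: "W \<in> sMlt Q (M \<otimes> N)" by simp
    have eL: "(cfst C D)\<^sup>\<triangleright> \<circ>\<^sub>s (?S \<circ>\<^sub>s W) = (cfst C D)\<^sup>\<triangleright> \<circ>\<^sub>s (?S \<circ>\<^sub>s H)"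
      using scomp_assoc[OF seq_fun_sMlt[OF cf] sisosD(1)[OF S] Ws] p(2) scomp_assoc[OF sisosD(1)[OF C(2)] p(1) Ws]
        scomp_assoc[OF seq_fun_sMlt[OF cf] sisosD(1)[OF S] H] scomp_assoc[OF sisosD(1)[OF C(2)] p(1) H] W pL
      by simp
    have eR: "(csnd C D)\<^sup>\<triangleright> \<circ>\<^sub>s (?S \<circ>\<^sub>s W) = (csnd C D)\<^sup>\<triangleright> \<circ>\<^sub>s (?S \<circ>\<^sub>s H)"
      using scomp_assoc[OF seq_fun_sMlt[OF cs] sisosD(1)[OF S] Ws] p(4) scomp_assoc[OF sisosD(1)[OF D(2)] p(3) Ws]
        scomp_assoc[OF seq_fun_sMlt[OF cs] sisosD(1)[OF S] H] scomp_assoc[OF sisosD(1)[OF D(2)] p(3) H] W pR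
      by simp
    note SW = scomp_sMlt[OF sisosD(1)[OF S] Ws] and SH' = scomp_sMlt[OF sisosD(1)[OF S] H]
    \<comment> \<open>In the image of the product category, objects and arrows are determined by
      their two projections, which agree by \<open>eL\<close> and \<open>eR\<close>.\<close>
    have "?S \<circ>\<^sub>s W = ?S \<circ>\<^sub>s H"
    proof (rule sfun_eqI[OF SW SH'])
      fix X assume X: "X \<in> obj Q"
      have "sob (?S \<circ>\<^sub>s W) X \<in> Ob C \<times> Ob D" "sob (?S \<circ>\<^sub>s H) X \<in> Ob C \<times> Ob D"
        using sMltD(7)[OF SW X] sMltD(7)[OF SH' X] by auto
      moreover have "cob (cfst C D) (sob (?S \<circ>\<^sub>s W) X) = cob (cfst C D) (sob (?S \<circ>\<^sub>s H) X)"
        using arg_cong[OF eL, of "\<lambda>V. sob V X"] X sMltD(1)[OF SW] sMltD(1)[OF SH']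
          scomp_simps(3)[of X "?S \<circ>\<^sub>s W" "(cfst C D)\<^sup>\<triangleright>"] scomp_simps(3)[of X "?S \<circ>\<^sub>s H" "(cfst C D)\<^sup>\<triangleright>"]
        by (simp del: scomp_simps)
      moreover have "cob (csnd C D) (sob (?S \<circ>\<^sub>s W) X) = cob (csnd C D) (sob (?S \<circ>\<^sub>s H) X)"
        using arg_cong[OF eR, of "\<lambda>V. sob V X"] X sMltD(1)[OF SW] sMltD(1)[OF SH']
          scomp_simps(3)[of X "?S \<circ>\<^sub>s W" "(csnd C D)\<^sup>\<triangleright>"] scomp_simps(3)[of X "?S \<circ>\<^sub>s H" "(csnd C D)\<^sup>\<triangleright>"]
        by (simp del: scomp_simps)
      ultimately show "sob (?S \<circ>\<^sub>s W) X = sob (?S \<circ>\<^sub>s H) X"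
        by (cases "sob (?S \<circ>\<^sub>s W) X"; cases "sob (?S \<circ>\<^sub>s H) X") (auto simp del: scomp_simps)
    next
      fix q assume q: "q \<in> arr Q"
      show "sar (?S \<circ>\<^sub>s W) q = sar (?S \<circ>\<^sub>s H) q"
        using arg_cong[OF eL, of "\<lambda>V. sar V q"] arg_cong[OF eR, of "\<lambda>V. sar V q"] q
          sMltD(1)[OF SW] sMltD(1)[OF SH'] scomp_simps(4)[of q "?S \<circ>\<^sub>s W" "(cfst C D)\<^sup>\<triangleright>"]
          scomp_simps(4)[of q "?S \<circ>\<^sub>s H" "(cfst C D)\<^sup>\<triangleright>"] scomp_simps(4)[of q "?S \<circ>\<^sub>s W" "(csnd C D)\<^sup>\<triangleright>"]
          scomp_simps(4)[of q "?S \<circ>\<^sub>s H" "(csnd C D)\<^sup>\<triangleright>"]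
        by (intro prod_arr_eqI[OF sMltD(8)[OF SW q] sMltD(8)[OF SH' q]]) (simp_all del: scomp_simps)
    qed
    then show "W = H" by (rule sisos_cancel_left[OF S Ws H])
  qed
qed

subsection \<open>Comparison with the cartesian structure of Cat\<close>

lemma seq_iso_sid:
  assumes "category C" "category D"
  shows "seq_iso C D (sid C\<^sub>\<triangleright>) (sid D\<^sub>\<triangleright>) = seq_prod C D"
proof -
  interpret cat_pair C D using assms by (simp add: cat_pair_def)
  show ?thesis
    unfolding seq_iso_def tensor_map_sid[OF M N] by (rule scomp_sid(1)[OF seq_prod(1)])
qed

lemma seq_sid_sisos: "category C \<Longrightarrow> sid C\<^sub>\<triangleright> \<in> sisos C\<^sub>\<triangleright> C\<^sub>\<triangleright>"
  by (simp add: category.sym_multicategory_seq)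

lemma prod_fun:
  assumes F: "F \<in> Cat C C'" and G: "G \<in> Cat D D'"
  shows "F \<times>\<^sub>f G \<in> Cat (C \<times>\<^sub>c D) (C' \<times>\<^sub>c D')"
proof -
  note FD = functorD[OF F] and GD = functorD[OF G]
  interpret C: category C by (rule FD)
  interpret D: category D by (rule GD)
  show ?thesis
    by (rule CatI)
      (use category_prod[OF FD(3) GD(3)] category_prod[OF FD(4) GD(4)] in
        \<open>auto simp: prod_fun_def FD(1,2,7-12) GD(1,2,7-12) C.Dom_Ob C.Cod_Ob C.Idn_Ar C.Cmp_Ar D.Dom_Ob D.Cod_Ob D.Idn_Ar D.Cmp_Ar\<close>)
qed

lemma sar_seq_fun: "F \<in> Cat C D \<Longrightarrow> a \<in> arr C\<^sub>\<triangleright> \<Longrightarrow> sar F\<^sup>\<triangleright> a = (map (car F) (fst a), cob F (snd a))"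
  using functorD(1)[of F C D] by (cases a) simp

lemma seq_prod_natural:
  assumes F: "F \<in> Cat C C'" and G: "G \<in> Cat D D'"
  shows "seq_prod C' D' \<circ>\<^sub>s (F\<^sup>\<triangleright> \<otimes>\<^sub>f G\<^sup>\<triangleright>) = (F \<times>\<^sub>f G)\<^sup>\<triangleright> \<circ>\<^sub>s seq_prod C D"
proof -
  note FD = functorD[OF F] and GD = functorD[OF G]
  interpret cat_pair C D using FD GD by (simp add: cat_pair_def)
  note s = seq_iso[OF FD(4) GD(4) seq_fun_sMlt[OF F] seq_fun_sMlt[OF G]]
  note p = seq_prod
  note FG = prod_fun[OF F G]
  have sa: "sar (seq_prod C D) a \<in> arr (C \<times>\<^sub>c D)\<^sub>\<triangleright>" if "a \<in> arr (C\<^sub>\<triangleright> \<otimes> D\<^sub>\<triangleright>)" for a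
    using sMltD(8)[OF p(1) that] .
  have d: "sdom (seq_prod C D) = C\<^sub>\<triangleright> \<otimes> D\<^sub>\<triangleright>" using sMltD(1)[OF p(1)] .
  have FGv: "cob (F \<times>\<^sub>f G) (A, X) = (cob F A, cob G X)" if "A \<in> Ob C" "X \<in> Ob D" for A X
    using that FD GD by (simp add: prod_fun_def)
  have FGa: "car (F \<times>\<^sub>f G) (f, h) = (car F f, car G h)" if "f \<in> Ar C" "h \<in> Ar D" for f h
    using that FD GD by (simp add: prod_fun_def)
  have "seq_iso C' D' F\<^sup>\<triangleright> G\<^sup>\<triangleright> = (F \<times>\<^sub>f G)\<^sup>\<triangleright> \<circ>\<^sub>s seq_prod C D"
  proof (rule tensor_ext[OF s(1) scomp_sMlt[OF seq_fun_sMlt[OF FG] p(1)]])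
    fix a X assume a: "a \<in> arr C\<^sub>\<triangleright>" and X: "X \<in> obj D\<^sub>\<triangleright>"
    obtain fs A where fs: "a = (fs, A)" by fastforce
    have g: "gL a X \<in> arr CT" using a X by simp
    show "sar (seq_iso C' D' F\<^sup>\<triangleright> G\<^sup>\<triangleright>) (gL a X) = sar ((F \<times>\<^sub>f G)\<^sup>\<triangleright> \<circ>\<^sub>s seq_prod C D) (gL a X)"
      using a X g sar_seq_fun[OF FG sa[OF g]] D.Idn_Ar[of X] FD(1)
      by (simp add: d s(3) p(3) fs FGv FGa GD(11))
  next
    fix A b assume A: "A \<in> obj C\<^sub>\<triangleright>" and b: "b \<in> arr D\<^sub>\<triangleright>"
    obtain hs X where hs: "b = (hs, X)" by fastforce
    have g: "gR A b \<in> arr CT" using A b by simp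
    show "sar (seq_iso C' D' F\<^sup>\<triangleright> G\<^sup>\<triangleright>) (gR A b) = sar ((F \<times>\<^sub>f G)\<^sup>\<triangleright> \<circ>\<^sub>s seq_prod C D) (gR A b)"
      using A b g sar_seq_fun[OF FG sa[OF g]] C.Idn_Ar[of A] GD(1)
      by (simp add: d s(4) p(4) hs FGv FGa FD(11))
  qed (simp_all add: d s(2) p(2) FGv)
  then show ?thesis unfolding seq_iso_def .
qed

text \<open>With identities for \<open>J\<close>, \<open>K\<close> and \<open>L\<close>, the formula
  for \<open>assoc\<close> in \<open>assoc_aux\<close> is this equation solved for the
  associator.\<close>

lemma seq_prod_assoc:
  assumes cat: "category C" "category D" "category E"
  shows "(cassoc C D E)\<^sup>\<triangleright> \<circ>\<^sub>s seq_prod (C \<times>\<^sub>c D) E \<circ>\<^sub>s (seq_prod C D \<otimes>\<^sub>f sid E\<^sub>\<triangleright>) =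
       seq_prod C (D \<times>\<^sub>c E) \<circ>\<^sub>s (sid C\<^sub>\<triangleright> \<otimes>\<^sub>f seq_prod D E) \<circ>\<^sub>s assoc C\<^sub>\<triangleright> D\<^sub>\<triangleright> E\<^sub>\<triangleright>"
proof -
  interpret CD: cat_pair C D using cat by (simp add: cat_pair_def)
  interpret DE: cat_pair D E using cat by (simp add: cat_pair_def)
  note id = seq_sid_sisos[OF cat(1)] seq_sid_sisos[OF cat(2)] seq_sid_sisos[OF cat(3)]
  note CDc = category_prod[OF cat(1,2)] and DEc = category_prod[OF cat(2,3)]
  interpret CD_E: cat_pair "C \<times>\<^sub>c D" E using cat CDc by (simp add: cat_pair_def)
  note a = assoc_aux[OF cat id, unfolded seq_iso_sid[OF cat(1,2)] seq_iso_sid[OF cat(2,3)]]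
  note i3 = seq_iso_sisos[OF CDc cat(3) CD.seq_prod_sisos id(3)]
  note i4 = seq_iso_sisos[OF cat(1) DEc id(1) DE.seq_prod_sisos]
  note ca = seq_fun_sMlt[OF cassoc(1)[OF cat]]
  have "seq_iso C (D \<times>\<^sub>c E) (sid C\<^sub>\<triangleright>) (seq_prod D E) \<circ>\<^sub>s assoc C\<^sub>\<triangleright> D\<^sub>\<triangleright> E\<^sub>\<triangleright> =
      (cassoc C D E)\<^sup>\<triangleright> \<circ>\<^sub>s seq_iso (C \<times>\<^sub>c D) E (seq_prod C D) (sid E\<^sub>\<triangleright>)"
    unfolding a(1) by (rule sinv_cancel[OF i4 scomp_sMlt[OF ca sisosD(1)[OF i3]]])
  then show ?thesis
    unfolding seq_iso_def
    using scomp_assoc[OF ca CD_E.seq_prod(1) tensor_map(1)[OF CD.seq_prod(1) sisosD(1)[OF id(3)]]] by simp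
qed

lemma seq_prod_unit:
  assumes "category C"
  shows "(clunit C)\<^sup>\<triangleright> = seq_prod one_cat C \<circ>\<^sub>s lunit C\<^sub>\<triangleright>" "(crunit C)\<^sup>\<triangleright> = seq_prod C one_cat \<circ>\<^sub>s runit C\<^sub>\<triangleright>"
proof -
  note id = sisosD(1)[OF seq_sid_sisos[OF assms]]
  note u = unit_seq_iso[OF assms id] and cl = seq_fun_sMlt[OF clunit(1)[OF assms]]
    and cr = seq_fun_sMlt[OF crunit(1)[OF assms]]
  show "(clunit C)\<^sup>\<triangleright> = seq_prod one_cat C \<circ>\<^sub>s lunit C\<^sub>\<triangleright>"
    using u(1) seq_iso_sid[OF category_one assms] scomp_sid(1)[OF cl] by (simp add: one_smc_def)
  show "(crunit C)\<^sup>\<triangleright> = seq_prod C one_cat \<circ>\<^sub>s runit C\<^sub>\<triangleright>"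
    using u(2) seq_iso_sid[OF assms category_one] scomp_sid(1)[OF cr] by (simp add: one_smc_def)
qed

lemma seq_prod_proj:
  assumes "category C" "category D"
  shows "(cfst C D)\<^sup>\<triangleright> \<circ>\<^sub>s seq_prod C D = projL C\<^sub>\<triangleright> D\<^sub>\<triangleright>" "(csnd C D)\<^sup>\<triangleright> \<circ>\<^sub>s seq_prod C D = projR C\<^sub>\<triangleright> D\<^sub>\<triangleright>"
  using proj_seq[OF assms seq_sid_sisos[OF assms(1)] seq_sid_sisos[OF assms(2)]]
  unfolding seq_iso_sid[OF assms] by auto


subsection \<open>The internal hom\<close>

lemma ihom_simps [simp]:
  "obj (ihom M N) = sMlt M N"
  "(Fs, F, \<alpha>) \<in> arr (ihom M N) \<longleftrightarrow> set Fs \<subseteq> sMlt M N \<and> F \<in> sMlt M N \<and> multi_trans M N Fs F \<alpha>"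
  "src (ihom M N) (Fs, F, \<alpha>) = Fs" "tgt (ihom M N) (Fs, F, \<alpha>) = F"
  "idn (ihom M N) F = ([F], F, \<lambda>A\<in>obj M. idn N (sob F A))"
  "cmp (ihom M N) (Fs, F, \<alpha>) \<beta>s = (concat (map fst \<beta>s), F,
     \<lambda>A\<in>obj M. cmp N (\<alpha> A) (map (\<lambda>(Gs, G, \<beta>). \<beta> A) \<beta>s))"
  "act (ihom M N) \<sigma> (Fs, F, \<alpha>) = (permute_list \<sigma> Fs, F, \<lambda>A\<in>obj M. act N \<sigma> (\<alpha> A))"
  by (simp_all add: ihom_def)

lemma multi_transD:
  assumes "multi_trans M N Fs F \<alpha>"
  shows "\<alpha> \<in> extensional (obj M)" "A \<in> obj M \<Longrightarrow> \<alpha> A \<in> arr N"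
    "A \<in> obj M \<Longrightarrow> src N (\<alpha> A) = map (\<lambda>G. sob G A) Fs" "A \<in> obj M \<Longrightarrow> tgt N (\<alpha> A) = sob F A"
    "f \<in> arr M \<Longrightarrow> cmp N (sar F f) (map \<alpha> (src M f)) =
        act N (transp_perm (length (src M f)) (length Fs)) (cmp N (\<alpha> (tgt M f)) (map (\<lambda>G. sar G f) Fs))"
  using assms unfolding multi_trans_def by auto

lemma composable_ihom_at:
  assumes "composable (ihom M N) (Fs, F, \<alpha>) \<beta>s" "A \<in> obj M"
  shows "composable N (\<alpha> A) (map (\<lambda>(Gs, G, \<beta>). \<beta> A) \<beta>s)"
proof -
  have f: "(Fs, F, \<alpha>) \<in> arr (ihom M N)" and b: "\<beta> \<in> set \<beta>s \<Longrightarrow> \<beta> \<in> arr (ihom M N)"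
    and Fs: "Fs = map (tgt (ihom M N)) \<beta>s" for \<beta>
    using assms(1) unfolding composable_def by auto
  have v: "(\<lambda>(Gs, G, \<beta>). \<beta> A) \<beta> \<in> arr N \<and>
      tgt N ((\<lambda>(Gs, G, \<beta>). \<beta> A) \<beta>) = sob (tgt (ihom M N) \<beta>) A" if "\<beta> \<in> set \<beta>s" for \<beta>
    using b[OF that] multi_transD assms(2) by (cases \<beta>) auto
  show ?thesis
    unfolding composable_def using f multi_transD[of M N Fs F \<alpha>] assms(2) v
    by (auto simp: Fs)
qed

text \<open>Allows a law of the form \<open>x = act P (transp_perm n m) y\<close> to be solved for
  \<open>y\<close>, which exchanges the roles of the two variables.\<close>

lemma act_transp_transp:
  assumes "sym_multicategory P" "y \<in> arr P" "length (src P y) = n * m"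
  shows "act P (transp_perm m n) (act P (transp_perm n m) y) = y"
proof -
  interpret sym_multicategory P by fact
  have "act P (transp_perm n m \<circ> transp_perm m n) y = act P (transp_perm m n) (act P (transp_perm n m) y)"
    using act_comp[OF assms(2), of "transp_perm n m" "transp_perm m n"] transp_perm_permutes[of n m]
      transp_perm_permutes[of m n] assms(3) by (simp add: mult.commute)
  then show ?thesis using act_id[OF assms(2)] transp_perm_inverse by metis
qed

text \<open>The last claim gives the size of the grid on which the transposition in the naturality
  condition acts.\<close>

lemma multi_trans_composable:
  assumes t: "multi_trans M N Fs F \<alpha>" and Fs: "set Fs \<subseteq> sMlt M N" and F: "F \<in> sMlt M N" and f: "f \<in> arr M"
  shows "composable N (sar F f) (map \<alpha> (src M f))"
    "composable N (\<alpha> (tgt M f)) (map (\<lambda>G. sar G f) Fs)"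
    "length (src N (cmp N (\<alpha> (tgt M f)) (map (\<lambda>G. sar G f) Fs))) = length (src M f) * length Fs"
proof -
  note D = multi_transD[OF t] and FD = sMltD[OF F]
  interpret M: sym_multicategory M by (rule FD)
  interpret N: sym_multicategory N by (rule FD)
  have G: "sar G f \<in> arr N" "src N (sar G f) = map (sob G) (src M f)" "tgt N (sar G f) = sob G (tgt M f)"
    if "G \<in> set Fs" for G using sMltD(8-10)[of G M N f] Fs f that by auto
  show "composable N (sar F f) (map \<alpha> (src M f))"
    unfolding composable_def using FD f D M.src_obj[OF f] by (auto simp: subset_iff)
  show c: "composable N (\<alpha> (tgt M f)) (map (\<lambda>G. sar G f) Fs)"
    unfolding composable_def using D M.tgt_obj[OF f] G by auto
  have m: "map (src N) (map (\<lambda>G. sar G f) Fs) = map (\<lambda>G. map (sob G) (src M f)) Fs"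
    using G by auto
  show "length (src N (cmp N (\<alpha> (tgt M f)) (map (\<lambda>G. sar G f) Fs))) = length (src M f) * length Fs"
    unfolding N.src_cmp[OF c] m by (simp add: length_concat comp_def sum_list_triv)
qed

section \<open>Action of functors on the internal hom\<close>

lemma ihom_map_simps [simp]:
  "sdom (ihom_map G H) = ihom (scod G) (sdom H)" "scod (ihom_map G H) = ihom (sdom G) (scod H)"
  by (simp_all add: ihom_map_def)

text \<open>The conclusion is \<open>smorph\<close>, with the axioms assumed for the domain hom
  only: for the codomain hom they are to be deduced from this by \<open>smorph_bij\<close>, in
  \<open>ihom_iso\<close>.\<close>

lemma ihom_map_smorph:
  assumes G: "G \<in> sMlt N' N" and H: "H \<in> sMlt P P'"
  shows "sym_multicategory (ihom N P) \<Longrightarrow> smorph (ihom_map G H)"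
    and "F \<in> sMlt N P \<Longrightarrow> sob (ihom_map G H) F = H \<circ>\<^sub>s F \<circ>\<^sub>s G"
    and "(Fs, F, \<alpha>) \<in> arr (ihom N P) \<Longrightarrow> sar (ihom_map G H) (Fs, F, \<alpha>) =
      (map (\<lambda>F'. H \<circ>\<^sub>s F' \<circ>\<^sub>s G) Fs, H \<circ>\<^sub>s F \<circ>\<^sub>s G, \<lambda>A\<in>obj N'. sar H (\<alpha> (sob G A)))"
    and "x \<in> arr (ihom N P) \<Longrightarrow> sar (ihom_map G H) x \<in> arr (ihom N' P')"
proof -
  note GD = sMltD[OF G] and HD = sMltD[OF H]
  interpret N': sym_multicategory N' by (rule GD)
  interpret P: sym_multicategory P by (rule HD)
  have o: "H \<circ>\<^sub>s F \<circ>\<^sub>s G \<in> sMlt N' P'" if "F \<in> sMlt N P" for F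
    using scomp_sMlt[OF scomp_sMlt[OF H that] G] .
  show ob: "F \<in> sMlt N P \<Longrightarrow> sob (ihom_map G H) F = H \<circ>\<^sub>s F \<circ>\<^sub>s G" for F
    by (simp add: ihom_map_def GD HD)
  show ar: "(Fs, F, \<alpha>) \<in> arr (ihom N P) \<Longrightarrow> sar (ihom_map G H) (Fs, F, \<alpha>) =
      (map (\<lambda>F'. H \<circ>\<^sub>s F' \<circ>\<^sub>s G) Fs, H \<circ>\<^sub>s F \<circ>\<^sub>s G, \<lambda>A\<in>obj N'. sar H (\<alpha> (sob G A)))" for Fs F \<alpha>
    by (simp add: ihom_map_def GD(1,2) HD(1,2))
  have valo: "sob (H \<circ>\<^sub>s F \<circ>\<^sub>s G) A = sob H (sob F (sob G A))" if "F \<in> sMlt N P" "A \<in> obj N'" for F A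
    using that GD sMltD(1)[OF that(1)] by simp
  have vala: "sar (H \<circ>\<^sub>s F \<circ>\<^sub>s G) f = sar H (sar F (sar G f))" if "F \<in> sMlt N P" "f \<in> arr N'" for F f
    using that GD sMltD(1)[OF that(1)] by simp
  \<comment> \<open>The condition at an arrow \<open>f\<close> is the image under \<open>H\<close>
    of the condition for \<open>\<alpha>\<close> at \<open>sar G f\<close>.\<close>
  have mt: "multi_trans N' P' (map (\<lambda>F'. H \<circ>\<^sub>s F' \<circ>\<^sub>s G) Fs) (H \<circ>\<^sub>s F \<circ>\<^sub>s G) (\<lambda>A\<in>obj N'. sar H (\<alpha> (sob G A)))"
    if Fs: "set Fs \<subseteq> sMlt N P" and F: "F \<in> sMlt N P" and t: "multi_trans N P Fs F \<alpha>" for Fs F \<alpha>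
    unfolding multi_trans_def
  proof (intro conjI ballI)
    note D = multi_transD[OF t]
    fix A assume A: "A \<in> obj N'"
    show "(\<lambda>A\<in>obj N'. sar H (\<alpha> (sob G A))) A \<in> arr P'"
      "tgt P' ((\<lambda>A\<in>obj N'. sar H (\<alpha> (sob G A))) A) = sob (H \<circ>\<^sub>s F \<circ>\<^sub>s G) A"
      using A D(2-4) GD(7) HD(8,10) by (simp_all add: GD(1) sMltD(1)[OF F])
    have "map (\<lambda>K. sob K A) (map (\<lambda>F'. H \<circ>\<^sub>s F' \<circ>\<^sub>s G) Fs) = map (\<lambda>K. sob H (sob K (sob G A))) Fs"
      using Fs valo A by auto
    then show "src P' ((\<lambda>A\<in>obj N'. sar H (\<alpha> (sob G A))) A) =
        map (\<lambda>K. sob K A) (map (\<lambda>F'. H \<circ>\<^sub>s F' \<circ>\<^sub>s G) Fs)"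
      using A D(2,3) GD(7) HD(9) by (simp del: map_map) (simp add: comp_def)
  next
    note D = multi_transD[OF t]
    fix f assume f: "f \<in> arr N'"
    have Gf: "sar G f \<in> arr N" using f GD by simp
    note c = multi_trans_composable[OF t Fs F Gf]
    have m1: "map (\<lambda>A\<in>obj N'. sar H (\<alpha> (sob G A))) (src N' f) = map (sar H) (map \<alpha> (src N (sar G f)))"
      using N'.src_obj[OF f] GD(9)[OF f] by auto
    have m2: "map (\<lambda>K. sar K f) (map (\<lambda>F'. H \<circ>\<^sub>s F' \<circ>\<^sub>s G) Fs) = map (sar H) (map (\<lambda>K. sar K (sar G f)) Fs)"
      using Fs vala f by auto
    have len: "length (src N' f) = length (src N (sar G f))" using GD(9)[OF f] by simp
    have "cmp P' (sar H (sar F (sar G f))) (map (sar H) (map \<alpha> (src N (sar G f)))) =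
        sar H (act P (transp_perm (length (src N (sar G f))) (length Fs))
          (cmp P (\<alpha> (tgt N (sar G f))) (map (\<lambda>K. sar K (sar G f)) Fs)))"
      using HD(12)[OF c(1)] D(5)[OF Gf] by simp
    also have "\<dots> = act P' (transp_perm (length (src N (sar G f))) (length Fs))
        (cmp P' (sar H (\<alpha> (tgt N (sar G f)))) (map (sar H) (map (\<lambda>K. sar K (sar G f)) Fs)))"
      using HD(13)[OF P.cmp_arr[OF c(2)]] HD(12)[OF c(2)] c(3) transp_perm_permutes by simp
    finally show "cmp P' (sar (H \<circ>\<^sub>s F \<circ>\<^sub>s G) f) (map (\<lambda>A\<in>obj N'. sar H (\<alpha> (sob G A))) (src N' f)) =
        act P' (transp_perm (length (src N' f)) (length (map (\<lambda>F'. H \<circ>\<^sub>s F' \<circ>\<^sub>s G) Fs)))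
         (cmp P' ((\<lambda>A\<in>obj N'. sar H (\<alpha> (sob G A))) (tgt N' f))
           (map (\<lambda>K. sar K f) (map (\<lambda>F'. H \<circ>\<^sub>s F' \<circ>\<^sub>s G) Fs)))"
      unfolding vala[OF F f] m1 m2 length_map len using f GD(10)[OF f] N'.tgt_obj[OF f] by simp
  qed simp
  have mem: "sar (ihom_map G H) x \<in> arr (ihom N' P')" if "x \<in> arr (ihom N P)" for x
  proof -
    obtain Fs F \<alpha> where xe: "x = (Fs, F, \<alpha>)" by (cases x)
    show ?thesis using that ar[OF that[unfolded xe]] mt o by (auto simp: xe)
  qed
  then show "x \<in> arr (ihom N P) \<Longrightarrow> sar (ihom_map G H) x \<in> arr (ihom N' P')" .
  assume IH: "sym_multicategory (ihom N P)"
  interpret I: sym_multicategory "ihom N P" by fact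
  show "smorph (ihom_map G H)"
    unfolding smorph_def ihom_map_simps GD(1,2) HD(1,2)
  proof (intro conjI ballI allI impI)
    show "sob (ihom_map G H) \<in> obj (ihom N P) \<rightarrow>\<^sub>E obj (ihom N' P')"
      using o by (auto simp: ihom_map_def GD(1,2) HD(1,2))
    show "sar (ihom_map G H) \<in> arr (ihom N P) \<rightarrow>\<^sub>E arr (ihom N' P')"
      using mem by (intro PiE_I) (auto simp: ihom_map_def GD(1,2) HD(1,2))
  next
    fix x assume x: "x \<in> arr (ihom N P)"
    obtain Fs F \<alpha> where xe: "x = (Fs, F, \<alpha>)" by (cases x)
    show "src (ihom N' P') (sar (ihom_map G H) x) = map (sob (ihom_map G H)) (src (ihom N P) x)"
      "tgt (ihom N' P') (sar (ihom_map G H) x) = sob (ihom_map G H) (tgt (ihom N P) x)"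
      using x ar[OF x[unfolded xe]] ob by (auto simp: xe)
  next
    fix F assume F: "F \<in> obj (ihom N P)"
    then have "F \<in> sMlt N P" by simp
    then show "sar (ihom_map G H) (idn (ihom N P) F) = idn (ihom N' P') (sob (ihom_map G H) F)"
      using ar[OF I.idn_arr[OF F, unfolded ihom_simps(5)]] GD HD ob[of F] sMltD(1,7)[of F N P]
      by (simp cong: restrict_cong)
  next
    fix x \<beta>s assume c: "composable (ihom N P) x \<beta>s"
    obtain Fs F \<alpha> where xe: "x = (Fs, F, \<alpha>)" by (cases x)
    note x = composableD(1)[OF c, unfolded xe]
    have b: "fst (sar (ihom_map G H) \<beta>) = map (\<lambda>F'. H \<circ>\<^sub>s F' \<circ>\<^sub>s G) (fst \<beta>)"
      "A \<in> obj N' \<Longrightarrow> (\<lambda>(Gs, G, \<beta>). \<beta> A) (sar (ihom_map G H) \<beta>) = sar H ((\<lambda>(Gs, G, \<beta>). \<beta>) \<beta> (sob G A))"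
      if "\<beta> \<in> set \<beta>s" for \<beta> A
    proof -
      obtain Gs K \<gamma> where be: "\<beta> = (Gs, K, \<gamma>)" by (cases \<beta>)
      note ar[OF composable_arr[OF c that, unfolded be]]
      then show "fst (sar (ihom_map G H) \<beta>) = map (\<lambda>F'. H \<circ>\<^sub>s F' \<circ>\<^sub>s G) (fst \<beta>)"
        "A \<in> obj N' \<Longrightarrow> (\<lambda>(Gs, G, \<beta>). \<beta> A) (sar (ihom_map G H) \<beta>) = sar H ((\<lambda>(Gs, G, \<beta>). \<beta>) \<beta> (sob G A))"
        by (simp_all add: be)
    qed
    have m1: "map (\<lambda>F'. H \<circ>\<^sub>s F' \<circ>\<^sub>s G) (concat (map fst \<beta>s)) = concat (map fst (map (sar (ihom_map G H)) \<beta>s))"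
      using b(1) by (simp add: map_concat cong: map_cong)
    have m2: "sar H (cmp P (\<alpha> (sob G A)) (map (\<lambda>(Gs, K, \<beta>). \<beta> (sob G A)) \<beta>s)) =
        cmp P' (sar H (\<alpha> (sob G A))) (map (\<lambda>(Gs, K, \<beta>). \<beta> A) (map (sar (ihom_map G H)) \<beta>s))"
      if A: "A \<in> obj N'" for A
    proof -
      have m: "map (sar H) (map (\<lambda>(Gs, K, \<beta>). \<beta> (sob G A)) \<beta>s) =
          map (\<lambda>(Gs, K, \<beta>). \<beta> A) (map (sar (ihom_map G H)) \<beta>s)"
        using b(2)[OF _ A] by (auto simp: split_def)
      show ?thesis
        using HD(12)[OF composable_ihom_at[OF c[unfolded xe] GD(7)[OF A]]] unfolding m .
    qed
    have "cmp (ihom N P) (Fs, F, \<alpha>) \<beta>s \<in> arr (ihom N P)" using I.cmp_arr[OF c] unfolding xe .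
    then show "sar (ihom_map G H) (cmp (ihom N P) x \<beta>s) =
        cmp (ihom N' P') (sar (ihom_map G H) x) (map (sar (ihom_map G H)) \<beta>s)"
      using m1 m2 GD(7) unfolding xe ar[OF x] ihom_simps(6)
      by (subst ar) (auto simp del: map_map ihom_simps(2) cong: restrict_cong)
  next
    fix x \<sigma> assume x: "x \<in> arr (ihom N P) \<and> \<sigma> permutes {..<length (src (ihom N P) x)}"
    obtain Fs F \<alpha> where xe: "x = (Fs, F, \<alpha>)" by (cases x)
    have xa: "(Fs, F, \<alpha>) \<in> arr (ihom N P)" and \<sigma>: "\<sigma> permutes {..<length Fs}" using x by (auto simp: xe)
    have "act (ihom N P) \<sigma> (Fs, F, \<alpha>) \<in> arr (ihom N P)"
      using I.act_arr[OF xa, of \<sigma>] \<sigma> by simp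
    moreover have "sar H (act P \<sigma> (\<alpha> (sob G A))) = act P' \<sigma> (sar H (\<alpha> (sob G A)))" if "A \<in> obj N'" for A
      using HD(13)[of "\<alpha> (sob G A)" \<sigma>] xa multi_transD(2,3)[of N P Fs F \<alpha> "sob G A"] GD(7)[OF that] \<sigma> by simp
    ultimately show "sar (ihom_map G H) (act (ihom N P) \<sigma> x) = act (ihom N' P') \<sigma> (sar (ihom_map G H) x)"
      using GD(7) \<sigma> unfolding xe ar[OF xa] ihom_simps(7)
      by (subst ar) (auto simp: permute_list_map simp del: ihom_simps(2) cong: restrict_cong)
  qed
qed

text \<open>Functoriality in a pointwise form, which can be used while it is still open whether the
  homs are symmetric multicategories.\<close>

lemma ihom_map_scomp_at:
  assumes G: "G \<in> sMlt N' N" and H: "H \<in> sMlt P P'" and G': "G' \<in> sMlt N'' N'" and H': "H' \<in> sMlt P' P''"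
  shows "F \<in> sMlt N P \<Longrightarrow> sob (ihom_map G' H') (sob (ihom_map G H) F) = sob (ihom_map (G \<circ>\<^sub>s G') (H' \<circ>\<^sub>s H)) F"
    and "x \<in> arr (ihom N P) \<Longrightarrow> sar (ihom_map G H) x \<in> arr (ihom N' P') \<Longrightarrow>
      sar (ihom_map G' H') (sar (ihom_map G H) x) = sar (ihom_map (G \<circ>\<^sub>s G') (H' \<circ>\<^sub>s H)) x"
proof -
  note m = ihom_map_smorph(2,3)[OF G H] and m' = ihom_map_smorph(2,3)[OF G' H']
    and mm = ihom_map_smorph(2,3)[OF scomp_sMlt[OF G G'] scomp_sMlt[OF H' H]]
  have e: "H' \<circ>\<^sub>s (H \<circ>\<^sub>s F \<circ>\<^sub>s G) \<circ>\<^sub>s G' = (H' \<circ>\<^sub>s H) \<circ>\<^sub>s F \<circ>\<^sub>s (G \<circ>\<^sub>s G')" if F: "F \<in> sMlt N P" for F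
    using scomp_assoc[OF H' scomp_sMlt[OF H F] G] scomp_assoc[OF H' H F]
      scomp_assoc[OF scomp_sMlt[OF scomp_sMlt[OF H' H] F] G G'] by simp
  show "F \<in> sMlt N P \<Longrightarrow> sob (ihom_map G' H') (sob (ihom_map G H) F) = sob (ihom_map (G \<circ>\<^sub>s G') (H' \<circ>\<^sub>s H)) F"
    using m(1)[of F] m'(1)[of "H \<circ>\<^sub>s F \<circ>\<^sub>s G"] mm(1)[of F] e[of F]
      scomp_sMlt[OF scomp_sMlt[OF H, of F] G] by simp
  assume x: "x \<in> arr (ihom N P)" and y: "sar (ihom_map G H) x \<in> arr (ihom N' P')"
  obtain Fs F \<alpha> where xe: "x = (Fs, F, \<alpha>)" by (cases x)
  have m3: "map (\<lambda>F'. H' \<circ>\<^sub>s F' \<circ>\<^sub>s G') (map (\<lambda>F'. H \<circ>\<^sub>s F' \<circ>\<^sub>s G) Fs) =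
      map (\<lambda>F'. (H' \<circ>\<^sub>s H) \<circ>\<^sub>s F' \<circ>\<^sub>s (G \<circ>\<^sub>s G')) Fs"
    using x e by (auto simp: xe subset_iff)
  show "sar (ihom_map G' H') (sar (ihom_map G H) x) = sar (ihom_map (G \<circ>\<^sub>s G') (H' \<circ>\<^sub>s H)) x"
    unfolding xe m(2)[OF x[unfolded xe]] mm(2)[OF x[unfolded xe]]
      m'(2)[OF y[unfolded xe m(2)[OF x[unfolded xe]]]] m3
    using x e[of F] sMltD[OF G'] sMltD(1)[OF H] multi_transD(2)[of N P Fs F \<alpha>] sMltD(7)[OF G]
    by (auto simp: xe cong: restrict_cong)
qed

lemma ihom_map_sid_at:
  assumes N: "sym_multicategory N" and P: "sym_multicategory P"
  shows "F \<in> sMlt N P \<Longrightarrow> sob (ihom_map (sid N) (sid P)) F = F"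
    and "x \<in> arr (ihom N P) \<Longrightarrow> sar (ihom_map (sid N) (sid P)) x = x"
proof -
  note m = ihom_map_smorph(2,3)[OF sid_sMlt[OF N] sid_sMlt[OF P]]
  show "F \<in> sMlt N P \<Longrightarrow> sob (ihom_map (sid N) (sid P)) F = F" using m(1) by simp
  assume x: "x \<in> arr (ihom N P)"
  obtain Fs F \<alpha> where xe: "x = (Fs, F, \<alpha>)" by (cases x)
  have t: "multi_trans N P Fs F \<alpha>" and Fs: "set Fs \<subseteq> sMlt N P" and F: "F \<in> sMlt N P" using x by (auto simp: xe)
  have "(\<lambda>A\<in>obj N. sar (sid P) (\<alpha> (sob (sid N) A))) = \<alpha>"
    using multi_transD(1,2)[OF t] by (intro extensionalityI[of _ "obj N"]) auto
  moreover have "map (\<lambda>F'. sid P \<circ>\<^sub>s F' \<circ>\<^sub>s sid N) Fs = Fs" using Fs by (intro map_idI) auto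
  ultimately show "sar (ihom_map (sid N) (sid P)) x = x"
    unfolding xe m(2)[OF x[unfolded xe]] using F by simp
qed

section \<open>Functor categories\<close>

lemma fun_cat_simps [simp]:
  "Ob (fun_cat C D) = Cat C D"
  "(F, G, \<tau>) \<in> Ar (fun_cat C D) \<longleftrightarrow> F \<in> Cat C D \<and> G \<in> Cat C D \<and> nat_trans F G \<tau>"
  "Dom (fun_cat C D) (F, G, \<tau>) = F" "Cod (fun_cat C D) (F, G, \<tau>) = G"
  "Idn (fun_cat C D) F = (F, F, \<lambda>X\<in>Ob C. Idn D (cob F X))"
  "Cmp (fun_cat C D) (G', H, \<tau>) (F, G, \<upsilon>) = (F, H, \<lambda>X\<in>Ob C. Cmp D (\<tau> X) (\<upsilon> X))"
  by (simp_all add: fun_cat_def)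

lemma nat_transD:
  assumes "nat_trans F G \<tau>" "F \<in> Cat C D"
  shows "\<tau> \<in> extensional (Ob C)" "X \<in> Ob C \<Longrightarrow> \<tau> X \<in> Ar D" "X \<in> Ob C \<Longrightarrow> Dom D (\<tau> X) = cob F X"
    "X \<in> Ob C \<Longrightarrow> Cod D (\<tau> X) = cob G X"
    "f \<in> Ar C \<Longrightarrow> Cmp D (car G f) (\<tau> (Dom C f)) = Cmp D (\<tau> (Cod C f)) (car F f)"
  using assms functorD(1,2)[OF assms(2)] unfolding nat_trans_def by auto

lemma nat_transI:
  assumes "F \<in> Cat C D" "\<tau> \<in> extensional (Ob C)" "\<And>X. X \<in> Ob C \<Longrightarrow> \<tau> X \<in> Ar D"
    "\<And>X. X \<in> Ob C \<Longrightarrow> Dom D (\<tau> X) = cob F X" "\<And>X. X \<in> Ob C \<Longrightarrow> Cod D (\<tau> X) = cob G X"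
    "\<And>f. f \<in> Ar C \<Longrightarrow> Cmp D (car G f) (\<tau> (Dom C f)) = Cmp D (\<tau> (Cod C f)) (car F f)"
  shows "nat_trans F G \<tau>"
  using assms functorD(1,2)[OF assms(1)] unfolding nat_trans_def by auto

lemma category_fun_cat:
  assumes "category C" "category D"
  shows "category (fun_cat C D)"
proof -
  interpret C: category C by fact
  interpret D: category D by fact
  have idn: "nat_trans F F (\<lambda>X\<in>Ob C. Idn D (cob F X))" if F: "F \<in> Cat C D" for F
  proof -
    note FD = functorD[OF F]
    have "Cmp D (car F f) (Idn D (cob F (Dom C f))) = car F f"
      "Cmp D (Idn D (cob F (Cod C f))) (car F f) = car F f" if "f \<in> Ar C" for f
      using that FD(8-10) D.Cmp_Idn[of "car F f"] D.Idn_Cmp[of "car F f"] by simp_all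
    then show ?thesis
      using FD(7) by (intro nat_transI[OF F]) (auto simp: D.Idn_Ar D.Dom_Idn D.Cod_Idn C.Dom_Ob C.Cod_Ob)
  qed
  have comp: "nat_trans F H (\<lambda>X\<in>Ob C. Cmp D (\<tau> X) (\<upsilon> X))"
    if F: "F \<in> Cat C D" and G: "G \<in> Cat C D" and H: "H \<in> Cat C D"
      and \<tau>: "nat_trans G H \<tau>" and \<upsilon>: "nat_trans F G \<upsilon>" for F G H \<tau> \<upsilon>
  proof (rule nat_transI[OF F])
    note t = nat_transD[OF \<tau> G] and u = nat_transD[OF \<upsilon> F]
    fix f assume f: "f \<in> Ar C"
    note FD = functorD[OF F] and GD = functorD[OF G] and HD = functorD[OF H]
    note ob = C.Dom_Ob[OF f] C.Cod_Ob[OF f]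
    have "Cmp D (car H f) (Cmp D (\<tau> (Dom C f)) (\<upsilon> (Dom C f))) =
        Cmp D (Cmp D (car H f) (\<tau> (Dom C f))) (\<upsilon> (Dom C f))"
      using f ob t u HD by (intro D.Cmp_assoc[symmetric]) auto
    also have "\<dots> = Cmp D (\<tau> (Cod C f)) (Cmp D (car G f) (\<upsilon> (Dom C f)))"
      unfolding t(5)[OF f] using f ob t u GD by (intro D.Cmp_assoc) auto
    also have "\<dots> = Cmp D (Cmp D (\<tau> (Cod C f)) (\<upsilon> (Cod C f))) (car F f)"
      unfolding u(5)[OF f] using f ob t u FD by (intro D.Cmp_assoc[symmetric]) auto
    finally show "Cmp D (car H f) ((\<lambda>X\<in>Ob C. Cmp D (\<tau> X) (\<upsilon> X)) (Dom C f)) =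
        Cmp D ((\<lambda>X\<in>Ob C. Cmp D (\<tau> X) (\<upsilon> X)) (Cod C f)) (car F f)" using ob by simp
  qed (use nat_transD[OF \<tau> G] nat_transD[OF \<upsilon> F] in \<open>auto simp: D.Cmp_Ar D.Dom_Cmp D.Cod_Cmp\<close>)
  have ext: "(\<lambda>X\<in>Ob C. \<sigma> X) = \<tau>" if "\<tau> \<in> extensional (Ob C)" "\<And>X. X \<in> Ob C \<Longrightarrow> \<sigma> X = \<tau> X" for \<sigma> \<tau>
    using that by (intro extensionalityI[of _ "Ob C"]) auto
  show ?thesis
  proof (rule category.intro)
    fix f assume f: "f \<in> Ar (fun_cat C D)"
    obtain F G \<tau> where fe: "f = (F, G, \<tau>)" by (cases f)
    have F: "F \<in> Cat C D" and G: "G \<in> Cat C D" and t: "nat_trans F G \<tau>" using f by (auto simp: fe)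
    note t = nat_transD[OF t F]
    have tid: "Cmp D (Idn D (cob G X)) (\<tau> X) = \<tau> X" "Cmp D (\<tau> X) (Idn D (cob F X)) = \<tau> X"
      if "X \<in> Ob C" for X
      using t(2-4)[OF that] D.Idn_Cmp[of "\<tau> X"] D.Cmp_Idn[of "\<tau> X"] by simp_all
    have "(\<lambda>X\<in>Ob C. Cmp D ((\<lambda>X\<in>Ob C. Idn D (cob G X)) X) (\<tau> X)) = \<tau>"
      using t(1) tid by (intro ext) auto
    then show "Cmp (fun_cat C D) (Idn (fun_cat C D) (Cod (fun_cat C D) f)) f = f"
      by (simp add: fe cong: restrict_cong)
    have "(\<lambda>X\<in>Ob C. Cmp D (\<tau> X) ((\<lambda>X\<in>Ob C. Idn D (cob F X)) X)) = \<tau>"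
      using t(1) tid by (intro ext) auto
    then show "Cmp (fun_cat C D) f (Idn (fun_cat C D) (Dom (fun_cat C D) f)) = f"
      by (simp add: fe cong: restrict_cong)
    fix g assume g: "g \<in> Ar (fun_cat C D)" "Cod (fun_cat C D) g = Dom (fun_cat C D) f"
    obtain E \<upsilon> where ge: "g = (E, F, \<upsilon>)" using g(2) by (cases g) (simp add: fe)
    show "Cmp (fun_cat C D) f g \<in> Ar (fun_cat C D)"
      using f g comp by (auto simp: fe ge)
    fix h assume h: "h \<in> Ar (fun_cat C D)" "Cod (fun_cat C D) h = Dom (fun_cat C D) g"
    obtain B \<omega> where he: "h = (B, E, \<omega>)" using h(2) by (cases h) (simp add: ge)
    have E: "E \<in> Cat C D" "nat_trans E F \<upsilon>" and B: "B \<in> Cat C D" "nat_trans B E \<omega>"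
      using g h by (auto simp: ge he)
    show "Cmp (fun_cat C D) (Cmp (fun_cat C D) f g) h = Cmp (fun_cat C D) f (Cmp (fun_cat C D) g h)"
      using t nat_transD[OF E(2,1)] nat_transD[OF B(2,1)]
      by (auto simp: fe ge he D.Cmp_assoc intro!: restrict_ext)
  qed (use idn in \<open>auto simp: fun_cat_def\<close>)
qed

text \<open>At a unary arrow the transposition disappears from the naturality condition of the
  internal hom, leaving one ordinary naturality square for each source functor.\<close>

lemma transp_perm_1: "transp_perm (Suc 0) n = id"
proof
  fix k show "transp_perm (Suc 0) n k = id k"
    using transp_perm_index[of 0 "Suc 0" k n]
      permutes_not_in[OF transp_perm_permutes[of "Suc 0" n], of k]
    by (cases "k < n") auto
qed

section \<open>The internal hom of images of categories\<close>

context cat_pair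
begin

abbreviation "fc \<equiv> fun_cat C D"

lemma seq_hom_arr:
  assumes "(\<tau>s, F) \<in> arr fc\<^sub>\<triangleright>"
  shows "sar (seq_hom C D) (\<tau>s, F) = (map (\<lambda>(G, G', \<tau>). G\<^sup>\<triangleright>) \<tau>s, F\<^sup>\<triangleright>,
     \<lambda>A\<in>Ob C. (map (\<lambda>(G, G', \<tau>). \<tau> A) \<tau>s, cob F A))"
  using assms by (simp add: seq_hom_def del: seq_smc_arr)

lemma fc_arrD:
  assumes "(\<tau>s, F) \<in> arr fc\<^sub>\<triangleright>"
  shows "F \<in> Cat C D" "(G, G', \<tau>) \<in> set \<tau>s \<Longrightarrow> G \<in> Cat C D \<and> G' = F \<and> nat_trans G F \<tau>"
  using assms by auto

text \<open>For an entry \<open>f\<close> of the arrow and a transformation \<open>p\<close>, both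
  composites contain the diagonal of a naturality square. They list the same table of diagonals, one
  by rows and the other by columns.\<close>

lemma seq_hom_multi_trans:
  assumes "(\<tau>s, F) \<in> arr fc\<^sub>\<triangleright>"
  shows "multi_trans C\<^sub>\<triangleright> D\<^sub>\<triangleright> (map (\<lambda>(G, G', \<tau>). G\<^sup>\<triangleright>) \<tau>s) F\<^sup>\<triangleright>
    (\<lambda>A\<in>Ob C. (map (\<lambda>(G, G', \<tau>). \<tau> A) \<tau>s, cob F A))" (is "multi_trans _ _ ?Gs _ ?\<alpha>")
  unfolding multi_trans_def
proof (intro conjI ballI)
  note d = fc_arrD[OF assms] and FD = functorD[OF fc_arrD(1)[OF assms]]
  have nt: "G \<in> Cat C D" "nat_trans G F \<tau>" if "(G, G', \<tau>) \<in> set \<tau>s" for G G' \<tau>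
    using d(2)[OF that] by auto
  fix A assume A: "A \<in> obj C\<^sub>\<triangleright>"
  show "?\<alpha> A \<in> arr D\<^sub>\<triangleright>" "src D\<^sub>\<triangleright> (?\<alpha> A) = map (\<lambda>G. sob G A) ?Gs" "tgt D\<^sub>\<triangleright> (?\<alpha> A) = sob F\<^sup>\<triangleright> A"
    using A FD(7) nat_transD[OF nt(2,1)] by (auto simp: split_def)
next
  note d = fc_arrD[OF assms] and FD = functorD[OF fc_arrD(1)[OF assms]]
  fix a assume a: "a \<in> arr C\<^sub>\<triangleright>"
  obtain fs A where fs: "a = (fs, A)" by fastforce
  have A: "A \<in> Ob C" and f: "f \<in> Ar C" "Cod C f = A" if "f \<in> set fs" for f using a that by (auto simp: fs)
  have A: "A \<in> Ob C" using a by (simp add: fs)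
  \<comment> \<open>The diagonal through the source of \<open>f\<close>; the other composite
    produces the diagonal through the target, which naturality identifies with this one.\<close>
  let ?H = "\<lambda>f p. Cmp D (car F f) ((\<lambda>(G, G', \<tau>). \<tau>) p (Dom C f))"
  have 1: "cmp D\<^sub>\<triangleright> (sar F\<^sup>\<triangleright> a) (map ?\<alpha> (src C\<^sub>\<triangleright> a)) =
      (concat (map (\<lambda>f. map (?H f) \<tau>s) fs), cob F A)"
  proof -
    have "map2 (\<lambda>f g. map (Cmp D f) (fst g)) (map (car F) fs) (map ?\<alpha> (map (Dom C) fs)) =
        map (\<lambda>f. map (?H f) \<tau>s) fs"
      using f C.Dom_Ob by (auto intro!: nth_equalityI simp: split_def)
    then show ?thesis using a FD(1) by (simp add: fs)
  qed
  have 2: "cmp D\<^sub>\<triangleright> (?\<alpha> (tgt C\<^sub>\<triangleright> a)) (map (\<lambda>G. sar G a) ?Gs) =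
      (concat (map (\<lambda>p. map (\<lambda>f. ?H f p) fs) \<tau>s), cob F A)"
  proof -
    have "map2 (\<lambda>f g. map (Cmp D f) (fst g)) (map (\<lambda>(G, G', \<tau>). \<tau> A) \<tau>s) (map (\<lambda>G. sar G a) ?Gs) =
        map (\<lambda>p. map (\<lambda>f. ?H f p) fs) \<tau>s"
    proof (rule nth_equalityI)
      fix i assume "i < length (map2 (\<lambda>f g. map (Cmp D f) (fst g)) (map (\<lambda>(G, G', \<tau>). \<tau> A) \<tau>s) (map (\<lambda>G. sar G a) ?Gs))"
      then have i: "i < length \<tau>s" by simp
      obtain G G' \<tau> where p: "\<tau>s ! i = (G, G', \<tau>)" by (cases "\<tau>s ! i")
      have G: "G \<in> Cat C D" "nat_trans G F \<tau>" using d(2)[of G G' \<tau>] nth_mem[OF i] p by auto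
      have "map (\<lambda>f. Cmp D (\<tau> A) (car G f)) fs = map (\<lambda>f. Cmp D (car F f) (\<tau> (Dom C f))) fs"
        using nat_transD(5)[OF G(2,1)] f by auto
      then show "map2 (\<lambda>f g. map (Cmp D f) (fst g)) (map (\<lambda>(G, G', \<tau>). \<tau> A) \<tau>s) (map (\<lambda>G. sar G a) ?Gs) ! i =
          map (\<lambda>p. map (\<lambda>f. ?H f p) fs) \<tau>s ! i"
        using i p sar_seq_fun[OF G(1) a] by (simp add: fs comp_def)
    qed simp
    then show ?thesis using A by (simp add: fs)
  qed
  show "cmp D\<^sub>\<triangleright> (sar F\<^sup>\<triangleright> a) (map ?\<alpha> (src C\<^sub>\<triangleright> a)) =
      act D\<^sub>\<triangleright> (transp_perm (length (src C\<^sub>\<triangleright> a)) (length ?Gs)) (cmp D\<^sub>\<triangleright> (?\<alpha> (tgt C\<^sub>\<triangleright> a)) (map (\<lambda>G. sar G a) ?Gs))"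
    unfolding 1 2 using permute_transp_perm[of fs \<tau>s ?H] by (simp add: fs)
qed simp

lemma seq_hom_smorph: "smorph (seq_hom C D)"
proof -
  have fcc: "category fc" using category_fun_cat[OF C D] .
  interpret fc: category fc by fact
  have s: "sdom (seq_hom C D) = fc\<^sub>\<triangleright>" "scod (seq_hom C D) = ihom C\<^sub>\<triangleright> D\<^sub>\<triangleright>"
    "\<And>F. F \<in> Cat C D \<Longrightarrow> sob (seq_hom C D) F = F\<^sup>\<triangleright>"
    by (simp_all add: seq_hom_def)
  show ?thesis
    unfolding smorph_def s(1,2)
  proof (intro conjI ballI allI impI)
    show "sob (seq_hom C D) \<in> obj fc\<^sub>\<triangleright> \<rightarrow>\<^sub>E obj (ihom C\<^sub>\<triangleright> D\<^sub>\<triangleright>)"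
      by (auto simp: seq_hom_def)
    show "sar (seq_hom C D) \<in> arr fc\<^sub>\<triangleright> \<rightarrow>\<^sub>E arr (ihom C\<^sub>\<triangleright> D\<^sub>\<triangleright>)"
    proof (intro PiE_I)
      fix x assume x: "x \<in> arr fc\<^sub>\<triangleright>"
      obtain \<tau>s F where xe: "x = (\<tau>s, F)" by fastforce
      note x' = x[unfolded xe]
      show "sar (seq_hom C D) x \<in> arr (ihom C\<^sub>\<triangleright> D\<^sub>\<triangleright>)"
        unfolding xe seq_hom_arr[OF x'] using seq_hom_multi_trans[OF x'] fc_arrD[OF x'] by auto
    qed (simp add: seq_hom_def del: seq_smc_arr)
  next
    fix x assume x: "x \<in> arr fc\<^sub>\<triangleright>"
    obtain \<tau>s F where xe: "x = (\<tau>s, F)" by fastforce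
    note x' = x[unfolded xe]
    show "src (ihom C\<^sub>\<triangleright> D\<^sub>\<triangleright>) (sar (seq_hom C D) x) = map (sob (seq_hom C D)) (src fc\<^sub>\<triangleright> x)"
      "tgt (ihom C\<^sub>\<triangleright> D\<^sub>\<triangleright>) (sar (seq_hom C D) x) = sob (seq_hom C D) (tgt fc\<^sub>\<triangleright> x)"
      unfolding xe seq_hom_arr[OF x'] using fc_arrD[OF x'] by (auto simp: s(3))
  next
    fix F assume "F \<in> obj fc\<^sub>\<triangleright>"
    then have F: "F \<in> Cat C D" by simp
    have "idn fc\<^sub>\<triangleright> F \<in> arr fc\<^sub>\<triangleright>" using sym_multicategory.idn_arr[OF fc.sym_multicategory_seq] F by simp
    then show "sar (seq_hom C D) (idn fc\<^sub>\<triangleright> F) = idn (ihom C\<^sub>\<triangleright> D\<^sub>\<triangleright>) (sob (seq_hom C D) F)"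
      using seq_hom_arr[of "[Idn fc F]" F] F by (simp add: s(3) del: seq_smc_arr cong: restrict_cong)
  next
    fix x gs assume c: "composable fc\<^sub>\<triangleright> x gs"
    obtain \<tau>s F where xe: "x = (\<tau>s, F)" by fastforce
    note x' = composableD(1)[OF c, unfolded xe]
    have fg: "list_all2 (\<lambda>f g. f \<in> Ar fc \<and> g \<in> arr fc\<^sub>\<triangleright> \<and> snd g = Dom fc f) \<tau>s gs"
      using c unfolding xe composable_seq_smc by blast
    have "map (\<lambda>(G, G', \<tau>). G\<^sup>\<triangleright>) (concat (map2 (\<lambda>f g. map (Cmp fc f) (fst g)) \<tau>s gs)) =
        concat (map fst (map (sar (seq_hom C D)) gs)) \<and>
      (\<forall>A\<in>Ob C. map (\<lambda>(G, G', \<tau>). \<tau> A) (concat (map2 (\<lambda>f g. map (Cmp fc f) (fst g)) \<tau>s gs)) =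
        concat (map2 (\<lambda>f g. map (Cmp D f) (fst g)) (map (\<lambda>(G, G', \<tau>). \<tau> A) \<tau>s)
          (map (\<lambda>(Gs, G, \<beta>). \<beta> A) (map (sar (seq_hom C D)) gs))))"
      using fg
    proof (induction rule: list_all2_induct)
      case (Cons f fs g gs)
      obtain G G' \<tau> where f: "f = (G, G', \<tau>)" by (cases f)
      obtain us K where g: "g = (us, K)" by (cases g)
      have ga: "(us, K) \<in> arr fc\<^sub>\<triangleright>" using Cons.hyps(1) unfolding g by blast
      have "map (\<lambda>(G, p). G\<^sup>\<triangleright>) (map (Cmp fc f) us) = map (\<lambda>(G, G', \<tau>). G\<^sup>\<triangleright>) us"
        by (auto simp: f)
      moreover have "map (\<lambda>(G, G', \<tau>). \<tau> A) (map (Cmp fc f) us) =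
          map (Cmp D (\<tau> A)) (map (\<lambda>(G, G', \<tau>). \<tau> A) us)" if "A \<in> Ob C" for A
        using that by (auto simp: f)
      ultimately show ?case
        using Cons.IH seq_hom_arr[OF ga] by (simp add: f g del: map_map map_eq_conv)
    qed simp
    moreover have "cmp fc\<^sub>\<triangleright> x gs \<in> arr fc\<^sub>\<triangleright>"
      using sym_multicategory.cmp_arr[OF fc.sym_multicategory_seq c] .
    ultimately show "sar (seq_hom C D) (cmp fc\<^sub>\<triangleright> x gs) =
        cmp (ihom C\<^sub>\<triangleright> D\<^sub>\<triangleright>) (sar (seq_hom C D) x) (map (sar (seq_hom C D)) gs)"
      unfolding xe seq_hom_arr[OF x'] seq_smc_simps(5) ihom_simps(6)
      by (subst seq_hom_arr) (auto simp del: map_map map_eq_conv cong: restrict_cong)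
  next
    fix x \<sigma> assume x: "x \<in> arr fc\<^sub>\<triangleright> \<and> \<sigma> permutes {..<length (src fc\<^sub>\<triangleright> x)}"
    obtain \<tau>s F where xe: "x = (\<tau>s, F)" by fastforce
    have x': "(\<tau>s, F) \<in> arr fc\<^sub>\<triangleright>" and \<sigma>: "\<sigma> permutes {..<length \<tau>s}" using x by (auto simp: xe)
    have "act fc\<^sub>\<triangleright> \<sigma> (\<tau>s, F) \<in> arr fc\<^sub>\<triangleright>" using x' \<sigma> by simp
    then show "sar (seq_hom C D) (act fc\<^sub>\<triangleright> \<sigma> x) = act (ihom C\<^sub>\<triangleright> D\<^sub>\<triangleright>) \<sigma> (sar (seq_hom C D) x)"
      unfolding xe seq_hom_arr[OF x'] seq_smc_simps(6)
      by (subst seq_hom_arr) (use \<sigma> in \<open>auto simp: permute_list_map cong: restrict_cong\<close>)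
  qed
qed

text \<open>For surjectivity, all functors involved come from \<open>Cat\<close> by fullness. The
  i-th entries of the lists \<open>\<alpha> A\<close> form a transformation from the i-th source
  functor, natural because of the condition at unary arrows.\<close>

lemma seq_hom_bij:
  "bij_betw (sob (seq_hom C D)) (obj fc\<^sub>\<triangleright>) (obj (ihom C\<^sub>\<triangleright> D\<^sub>\<triangleright>))"
  "bij_betw (sar (seq_hom C D)) (arr fc\<^sub>\<triangleright>) (arr (ihom C\<^sub>\<triangleright> D\<^sub>\<triangleright>))"
proof -
  note bij = bij_betw_seq_fun[OF C D]
  have inj: "F\<^sup>\<triangleright> = G\<^sup>\<triangleright> \<Longrightarrow> F = G" if "F \<in> Cat C D" "G \<in> Cat C D" for F G :: "('o, 'a, 'p, 'b) cfun"
    using bij that unfolding bij_betw_def inj_on_def by blast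
  show "bij_betw (sob (seq_hom C D)) (obj fc\<^sub>\<triangleright>) (obj (ihom C\<^sub>\<triangleright> D\<^sub>\<triangleright>))"
    using bij by (simp add: seq_hom_def)
  have "inj_on (sar (seq_hom C D)) (arr fc\<^sub>\<triangleright>)"
  proof (rule inj_onI)
    fix x y assume x: "x \<in> arr fc\<^sub>\<triangleright>" and y: "y \<in> arr fc\<^sub>\<triangleright>" and eq: "sar (seq_hom C D) x = sar (seq_hom C D) y"
    obtain \<tau>s F where xe: "x = (\<tau>s, F)" by fastforce
    obtain \<upsilon>s G where ye: "y = (\<upsilon>s, G)" by fastforce
    note x' = x[unfolded xe] and y' = y[unfolded ye]
    note xd = fc_arrD[OF x'] and yd = fc_arrD[OF y']
    note eq' = eq[unfolded xe ye seq_hom_arr[OF x'] seq_hom_arr[OF y']]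
    have FG: "F = G" using eq' inj[OF xd(1) yd(1)] by simp
    have e1: "map (\<lambda>(G, G', \<tau>). G\<^sup>\<triangleright>) \<tau>s = map (\<lambda>(G, G', \<tau>). G\<^sup>\<triangleright>) \<upsilon>s" using eq' by simp
    then have len: "length \<tau>s = length \<upsilon>s" by (metis length_map)
    have e2: "map (\<lambda>(G, G', \<tau>). \<tau> A) \<tau>s = map (\<lambda>(G, G', \<tau>). \<tau> A) \<upsilon>s" if A: "A \<in> Ob C" for A
    proof -
      have "(\<lambda>A\<in>Ob C. (map (\<lambda>(G, G', \<tau>). \<tau> A) \<tau>s, cob F A)) =
          (\<lambda>A\<in>Ob C. (map (\<lambda>(G, G', \<tau>). \<tau> A) \<upsilon>s, cob G A))" using eq' by blast
      from fun_cong[OF this, of A] show ?thesis using A by (simp del: map_eq_conv)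
    qed
    have "\<tau>s ! i = \<upsilon>s ! i" if i: "i < length \<tau>s" for i
    proof -
      obtain K K' \<tau> where p: "\<tau>s ! i = (K, K', \<tau>)" by (cases "\<tau>s ! i")
      obtain L L' \<upsilon> where q: "\<upsilon>s ! i = (L, L', \<upsilon>)" by (cases "\<upsilon>s ! i")
      have K: "K \<in> Cat C D \<and> K' = F \<and> nat_trans K F \<tau>" using xd(2)[of K K' \<tau>] nth_mem[OF i] p by simp
      have L: "L \<in> Cat C D \<and> L' = F \<and> nat_trans L F \<upsilon>"
        using yd(2)[of L L' \<upsilon>] nth_mem[of i \<upsilon>s] i len q FG by simp
      have "K\<^sup>\<triangleright> = L\<^sup>\<triangleright>" using arg_cong[OF e1, of "\<lambda>l. l ! i"] i len p q by simp
      then have KL: "K = L" using inj K L by blast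
      have "\<tau> A = \<upsilon> A" if "A \<in> Ob C" for A
        using arg_cong[OF e2[OF that], of "\<lambda>l. l ! i"] i len p q by simp
      then have "\<tau> = \<upsilon>"
        using nat_transD(1)[of K F \<tau> C D] nat_transD(1)[of L F \<upsilon> C D] K L
        by (intro extensionalityI[of _ "Ob C"]) auto
      then show ?thesis using p q K L KL by simp
    qed
    then show "x = y" using len FG by (simp add: xe ye nth_equalityI)
  qed
  moreover have "sar (seq_hom C D) ` arr fc\<^sub>\<triangleright> \<subseteq> arr (ihom C\<^sub>\<triangleright> D\<^sub>\<triangleright>)"
  proof -
    have d: "sdom (seq_hom C D) = fc\<^sub>\<triangleright>" "scod (seq_hom C D) = ihom C\<^sub>\<triangleright> D\<^sub>\<triangleright>" by (simp_all add: seq_hom_def)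
    have "sar (seq_hom C D) \<in> arr fc\<^sub>\<triangleright> \<rightarrow>\<^sub>E arr (ihom C\<^sub>\<triangleright> D\<^sub>\<triangleright>)"
      using seq_hom_smorph unfolding smorph_def d by blast
    then show ?thesis by (intro image_subsetI) (erule (1) PiE_mem)
  qed
  moreover have "y \<in> sar (seq_hom C D) ` arr fc\<^sub>\<triangleright>" if y: "y \<in> arr (ihom C\<^sub>\<triangleright> D\<^sub>\<triangleright>)" for y
  proof -
    obtain Fs F' \<alpha> where ye: "y = (Fs, F', \<alpha>)" by (cases y)
    have Fs: "set Fs \<subseteq> sMlt C\<^sub>\<triangleright> D\<^sub>\<triangleright>" and F': "F' \<in> sMlt C\<^sub>\<triangleright> D\<^sub>\<triangleright>" and t: "multi_trans C\<^sub>\<triangleright> D\<^sub>\<triangleright> Fs F' \<alpha>"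
      using y by (auto simp: ye)
    note td = multi_transD[OF t]
    obtain F where F: "F \<in> Cat C D" "F' = F\<^sup>\<triangleright>" using seq_full[OF F' C D] .
    have "Fs \<in> lists (seq_fun ` Cat C D)" using Fs bij unfolding bij_betw_def by auto
    then obtain Gs where Gs: "set Gs \<subseteq> Cat C D" "Fs = map seq_fun Gs" by (auto simp: lists_image)
    define as where "as A = fst (\<alpha> A)" for A
    have \<alpha>: "\<alpha> A = (as A, cob F A)" "map (Dom D) (as A) = map (\<lambda>G. cob G A) Gs"
      "\<forall>f\<in>set (as A). f \<in> Ar D \<and> Cod D f = cob F A" "length (as A) = length Gs" if "A \<in> Ob C" for A
    proof -
      show 1: "\<alpha> A = (as A, cob F A)" using td(4)[of A] that F(2) tgt_seq_smc[of D "\<alpha> A"] by (simp add: as_def prod_eq_iff)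
      show 2: "map (Dom D) (as A) = map (\<lambda>G. cob G A) Gs"
        using td(3)[of A] that 1 Gs(2) by (simp add: comp_def)
      show "\<forall>f\<in>set (as A). f \<in> Ar D \<and> Cod D f = cob F A" using td(2)[of A] that 1 by simp
      show "length (as A) = length Gs" using 2 by (metis length_map)
    qed
    define \<tau>s where "\<tau>s = map (\<lambda>i. (Gs ! i, F, \<lambda>A\<in>Ob C. as A ! i)) [0..<length Gs]"
    have nt: "nat_trans (Gs ! i) F (\<lambda>A\<in>Ob C. as A ! i)" if i: "i < length Gs" for i
    proof (rule nat_transI)
      show G: "Gs ! i \<in> Cat C D" using Gs(1) nth_mem[OF i] by blast
      fix X assume X: "X \<in> Ob C"
      show "(\<lambda>A\<in>Ob C. as A ! i) X \<in> Ar D" "Cod D ((\<lambda>A\<in>Ob C. as A ! i) X) = cob F X"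
        using \<alpha>(3,4)[OF X] nth_mem[of i "as X"] X i by auto
      show "Dom D ((\<lambda>A\<in>Ob C. as A ! i) X) = cob (Gs ! i) X"
        using arg_cong[OF \<alpha>(2)[OF X], of "\<lambda>l. l ! i"] \<alpha>(4)[OF X] X i by simp
    next
      fix f assume f: "f \<in> Ar C"
      note ob = C.Dom_Ob[OF f] C.Cod_Ob[OF f]
      have fa: "([f], Cod C f) \<in> arr C\<^sub>\<triangleright>" using f ob by simp
      have m: "map (\<lambda>G. sar G ([f], Cod C f)) Fs = map (\<lambda>G. ([car G f], cob G (Cod C f))) Gs"
        using Gs sar_seq_fun[OF _ fa] by (auto simp: subset_iff)
      \<comment> \<open>The inner arrows are unary, so the concatenation consists of one composite
        for each index.\<close>
      have z: "concat (map2 (\<lambda>f g. map (Cmp D f) (fst g)) as' (map (\<lambda>G. ([car G f], cob G (Cod C f))) Gs')) =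
          map2 (Cmp D) as' (map (\<lambda>G. car G f) Gs')" for as' and Gs' :: "('o, 'a, 'p, 'b) cfun list"
        by (induction as' Gs' rule: list_induct2') auto
      have "map (Cmp D (car F f)) (as (Dom C f)) = map2 (Cmp D) (as (Cod C f)) (map (\<lambda>G. car G f) Gs)"
        using td(5)[OF fa] unfolding m
        by (simp add: transp_perm_1 \<alpha>(1) ob z F(2) sar_seq_fun[OF F(1) fa] del: seq_fun_simps)
      from arg_cong[OF this, of "\<lambda>l. l ! i"]
      show "Cmp D (car F f) ((\<lambda>A\<in>Ob C. as A ! i) (Dom C f)) =
          Cmp D ((\<lambda>A\<in>Ob C. as A ! i) (Cod C f)) (car (Gs ! i) f)"
        using i \<alpha>(4) ob by simp
    qed simp
    have ar: "(\<tau>s, F) \<in> arr fc\<^sub>\<triangleright>" using nt F(1) Gs(1) by (auto simp: \<tau>s_def subset_iff)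
    have m1: "map (\<lambda>(G, G', \<tau>). G\<^sup>\<triangleright>) \<tau>s = Fs"
      by (auto simp: \<tau>s_def Gs(2) intro: nth_equalityI)
    have "(map (\<lambda>(G, G', \<tau>). \<tau> A) \<tau>s, cob F A) = \<alpha> A" if "A \<in> Ob C" for A
      using \<alpha>(1,4)[OF that] that by (auto simp: \<tau>s_def intro: nth_equalityI)
    then have m2: "(\<lambda>A\<in>Ob C. (map (\<lambda>(G, G', \<tau>). \<tau> A) \<tau>s, cob F A)) = \<alpha>"
      using td(1) by (intro extensionalityI[of _ "Ob C"]) auto
    have "sar (seq_hom C D) (\<tau>s, F) = y"
      unfolding seq_hom_arr[OF ar] m1 m2 ye F(2) ..
    then show ?thesis using ar by blast
  qed
  ultimately show "bij_betw (sar (seq_hom C D)) (arr fc\<^sub>\<triangleright>) (arr (ihom C\<^sub>\<triangleright> D\<^sub>\<triangleright>))"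
    unfolding bij_betw_def by blast
qed

lemma seq_hom_sisos:
  "seq_hom C D \<in> sisos fc\<^sub>\<triangleright> (ihom C\<^sub>\<triangleright> D\<^sub>\<triangleright>)" "sym_multicategory (ihom C\<^sub>\<triangleright> D\<^sub>\<triangleright>)"
proof -
  have d: "sdom (seq_hom C D) = fc\<^sub>\<triangleright>" "scod (seq_hom C D) = ihom C\<^sub>\<triangleright> D\<^sub>\<triangleright>" by (simp_all add: seq_hom_def)
  note b = smorph_bij[of "seq_hom C D", unfolded d, OF category.sym_multicategory_seq[OF category_fun_cat[OF C D]]
      seq_hom_smorph seq_hom_bij]
  show "seq_hom C D \<in> sisos fc\<^sub>\<triangleright> (ihom C\<^sub>\<triangleright> D\<^sub>\<triangleright>)" "sym_multicategory (ihom C\<^sub>\<triangleright> D\<^sub>\<triangleright>)" using b by auto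
qed

end

text \<open>The inverses of \<open>J\<close> and \<open>K\<close> induce an inverse of the
  underlying functions, by the pointwise lemmas. Bijectivity is enough for
  \<open>smorph_bij\<close>, which then yields the axioms for \<open>ihom M N'\<close> and the
  isomorphism together.\<close>

lemma ihom_iso:
  assumes J: "J \<in> sisos M M'" and K: "K \<in> sisos N N'" and sym: "sym_multicategory (ihom M' N)"
  shows "ihom_map J K \<in> sisos (ihom M' N) (ihom M N')" "sym_multicategory (ihom M N')"
proof -
  note JD = sisosD[OF J] and KD = sisosD[OF K]
  note sd = sMltD(1,2)[OF JD(1)] sMltD(1,2)[OF KD(1)]
  have s: "smorph (ihom_map J K)" using ihom_map_smorph(1)[OF JD(1) KD(1) sym] .
  have d: "sdom (ihom_map J K) = ihom M' N" "scod (ihom_map J K) = ihom M N'" using sd by simp_all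
  have o: "sob (ihom_map J K) \<in> obj (ihom M' N) \<rightarrow>\<^sub>E obj (ihom M N')"
    and a: "sar (ihom_map J K) \<in> arr (ihom M' N) \<rightarrow>\<^sub>E arr (ihom M N')"
    using s unfolding smorph_def d by blast+
  have a': "sar (ihom_map (sinv J) (sinv K)) x \<in> arr (ihom M' N)" if "x \<in> arr (ihom M N')" for x
    using ihom_map_smorph(4)[OF JD(3) KD(3) that] .
  have o': "sob (ihom_map (sinv J) (sinv K)) F \<in> sMlt M' N" if "F \<in> sMlt M N'" for F
    using ihom_map_smorph(2)[OF JD(3) KD(3) that] scomp_sMlt[OF scomp_sMlt[OF KD(3) that] JD(3)] by simp
  note sM = sMltD(3,4)[OF JD(1)] sMltD(3,4)[OF KD(1)]
  have bo: "bij_betw (sob (ihom_map J K)) (obj (ihom M' N)) (obj (ihom M N'))"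
  proof (rule bij_betw_byWitness[where f' = "sob (ihom_map (sinv J) (sinv K))"])
    show "\<forall>F\<in>obj (ihom M' N). sob (ihom_map (sinv J) (sinv K)) (sob (ihom_map J K) F) = F"
      using ihom_map_scomp_at(1)[OF JD(1) KD(1) JD(3) KD(3)] ihom_map_sid_at(1)[OF sM(2,3)]
      by (simp add: JD KD)
    show "\<forall>F\<in>obj (ihom M N'). sob (ihom_map J K) (sob (ihom_map (sinv J) (sinv K)) F) = F"
      using ihom_map_scomp_at(1)[OF JD(3) KD(3) JD(1) KD(1)] ihom_map_sid_at(1)[OF sM(1,4)]
      by (simp add: JD KD)
  qed (use o o' in \<open>auto dest: PiE_mem\<close>)
  have ba: "bij_betw (sar (ihom_map J K)) (arr (ihom M' N)) (arr (ihom M N'))"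
  proof (rule bij_betw_byWitness[where f' = "sar (ihom_map (sinv J) (sinv K))"])
    show "\<forall>x\<in>arr (ihom M' N). sar (ihom_map (sinv J) (sinv K)) (sar (ihom_map J K) x) = x"
      using ihom_map_scomp_at(2)[OF JD(1) KD(1) JD(3) KD(3)] ihom_map_sid_at(2)[OF sM(2,3)] PiE_mem[OF a]
      by (simp add: JD KD)
    show "\<forall>x\<in>arr (ihom M N'). sar (ihom_map J K) (sar (ihom_map (sinv J) (sinv K)) x) = x"
      using ihom_map_scomp_at(2)[OF JD(3) KD(3) JD(1) KD(1)] ihom_map_sid_at(2)[OF sM(1,4)] a'
      by (simp add: JD KD)
    show "sar (ihom_map J K) ` arr (ihom M' N) \<subseteq> arr (ihom M N')"
      using PiE_mem[OF a] by blast
    show "sar (ihom_map (sinv J) (sinv K)) ` arr (ihom M N') \<subseteq> arr (ihom M' N)" using a' by blast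
  qed
  show "ihom_map J K \<in> sisos (ihom M' N) (ihom M N')" "sym_multicategory (ihom M N')"
    using smorph_bij[of "ihom_map J K", unfolded d, OF sym s bo ba] by auto
qed

lemma sequential_ihom:
  assumes "sequential M" "sequential N"
  shows "sequential (ihom M N)"
proof -
  obtain C :: "('a, 'b) cat" and J where CJ: "category C" "J \<in> sisos M C\<^sub>\<triangleright>"
    using assms(1) by (rule sequentialE)
  obtain D :: "('c, 'd) cat" and K where DK: "category D" "K \<in> sisos N D\<^sub>\<triangleright>"
    using assms(2) by (rule sequentialE)
  interpret cat_pair C D using CJ DK by (simp add: cat_pair_def)
  note h = seq_hom_sisos
  \<comment> \<open>The hom is contravariant in its first argument, so \<open>J\<close> is used
    there and the inverse of \<open>K\<close> in the second place.\<close>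
  note i = ihom_iso(1)[OF CJ(2) sisosD(2)[OF DK(2)] h(2)]
  show ?thesis
    by (rule sequentialI[OF sisosD(2)[OF scomp_sisos[OF i h(1)]] category_fun_cat[OF CJ(1) DK(1)]])
qed

section \<open>Functoriality of the internal hom on sequential multicategories\<close>

lemma ihom_map_sMlt:
  assumes "sequential N" "sequential P" "sequential N'" "sequential P'"
    and G: "G \<in> sMlt N' N" and H: "H \<in> sMlt P P'"
  shows "ihom_map G H \<in> sMlt (ihom N P) (ihom N' P')"
proof -
  note s = sequential_sym_multicategory[OF sequential_ihom[OF assms(1,2)]]
    sequential_sym_multicategory[OF sequential_ihom[OF assms(3,4)]]
  show ?thesis
    unfolding sMlt_iff using ihom_map_smorph(1)[OF G H s(1)] s sMltD(1,2)[OF G] sMltD(1,2)[OF H] by simp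
qed

lemma ihom_map_sid:
  assumes "sequential N" "sequential P"
  shows "ihom_map (sid N) (sid P) = sid (ihom N P)"
proof -
  note s = assms[THEN sequential_sym_multicategory]
  show ?thesis
    by (rule sfun_eqI[OF ihom_map_sMlt[OF assms assms sid_sMlt[OF s(1)] sid_sMlt[OF s(2)]]
          sid_sMlt[OF sequential_sym_multicategory[OF sequential_ihom[OF assms]]]])
      (use ihom_map_sid_at[OF s] in simp_all)
qed

lemma ihom_map_scomp:
  assumes seq: "sequential N" "sequential P" "sequential N'" "sequential P'" "sequential N''" "sequential P''"
    and G: "G \<in> sMlt N' N" and H: "H \<in> sMlt P P'" and G': "G' \<in> sMlt N'' N'" and H': "H' \<in> sMlt P' P''"
  shows "ihom_map (G \<circ>\<^sub>s G') (H' \<circ>\<^sub>s H) = ihom_map G' H' \<circ>\<^sub>s ihom_map G H"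
proof -
  note m1 = ihom_map_sMlt[OF seq(1-4) G H] and m2 = ihom_map_sMlt[OF seq(3-6) G' H']
    and m = ihom_map_sMlt[OF seq(1,2,5,6) scomp_sMlt[OF G G'] scomp_sMlt[OF H' H]]
  show ?thesis
    by (rule sfun_eqI[OF m scomp_sMlt[OF m2 m1]])
      (use ihom_map_scomp_at[OF G H G' H'] sMltD(1,8)[OF m1] in \<open>simp_all del: ihom_map_simps\<close>)
qed


subsection \<open>The closed structure\<close>

text \<open>Evaluation at an object \<open>X\<close> supplies the functors in the first variable
  that \<open>tensor_lift_sMlt\<close> asks for when a functor \<open>M \<rightarrow> [N, P]\<close>
  is uncurried.\<close>

definition ihom_eval :: "('o, 'a) smc \<Rightarrow> ('p, 'b) smc \<Rightarrow> 'o \<Rightarrow>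
    (('o, 'a, 'p, 'b) sfun, ('o, 'a, 'p, 'b) mtrans, 'p, 'b) sfun" where
  "ihom_eval N P X = \<lparr>sdom = ihom N P, scod = P, sob = \<lambda>F\<in>sMlt N P. sob F X,
     sar = \<lambda>x\<in>arr (ihom N P). snd (snd x) X\<rparr>"

lemma ihom_eval_sMlt:
  assumes sym: "sym_multicategory (ihom N P)" and P: "sym_multicategory P" and X: "X \<in> obj N"
  shows "ihom_eval N P X \<in> sMlt (ihom N P) P"
proof -
  interpret I: sym_multicategory "ihom N P" by fact
  have d: "sob (ihom_eval N P X) F = sob F X" if "F \<in> sMlt N P" for F using that by (simp add: ihom_eval_def)
  have a: "sar (ihom_eval N P X) x = snd (snd x) X" if "x \<in> arr (ihom N P)" for x
    using that by (simp add: ihom_eval_def)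
  show ?thesis
  proof (rule sMltI)
    fix x assume x: "x \<in> arr (ihom N P)"
    obtain Fs F \<alpha> where xe: "x = (Fs, F, \<alpha>)" by (cases x)
    have Fs: "set Fs \<subseteq> sMlt N P" and F: "F \<in> sMlt N P" and t: "multi_trans N P Fs F \<alpha>" using x by (auto simp: xe)
    note td = multi_transD[OF t]
    show "sar (ihom_eval N P X) x \<in> arr P"
      "src P (sar (ihom_eval N P X) x) = map (sob (ihom_eval N P X)) (src (ihom N P) x)"
      "tgt P (sar (ihom_eval N P X) x) = sob (ihom_eval N P X) (tgt (ihom N P) x)"
      unfolding a[OF x] using td X Fs d[OF F] d by (auto simp: xe subset_iff)
    fix \<sigma> assume "\<sigma> permutes {..<length (src (ihom N P) x)}"
    then show "sar (ihom_eval N P X) (act (ihom N P) \<sigma> x) = act P \<sigma> (sar (ihom_eval N P X) x)"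
      using a[OF I.act_arr[OF x]] a[OF x] X by (simp add: xe)
  next
    fix F assume F: "F \<in> obj (ihom N P)"
    then show "sar (ihom_eval N P X) (idn (ihom N P) F) = idn P (sob (ihom_eval N P X) F)"
      using a[OF I.idn_arr[OF F]] X d by simp
    show "sob (ihom_eval N P X) F \<in> obj P" using F X d sMltD(7)[of F N P X] by simp
  next
    fix x gs assume c: "composable (ihom N P) x gs"
    obtain Fs F \<alpha> where xe: "x = (Fs, F, \<alpha>)" by (cases x)
    have m: "map (sar (ihom_eval N P X)) gs = map (\<lambda>(Gs, G, \<beta>). \<beta> X) gs"
      using a composable_arr[OF c] by (auto simp: split_def)
    show "sar (ihom_eval N P X) (cmp (ihom N P) x gs) =
        cmp P (sar (ihom_eval N P X) x) (map (sar (ihom_eval N P X)) gs)"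
      unfolding m using a[OF I.cmp_arr[OF c]] a[OF composableD(1)[OF c]] X by (simp add: xe)
  qed (use sym P in \<open>auto simp: ihom_eval_def\<close>)
qed

text \<open>The axioms for \<open>ihom N P\<close> enter as an assumption; for sequential
  multicategories \<open>smc_closedI\<close> provides them.\<close>

locale smc_closed = smc_pair M N for M :: "('o, 'a) smc" and N :: "('p, 'b) smc" +
  fixes P :: "('q, 'c) smc"
  assumes P: "sym_multicategory P" and IP: "sym_multicategory (ihom N P)"
begin

sublocale P: sym_multicategory P by (rule P)
sublocale I: sym_multicategory "ihom N P" by (rule IP)

lemma scurry_partial: "H \<in> sMlt (M \<otimes> N) P \<Longrightarrow> A \<in> obj M \<Longrightarrow> H \<circ>\<^sub>s inclR M N A \<in> sMlt N P"
  by (rule scomp_sMlt[OF _ inclR_sMlt])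

lemma scurry_simps:
  assumes "H \<in> sMlt (M \<otimes> N) P"
  shows "A \<in> obj M \<Longrightarrow> sob (scurry M N H) A = H \<circ>\<^sub>s inclR M N A"
    "f \<in> arr M \<Longrightarrow> sar (scurry M N H) f = (map (\<lambda>A. H \<circ>\<^sub>s inclR M N A) (src M f), H \<circ>\<^sub>s inclR M N (tgt M f),
      \<lambda>X\<in>obj N. sar H (genL M N f X))"
  by (simp_all add: scurry_def)

text \<open>The interchange relation is solved for the side that starts with \<open>h\<close>. This
  is the orientation of the naturality condition in \<open>ihom N P\<close>, which is indexed by the
  arrows \<open>h\<close> of \<open>N\<close>.\<close>

lemma tensor_interchange':
  assumes f: "f \<in> arr M" and h: "h \<in> arr N"
  shows "cmp (M \<otimes> N) (genR M N (tgt M f) h) (map (\<lambda>X. genL M N f X) (src N h)) =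
    act (M \<otimes> N) (transp_perm (length (src N h)) (length (src M f)))
      (cmp (M \<otimes> N) (genL M N f (tgt N h)) (map (\<lambda>A. genR M N A h) (src M f)))"
  unfolding tensor_interchange[OF assms]
  using act_transp_transp[OF T T.cmp_arr[OF gen_composable(2)[OF assms]] gen_composable(3)[OF assms]] by simp

text \<open>Naturality of the family \<open>sar H (genL M N f X)\<close> in \<open>X\<close> is the
  image under \<open>H\<close> of interchange; functoriality in \<open>f\<close> is that of the
  inclusions \<open>inclL M N X\<close>.\<close>

lemma scurry_sMlt:
  assumes H: "H \<in> sMlt (M \<otimes> N) P"
  shows "scurry M N H \<in> sMlt M (ihom N P)"
proof -
  note HD = sMltD[OF H]
  have po: "sob (H \<circ>\<^sub>s inclR M N A) X = sob H (A, X)" if "X \<in> obj N" for A X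
    using that by simp
  have pa: "sar (H \<circ>\<^sub>s inclR M N A) h = sar H (genR M N A h)" if "h \<in> arr N" for A h
    using that by simp
  have sc: "scod H = P" by (rule HD)
  have arr: "sar (scurry M N H) f \<in> arr (ihom N P)" if f: "f \<in> arr M" for f
  proof -
    have "multi_trans N P (map (\<lambda>A. H \<circ>\<^sub>s inclR M N A) (src M f)) (H \<circ>\<^sub>s inclR M N (tgt M f))
        (\<lambda>X\<in>obj N. sar H (genL M N f X))"
      unfolding multi_trans_def
    proof (intro conjI ballI)
      fix X assume X: "X \<in> obj N"
      show "(\<lambda>X\<in>obj N. sar H (genL M N f X)) X \<in> arr P"
        "src P ((\<lambda>X\<in>obj N. sar H (genL M N f X)) X) = map (\<lambda>G. sob G X) (map (\<lambda>A. H \<circ>\<^sub>s inclR M N A) (src M f))"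
        "tgt P ((\<lambda>X\<in>obj N. sar H (genL M N f X)) X) = sob (H \<circ>\<^sub>s inclR M N (tgt M f)) X"
        using X f HD(8-10) by (simp_all add: comp_def)
    next
      fix h assume h: "h \<in> arr N"
      note c = gen_composable[OF f h]
      have m1: "map (\<lambda>X\<in>obj N. sar H (genL M N f X)) (src N h) = map (sar H) (map (\<lambda>X. genL M N f X) (src N h))"
        using N.src_obj[OF h] by auto
      have m2: "map (\<lambda>G. sar G h) (map (\<lambda>A. H \<circ>\<^sub>s inclR M N A) (src M f)) =
          map (sar H) (map (\<lambda>A. genR M N A h) (src M f))"
        using pa[OF h] by simp
      have m3: "map (src (M \<otimes> N)) (map (\<lambda>A. genR M N A h) (src M f)) = map (\<lambda>A. map (Pair A) (src N h)) (src M f)"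
        using M.src_obj[OF f] h by auto
      have l: "length (src (M \<otimes> N) (cmp (M \<otimes> N) (genL M N f (tgt N h)) (map (\<lambda>A. genR M N A h) (src M f)))) =
          length (src N h) * length (src M f)"
        unfolding T.src_cmp[OF c(1)] m3 by (simp add: length_concat comp_def sum_list_triv)
      show "cmp P (sar (H \<circ>\<^sub>s inclR M N (tgt M f)) h) (map (\<lambda>X\<in>obj N. sar H (genL M N f X)) (src N h)) =
          act P (transp_perm (length (src N h)) (length (map (\<lambda>A. H \<circ>\<^sub>s inclR M N A) (src M f))))
           (cmp P ((\<lambda>X\<in>obj N. sar H (genL M N f X)) (tgt N h))
             (map (\<lambda>G. sar G h) (map (\<lambda>A. H \<circ>\<^sub>s inclR M N A) (src M f))))"
        unfolding m1 m2 pa[OF h] restrict_apply' [OF N.tgt_obj[OF h]] length_map HD(12)[OF c(1), symmetric]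
          HD(12)[OF c(2), symmetric] tensor_interchange'[OF f h]
        using HD(13)[OF T.cmp_arr[OF c(1)]] l transp_perm_permutes by simp
    qed simp
    then show ?thesis
      unfolding scurry_simps[OF H] using f scurry_partial[OF H] M.src_obj[OF f] M.tgt_obj[OF f]
      by (auto simp: scurry_simps[OF H])
  qed
  show ?thesis
  proof (rule sMltI)
    show "sdom (scurry M N H) = M" "scod (scurry M N H) = ihom N P" by (simp_all add: scurry_def sc)
    show "sob (scurry M N H) \<in> extensional (obj M)" "sar (scurry M N H) \<in> extensional (arr M)"
      by (simp_all add: scurry_def)
    fix f assume f: "f \<in> arr M"
    show "sar (scurry M N H) f \<in> arr (ihom N P)" by (rule arr[OF f])
    show "src (ihom N P) (sar (scurry M N H) f) = map (sob (scurry M N H)) (src M f)"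
      using M.src_obj[OF f] f by (auto simp: scurry_simps[OF H])
    show "tgt (ihom N P) (sar (scurry M N H) f) = sob (scurry M N H) (tgt M f)"
      using M.tgt_obj[OF f] f by (simp add: scurry_simps[OF H])
    fix \<sigma> assume \<sigma>: "\<sigma> permutes {..<length (src M f)}"
    have "sar H (genL M N (act M \<sigma> f) X) = act P \<sigma> (sar H (genL M N f X))" if X: "X \<in> obj N" for X
      using sMltD(13)[OF inclL_sMlt[OF X] f \<sigma>] HD(13)[of "genL M N f X" \<sigma>] f \<sigma> X M.act_arr by simp
    then show "sar (scurry M N H) (act M \<sigma> f) = act (ihom N P) \<sigma> (sar (scurry M N H) f)"
      using f \<sigma> by (simp add: scurry_simps[OF H] M.act_arr M.src_act M.tgt_act permute_list_map cong: restrict_cong)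
  next
    fix A assume A: "A \<in> obj M"
    show "sob (scurry M N H) A \<in> obj (ihom N P)"
      using scurry_partial[OF H A] by (simp add: scurry_simps[OF H] A)
    have "sar H (genL M N (idn M A) X) = idn P (sob H (A, X))" if X: "X \<in> obj N" for X
      using sMltD(11)[OF inclL_sMlt[OF X] A] HD(11)[of "(A, X)"] A X M.idn_arr by simp
    then show "sar (scurry M N H) (idn M A) = idn (ihom N P) (sob (scurry M N H) A)"
      using A by (simp add: scurry_simps[OF H] M.idn_arr M.src_idn M.tgt_idn cong: restrict_cong)
  next
    fix f gs assume c: "composable M f gs"
    have g: "g \<in> arr M" if "g \<in> set gs" for g using composable_arr[OF c that] .
    have m1: "map fst (map (sar (scurry M N H)) gs) = map (map (\<lambda>A. H \<circ>\<^sub>s inclR M N A)) (map (src M) gs)"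
      using g by (simp add: scurry_simps[OF H])
    have m2: "sar H (genL M N (cmp M f gs) X) =
        cmp P (sar H (genL M N f X)) (map (\<lambda>(Gs, G, \<beta>). \<beta> X) (map (sar (scurry M N H)) gs))" if X: "X \<in> obj N" for X
    proof -
      have m: "map (sar H) (map (sar (inclL M N X)) gs) = map (\<lambda>(Gs, G, \<beta>). \<beta> X) (map (sar (scurry M N H)) gs)"
        using g X by (auto simp: scurry_simps[OF H])
      show ?thesis
        using sMltD(12)[OF inclL_sMlt[OF X] c] HD(12)[OF composable_sMlt[OF inclL_sMlt[OF X] c]]
          composableD(1)[OF c] M.cmp_arr[OF c] unfolding m by simp
    qed
    show "sar (scurry M N H) (cmp M f gs) = cmp (ihom N P) (sar (scurry M N H) f) (map (sar (scurry M N H)) gs)"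
      unfolding scurry_simps(2)[OF H M.cmp_arr[OF c]] scurry_simps(2)[OF H composableD(1)[OF c]] ihom_simps(6) m1
        M.src_cmp[OF c] M.tgt_cmp[OF c]
      using m2 by (simp add: map_concat del: map_map cong: restrict_cong)
  qed (use M IP in auto)
qed

text \<open>A functor \<open>K\<close> into the hom is uncurried by sending \<open>f\<^sub>X\<close>
  to the component of \<open>K f\<close> at \<open>X\<close> and \<open>h\<^sub>A\<close> to the
  value of the functor \<open>K A\<close> at \<open>h\<close>. Interchange for these values is
  naturality of \<open>K f\<close>.\<close>

lemma scurry_bij: "bij_betw (scurry M N) (sMlt (M \<otimes> N) P) (sMlt M (ihom N P))"
proof -
  have "inj_on (scurry M N) (sMlt (M \<otimes> N) P)"
  proof (rule inj_onI)
    fix H K assume H: "H \<in> sMlt (M \<otimes> N) P" and K: "K \<in> sMlt (M \<otimes> N) P" and eq: "scurry M N H = scurry M N K"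
    have R: "H \<circ>\<^sub>s inclR M N A = K \<circ>\<^sub>s inclR M N A" if A: "A \<in> obj M" for A
      using arg_cong[OF eq, of "\<lambda>S. sob S A"] A by (simp add: scurry_simps[OF H] scurry_simps[OF K])
    have L: "(\<lambda>X\<in>obj N. sar H (genL M N f X)) = (\<lambda>X\<in>obj N. sar K (genL M N f X))" if f: "f \<in> arr M" for f
      using arg_cong[OF eq, of "\<lambda>S. snd (snd (sar S f))"] f by (simp add: scurry_simps[OF H] scurry_simps[OF K])
    show "H = K"
    proof (rule tensor_ext[OF H K])
      fix A X assume a: "A \<in> obj M" "X \<in> obj N"
      show "sob H (A, X) = sob K (A, X)" using arg_cong[OF R[OF a(1)], of "\<lambda>S. sob S X"] a by simp
    next
      fix f X assume a: "f \<in> arr M" "X \<in> obj N"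
      show "sar H (genL M N f X) = sar K (genL M N f X)" using fun_cong[OF L[OF a(1)], of X] a by simp
    next
      fix A h assume a: "A \<in> obj M" "h \<in> arr N"
      show "sar H (genR M N A h) = sar K (genR M N A h)" using arg_cong[OF R[OF a(1)], of "\<lambda>S. sar S h"] a by simp
    qed
  qed
  moreover have "scurry M N ` sMlt (M \<otimes> N) P \<subseteq> sMlt M (ihom N P)" using scurry_sMlt by blast
  moreover have "K \<in> scurry M N ` sMlt (M \<otimes> N) P" if K: "K \<in> sMlt M (ihom N P)" for K
  proof -
    note KD = sMltD[OF K]
    have Ko: "sob K A \<in> sMlt N P" if "A \<in> obj M" for A using KD(7)[OF that] by simp
    \<comment> \<open>Source and target of \<open>sar K f\<close> are prescribed by functoriality of
      \<open>K\<close>, so its family of components is the only free datum.\<close>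
    have Ka: "sar K f = (map (sob K) (src M f), sob K (tgt M f), snd (snd (sar K f)))"
      "multi_trans N P (map (sob K) (src M f)) (sob K (tgt M f)) (snd (snd (sar K f)))" if f: "f \<in> arr M" for f
    proof -
      obtain Fs F \<alpha> where x: "sar K f = (Fs, F, \<alpha>)" by (cases "sar K f")
      show "sar K f = (map (sob K) (src M f), sob K (tgt M f), snd (snd (sar K f)))"
        "multi_trans N P (map (sob K) (src M f)) (sob K (tgt M f)) (snd (snd (sar K f)))"
        using KD(8-10)[OF f] unfolding x by auto
    qed
    let ?l = "\<lambda>f X. snd (snd (sar K f)) X" and ?r = "\<lambda>A h. sar (sob K A) h"
    let ?H = "tensor_lift M N P (\<lambda>(A, X). sob (sob K A) X) ?l ?r"
    have L: "ihom_eval N P X \<circ>\<^sub>s K \<in> sMlt M P" if "X \<in> obj N" for X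
      by (rule scomp_sMlt[OF ihom_eval_sMlt[OF IP P that] K])
    \<comment> \<open>Naturality of \<open>sar K f\<close> at \<open>h\<close>, with the
      transposition moved to the other side.\<close>
    have I: "cmp P (?l f (tgt N h)) (map (\<lambda>A. ?r A h) (src M f)) =
        act P (transp_perm (length (src M f)) (length (src N h)))
          (cmp P (?r (tgt M f) h) (map (\<lambda>X. ?l f X) (src N h)))" if f: "f \<in> arr M" and h: "h \<in> arr N" for f h
    proof -
      note t = Ka(2)[OF f]
      have Fs: "set (map (sob K) (src M f)) \<subseteq> sMlt N P" using Ko M.src_obj[OF f] by auto
      note c = multi_trans_composable[OF t Fs Ko[OF M.tgt_obj[OF f]] h]
      have m: "map (\<lambda>G. sar G h) (map (sob K) (src M f)) = map (\<lambda>A. ?r A h) (src M f)" by simp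
      show ?thesis
        using multi_transD(5)[OF t h] act_transp_transp[OF P P.cmp_arr[OF c(2)], of "length (src N h)" "length (src M f)"]
          c(3) unfolding m length_map by simp
    qed
    have lo: "sob (ihom_eval N P X \<circ>\<^sub>s K) A = (case (A, X) of (A, X) \<Rightarrow> sob (sob K A) X)"
      if "A \<in> obj M" "X \<in> obj N" for A X using that KD(1) Ko by (simp add: ihom_eval_def)
    have la: "sar (ihom_eval N P X \<circ>\<^sub>s K) f = ?l f X" if "f \<in> arr M" "X \<in> obj N" for f X
      using that KD(1) KD(8)[OF that(1)] by (simp add: ihom_eval_def)
    have ro: "sob (sob K A) X = (case (A, X) of (A, X) \<Rightarrow> sob (sob K A) X)" for A X by simp
    note lift = tensor_lift_sMlt[where L = "\<lambda>X. ihom_eval N P X \<circ>\<^sub>s K" and R = "\<lambda>A. sob K A"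
        and \<phi> = "\<lambda>(A, X). sob (sob K A) X" and l = ?l and r = ?r, OF L lo la Ko ro refl I P]
    have H: "?H \<in> sMlt (M \<otimes> N) P" by (rule lift(1))
    have Ho: "sob ?H (A, X) = sob (sob K A) X" if "A \<in> obj M" "X \<in> obj N" for A X
      using that by (simp add: tensor_lift_def)
    have HL: "sar ?H (genL M N f X) = ?l f X" if "f \<in> arr M" "X \<in> obj N" for f X
      by (rule lift(3)) (use that in auto)
    have HR: "sar ?H (genR M N A h) = ?r A h" if "A \<in> obj M" "h \<in> arr N" for A h
      by (rule lift(4)) (use that in auto)
    have R: "?H \<circ>\<^sub>s inclR M N A = sob K A" if A: "A \<in> obj M" for A
      by (rule sfun_eqI[OF scurry_partial[OF H A] Ko[OF A]]) (use A Ho HR in simp_all)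
    have e: "scurry M N ?H = K"
    proof (rule sfun_eqI[OF scurry_sMlt[OF H] K])
      fix f assume f: "f \<in> arr M"
      have m1: "map (\<lambda>A. ?H \<circ>\<^sub>s inclR M N A) (src M f) = map (sob K) (src M f)" using R M.src_obj[OF f] by auto
      have m2: "(\<lambda>X\<in>obj N. sar ?H (genL M N f X)) = snd (snd (sar K f))"
        using multi_transD(1)[OF Ka(2)[OF f]] HL[OF f] by (intro extensionalityI[of _ "obj N"]) auto
      show "sar (scurry M N ?H) f = sar K f"
        unfolding scurry_simps(2)[OF H f] m1 m2 R[OF M.tgt_obj[OF f]] by (rule Ka(1)[OF f, symmetric])
    qed (simp add: scurry_simps[OF H] R)
    show ?thesis by (rule image_eqI[of _ "scurry M N" ?H, OF e[symmetric] H])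
  qed
  ultimately show ?thesis unfolding bij_betw_def by blast
qed

end

lemma smc_closedI:
  assumes "sequential M" "sequential N" "sequential P"
  shows "smc_closed M N P"
  using assms[THEN sequential_sym_multicategory] sequential_sym_multicategory[OF sequential_ihom[OF assms(2,3)]]
  by (simp add: smc_closed_def smc_closed_axioms_def smc_pair_def)

lemma scurry_natural:
  assumes seq: "sequential M" "sequential N" "sequential P" "sequential M'" "sequential N'" "sequential P'"
    and F: "F \<in> sMlt M' M" and G: "G \<in> sMlt N' N" and H: "H \<in> sMlt P P'" and K: "K \<in> sMlt (M \<otimes> N) P"
  shows "scurry M' N' (H \<circ>\<^sub>s K \<circ>\<^sub>s (F \<otimes>\<^sub>f G)) = ihom_map G H \<circ>\<^sub>s scurry M N K \<circ>\<^sub>s F"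
proof -
  interpret c: smc_closed M N P using smc_closedI seq by blast
  interpret c': smc_closed M' N' P' using smc_closedI seq by blast
  note FD = sMltD[OF F] and GD = sMltD[OF G] and HD = sMltD[OF H] and KD = sMltD[OF K]
  note t = tensor_map[OF F G]
  have HK: "H \<circ>\<^sub>s K \<circ>\<^sub>s (F \<otimes>\<^sub>f G) \<in> sMlt (M' \<otimes> N') P'" using scomp_sMlt[OF scomp_sMlt[OF H K] t(1)] .
  note im = ihom_map_sMlt[OF seq(2,3,5,6) G H] and imv = ihom_map_smorph(2,3)[OF G H]
  note sK = c.scurry_sMlt[OF K] and sHK = c'.scurry_sMlt[OF HK]
  note vK = c.scurry_simps[OF K] and vHK = c'.scurry_simps[OF HK]
  have td: "sdom (F \<otimes>\<^sub>f G) = M' \<otimes> N'" by (rule sMltD(1)[OF t(1)])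
  have part: "H \<circ>\<^sub>s K \<circ>\<^sub>s (F \<otimes>\<^sub>f G) \<circ>\<^sub>s inclR M' N' A = H \<circ>\<^sub>s (K \<circ>\<^sub>s inclR M N (sob F A)) \<circ>\<^sub>s G" if A: "A \<in> obj M'" for A
  proof (rule sfun_eqI[OF c'.scurry_partial[OF HK A]
        scomp_sMlt[OF scomp_sMlt[OF H c.scurry_partial[OF K FD(7)[OF A]]] G]])
    fix X assume X: "X \<in> obj N'"
    show "sob (H \<circ>\<^sub>s K \<circ>\<^sub>s (F \<otimes>\<^sub>f G) \<circ>\<^sub>s inclR M' N' A) X = sob (H \<circ>\<^sub>s (K \<circ>\<^sub>s inclR M N (sob F A)) \<circ>\<^sub>s G) X"
      using A X FD(7) GD(7) by (simp add: GD(1) KD(1) td t(2))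
  next
    fix h assume h: "h \<in> arr N'"
    show "sar (H \<circ>\<^sub>s K \<circ>\<^sub>s (F \<otimes>\<^sub>f G) \<circ>\<^sub>s inclR M' N' A) h = sar (H \<circ>\<^sub>s (K \<circ>\<^sub>s inclR M N (sob F A)) \<circ>\<^sub>s G) h"
      using A h FD(7) GD(8) by (simp add: GD(1) KD(1) td t(4))
  qed
  show ?thesis
  proof (rule sfun_eqI[OF sHK scomp_sMlt[OF scomp_sMlt[OF im sK] F]])
    fix A assume A: "A \<in> obj M'"
    then show "sob (scurry M' N' (H \<circ>\<^sub>s K \<circ>\<^sub>s (F \<otimes>\<^sub>f G))) A = sob (ihom_map G H \<circ>\<^sub>s scurry M N K \<circ>\<^sub>s F) A"
      using FD(7) by (simp add: FD(1) sMltD(1)[OF sK] vK vHK part imv(1)[OF c.scurry_partial[OF K]])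
  next
    fix f assume f: "f \<in> arr M'"
    have m1: "map (\<lambda>A. H \<circ>\<^sub>s K \<circ>\<^sub>s (F \<otimes>\<^sub>f G) \<circ>\<^sub>s inclR M' N' A) (src M' f) =
        map (\<lambda>F'. H \<circ>\<^sub>s F' \<circ>\<^sub>s G) (map (\<lambda>A. K \<circ>\<^sub>s inclR M N A) (src M (sar F f)))"
      using c'.M.src_obj[OF f] FD(9)[OF f] part by auto
    have m2: "(\<lambda>X\<in>obj N'. sar (H \<circ>\<^sub>s K \<circ>\<^sub>s (F \<otimes>\<^sub>f G)) (genL M' N' f X)) =
        (\<lambda>X\<in>obj N'. sar H ((\<lambda>X\<in>obj N. sar K (genL M N (sar F f) X)) (sob G X)))"
      using f FD(8) GD(7) by (intro restrict_ext) (simp add: KD(1) td t(3))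
    have Ff: "sar F f \<in> arr M" by (rule FD(8)[OF f])
    show "sar (scurry M' N' (H \<circ>\<^sub>s K \<circ>\<^sub>s (F \<otimes>\<^sub>f G))) f = sar (ihom_map G H \<circ>\<^sub>s scurry M N K \<circ>\<^sub>s F) f"
      unfolding vHK(2)[OF f] m1 m2 part[OF c'.M.tgt_obj[OF f]]
      using imv(2)[OF sMltD(8)[OF sK Ff, unfolded vK(2)[OF Ff]]] f FD(10)[OF f] Ff
      by (simp add: FD(1) sMltD(1)[OF sK] vK del: ihom_simps(2))
  qed
qed


subsection \<open>Comparison with the closed structure of Cat\<close>

lemma fun_map:
  assumes G: "G \<in> Cat C' C" and H: "H \<in> Cat D D'"
  shows "fun_map G H \<in> Cat (fun_cat C D) (fun_cat C' D')"
    and "F \<in> Cat C D \<Longrightarrow> cob (fun_map G H) F = H \<circ>\<^sub>c F \<circ>\<^sub>c G"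
    and "(F, F', \<tau>) \<in> Ar (fun_cat C D) \<Longrightarrow> car (fun_map G H) (F, F', \<tau>) =
      (H \<circ>\<^sub>c F \<circ>\<^sub>c G, H \<circ>\<^sub>c F' \<circ>\<^sub>c G, \<lambda>X\<in>Ob C'. car H (\<tau> (cob G X)))"
proof -
  note GD = functorD[OF G] and HD = functorD[OF H]
  interpret C: category C by (rule GD)
  interpret C': category C' by (rule GD)
  interpret D: category D by (rule HD)
  note cc = category_fun_cat[OF GD(4) HD(3)] category_fun_cat[OF GD(3) HD(4)]
  interpret fc: category "fun_cat C D" by (rule cc)
  show o: "F \<in> Cat C D \<Longrightarrow> cob (fun_map G H) F = H \<circ>\<^sub>c F \<circ>\<^sub>c G" for F
    by (simp add: fun_map_def GD HD)
  show a: "(F, F', \<tau>) \<in> Ar (fun_cat C D) \<Longrightarrow> car (fun_map G H) (F, F', \<tau>) =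
      (H \<circ>\<^sub>c F \<circ>\<^sub>c G, H \<circ>\<^sub>c F' \<circ>\<^sub>c G, \<lambda>X\<in>Ob C'. car H (\<tau> (cob G X)))" for F F' \<tau>
    by (simp add: fun_map_def GD(1,2) HD(1,2))
  have HFG: "H \<circ>\<^sub>c F \<circ>\<^sub>c G \<in> Cat C' D'" if "F \<in> Cat C D" for F
    using ccomp_Cat[OF ccomp_Cat[OF H that] G] .
  have v: "X \<in> Ob C' \<Longrightarrow> cob (H \<circ>\<^sub>c F \<circ>\<^sub>c G) X = cob H (cob F (cob G X))"
    "f \<in> Ar C' \<Longrightarrow> car (H \<circ>\<^sub>c F \<circ>\<^sub>c G) f = car H (car F (car G f))" if "F \<in> Cat C D" for F X f
    using GD(1,7,8) functorD(1)[OF that] by simp_all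
  \<comment> \<open>The naturality square at \<open>f\<close> is obtained by applying
    \<open>H\<close> to the square of \<open>\<tau>\<close> at \<open>car G f\<close>.\<close>
  have nt: "nat_trans (H \<circ>\<^sub>c F \<circ>\<^sub>c G) (H \<circ>\<^sub>c F' \<circ>\<^sub>c G) (\<lambda>X\<in>Ob C'. car H (\<tau> (cob G X)))"
    if F: "F \<in> Cat C D" and F': "F' \<in> Cat C D" and t: "nat_trans F F' \<tau>" for F F' \<tau>
  proof (rule nat_transI[OF HFG[OF F]])
    note td = nat_transD[OF t F]
    fix f assume f: "f \<in> Ar C'"
    note ob = C'.Dom_Ob[OF f] C'.Cod_Ob[OF f]
    have Gf: "car G f \<in> Ar C" "Dom C (car G f) = cob G (Dom C' f)" "Cod C (car G f) = cob G (Cod C' f)"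
      using f GD by auto
    have "Cmp D' (car H (car F' (car G f))) (car H (\<tau> (cob G (Dom C' f)))) =
        car H (Cmp D (car F' (car G f)) (\<tau> (cob G (Dom C' f))))"
      using HD(12)[of "car F' (car G f)" "\<tau> (cob G (Dom C' f))"] Gf td(2,4)[OF GD(7)[OF ob(1)]]
        functorD(8,9)[OF F' Gf(1)] by simp
    also have "\<dots> = car H (Cmp D (\<tau> (cob G (Cod C' f))) (car F (car G f)))"
      using td(5)[OF Gf(1)] Gf by simp
    also have "\<dots> = Cmp D' (car H (\<tau> (cob G (Cod C' f)))) (car H (car F (car G f)))"
      using HD(12)[of "\<tau> (cob G (Cod C' f))" "car F (car G f)"] Gf td(2,3)[OF GD(7)[OF ob(2)]]
        functorD(8,10)[OF F Gf(1)] by simp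
    finally show "Cmp D' (car (H \<circ>\<^sub>c F' \<circ>\<^sub>c G) f) ((\<lambda>X\<in>Ob C'. car H (\<tau> (cob G X))) (Dom C' f)) =
        Cmp D' ((\<lambda>X\<in>Ob C'. car H (\<tau> (cob G X))) (Cod C' f)) (car (H \<circ>\<^sub>c F \<circ>\<^sub>c G) f)"
      using ob v(2)[OF F f] v(2)[OF F' f] by simp
  next
    note td = nat_transD[OF t F]
    fix X assume X: "X \<in> Ob C'"
    show "(\<lambda>X\<in>Ob C'. car H (\<tau> (cob G X))) X \<in> Ar D'"
      "Dom D' ((\<lambda>X\<in>Ob C'. car H (\<tau> (cob G X))) X) = cob (H \<circ>\<^sub>c F \<circ>\<^sub>c G) X"
      "Cod D' ((\<lambda>X\<in>Ob C'. car H (\<tau> (cob G X))) X) = cob (H \<circ>\<^sub>c F' \<circ>\<^sub>c G) X"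
      using X v(1)[OF F X] v(1)[OF F' X] td(2-4)[OF GD(7)[OF X]] HD(8-10) by simp_all
  qed simp
  show "fun_map G H \<in> Cat (fun_cat C D) (fun_cat C' D')"
  proof (rule CatI)
    fix x assume x: "x \<in> Ar (fun_cat C D)"
    obtain F F' \<tau> where xe: "x = (F, F', \<tau>)" by (cases x)
    show "car (fun_map G H) x \<in> Ar (fun_cat C' D')"
      "Dom (fun_cat C' D') (car (fun_map G H) x) = cob (fun_map G H) (Dom (fun_cat C D) x)"
      "Cod (fun_cat C' D') (car (fun_map G H) x) = cob (fun_map G H) (Cod (fun_cat C D) x)"
      unfolding xe a[OF x[unfolded xe]] using x nt HFG o by (auto simp: xe)
    fix y assume y: "y \<in> Ar (fun_cat C D)" "Cod (fun_cat C D) y = Dom (fun_cat C D) x"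
    obtain E \<upsilon> where ye: "y = (E, F, \<upsilon>)" using y(2) by (cases y) (simp add: xe)
    have t: "nat_trans F F' \<tau>" "nat_trans E F \<upsilon>" "F \<in> Cat C D" "E \<in> Cat C D" using x y by (auto simp: xe ye)
    have "car H (Cmp D (\<tau> (cob G X)) (\<upsilon> (cob G X))) = Cmp D' (car H (\<tau> (cob G X))) (car H (\<upsilon> (cob G X)))"
      if "X \<in> Ob C'" for X
      using HD(12) nat_transD(2-4)[OF t(1,3) GD(7)[OF that]] nat_transD(2-4)[OF t(2,4) GD(7)[OF that]] by simp
    then show "car (fun_map G H) (Cmp (fun_cat C D) x y) =
        Cmp (fun_cat C' D') (car (fun_map G H) x) (car (fun_map G H) y)"
      using fc.Cmp_Ar[OF x y] x y GD(7) unfolding xe ye fun_cat_simps(6)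
      by (simp add: a del: fun_cat_simps(2) cong: restrict_cong)
  next
    fix F assume F: "F \<in> Ob (fun_cat C D)"
    then show "car (fun_map G H) (Idn (fun_cat C D) F) = Idn (fun_cat C' D') (cob (fun_map G H) F)"
      using fc.Idn_Ar[OF F] v(1)[of F] GD(7) HD(11) functorD(7)[of F C D] o
      by (simp add: a del: fun_cat_simps(2) cong: restrict_cong)
  next
    fix F assume "F \<in> Ob (fun_cat C D)"
    then show "cob (fun_map G H) F \<in> Ob (fun_cat C' D')" using o HFG by simp
  qed (use cc in \<open>simp_all add: fun_map_def GD(1,2) HD(1,2)\<close>)
qed

text \<open>Both paths whisker every component with \<open>G\<close> and \<open>H\<close>. The
  embedding preserves composition, so it does not matter whether this is done before or after it is
  applied.\<close>

lemma seq_hom_natural: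
  assumes G: "G \<in> Cat C' C" and H: "H \<in> Cat D D'"
  shows "seq_hom C' D' \<circ>\<^sub>s (fun_map G H)\<^sup>\<triangleright> = ihom_map G\<^sup>\<triangleright> H\<^sup>\<triangleright> \<circ>\<^sub>s seq_hom C D"
proof -
  note GD = functorD[OF G] and HD = functorD[OF H]
  interpret p: cat_pair C D using GD HD by (simp add: cat_pair_def)
  interpret p': cat_pair C' D' using GD HD by (simp add: cat_pair_def)
  note fm = fun_map[OF G H]
  note Gs = seq_fun_sMlt[OF G] and Hs = seq_fun_sMlt[OF H]
  note s = sisosD(1)[OF p.seq_hom_sisos(1)] and s' = sisosD(1)[OF p'.seq_hom_sisos(1)]
  note im = ihom_map_sMlt[OF sequential_seq[OF GD(4)] sequential_seq[OF HD(3)] sequential_seq[OF GD(3)]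
      sequential_seq[OF HD(4)] Gs Hs]
  note imv = ihom_map_smorph(2,3)[OF Gs Hs]
  have o: "sob (seq_hom C D) F = F\<^sup>\<triangleright>" if "F \<in> Cat C D" for F using that by (simp add: seq_hom_def)
  have o': "sob (seq_hom C' D') F = F\<^sup>\<triangleright>" if "F \<in> Cat C' D'" for F using that by (simp add: seq_hom_def)
  have e: "(H \<circ>\<^sub>c F \<circ>\<^sub>c G)\<^sup>\<triangleright> = H\<^sup>\<triangleright> \<circ>\<^sub>s F\<^sup>\<triangleright> \<circ>\<^sub>s G\<^sup>\<triangleright>" if "F \<in> Cat C D" for F
    using seq_fun_ccomp[OF G ccomp_Cat[OF H that]] seq_fun_ccomp[OF that H] by simp
  have d: "sdom (seq_hom C D) = (fun_cat C D)\<^sub>\<triangleright>" "cdom (fun_map G H) = fun_cat C D"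
    using sMltD(1)[OF s] functorD(1)[OF fm(1)] by auto
  show ?thesis
  proof (rule sfun_eqI[OF scomp_sMlt[OF s' seq_fun_sMlt[OF fm(1)]] scomp_sMlt[OF im s]])
    fix F assume "F \<in> obj (fun_cat C D)\<^sub>\<triangleright>"
    then have F: "F \<in> Cat C D" by simp
    then show "sob (seq_hom C' D' \<circ>\<^sub>s (fun_map G H)\<^sup>\<triangleright>) F = sob (ihom_map G\<^sup>\<triangleright> H\<^sup>\<triangleright> \<circ>\<^sub>s seq_hom C D) F"
      using imv(1)[OF seq_fun_sMlt[OF F]] o o'[OF ccomp_Cat[OF ccomp_Cat[OF H F] G]] e[OF F] fm(2)
      by (simp add: d)
  next
    fix x assume x: "x \<in> arr (fun_cat C D)\<^sub>\<triangleright>"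
    obtain \<tau>s F where xe: "x = (\<tau>s, F)" by fastforce
    note x' = x[unfolded xe]
    have F: "F \<in> Cat C D" using p.fc_arrD(1)[OF x'] .
    note fx = sMltD(8)[OF seq_fun_sMlt[OF fm(1)] x, unfolded xe sar_seq_fun[OF fm(1) x', unfolded fst_conv snd_conv]]
    have ar: "(F1, F2, \<tau>) \<in> Ar (fun_cat C D)" if "(F1, F2, \<tau>) \<in> set \<tau>s" for F1 F2 \<tau>
      using x' that by auto
    have m1: "map (\<lambda>(G, G', \<tau>). G\<^sup>\<triangleright>) (map (car (fun_map G H)) \<tau>s) =
        map (\<lambda>F'. H\<^sup>\<triangleright> \<circ>\<^sub>s F' \<circ>\<^sub>s G\<^sup>\<triangleright>) (map (\<lambda>(G, G', \<tau>). G\<^sup>\<triangleright>) \<tau>s)"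
    proof -
      have "(\<lambda>(G, G', \<tau>). G\<^sup>\<triangleright>) (car (fun_map G H) p) = H\<^sup>\<triangleright> \<circ>\<^sub>s (\<lambda>(G, G', \<tau>). G\<^sup>\<triangleright>) p \<circ>\<^sub>s G\<^sup>\<triangleright>" if "p \<in> set \<tau>s" for p
      proof -
        obtain F1 F2 \<tau> where p: "p = (F1, F2, \<tau>)" by (cases p)
        show ?thesis using fm(3)[OF ar[OF that[unfolded p]]] e[of F1] ar[OF that[unfolded p]] by (simp add: p)
      qed
      then show ?thesis by simp
    qed
    have m2: "map (\<lambda>(G, G', \<tau>). \<tau> A) (map (car (fun_map G H)) \<tau>s) =
        map (car H) (map (\<lambda>(K, K', \<tau>). \<tau> (cob G A)) \<tau>s)" if A: "A \<in> Ob C'" for A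
    proof -
      have "(\<lambda>(G, G', \<tau>). \<tau> A) (car (fun_map G H) p) = car H ((\<lambda>(K, K', \<tau>). \<tau> (cob G A)) p)"
        if "p \<in> set \<tau>s" for p
      proof -
        obtain F1 F2 \<tau> where p: "p = (F1, F2, \<tau>)" by (cases p)
        show ?thesis using fm(3)[OF ar[OF that[unfolded p]]] A by (simp add: p)
      qed
      then show ?thesis by simp
    qed
    have y: "(map (\<lambda>(G, G', \<tau>). G\<^sup>\<triangleright>) \<tau>s, F\<^sup>\<triangleright>, \<lambda>A\<in>Ob C. (map (\<lambda>(G, G', \<tau>). \<tau> A) \<tau>s, cob F A))
        \<in> arr (ihom C\<^sub>\<triangleright> D\<^sub>\<triangleright>)"
      using sMltD(8)[OF s x] unfolding xe p.seq_hom_arr[OF x'] .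
    have m3: "(map (car H) (map (\<lambda>(K, K', \<tau>). \<tau> (cob G A)) \<tau>s), cob (H \<circ>\<^sub>c F \<circ>\<^sub>c G) A) =
        sar H\<^sup>\<triangleright> ((\<lambda>A\<in>Ob C. (map (\<lambda>(G, G', \<tau>). \<tau> A) \<tau>s, cob F A)) (sob G\<^sup>\<triangleright> A))" if A: "A \<in> Ob C'" for A
    proof -
      have GA: "cob G A \<in> Ob C" by (rule GD(7)[OF A])
      have "(map (\<lambda>(K, K', \<tau>). \<tau> (cob G A)) \<tau>s, cob F (cob G A)) \<in> arr D\<^sub>\<triangleright>"
        using multi_transD(2)[OF p.seq_hom_multi_trans[OF x'], of "cob G A"] GA by (simp del: seq_smc_arr)
      from sar_seq_fun[OF H this] show ?thesis
        using A GA GD(1) functorD(1)[OF F] by simp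
    qed
    have l: "sar (seq_hom C' D') (map (car (fun_map G H)) \<tau>s, cob (fun_map G H) F) =
        (map (\<lambda>F'. H\<^sup>\<triangleright> \<circ>\<^sub>s F' \<circ>\<^sub>s G\<^sup>\<triangleright>) (map (\<lambda>(G, G', \<tau>). G\<^sup>\<triangleright>) \<tau>s), H\<^sup>\<triangleright> \<circ>\<^sub>s F\<^sup>\<triangleright> \<circ>\<^sub>s G\<^sup>\<triangleright>,
          \<lambda>A\<in>Ob C'. sar H\<^sup>\<triangleright> ((\<lambda>A\<in>Ob C. (map (\<lambda>(G, G', \<tau>). \<tau> A) \<tau>s, cob F A)) (sob G\<^sup>\<triangleright> A)))"
      unfolding p'.seq_hom_arr[OF fx] unfolding m1 fm(2)[OF F] e[OF F]
      using m2 m3 by (simp del: map_map seq_fun_simps(3) restrict_apply cong: restrict_cong)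
    show "sar (seq_hom C' D' \<circ>\<^sub>s (fun_map G H)\<^sup>\<triangleright>) x = sar (ihom_map G\<^sup>\<triangleright> H\<^sup>\<triangleright> \<circ>\<^sub>s seq_hom C D) x"
      using x l imv(2)[OF y] p.seq_hom_arr[OF x'] sar_seq_fun[OF fm(1) x']
      by (simp add: d xe del: seq_smc_arr ihom_simps(2) map_map restrict_apply seq_fun_simps(3,4))
  qed
qed

section \<open>Currying in \<open>Cat\<close> and in sequential multicategories\<close>

lemma cpartial:
  assumes "category C" "category D" and H: "H \<in> Cat (C \<times>\<^sub>c D) E" and A: "A \<in> Ob C"
  shows "cpartial C D H A \<in> Cat D E" "X \<in> Ob D \<Longrightarrow> cob (cpartial C D H A) X = cob H (A, X)"
    "h \<in> Ar D \<Longrightarrow> car (cpartial C D H A) h = car H (Idn C A, h)"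
proof -
  interpret cat_pair C D using assms by (simp add: cat_pair_def)
  \<comment> \<open>Fixing \<open>A\<close> is restriction along the inclusion of the slice at
    \<open>A\<close>, so functoriality comes from composition of functors.\<close>
  have "cpartial C D H A = H \<circ>\<^sub>c partR A"
    by (simp add: cpartial_def ccomp_def partR_def cong: restrict_cong)
  then show "cpartial C D H A \<in> Cat D E" using ccomp_Cat[OF H partR[OF A]] by simp
qed (simp_all add: cpartial_def)

lemma ccurry:
  assumes C: "category C" and D: "category D" and H: "H \<in> Cat (C \<times>\<^sub>c D) E"
  shows "ccurry C D H \<in> Cat C (fun_cat D E)"
proof -
  interpret cat_pair C D using assms by (simp add: cat_pair_def)
  note HD = functorD[OF H]
  interpret E: category E by (rule HD)
  note cp = cpartial[OF C D H]
  have HC: "Cmp E (car H (f, h)) (car H (g, k)) = car H (Cmp C f g, Cmp D h k)"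
    if "f \<in> Ar C" "g \<in> Ar C" "Cod C g = Dom C f" "h \<in> Ar D" "k \<in> Ar D" "Cod D k = Dom D h" for f g h k
    using HD(12)[of "(f, h)" "(g, k)"] that by simp
  have Hv: "car H (f, h) \<in> Ar E" "Dom E (car H (f, h)) = cob H (Dom C f, Dom D h)"
    "Cod E (car H (f, h)) = cob H (Cod C f, Cod D h)" if "f \<in> Ar C" "h \<in> Ar D" for f h
    using HD(8-10)[of "(f, h)"] that by simp_all
  have nt: "nat_trans (cpartial C D H (Dom C f)) (cpartial C D H (Cod C f)) (\<lambda>X\<in>Ob D. car H (f, Idn D X))"
    if f: "f \<in> Ar C" for f
  proof (rule nat_transI[OF cp(1)[OF C.Dom_Ob[OF f]]])
    \<comment> \<open>Both composites are \<open>car H (f, h)\<close>, since each coordinate is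
      composed with one identity.\<close>
    fix h assume h: "h \<in> Ar D"
    show "Cmp E (car (cpartial C D H (Cod C f)) h) ((\<lambda>X\<in>Ob D. car H (f, Idn D X)) (Dom D h)) =
        Cmp E ((\<lambda>X\<in>Ob D. car H (f, Idn D X)) (Cod D h)) (car (cpartial C D H (Dom C f)) h)"
      using f h C.Dom_Ob[OF f] C.Cod_Ob[OF f] D.Dom_Ob[OF h] D.Cod_Ob[OF h]
      by (simp add: cp(3) HC C.Idn_Ar D.Idn_Ar C.Dom_Idn C.Cod_Idn D.Dom_Idn D.Cod_Idn C.Idn_Cmp C.Cmp_Idn
          D.Idn_Cmp D.Cmp_Idn)
  qed (use f C.Dom_Ob[OF f] C.Cod_Ob[OF f] in \<open>simp_all add: Hv D.Idn_Ar D.Dom_Idn D.Cod_Idn cp(2)\<close>)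
  show ?thesis
  proof (rule CatI)
    show "cdom (ccurry C D H) = C" "ccod (ccurry C D H) = fun_cat D E"
      using HD(2) by (simp_all add: ccurry_def)
    show "category (fun_cat D E)" by (rule category_fun_cat[OF D HD(4)])
    fix A assume A: "A \<in> Ob C"
    show "cob (ccurry C D H) A \<in> Ob (fun_cat D E)" using cp(1)[OF A] A by (simp add: ccurry_def)
    show "car (ccurry C D H) (Idn C A) = Idn (fun_cat D E) (cob (ccurry C D H) A)"
      using A HD(11)[of "(A, X)" for X]
      by (simp add: ccurry_def C.Idn_Ar C.Dom_Idn C.Cod_Idn cp(2) cong: restrict_cong)
  next
    fix f assume f: "f \<in> Ar C"
    show "car (ccurry C D H) f \<in> Ar (fun_cat D E)"
      using nt[OF f] cp(1) f C.Dom_Ob[OF f] C.Cod_Ob[OF f] by (simp add: ccurry_def)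
    show "Dom (fun_cat D E) (car (ccurry C D H) f) = cob (ccurry C D H) (Dom C f)"
      "Cod (fun_cat D E) (car (ccurry C D H) f) = cob (ccurry C D H) (Cod C f)"
      using f C.Dom_Ob[OF f] C.Cod_Ob[OF f] by (simp_all add: ccurry_def)
    fix g assume g: "g \<in> Ar C" "Cod C g = Dom C f"
    have "car H (Cmp C f g, Idn D X) = Cmp E (car H (f, Idn D X)) (car H (g, Idn D X))" if "X \<in> Ob D" for X
      using HC[OF f g, of "Idn D X" "Idn D X"] that by (simp add: D.Idn_Ar D.Dom_Idn D.Cod_Idn Idn_IdnD)
    then show "car (ccurry C D H) (Cmp C f g) =
        Cmp (fun_cat D E) (car (ccurry C D H) f) (car (ccurry C D H) g)"
      using f g by (simp add: ccurry_def C.Cmp_Ar C.Dom_Cmp C.Cod_Cmp cong: restrict_cong)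
  qed (use C in \<open>simp_all add: ccurry_def\<close>)
qed

text \<open>The comparison functor sends the generator \<open>f\<^sub>X\<close> to the pairs
  \<open>(f, 1)\<close> and \<open>h\<^sub>A\<close> to the pairs \<open>(1, h)\<close>. Applying
  \<open>H\<close> to these gives the components and the partial functors from which
  \<open>ccurry\<close> is built.\<close>

lemma seq_hom_curry:
  assumes C: "category C" and D: "category D" and E: "category E" and H: "H \<in> Cat (C \<times>\<^sub>c D) E"
  shows "seq_hom D E \<circ>\<^sub>s (ccurry C D H)\<^sup>\<triangleright> = scurry C\<^sub>\<triangleright> D\<^sub>\<triangleright> (H\<^sup>\<triangleright> \<circ>\<^sub>s seq_prod C D)"
proof -
  interpret p: cat_pair C D using assms by (simp add: cat_pair_def)
  interpret q: cat_pair D E using assms by (simp add: cat_pair_def)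
  interpret c: smc_closed "C\<^sub>\<triangleright>" "D\<^sub>\<triangleright>" "E\<^sub>\<triangleright>"
    using smc_closedI[OF sequential_seq[OF C] sequential_seq[OF D] sequential_seq[OF E]] .
  note HD = functorD[OF H] and cp = cpartial[OF C D H] and cc = ccurry[OF C D H]
  note s = sisosD(1)[OF q.seq_hom_sisos(1)]
  note Hs = seq_fun_sMlt[OF H]
  note HP = scomp_sMlt[OF Hs p.seq_prod(1)]
  note v = c.scurry_simps[OF HP]
  have d: "sdom (seq_prod C D) = C\<^sub>\<triangleright> \<otimes> D\<^sub>\<triangleright>" by (rule sMltD(1)[OF p.seq_prod(1)])
  have cd: "cdom (ccurry C D H) = C" by (rule functorD(1)[OF cc])
  have sv: "sar (seq_prod C D) a \<in> arr (C \<times>\<^sub>c D)\<^sub>\<triangleright>" if "a \<in> arr (C\<^sub>\<triangleright> \<otimes> D\<^sub>\<triangleright>)" for a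
    using sMltD(8)[OF p.seq_prod(1) that] .
  have part: "(cpartial C D H A)\<^sup>\<triangleright> = H\<^sup>\<triangleright> \<circ>\<^sub>s seq_prod C D \<circ>\<^sub>s inclR C\<^sub>\<triangleright> D\<^sub>\<triangleright> A" if A: "A \<in> Ob C" for A
  proof (rule sfun_eqI[OF seq_fun_sMlt[OF cp(1)[OF A]] c.scurry_partial[OF HP]])
    show "A \<in> obj C\<^sub>\<triangleright>" using A by simp
    fix X assume "X \<in> obj D\<^sub>\<triangleright>"
    then show "sob (cpartial C D H A)\<^sup>\<triangleright> X = sob (H\<^sup>\<triangleright> \<circ>\<^sub>s seq_prod C D \<circ>\<^sub>s inclR C\<^sub>\<triangleright> D\<^sub>\<triangleright> A) X"
      using A by (simp add: d p.seq_prod(2) cp(2))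
  next
    fix b assume b: "b \<in> arr D\<^sub>\<triangleright>"
    obtain hs X where hs: "b = (hs, X)" by fastforce
    have g: "genR C\<^sub>\<triangleright> D\<^sub>\<triangleright> A b \<in> arr (C\<^sub>\<triangleright> \<otimes> D\<^sub>\<triangleright>)" using A b by simp
    show "sar (cpartial C D H A)\<^sup>\<triangleright> b = sar (H\<^sup>\<triangleright> \<circ>\<^sub>s seq_prod C D \<circ>\<^sub>s inclR C\<^sub>\<triangleright> D\<^sub>\<triangleright> A) b"
      using A b g sar_seq_fun[OF cp(1)[OF A] b] sar_seq_fun[OF H sv[OF g]]
      by (simp add: d p.seq_prod(4) cp(2,3) hs)
  qed
  show ?thesis
  proof (rule sfun_eqI[OF scomp_sMlt[OF s seq_fun_sMlt[OF cc]] c.scurry_sMlt[OF HP]])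
    fix A assume "A \<in> obj C\<^sub>\<triangleright>"
    then have A: "A \<in> Ob C" by simp
    then show "sob (seq_hom D E \<circ>\<^sub>s (ccurry C D H)\<^sup>\<triangleright>) A = sob (scurry C\<^sub>\<triangleright> D\<^sub>\<triangleright> (H\<^sup>\<triangleright> \<circ>\<^sub>s seq_prod C D)) A"
      using cp(1)[OF A] by (simp add: cd v(1) part[symmetric] ccurry_def seq_hom_def)
  next
    fix a assume a: "a \<in> arr C\<^sub>\<triangleright>"
    obtain fs A where fs: "a = (fs, A)" by fastforce
    have A: "A \<in> Ob C" and f: "\<And>f. f \<in> set fs \<Longrightarrow> f \<in> Ar C \<and> Cod C f = A" using a by (auto simp: fs)
    note ca = sMltD(8)[OF seq_fun_sMlt[OF cc] a, unfolded sar_seq_fun[OF cc a]]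
    have m1: "map (\<lambda>(G, G', \<tau>). G\<^sup>\<triangleright>) (map (car (ccurry C D H)) fs) =
        map (\<lambda>A. H\<^sup>\<triangleright> \<circ>\<^sub>s seq_prod C D \<circ>\<^sub>s inclR C\<^sub>\<triangleright> D\<^sub>\<triangleright> A) (map (Dom C) fs)"
      using f part p.C.Dom_Ob by (auto simp: ccurry_def)
    have m2: "(map (\<lambda>(G, G', \<tau>). \<tau> X) (map (car (ccurry C D H)) fs), cob (cpartial C D H A) X) =
        sar (H\<^sup>\<triangleright> \<circ>\<^sub>s seq_prod C D) (genL C\<^sub>\<triangleright> D\<^sub>\<triangleright> a X)" if X: "X \<in> Ob D" for X
    proof -
      have g: "genL C\<^sub>\<triangleright> D\<^sub>\<triangleright> a X \<in> arr (C\<^sub>\<triangleright> \<otimes> D\<^sub>\<triangleright>)" using X a by simp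
      have "map (\<lambda>(G, G', \<tau>). \<tau> X) (map (car (ccurry C D H)) fs) = map (\<lambda>f. car H (f, Idn D X)) fs"
        using f X by (auto simp: ccurry_def)
      then show ?thesis
        using a X g sar_seq_fun[OF H sv[OF g]] cp(2)[OF A X]
        by (simp add: d p.seq_prod(3) fs comp_def)
    qed
    have cA: "cob (ccurry C D H) A = cpartial C D H A" using A by (simp add: ccurry_def)
    have "sar (seq_hom D E) (map (car (ccurry C D H)) fs, cob (ccurry C D H) A) =
        sar (scurry C\<^sub>\<triangleright> D\<^sub>\<triangleright> (H\<^sup>\<triangleright> \<circ>\<^sub>s seq_prod C D)) a"
      unfolding q.seq_hom_arr[OF ca[unfolded fs fst_conv snd_conv]] v(2)[OF a]
      unfolding m1 cA part[OF A]
      using m2 by (simp add: fs del: map_map cong: restrict_cong)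
    then show "sar (seq_hom D E \<circ>\<^sub>s (ccurry C D H)\<^sup>\<triangleright>) a = sar (scurry C\<^sub>\<triangleright> D\<^sub>\<triangleright> (H\<^sup>\<triangleright> \<circ>\<^sub>s seq_prod C D)) a"
      using a sar_seq_fun[OF cc a] by (simp add: cd fs)
  qed
qed

theorem corollary3p15:
  fixes M :: "('o1, 'a1) smc" and N :: "('o2, 'a2) smc"
    and P :: "('o3, 'a3) smc" and Q :: "('o4, 'a4) smc"
    and M' :: "('o5, 'a5) smc" and N' :: "('o6, 'a6) smc" and P' :: "('o7, 'a7) smc"
    and M'' :: "('o8, 'a8) smc" and N'' :: "('o9, 'a9) smc" and P'' :: "('o10, 'a10) smc"
    and C :: "('c1, 'd1) cat" and D :: "('c2, 'd2) cat" and E :: "('c3, 'd3) cat"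
    and C' :: "('c4, 'd4) cat" and D' :: "('c5, 'd5) cat"
  assumes "sequential M" "sequential N" "sequential P" "sequential Q"
    and "sequential M'" "sequential N'" "sequential P'"
    and "sequential M''" "sequential N''" "sequential P''"
    and "category C" "category D" "category E" "category C'" "category D'"
  shows
    \<comment> \<open>the tensor product, the internal hom and the unit restrict to Seq\<close>
    "sequential one_smc \<and> sequential (M \<otimes> N) \<and> sequential (ihom M N) \<and>
     (\<forall>F\<in>sMlt M M'. \<forall>G\<in>sMlt N N'. F \<otimes>\<^sub>f G \<in> sMlt (M \<otimes> N) (M' \<otimes> N')) \<and>
     sid M \<otimes>\<^sub>f sid N = sid (M \<otimes> N) \<and>
     (\<forall>F\<in>sMlt M M'. \<forall>G\<in>sMlt N N'. \<forall>F'\<in>sMlt M' M''. \<forall>G'\<in>sMlt N' N''.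
        (F' \<circ>\<^sub>s F) \<otimes>\<^sub>f (G' \<circ>\<^sub>s G) = (F' \<otimes>\<^sub>f G') \<circ>\<^sub>s (F \<otimes>\<^sub>f G)) \<and>
     (\<forall>G\<in>sMlt N' N. \<forall>H\<in>sMlt P P'. ihom_map G H \<in> sMlt (ihom N P) (ihom N' P')) \<and>
     ihom_map (sid N) (sid P) = sid (ihom N P) \<and>
     (\<forall>G\<in>sMlt N' N. \<forall>H\<in>sMlt P P'. \<forall>G'\<in>sMlt N'' N'. \<forall>H'\<in>sMlt P' P''.
        ihom_map (G \<circ>\<^sub>s G') (H' \<circ>\<^sub>s H) = ihom_map G' H' \<circ>\<^sub>s ihom_map G H) \<and>
     \<comment> \<open>(Seq, one_smc, tensor) is monoidal\<close>
     assoc M N P \<in> sisos ((M \<otimes> N) \<otimes> P) (M \<otimes> (N \<otimes> P)) \<and>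
     lunit M \<in> sisos M (one_smc \<otimes> M) \<and>
     runit M \<in> sisos M (M \<otimes> one_smc) \<and>
     (\<forall>F\<in>sMlt M M'. \<forall>G\<in>sMlt N N'. \<forall>H\<in>sMlt P P'.
        assoc M' N' P' \<circ>\<^sub>s ((F \<otimes>\<^sub>f G) \<otimes>\<^sub>f H) = (F \<otimes>\<^sub>f (G \<otimes>\<^sub>f H)) \<circ>\<^sub>s assoc M N P) \<and>
     (\<forall>F\<in>sMlt M M'. lunit M' \<circ>\<^sub>s F = (sid one_smc \<otimes>\<^sub>f F) \<circ>\<^sub>s lunit M) \<and>
     (\<forall>F\<in>sMlt M M'. runit M' \<circ>\<^sub>s F = (F \<otimes>\<^sub>f sid one_smc) \<circ>\<^sub>s runit M) \<and>
     assoc M N (P \<otimes> Q) \<circ>\<^sub>s assoc (M \<otimes> N) P Q =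
       (sid M \<otimes>\<^sub>f assoc N P Q) \<circ>\<^sub>s assoc M (N \<otimes> P) Q \<circ>\<^sub>s (assoc M N P \<otimes>\<^sub>f sid Q) \<and>
     assoc M one_smc N \<circ>\<^sub>s (runit M \<otimes>\<^sub>f sid N) = sid M \<otimes>\<^sub>f lunit N \<and>
     \<comment> \<open>closed: tensoring with N is left adjoint to the internal hom out of N\<close>
     bij_betw (scurry M N) (sMlt (M \<otimes> N) P) (sMlt M (ihom N P)) \<and>
     (\<forall>F\<in>sMlt M' M. \<forall>G\<in>sMlt N' N. \<forall>H\<in>sMlt P P'. \<forall>K\<in>sMlt (M \<otimes> N) P.
        scurry M' N' (H \<circ>\<^sub>s K \<circ>\<^sub>s (F \<otimes>\<^sub>f G)) = ihom_map G H \<circ>\<^sub>s scurry M N K \<circ>\<^sub>s F) \<and>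
     \<comment> \<open>cartesian\<close>
     (\<exists>!F. F \<in> sMlt M one_smc) \<and>
     projL M N \<in> sMlt (M \<otimes> N) M \<and> projR M N \<in> sMlt (M \<otimes> N) N \<and>
     (\<forall>F\<in>sMlt Q M. \<forall>G\<in>sMlt Q N.
        \<exists>!H. H \<in> sMlt Q (M \<otimes> N) \<and> projL M N \<circ>\<^sub>s H = F \<and> projR M N \<circ>\<^sub>s H = G) \<and>
     \<comment> \<open>the equivalence between Cat and Seq; it is essentially surjective by definition of Seq\<close>
     sequential C\<^sub>\<triangleright> \<and>
     bij_betw seq_fun (Cat C D) (sMlt C\<^sub>\<triangleright> D\<^sub>\<triangleright>) \<and>
     (cid C)\<^sup>\<triangleright> = sid C\<^sub>\<triangleright> \<and>
     (\<forall>F\<in>Cat C D. \<forall>G\<in>Cat D E. (G \<circ>\<^sub>c F)\<^sup>\<triangleright> = G\<^sup>\<triangleright> \<circ>\<^sub>s F\<^sup>\<triangleright>) \<and>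
     \<comment> \<open>it takes the cartesian structure of Cat (with unit one_cat, whose image is one_smc) ...\<close>
     seq_prod C D \<in> sisos (C\<^sub>\<triangleright> \<otimes> D\<^sub>\<triangleright>) (C \<times>\<^sub>c D)\<^sub>\<triangleright> \<and>
     (\<forall>F\<in>Cat C C'. \<forall>G\<in>Cat D D'.
        seq_prod C' D' \<circ>\<^sub>s (F\<^sup>\<triangleright> \<otimes>\<^sub>f G\<^sup>\<triangleright>) = (F \<times>\<^sub>f G)\<^sup>\<triangleright> \<circ>\<^sub>s seq_prod C D) \<and>
     (cassoc C D E)\<^sup>\<triangleright> \<circ>\<^sub>s seq_prod (C \<times>\<^sub>c D) E \<circ>\<^sub>s (seq_prod C D \<otimes>\<^sub>f sid E\<^sub>\<triangleright>) =
       seq_prod C (D \<times>\<^sub>c E) \<circ>\<^sub>s (sid C\<^sub>\<triangleright> \<otimes>\<^sub>f seq_prod D E) \<circ>\<^sub>s assoc C\<^sub>\<triangleright> D\<^sub>\<triangleright> E\<^sub>\<triangleright> \<and>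
     (clunit C)\<^sup>\<triangleright> = seq_prod one_cat C \<circ>\<^sub>s lunit C\<^sub>\<triangleright> \<and>
     (crunit C)\<^sup>\<triangleright> = seq_prod C one_cat \<circ>\<^sub>s runit C\<^sub>\<triangleright> \<and>
     (cfst C D)\<^sup>\<triangleright> \<circ>\<^sub>s seq_prod C D = projL C\<^sub>\<triangleright> D\<^sub>\<triangleright> \<and>
     (csnd C D)\<^sup>\<triangleright> \<circ>\<^sub>s seq_prod C D = projR C\<^sub>\<triangleright> D\<^sub>\<triangleright> \<and>
     \<comment> \<open>... and its internal hom to those of Seq\<close>
     seq_hom C D \<in> sisos (fun_cat C D)\<^sub>\<triangleright> (ihom C\<^sub>\<triangleright> D\<^sub>\<triangleright>) \<and>
     (\<forall>G\<in>Cat C' C. \<forall>H\<in>Cat D D'.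
        seq_hom C' D' \<circ>\<^sub>s (fun_map G H)\<^sup>\<triangleright> = ihom_map G\<^sup>\<triangleright> H\<^sup>\<triangleright> \<circ>\<^sub>s seq_hom C D) \<and>
     (\<forall>H\<in>Cat (C \<times>\<^sub>c D) E.
        seq_hom D E \<circ>\<^sub>s (ccurry C D H)\<^sup>\<triangleright> = scurry C\<^sub>\<triangleright> D\<^sub>\<triangleright> (H\<^sup>\<triangleright> \<circ>\<^sub>s seq_prod C D))"
proof -
  note seq = assms(1-10) and cat = assms(11-15)
  note smc = seq[THEN sequential_sym_multicategory]
  interpret CD: cat_pair C D using cat by (simp add: cat_pair_def)
  \<comment> \<open>These categories serve only to instantiate \<open>proj_seq\<close>; that the
    projections are functors is a statement free of them.\<close>
  obtain CM :: "('o1, 'a1) cat" and JM where CM: "category CM" "JM \<in> sisos M CM\<^sub>\<triangleright>"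
    using seq(1) by (rule sequentialE)
  obtain CN :: "('o2, 'a2) cat" and JN where CN: "category CN" "JN \<in> sisos N CN\<^sub>\<triangleright>"
    using seq(2) by (rule sequentialE)
  note proj = proj_seq[OF CM(1) CN(1) CM(2) CN(2)]
  show ?thesis
  proof (intro conjI ballI)
    show "sequential one_smc" by (rule sequential_one)
    show "sequential (M \<otimes> N)" by (rule sequential_tensor[OF seq(1,2)])
    show "sequential (ihom M N)" by (rule sequential_ihom[OF seq(1,2)])
    show "sid M \<otimes>\<^sub>f sid N = sid (M \<otimes> N)" by (rule tensor_map_sid[OF smc(1,2)])
    show "ihom_map (sid N) (sid P) = sid (ihom N P)" by (rule ihom_map_sid[OF seq(2,3)])
    show "assoc M N P \<in> sisos ((M \<otimes> N) \<otimes> P) (M \<otimes> (N \<otimes> P))" by (rule assoc(1)[OF seq(1-3)])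
    show "lunit M \<in> sisos M (one_smc \<otimes> M)" "runit M \<in> sisos M (M \<otimes> one_smc)"
      by (rule unit_sisos[OF seq(1)])+
    show "assoc M N (P \<otimes> Q) \<circ>\<^sub>s assoc (M \<otimes> N) P Q =
        (sid M \<otimes>\<^sub>f assoc N P Q) \<circ>\<^sub>s assoc M (N \<otimes> P) Q \<circ>\<^sub>s (assoc M N P \<otimes>\<^sub>f sid Q)"
      by (rule assoc_pentagon[OF seq(1-4)])
    show "assoc M one_smc N \<circ>\<^sub>s (runit M \<otimes>\<^sub>f sid N) = sid M \<otimes>\<^sub>f lunit N"
      by (rule unit_triangle[OF seq(1,2)])
    show "bij_betw (scurry M N) (sMlt (M \<otimes> N) P) (sMlt M (ihom N P))"
      by (rule smc_closed.scurry_bij[OF smc_closedI[OF seq(1-3)]])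
    show "\<exists>!F. F \<in> sMlt M one_smc" by (rule one_terminal[OF smc(1)])
    show "projL M N \<in> sMlt (M \<otimes> N) M" "projR M N \<in> sMlt (M \<otimes> N) N" by (rule proj(1,3))+
    show "sequential C\<^sub>\<triangleright>" by (rule sequential_seq[OF cat(1)])
    show "bij_betw seq_fun (Cat C D) (sMlt C\<^sub>\<triangleright> D\<^sub>\<triangleright>)" by (rule bij_betw_seq_fun[OF cat(1,2)])
    show "(cid C)\<^sup>\<triangleright> = sid C\<^sub>\<triangleright>" by (rule seq_fun_cid[OF cat(1)])
    show "seq_prod C D \<in> sisos (C\<^sub>\<triangleright> \<otimes> D\<^sub>\<triangleright>) (C \<times>\<^sub>c D)\<^sub>\<triangleright>" by (rule CD.seq_prod_sisos)
    show "(cassoc C D E)\<^sup>\<triangleright> \<circ>\<^sub>s seq_prod (C \<times>\<^sub>c D) E \<circ>\<^sub>s (seq_prod C D \<otimes>\<^sub>f sid E\<^sub>\<triangleright>) =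
        seq_prod C (D \<times>\<^sub>c E) \<circ>\<^sub>s (sid C\<^sub>\<triangleright> \<otimes>\<^sub>f seq_prod D E) \<circ>\<^sub>s assoc C\<^sub>\<triangleright> D\<^sub>\<triangleright> E\<^sub>\<triangleright>"
      by (rule seq_prod_assoc[OF cat(1-3)])
    show "(clunit C)\<^sup>\<triangleright> = seq_prod one_cat C \<circ>\<^sub>s lunit C\<^sub>\<triangleright>" "(crunit C)\<^sup>\<triangleright> = seq_prod C one_cat \<circ>\<^sub>s runit C\<^sub>\<triangleright>"
      by (rule seq_prod_unit[OF cat(1)])+
    show "(cfst C D)\<^sup>\<triangleright> \<circ>\<^sub>s seq_prod C D = projL C\<^sub>\<triangleright> D\<^sub>\<triangleright>" "(csnd C D)\<^sup>\<triangleright> \<circ>\<^sub>s seq_prod C D = projR C\<^sub>\<triangleright> D\<^sub>\<triangleright>"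
      by (rule seq_prod_proj[OF cat(1,2)])+
    show "seq_hom C D \<in> sisos (fun_cat C D)\<^sub>\<triangleright> (ihom C\<^sub>\<triangleright> D\<^sub>\<triangleright>)" by (rule CD.seq_hom_sisos(1))
  next
    fix F G assume "F \<in> sMlt M M'" "G \<in> sMlt N N'"
    then show "F \<otimes>\<^sub>f G \<in> sMlt (M \<otimes> N) (M' \<otimes> N')" by (rule tensor_map(1))
  next
    fix F G F' G' assume "F \<in> sMlt M M'" "G \<in> sMlt N N'" "F' \<in> sMlt M' M''" "G' \<in> sMlt N' N''"
    then show "(F' \<circ>\<^sub>s F) \<otimes>\<^sub>f (G' \<circ>\<^sub>s G) = (F' \<otimes>\<^sub>f G') \<circ>\<^sub>s (F \<otimes>\<^sub>f G)" by (rule tensor_map_scomp)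
  next
    fix G H assume "G \<in> sMlt N' N" "H \<in> sMlt P P'"
    then show "ihom_map G H \<in> sMlt (ihom N P) (ihom N' P')" by (rule ihom_map_sMlt[OF seq(2,3,6,7)])
  next
    fix G H G' H' assume "G \<in> sMlt N' N" "H \<in> sMlt P P'" "G' \<in> sMlt N'' N'" "H' \<in> sMlt P' P''"
    then show "ihom_map (G \<circ>\<^sub>s G') (H' \<circ>\<^sub>s H) = ihom_map G' H' \<circ>\<^sub>s ihom_map G H"
      by (rule ihom_map_scomp[OF seq(2,3,6,7,9,10)])
  next
    fix F G H assume "F \<in> sMlt M M'" "G \<in> sMlt N N'" "H \<in> sMlt P P'"
    then show "assoc M' N' P' \<circ>\<^sub>s ((F \<otimes>\<^sub>f G) \<otimes>\<^sub>f H) = (F \<otimes>\<^sub>f (G \<otimes>\<^sub>f H)) \<circ>\<^sub>s assoc M N P"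
      by (rule assoc_natural[OF seq(1-3,5-7)])
  next
    fix F assume "F \<in> sMlt M M'"
    then show "lunit M' \<circ>\<^sub>s F = (sid one_smc \<otimes>\<^sub>f F) \<circ>\<^sub>s lunit M" by (rule unit_natural(1))
  next
    fix F assume "F \<in> sMlt M M'"
    then show "runit M' \<circ>\<^sub>s F = (F \<otimes>\<^sub>f sid one_smc) \<circ>\<^sub>s runit M" by (rule unit_natural(2))
  next
    fix F G H K assume "F \<in> sMlt M' M" "G \<in> sMlt N' N" "H \<in> sMlt P P'" "K \<in> sMlt (M \<otimes> N) P"
    then show "scurry M' N' (H \<circ>\<^sub>s K \<circ>\<^sub>s (F \<otimes>\<^sub>f G)) = ihom_map G H \<circ>\<^sub>s scurry M N K \<circ>\<^sub>s F"
      by (rule scurry_natural[OF seq(1-3,5-7)])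
  next
    fix F G assume "F \<in> sMlt Q M" "G \<in> sMlt Q N"
    then show "\<exists>!H. H \<in> sMlt Q (M \<otimes> N) \<and> projL M N \<circ>\<^sub>s H = F \<and> projR M N \<circ>\<^sub>s H = G"
      by (rule tensor_product_universal[OF seq(1,2,4)])
  next
    fix F G assume "F \<in> Cat C D" "G \<in> Cat D E"
    then show "(G \<circ>\<^sub>c F)\<^sup>\<triangleright> = G\<^sup>\<triangleright> \<circ>\<^sub>s F\<^sup>\<triangleright>" by (rule seq_fun_ccomp)
  next
    fix F G assume "F \<in> Cat C C'" "G \<in> Cat D D'"
    then show "seq_prod C' D' \<circ>\<^sub>s (F\<^sup>\<triangleright> \<otimes>\<^sub>f G\<^sup>\<triangleright>) = (F \<times>\<^sub>f G)\<^sup>\<triangleright> \<circ>\<^sub>s seq_prod C D"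
      by (rule seq_prod_natural)
  next
    fix G H assume "G \<in> Cat C' C" "H \<in> Cat D D'"
    then show "seq_hom C' D' \<circ>\<^sub>s (fun_map G H)\<^sup>\<triangleright> = ihom_map G\<^sup>\<triangleright> H\<^sup>\<triangleright> \<circ>\<^sub>s seq_hom C D"
      by (rule seq_hom_natural)
  next
    fix H assume "H \<in> Cat (C \<times>\<^sub>c D) E"
    then show "seq_hom D E \<circ>\<^sub>s (ccurry C D H)\<^sup>\<triangleright> = scurry C\<^sub>\<triangleright> D\<^sub>\<triangleright> (H\<^sup>\<triangleright> \<circ>\<^sub>s seq_prod C D)"
      by (rule seq_hom_curry[OF cat(1-3)])
  qed
qed

end
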